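(* Let $\beta=(\beta_j)_{j\ge0}$ be a sequence of non-negative real numbers, with generating series $\beta(t)=\sum_{j\ge0}\beta_jt^j$ of radius of convergence $R$ and derived series $\beta'(t)=\sum_{j\ge1}j\beta_jt^{j-1}$. Set $$z^*=\inf\{t\in[0,1):\beta'(t)+\log(1-t)<0\}\wedge1,$$ and let $\zeta$ be the set of zeros of $\beta'(t)+\log(1-t)$ in $[0,z^* )$. Assume that $R\notin\zeta$. Let $(W_t)_{t\ge0}$ be a Brownian motion and set $$Z=\min\{z\in\zeta:W(z/(1-z))<0\}\wedge z^*.$$ For $N\in\mathbb{N}$, let $V^N$ be a set of $N$ vertices and let $\Lambda^N$ be a Poisson$(\beta)$ hypergraph on $V^N$. Denote by $V^{N*}$ the set of identifiable vertices of $\Lambda^N$ and by $\Lambda^{N*}$ the identifiable hypergraph of $\Lambda^N$. Then, as $N\to\infty$, the following limits exist in distribution: $$|V^{N*}|/N\to Z,\qquad |\Lambda^{N*}|/N\to\beta(Z)-(1-Z)\log(1-Z).$$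
   Context: A hypergraph on a finite set $V$ is a map $\Lambda:\mathcal{P}(V)\to\mathbb{Z}^+=\{0,1,2,\dots\}$ on the power set of $V$; $\Lambda(A)$ is the number of hyperedges over $A$, and $|\Lambda|=\sum_{A\subseteq V}\Lambda(A)$ is the total number of hyperedges. Identifiability: a vertex $v$ is identifiable in $1$ step if $\Lambda(\{v\})\ge1$; for $n\ge2$, it is identifiable in $n$ steps if it belongs to some $A\subseteq V$ with $\Lambda(A)\ge1$ all of whose other elements are identifiable in fewer than $n$ steps. A vertex is identifiable if it is identifiable in $n$ steps for some $n\ge1$. Let $V^*$ be the set of identifiable vertices. The identifiable hypergraph is $\Lambda^*(A)=\Lambda(A)1_{A\subseteq V^*}$ (so $|\Lambda^*|$ counts all hyperedges, including those over $\emptyset$, contained in $V^*$). A random hypergraph $\Lambda$ on a set $V$ with $|V|=N$ is Poisson$(\beta)$ if: the random variables $\Lambda(A)$, $A\subseteq V$, are independent; the distribution of $\Lambda(A)$ depends only on $|A|$; and $\sum_{|A|=j}\Lambda(A)\sim$ Poisson$(N\beta_j)$ for $j=0,1,\dots,N$. In particular $\Lambda(A)$ has mean $N\beta_j/\binom{N}{j}$ when $|A|=j$. Notation: the Brownian motion $W$ is one-dimensional and starts at $0$; a series of non-negative terms has value $+\infty$ where it diverges; $0\log0=0$; $a\wedge b=\min(a,b)$; $\inf\emptyset=\min\emptyset=\infty$.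
   Formalization: The formal theorem also assumes that 0 is not in ζ; without this the claim fails, e.g. for β_2=1 and all other β_j=0, where V^{N*} is a.s. empty but Z=z*>0. *)

theory Defs
  imports "HOL-Probability.Probability"
begin

section \<open>Hypergraphs and identifiability\<close>

text \<open>
  A hypergraph on \<open>V\<close> is represented by a function \<open>\<Lambda> :: 'v set \<Rightarrow> nat\<close>, of which only the
  values on subsets of \<open>V\<close> are ever used.
\<close>

inductive identifiable_in :: "'v set \<Rightarrow> ('v set \<Rightarrow> nat) \<Rightarrow> nat \<Rightarrow> 'v \<Rightarrow> bool"
  for V :: "'v set" and \<Lambda> :: "'v set \<Rightarrow> nat" where
  one_step: "v \<in> V \<Longrightarrow> 1 \<le> \<Lambda> {v} \<Longrightarrow> identifiable_in V \<Lambda> 1 v"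
| more_steps: "2 \<le> n \<Longrightarrow> A \<subseteq> V \<Longrightarrow> v \<in> A \<Longrightarrow> 1 \<le> \<Lambda> A \<Longrightarrow>
    \<forall>w\<in>A - {v}. \<exists>m<n. identifiable_in V \<Lambda> m w \<Longrightarrow> identifiable_in V \<Lambda> n v"

definition identifiable_vertices :: "'v set \<Rightarrow> ('v set \<Rightarrow> nat) \<Rightarrow> 'v set" where
  "identifiable_vertices V \<Lambda> = {v \<in> V. \<exists>n\<ge>1. identifiable_in V \<Lambda> n v}"

definition identifiable_hypergraph :: "'v set \<Rightarrow> ('v set \<Rightarrow> nat) \<Rightarrow> 'v set \<Rightarrow> nat" where
  "identifiable_hypergraph V \<Lambda> A = (if A \<subseteq> identifiable_vertices V \<Lambda> then \<Lambda> A else 0)"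

definition num_hyperedges :: "'v set \<Rightarrow> ('v set \<Rightarrow> nat) \<Rightarrow> nat" where
  "num_hyperedges V \<Lambda> = (\<Sum>A\<in>Pow V. \<Lambda> A)"


section \<open>Poisson hypergraphs\<close>

text \<open>
  The mass function of the Poisson law is written out because the library's \<open>poisson_pmf\<close>
  requires a strictly positive rate, whereas \<open>\<beta> j = 0\<close> is allowed here.
\<close>

definition poisson_distributed :: "'a measure \<Rightarrow> real \<Rightarrow> ('a \<Rightarrow> nat) \<Rightarrow> bool" where
  "poisson_distributed M r X \<longleftrightarrow>
     X \<in> measurable M (count_space UNIV) \<and>
     (\<forall>k. measure M {\<omega> \<in> space M. X \<omega> = k} = r ^ k / fact k * exp (- r))"

definition poisson_hypergraph ::
  "'a measure \<Rightarrow> 'v set \<Rightarrow> (nat \<Rightarrow> real) \<Rightarrow> ('a \<Rightarrow> 'v set \<Rightarrow> nat) \<Rightarrow> bool" where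
  "poisson_hypergraph M V \<beta> \<Lambda> \<longleftrightarrow>
     prob_space M \<and> finite V \<and>
     prob_space.indep_vars M (\<lambda>_. count_space UNIV) (\<lambda>A \<omega>. \<Lambda> \<omega> A) (Pow V) \<and>
     (\<forall>A\<in>Pow V. \<forall>B\<in>Pow V. card A = card B \<longrightarrow>
        distr M (count_space UNIV) (\<lambda>\<omega>. \<Lambda> \<omega> A) = distr M (count_space UNIV) (\<lambda>\<omega>. \<Lambda> \<omega> B)) \<and>
     (\<forall>j\<le>card V. poisson_distributed M (real (card V) * \<beta> j)
        (\<lambda>\<omega>. \<Sum>A\<in>{A \<in> Pow V. card A = j}. \<Lambda> \<omega> A))"


section \<open>The generating series and its derived quantities\<close>

text \<open>
  The series are taken in the extended reals, so that for \<open>\<beta> j \<ge> 0\<close> and \<open>t \<ge> 0\<close> they have the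
  value \<open>\<infinity>\<close> where they diverge.
\<close>

definition gen_series :: "(nat \<Rightarrow> real) \<Rightarrow> real \<Rightarrow> ereal" where
  "gen_series \<beta> t = (\<Sum>j. ereal (\<beta> j * t ^ j))"

text \<open>The term for \<open>j = 0\<close> vanishes because of the factor \<open>real j\<close>.\<close>

definition derived_series :: "(nat \<Rightarrow> real) \<Rightarrow> real \<Rightarrow> ereal" where
  "derived_series \<beta> t = (\<Sum>j. ereal (real j * \<beta> j * t ^ (j - 1)))"

definition drift :: "(nat \<Rightarrow> real) \<Rightarrow> real \<Rightarrow> ereal" where
  "drift \<beta> t = derived_series \<beta> t + ereal (ln (1 - t))"

text \<open>
  Here and in \<open>Z_limit\<close>, \<open>inf S \<and> c\<close> with \<open>inf {} = \<infinity>\<close> is rendered as the real infimum of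
  \<open>insert c S\<close>; all sets concerned are bounded below by \<open>0\<close>.
\<close>

definition z_star :: "(nat \<Rightarrow> real) \<Rightarrow> real" where
  "z_star \<beta> = Inf (insert 1 {t. 0 \<le> t \<and> t < 1 \<and> drift \<beta> t < 0})"

definition zero_set :: "(nat \<Rightarrow> real) \<Rightarrow> real set" where
  "zero_set \<beta> = {t. 0 \<le> t \<and> t < z_star \<beta> \<and> drift \<beta> t = 0}"

text \<open>
  The argument \<open>w\<close> is a path \<open>t \<mapsto> W t \<omega>\<close>. If neither \<open>0\<close> nor the radius of convergence of \<open>\<beta>\<close>
  lies in \<open>zero_set \<beta>\<close>, then the zeros can accumulate only at \<open>1\<close>, so the infimum below is
  a minimum.

  If \<open>0 \<in> zero_set \<beta>\<close>, then \<open>\<beta> 1 = 0\<close> and there are almost surely no identifiable vertices,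
  whereas a path with \<open>w 0 = 0\<close> never selects the zero \<open>z = 0\<close>. For instance, \<open>\<beta> 2 = 1\<close> and
  \<open>\<beta> j = 0\<close> otherwise gives \<open>zero_set \<beta> = {0}\<close> and \<open>Z_limit \<beta> w = z_star \<beta> > 0\<close>, which is not
  the limiting proportion of identifiable vertices.
\<close>

definition Z_limit :: "(nat \<Rightarrow> real) \<Rightarrow> (real \<Rightarrow> real) \<Rightarrow> real" where
  "Z_limit \<beta> w = Inf (insert (z_star \<beta>) {z \<in> zero_set \<beta>. w (z / (1 - z)) < 0})"

text \<open>At \<open>z = 1\<close> the convention \<open>0 log 0 = 0\<close> holds because of the factor \<open>1 - z\<close>.\<close>

definition edge_limit :: "(nat \<Rightarrow> real) \<Rightarrow> real \<Rightarrow> ereal" where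
  "edge_limit \<beta> z = gen_series \<beta> z - ereal ((1 - z) * ln (1 - z))"


section \<open>Brownian motion and convergence in distribution\<close>

text \<open>Standard one-dimensional Brownian motion from \<open>0\<close>; only times \<open>t \<ge> 0\<close> matter.\<close>

definition brownian_motion :: "'b measure \<Rightarrow> (real \<Rightarrow> 'b \<Rightarrow> real) \<Rightarrow> bool" where
  "brownian_motion M W \<longleftrightarrow>
     prob_space M \<and>
     (\<forall>t\<ge>0. W t \<in> borel_measurable M) \<and>
     (AE \<omega> in M. W 0 \<omega> = 0) \<and>
     (AE \<omega> in M. continuous_on {0..} (\<lambda>t. W t \<omega>)) \<and>
     (\<forall>s t. 0 \<le> s \<and> s < t \<longrightarrow>
        distributed M lborel (\<lambda>\<omega>. W t \<omega> - W s \<omega>) (normal_density 0 (sqrt (t - s)))) \<and>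
     (\<forall>(n::nat) (\<tau>::nat \<Rightarrow> real). 0 \<le> \<tau> 0 \<and> (\<forall>i<n. \<tau> i \<le> \<tau> (Suc i)) \<longrightarrow>
        prob_space.indep_vars M (\<lambda>_. borel) (\<lambda>i \<omega>. W (\<tau> (Suc i)) \<omega> - W (\<tau> i) \<omega>) {..<n})"

text \<open>
  The library's \<open>weak_conv_m\<close> covers only laws on the reals. Weak convergence of Borel laws on
  a general topological space is needed because \<open>edge_limit\<close> may be infinite.
\<close>

definition weakly_converges ::
  "(nat \<Rightarrow> 'c::topological_space measure) \<Rightarrow> 'c measure \<Rightarrow> bool" where
  "weakly_converges \<mu> \<nu> \<longleftrightarrow>
     (\<forall>f :: 'c \<Rightarrow> real. continuous_on UNIV f \<and> bounded (range f) \<longrightarrow>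
        (\<lambda>n. \<integral>x. f x \<partial>\<mu> n) \<longlonglongrightarrow> (\<integral>x. f x \<partial>\<nu>))"

end

theory Submission
  imports Defs "HOL-Complex_Analysis.Conformal_Mappings"
begin

text \<open>
  The proof compares the set \<open>V*\<close> of identifiable vertices with a stopped random walk.

  The set \<open>V*\<close> is the least set that contains every vertex \<open>v\<close> lying in some hyperedge whose other
  vertices it contains. Hence, for the part of the hypergraph inside \<open>S\<close>, the identifiable set is \<open>T\<close>
  if and only if \<open>T\<close> is identified by the hyperedges inside \<open>T\<close> alone and there is no hyperedge
  \<open>insert v B\<close> with \<open>v \<in> S - T\<close> and \<open>B \<subseteq> T\<close>. These two conditions concern disjoint families of
  hyperedges; the second has probability \<open>exp (- hazard (|T|) * |S - T|)\<close>. Summing over \<open>T\<close>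
  determines, by recursion on \<open>|S|\<close>, the probability \<open>a k\<close> that a set of \<open>k\<close> vertices is entirely
  identified from within, and with it the law of \<open>|V*|\<close> (\<open>prob_card_identifiable\<close>).

  Let \<open>E i\<close> be independent standard exponential variables. The sums \<open>T k = (\<Sum>i<k. E i / (N - i))\<close> are
  the order statistics of \<open>N\<close> exponential variables. Stop at the first \<open>k\<close> with \<open>hazard k < T (k + 1)\<close>.
  Integrating out one step at a time gives for the stopping index the same formula with the same
  recursion (\<open>prob_stop_index\<close>, \<open>full_run_prob_recursion\<close>), so the stopping index has the law of \<open>|V*|\<close>
  (\<open>card_identifiable_law\<close>).

  In terms of \<open>noise n = sqrt N * (\<Sum>i<n. (1 - E i) / (N - i))\<close> the walk stops when \<open>noise (k + 1)\<close>
  falls below \<open>- sqrt N * gap k\<close>, where \<open>gap k\<close> is \<open>\<beta>' (k / N) + log (1 - k / N)\<close> up to an error of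
  order \<open>1 / N\<close>. The noise near the index \<open>z * N\<close> has variance about \<open>z / (1 - z)\<close> and converges,
  jointly in \<open>z\<close>, to \<open>W (z / (1 - z))\<close>; the maximal inequality of Kolmogorov controls it between the
  levels considered. Where the drift is positive, the barrier is of order \<open>- sqrt N\<close> and is not
  reached. Just beyond \<open>z*\<close> there are points of negative drift, where the barrier is certainly
  crossed. At a zero \<open>z < z*\<close> the barrier is of order \<open>1 / sqrt N\<close>, so the walk stops near \<open>z\<close> if and
  only if the noise is negative there. This is the rule that defines \<open>Z\<close> (\<open>stopped_stays\<close>,
  \<open>stopped_crosses\<close>). The condition that the radius of convergence is not a zero puts all zeros
  strictly inside the disc of convergence; there the error bound is uniform, and the zeros are
  isolated because the drift is analytic.

  For the hyperedges, condition on \<open>V* = S\<close>. Hyperedges with exactly one vertex outside \<open>S\<close> are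
  absent, and those with at least two vertices outside \<open>S\<close> keep their law. So the number of
  identified hyperedges of size \<open>j\<close> is the total number minus an unconditioned Poisson count, which
  is about \<open>N * \<beta> j * (t ^ j + j * t ^ (j - 1) * (1 - t))\<close> with \<open>t = |V*| / N\<close>. Chebyshev's inequality
  makes this precise for bounded sizes (\<open>edges_upto_concentration\<close>); large sizes are bounded in
  mean, because the multiplicity of one hyperedge and the event that \<open>V*\<close> is small are negatively
  correlated (\<open>edge_negatively_correlated\<close>). The sum over \<open>j\<close> is \<open>\<beta> t + (1 - t) * \<beta>' t\<close>, and \<open>\<beta>' t\<close> equals
  \<open>- log (1 - t)\<close> at every possible value \<open>t < 1\<close> of \<open>Z\<close>. The value \<open>1\<close> is approached by bounds from both
  sides, since \<open>\<beta> 1\<close> may be infinite. The lemma \<open>functional_limit\<close> turns this local information about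
  \<open>|V*| / N\<close> into both limits in distribution.
\<close>

section \<open>Poisson variables and sums of independent variables\<close>

lemma (in prob_space) expectation_nat_valued:
  fixes X :: "'a \<Rightarrow> nat" and f :: "nat \<Rightarrow> real"
  assumes [measurable]: "X \<in> measurable M (count_space UNIV)" and f: "\<And>k. 0 \<le> f k"
    and sums: "(\<lambda>k. f k * \<P>(w in M. X w = k)) sums s"
  shows "integrable M (\<lambda>w. f (X w))" "expectation (\<lambda>w. f (X w)) = s"
proof -
  have "(\<integral>\<^sup>+w. ennreal (f (X w)) \<partial>M) = (\<integral>\<^sup>+w. (\<Sum>k. ennreal (f k) * indicator {w\<in>space M. X w = k} w) \<partial>M)"
  proof (rule nn_integral_cong)
    fix w assume "w \<in> space M"
    then have "(\<Sum>k. ennreal (f k) * indicator {w\<in>space M. X w = k} w) = (\<Sum>k. if k = X w then ennreal (f k) else 0)"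
      by (intro suminf_cong) auto
    also have "\<dots> = ennreal (f (X w))"
      using sums_single[of "X w" "\<lambda>k. ennreal (f k)"] by (simp add: sums_iff)
    finally show "ennreal (f (X w)) = (\<Sum>k. ennreal (f k) * indicator {w\<in>space M. X w = k} w)" by simp
  qed
  also have "\<dots> = (\<Sum>k. \<integral>\<^sup>+w. ennreal (f k) * indicator {w\<in>space M. X w = k} w \<partial>M)"
    by (rule nn_integral_suminf) measurable
  also have "\<dots> = (\<Sum>k. ennreal (f k * \<P>(w in M. X w = k)))"
    using f by (intro suminf_cong) (subst nn_integral_cmult_indicator, auto simp: emeasure_eq_measure ennreal_mult)
  also have "\<dots> = ennreal s"
    using sums f by (subst suminf_ennreal2) (auto simp: sums_iff)
  finally have *: "(\<integral>\<^sup>+w. ennreal (f (X w)) \<partial>M) = ennreal s" .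
  have s0: "0 \<le> s" by (rule sums_le[OF _ sums_zero sums]) (simp add: f)
  show "integrable M (\<lambda>w. f (X w))"
    using * f by (intro integrableI_bounded) auto
  show "expectation (\<lambda>w. f (X w)) = s"
    using * f s0 by (intro integral_eq_nn_integral[THEN trans]) auto
qed

lemma poisson_weights_sums:
  fixes r :: real
  shows "(\<lambda>k. real k * (r ^ k / fact k * exp (- r))) sums r"
    and "(\<lambda>k. (real k)\<^sup>2 * (r ^ k / fact k * exp (- r))) sums (r\<^sup>2 + r)"
proof -
  have e: "(\<lambda>k. r ^ k / fact k) sums exp r"
    using exp_converges[of r] by (simp add: divide_inverse mult.commute scaleR_conv_of_real)
  have Suc: "r * (r ^ k / fact k) = real (Suc k) * (r ^ Suc k / fact (Suc k))" for k
    unfolding fact_Suc by (simp del: of_nat_Suc)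
  have 1: "(\<lambda>k. real k * (r ^ k / fact k)) sums (r * exp r)"
  proof -
    have "(\<lambda>k. r * (r ^ k / fact k)) sums (r * exp r)" using e by (rule sums_mult)
    moreover have "r * (r ^ k / fact k) = real (Suc k) * (r ^ Suc k / fact (Suc k))" for k
      by (rule Suc)
    ultimately have "(\<lambda>k. real (Suc k) * (r ^ Suc k / fact (Suc k))) sums (r * exp r)" by (simp only:)
    from sums_Suc[OF this] show ?thesis by simp
  qed
  have 2: "(\<lambda>k. (real k)\<^sup>2 * (r ^ k / fact k)) sums ((r\<^sup>2 + r) * exp r)"
  proof -
    have "(\<lambda>k. r * (real k * (r ^ k / fact k)) + r * (r ^ k / fact k)) sums (r * (r * exp r) + r * exp r)"
      using e 1 by (intro sums_add sums_mult)
    moreover have "r * (real k * (r ^ k / fact k)) + r * (r ^ k / fact k) = (real (Suc k))\<^sup>2 * (r ^ Suc k / fact (Suc k))" for k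
    proof -
      have "(real (Suc k))\<^sup>2 * (r ^ Suc k / fact (Suc k)) = real (Suc k) * (r * (r ^ k / fact k))"
        unfolding Suc power2_eq_square by (simp only: mult.assoc)
      then show ?thesis by (simp only: of_nat_Suc distrib_right mult_1_left) (simp only: mult_ac add_ac)
    qed
    ultimately have "(\<lambda>k. (real (Suc k))\<^sup>2 * (r ^ Suc k / fact (Suc k))) sums (r * (r * exp r) + r * exp r)" by (simp only:)
    from sums_Suc[OF this] show ?thesis by (simp add: power2_eq_square algebra_simps)
  qed
  show "(\<lambda>k. real k * (r ^ k / fact k * exp (- r))) sums r"
    using sums_mult2[OF 1, of "exp (- r)"] by (simp add: exp_minus mult.assoc)
  show "(\<lambda>k. (real k)\<^sup>2 * (r ^ k / fact k * exp (- r))) sums (r\<^sup>2 + r)"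
    using sums_mult2[OF 2, of "exp (- r)"] by (simp add: exp_minus mult.assoc)
qed

text \<open>
  The mass function also describes the degenerate law at rate \<open>0\<close>, so moments are computed from it
  directly.
\<close>

lemma poisson_distributed_moments:
  assumes "prob_space M" "poisson_distributed M r X"
  shows "integrable M (\<lambda>w. real (X w))" "(\<integral>w. real (X w) \<partial>M) = r"
    "integrable M (\<lambda>w. (real (X w))\<^sup>2)" "(\<integral>w. (real (X w))\<^sup>2 \<partial>M) = r\<^sup>2 + r"
proof -
  interpret prob_space M by fact
  have X: "X \<in> measurable M (count_space UNIV)" and p: "\<And>k. prob {w \<in> space M. X w = k} = r ^ k / fact k * exp (- r)"
    using assms(2) by (auto simp: poisson_distributed_def)
  show "integrable M (\<lambda>w. real (X w))" "(\<integral>w. real (X w) \<partial>M) = r"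
    using expectation_nat_valued[OF X, of real r] poisson_weights_sums(1)[of r] by (auto simp: p)
  show "integrable M (\<lambda>w. (real (X w))\<^sup>2)" "(\<integral>w. (real (X w))\<^sup>2 \<partial>M) = r\<^sup>2 + r"
    using expectation_nat_valued[OF X, of "\<lambda>k. (real k)\<^sup>2" "r\<^sup>2+r"] poisson_weights_sums(2)[of r] by (auto simp: p)
qed

text \<open>
  Independent centred variables are orthogonal, so the mixed terms of the square vanish.
\<close>

lemma (in prob_space) second_moment_indep_sum:
  fixes X :: "'i \<Rightarrow> 'a \<Rightarrow> real"
  assumes "finite I" "indep_vars (\<lambda>_. borel) X I"
    "\<And>i. i \<in> I \<Longrightarrow> integrable M (\<lambda>w. (X i w)\<^sup>2)" "\<And>i. i \<in> I \<Longrightarrow> expectation (X i) = 0"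
  shows "integrable M (\<lambda>w. (\<Sum>i\<in>I. X i w)\<^sup>2)" (is ?A)
    and "expectation (\<lambda>w. (\<Sum>i\<in>I. X i w)\<^sup>2) = (\<Sum>i\<in>I. expectation (\<lambda>w. (X i w)\<^sup>2))" (is ?B)
proof -
  have "?A \<and> ?B" using assms
  proof (induction I rule: finite_induct)
    case empty
    then show ?case by simp
  next
    case (insert i I)
    have rv[measurable]: "random_variable borel (X j)" if "j \<in> insert i I" for j
      using insert.prems(1) that by (auto simp: indep_vars_def)
    have IH: "integrable M (\<lambda>w. (\<Sum>i\<in>I. X i w)\<^sup>2)"
      "expectation (\<lambda>w. (\<Sum>i\<in>I. X i w)\<^sup>2) = (\<Sum>i\<in>I. expectation (\<lambda>w. (X i w)\<^sup>2))"
      using insert.IH insert.prems indep_vars_subset[OF insert.prems(1), of I] by auto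
    have int: "integrable M (X j)" if "j \<in> insert i I" for j
      using square_integrable_imp_integrable[OF rv[OF that] insert.prems(2)[OF that]] .
    have ind: "indep_var borel (X i) borel (\<lambda>w. \<Sum>i\<in>I. X i w)"
      using indep_vars_sum[OF insert.hyps insert.prems(1)] .
    have intS: "integrable M (\<lambda>w. \<Sum>i\<in>I. X i w)" using int by auto
    have cross: "integrable M (\<lambda>w. X i w * (\<Sum>i\<in>I. X i w))"
      "expectation (\<lambda>w. X i w * (\<Sum>i\<in>I. X i w)) = 0"
      using indep_var_integrable[OF ind int intS] indep_var_lebesgue_integral[OF ind int intS] insert.prems(3)[of i]
      by auto
    have eq: "(\<Sum>j\<in>insert i I. X j w)\<^sup>2 = (X i w)\<^sup>2 + (2 * (X i w * (\<Sum>i\<in>I. X i w)) + (\<Sum>i\<in>I. X i w)\<^sup>2)" for w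
      using insert.hyps by (simp add: power2_eq_square algebra_simps)
    show ?case unfolding eq using IH cross insert.prems(2) insert.hyps by auto
  qed
  then show ?A ?B by auto
qed

lemma (in prob_space) variance_indep_sum:
  fixes X :: "'i \<Rightarrow> 'a \<Rightarrow> real"
  assumes "finite I" and ind: "indep_vars (\<lambda>_. borel) X I"
    and sq: "\<And>i. i \<in> I \<Longrightarrow> integrable M (\<lambda>w. (X i w)\<^sup>2)"
  shows "integrable M (\<lambda>w. (\<Sum>i\<in>I. X i w)\<^sup>2)"
    and "variance (\<lambda>w. \<Sum>i\<in>I. X i w) = (\<Sum>i\<in>I. variance (X i))"
proof -
  have rv[measurable]: "random_variable borel (X j)" if "j \<in> I" for j
    using ind that by (auto simp: indep_vars_def)
  have int: "integrable M (X j)" if "j \<in> I" for j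
    using square_integrable_imp_integrable[OF rv[OF that] sq[OF that]] .
  let ?Y = "\<lambda>i w. X i w - expectation (X i)"
  have indY: "indep_vars (\<lambda>_. borel) ?Y I"
    using indep_vars_compose2[OF ind, of "\<lambda>i x. x - expectation (X i)" "\<lambda>_. borel"] by auto
  have sqY: "integrable M (\<lambda>w. (?Y i w)\<^sup>2)" if "i \<in> I" for i
  proof -
    have "integrable M (\<lambda>w. (X i w)\<^sup>2 - 2 * expectation (X i) * X i w + (expectation (X i))\<^sup>2)"
      using int[OF that] sq[OF that] by auto
    then show ?thesis by (simp add: power2_diff algebra_simps)
  qed
  have mY: "expectation (?Y i) = 0" if "i \<in> I" for i
    using int[OF that] by (simp add: prob_space)
  note s = second_moment_indep_sum[OF assms(1) indY sqY mY]
  have intS: "integrable M (\<lambda>w. \<Sum>i\<in>I. ?Y i w)" using int by auto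
  let ?m = "\<Sum>i\<in>I. expectation (X i)"
  have E: "expectation (\<lambda>w. \<Sum>i\<in>I. X i w) = ?m" using int by simp
  have "integrable M (\<lambda>w. (\<Sum>i\<in>I. ?Y i w)\<^sup>2 + 2 * ?m * (\<Sum>i\<in>I. ?Y i w) + ?m\<^sup>2)"
    using s(1) intS by auto
  moreover have "(\<Sum>i\<in>I. ?Y i w)\<^sup>2 + 2 * ?m * (\<Sum>i\<in>I. ?Y i w) + ?m\<^sup>2 = (\<Sum>i\<in>I. X i w)\<^sup>2" for w
    by (simp add: sum_subtractf power2_eq_square algebra_simps)
  ultimately show "integrable M (\<lambda>w. (\<Sum>i\<in>I. X i w)\<^sup>2)" by simp
  show "variance (\<lambda>w. \<Sum>i\<in>I. X i w) = (\<Sum>i\<in>I. variance (X i))"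
    using s(2) unfolding E by (simp add: sum_subtractf)
qed

lemma (in prob_space) Chebyshev_indep_sum:
  fixes X :: "'i \<Rightarrow> 'a \<Rightarrow> real"
  assumes "finite I" and ind: "indep_vars (\<lambda>_. borel) X I"
    and sq: "\<And>i. i \<in> I \<Longrightarrow> integrable M (\<lambda>w. (X i w)\<^sup>2)" and "0 < a"
  shows "\<P>(w in M. a \<le> \<bar>(\<Sum>i\<in>I. X i w) - (\<Sum>i\<in>I. expectation (X i))\<bar>) \<le> (\<Sum>i\<in>I. variance (X i)) / a\<^sup>2"
proof -
  have rv[measurable]: "random_variable borel (X j)" if "j \<in> I" for j
    using ind that by (auto simp: indep_vars_def)
  have int: "integrable M (X j)" if "j \<in> I" for j
    using square_integrable_imp_integrable[OF rv[OF that] sq[OF that]] .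
  have E: "expectation (\<lambda>w. \<Sum>i\<in>I. X i w) = (\<Sum>i\<in>I. expectation (X i))" using int by simp
  show ?thesis
    using Chebyshev_inequality[of "\<lambda>w. \<Sum>i\<in>I. X i w" a] variance_indep_sum[OF assms(1-3)] assms(4)
    unfolding E by simp
qed

text \<open>
  On finitely many coordinates in the natural numbers the product sigma-algebra is discrete.
\<close>

lemma measurable_restrict_nat:
  fixes L :: "'a \<Rightarrow> 'i \<Rightarrow> nat" and F :: "('i \<Rightarrow> nat) \<Rightarrow> 'c"
  assumes "finite I" "\<And>i. i \<in> I \<Longrightarrow> (\<lambda>w. L w i) \<in> measurable M (count_space UNIV)"
    and "\<And>x. F x \<in> space N"
  shows "(\<lambda>w. F (restrict (L w) I)) \<in> measurable M N"
    and "F \<in> measurable (PiM I (\<lambda>_. count_space (UNIV::nat set))) N"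
proof -
  have eq: "PiM I (\<lambda>_. count_space (UNIV::nat set)) = count_space (PiE I (\<lambda>_. UNIV))"
    by (rule count_space_PiM_finite) (use assms in auto)
  show 1: "F \<in> measurable (PiM I (\<lambda>_. count_space (UNIV::nat set))) N"
    unfolding eq using assms(3) by (auto simp: measurable_count_space_eq1)
  have "(\<lambda>w. restrict (L w) I) \<in> measurable M (PiM I (\<lambda>_. count_space (UNIV::nat set)))"
    using assms(2) by (auto intro!: measurable_restrict)
  from measurable_compose[OF this 1] show "(\<lambda>w. F (restrict (L w) I)) \<in> measurable M N" .
qed

text \<open>
  Whether \<open>T\<close> is the identifiable set depends on the multiplicities in a complicated way;
  discreteness makes every such function measurable, so that disjoint families of hyperedges give
  independent functions.
\<close>

lemma (in prob_space) indep_var_disjoint_blocks: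
  fixes L :: "'a \<Rightarrow> 'i \<Rightarrow> nat" and f g :: "('i \<Rightarrow> nat) \<Rightarrow> real"
  assumes "finite I" "indep_vars (\<lambda>_. count_space UNIV) (\<lambda>i w. L w i) I"
    "A \<subseteq> I" "B \<subseteq> I" "A \<inter> B = {}"
  shows "indep_var borel (\<lambda>w. f (restrict (L w) A)) borel (\<lambda>w. g (restrict (L w) B))"
proof -
  have "finite A" "finite B" using assms(1,3,4) by (auto intro: finite_subset)
  have rv: "(\<lambda>w. L w i) \<in> measurable M (count_space UNIV)" if "i \<in> I" for i
    using assms(2) that by (auto simp: indep_vars_def)
  show ?thesis
    using indep_var_compose[OF indep_var_restrict[OF assms(2,5,3,4)],
        of f borel g borel] measurable_restrict_nat(2)[OF \<open>finite A\<close>, of L M f borel] measurable_restrict_nat(2)[OF \<open>finite B\<close>, of L M g borel] rv assms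
    by (auto simp: comp_def subset_iff)
qed

lemma (in prob_space) prob_disjoint_blocks:
  fixes L :: "'a \<Rightarrow> 'i \<Rightarrow> nat" and p q :: "('i \<Rightarrow> nat) \<Rightarrow> bool"
  assumes "finite I" "indep_vars (\<lambda>_. count_space UNIV) (\<lambda>i w. L w i) I"
    "A \<subseteq> I" "B \<subseteq> I" "A \<inter> B = {}"
  shows "\<P>(w in M. p (restrict (L w) A) \<and> q (restrict (L w) B)) =
    \<P>(w in M. p (restrict (L w) A)) * \<P>(w in M. q (restrict (L w) B))"
proof -
  have ind: "indep_var borel (\<lambda>w. of_bool (p (restrict (L w) A)) :: real) borel (\<lambda>w. of_bool (q (restrict (L w) B)) :: real)"
    by (rule indep_var_disjoint_blocks[OF assms])
  from prob_indep_random_variable[OF ind, of "{1}" "{1}"] show ?thesis by simp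
qed

section \<open>The law of the set of identifiable vertices\<close>

text \<open>
  Closure under the inference step: once all vertices of a hyperedge but one are known, so is the
  last one. The identifiable vertices form the least closed set.
\<close>

definition closed_set :: "'v set \<Rightarrow> ('v set \<Rightarrow> nat) \<Rightarrow> 'v set \<Rightarrow> bool" where
  "closed_set V L T \<longleftrightarrow> (\<forall>A v. A \<subseteq> V \<longrightarrow> v \<in> A \<longrightarrow> 1 \<le> L A \<longrightarrow> A - {v} \<subseteq> T \<longrightarrow> v \<in> T)"

lemma identifiable_vertices_subset: "identifiable_vertices V L \<subseteq> V"
  by (auto simp: identifiable_vertices_def)

lemma identifiable_in_closed:
  assumes "identifiable_in V L n v" "closed_set V L T"
  shows "v \<in> T"
  using assms(1)
proof (induction rule: identifiable_in.induct)
  case (one_step v)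
  then show ?case using assms(2) unfolding closed_set_def by (metis Diff_cancel empty_subsetI singletonI empty_iff insert_subset)
next
  case (more_steps n A v)
  then show ?case using assms(2) unfolding closed_set_def by blast
qed

lemma identifiable_vertices_least:
  "closed_set V L T \<Longrightarrow> identifiable_vertices V L \<subseteq> T"
  by (auto simp: identifiable_vertices_def dest: identifiable_in_closed)

text \<open>
  The other vertices of a hyperedge are finitely many, so some number of steps suffices for all of
  them, and one more step gives the last vertex.
\<close>

lemma closed_identifiable_vertices:
  assumes "finite V"
  shows "closed_set V L (identifiable_vertices V L)"
  unfolding closed_set_def
proof (intro allI impI)
  fix A v assume A: "A \<subseteq> V" "v \<in> A" "1 \<le> L A" "A - {v} \<subseteq> identifiable_vertices V L"
  then have "\<forall>w\<in>A-{v}. \<exists>n. identifiable_in V L n w"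
    by (auto simp: identifiable_vertices_def)
  then obtain f where f: "\<forall>w\<in>A-{v}. identifiable_in V L (f w) w" by metis
  define n where "n = Suc (Suc (\<Sum>w\<in>A-{v}. f w))"
  have fin: "finite (A - {v})" using A(1) assms finite_subset by blast
  have "f w < n" if "w \<in> A - {v}" for w
    using member_le_sum[OF that, of f] fin unfolding n_def by auto
  then have "\<forall>w\<in>A - {v}. \<exists>m<n. identifiable_in V L m w" using f by blast
  moreover have "2 \<le> n" by (simp add: n_def)
  ultimately have "identifiable_in V L n v" using A by (intro identifiable_in.more_steps) auto
  then show "v \<in> identifiable_vertices V L"
    using A \<open>2 \<le> n\<close> unfolding identifiable_vertices_def by auto
qed

lemma identifiable_vertices_mono:
  assumes "finite V" "\<And>A. L A \<le> L' A"
  shows "identifiable_vertices V L \<subseteq> identifiable_vertices V L'"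
proof (rule identifiable_vertices_least)
  show "closed_set V L (identifiable_vertices V L')"
    using closed_identifiable_vertices[OF assms(1), of L'] assms(2)
    unfolding closed_set_def by (meson order_trans)
qed

lemma identifiable_vertices_cong:
  assumes "finite V" "\<And>A. A \<subseteq> V \<Longrightarrow> L A = L' A"
  shows "identifiable_vertices V L = identifiable_vertices V L'"
proof -
  have "closed_set V L T = closed_set V L' T" for T
    unfolding closed_set_def using assms(2) by metis
  then show ?thesis
    using closed_identifiable_vertices[OF assms(1)] identifiable_vertices_least
    by (metis subset_antisym)
qed

text \<open>
  If the least closed set of \<open>S\<close> is \<open>T\<close>, hyperedges that leave \<open>T\<close> have contributed nothing to it.
  Conversely, if no hyperedge leaves \<open>T\<close> by a single vertex, then \<open>T\<close> is closed in \<open>S\<close>, and it is least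
  because it is already generated from within.
\<close>

lemma identifiable_vertices_eq_iff:
  assumes "finite S" "T \<subseteq> S"
  shows "identifiable_vertices S L = T \<longleftrightarrow>
    identifiable_vertices T L = T \<and> (\<forall>v\<in>S-T. \<forall>B\<in>Pow T. L (insert v B) = 0)"
proof (intro iffI conjI)
  have finT: "finite T" using assms finite_subset by blast
  assume eq: "identifiable_vertices S L = T"
  then have cl: "closed_set S L T" using closed_identifiable_vertices[OF assms(1)] by metis
  let ?U = "identifiable_vertices T L"
  have clU: "closed_set T L ?U" using closed_identifiable_vertices[OF finT] .
  have UT: "?U \<subseteq> T" by (rule identifiable_vertices_subset)
  have "closed_set S L ?U"
    unfolding closed_set_def
  proof (intro allI impI)
    fix A v assume A: "A \<subseteq> S" "v \<in> A" "1 \<le> L A" "A - {v} \<subseteq> ?U"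
    then have "v \<in> T" using cl UT unfolding closed_set_def by (meson order_trans)
    then have "A \<subseteq> T" using A UT by blast
    then show "v \<in> ?U" using A clU unfolding closed_set_def by blast
  qed
  then show "?U = T" using identifiable_vertices_least eq UT by blast
  show "\<forall>v\<in>S-T. \<forall>B\<in>Pow T. L (insert v B) = 0"
  proof (intro ballI, rule ccontr)
    fix v B assume v: "v \<in> S - T" "B \<in> Pow T" "L (insert v B) \<noteq> 0"
    then have "insert v B \<subseteq> S" "insert v B - {v} \<subseteq> T" "1 \<le> L (insert v B)" using assms by auto
    then have "v \<in> T" using cl unfolding closed_set_def by blast
    then show False using v by simp
  qed
next
  have finT: "finite T" using assms finite_subset by blast
  assume *: "identifiable_vertices T L = T \<and> (\<forall>v\<in>S-T. \<forall>B\<in>Pow T. L (insert v B) = 0)"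
  have "closed_set S L T"
    unfolding closed_set_def
  proof (intro allI impI, rule ccontr)
    fix A v assume A: "A \<subseteq> S" "v \<in> A" "1 \<le> L A" "A - {v} \<subseteq> T" "v \<notin> T"
    then have "v \<in> S - T" "A - {v} \<in> Pow T" by auto
    then have "L (insert v (A - {v})) = 0" using * by blast
    then show False using A by (simp add: insert_absorb)
  qed
  then have 1: "identifiable_vertices S L \<subseteq> T" by (rule identifiable_vertices_least)
  have "closed_set T L (identifiable_vertices S L)"
    using closed_identifiable_vertices[OF assms(1), of L] assms(2)
    unfolding closed_set_def by (meson order_trans)
  then have "T \<subseteq> identifiable_vertices S L" using * identifiable_vertices_least by metis
  with 1 show "identifiable_vertices S L = T" by simp
qed

text \<open>
  The mean multiplicity of one set of size \<open>j\<close>.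
\<close>

definition edge_rate :: "(nat \<Rightarrow> real) \<Rightarrow> nat \<Rightarrow> nat \<Rightarrow> real" where
  "edge_rate \<beta> N j = real N * \<beta> j / real (N choose j)"

text \<open>
  The mean number of hyperedges that join one given vertex to subsets of a given set of \<open>k\<close> other
  vertices.
\<close>

definition hazard :: "(nat \<Rightarrow> real) \<Rightarrow> nat \<Rightarrow> nat \<Rightarrow> real" where
  "hazard \<beta> N k = (\<Sum>i\<le>k. real (k choose i) * edge_rate \<beta> N (Suc i))"

lemma sum_Pow_card:
  fixes f :: "nat \<Rightarrow> real"
  assumes "finite T"
  shows "(\<Sum>B\<in>Pow T. f (card B)) = (\<Sum>i\<le>card T. real (card T choose i) * f i)"
proof -
  have "(\<Sum>B\<in>Pow T. f (card B)) = (\<Sum>i\<le>card T. \<Sum>B\<in>{B\<in>Pow T. card B = i}. f (card B))"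
    by (rule sum.group[symmetric]) (use assms in \<open>auto intro: card_mono\<close>)
  also have "\<dots> = (\<Sum>i\<le>card T. real (card T choose i) * f i)"
  proof (rule sum.cong[OF refl])
    fix i
    have "card {B\<in>Pow T. card B = i} = card T choose i"
      using n_subsets[OF assms, of i] by (simp add: Pow_def)
    then show "(\<Sum>B\<in>{B\<in>Pow T. card B = i}. f (card B)) = real (card T choose i) * f i"
      by simp
  qed
  finally show ?thesis .
qed

locale poisson_hg = prob_space M for M :: "'a measure" +
  fixes V :: "'v set" and \<beta> :: "nat \<Rightarrow> real" and L :: "'a \<Rightarrow> 'v set \<Rightarrow> nat" and N :: nat
  assumes hg: "poisson_hypergraph M V \<beta> L" and beta_nonneg: "\<And>j. 0 \<le> \<beta> j" and card_V: "card V = N"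
begin

lemma hypergraph_parts: "finite V"
  "indep_vars (\<lambda>_. count_space UNIV) (\<lambda>A w. L w A) (Pow V)"
  "\<forall>A\<in>Pow V. \<forall>B\<in>Pow V. card A = card B \<longrightarrow>
        distr M (count_space UNIV) (\<lambda>w. L w A) = distr M (count_space UNIV) (\<lambda>w. L w B)"
  "\<forall>j\<le>N. poisson_distributed M (real N * \<beta> j) (\<lambda>w. \<Sum>A\<in>{A \<in> Pow V. card A = j}. L w A)"
proof -
  note h = hg[unfolded poisson_hypergraph_def card_V, THEN conjunct2]
  note h2 = h[THEN conjunct2] note h3 = h2[THEN conjunct2]
  show "finite V" by (rule h[THEN conjunct1])
  show "indep_vars (\<lambda>_. count_space UNIV) (\<lambda>A w. L w A) (Pow V)" by (rule h2[THEN conjunct1])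
  show "\<forall>A\<in>Pow V. \<forall>B\<in>Pow V. card A = card B \<longrightarrow>
        distr M (count_space UNIV) (\<lambda>w. L w A) = distr M (count_space UNIV) (\<lambda>w. L w B)"
    by (rule h3[THEN conjunct1])
  show "\<forall>j\<le>N. poisson_distributed M (real N * \<beta> j) (\<lambda>w. \<Sum>A\<in>{A \<in> Pow V. card A = j}. L w A)"
    by (rule h3[THEN conjunct2])
qed

lemmas fin = hypergraph_parts(1) and indep = hypergraph_parts(2)

lemma exch: "A \<subseteq> V \<Longrightarrow> B \<subseteq> V \<Longrightarrow> card A = card B \<Longrightarrow>
      distr M (count_space UNIV) (\<lambda>w. L w A) = distr M (count_space UNIV) (\<lambda>w. L w B)"
  using hypergraph_parts(3) by blast

lemma pois: "j \<le> N \<Longrightarrow> poisson_distributed M (real N * \<beta> j) (\<lambda>w. \<Sum>A\<in>{A \<in> Pow V. card A = j}. L w A)"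
  using hypergraph_parts(4) by blast

lemma rv[measurable (raw)]: "A \<subseteq> V \<Longrightarrow> (\<lambda>w. L w A) \<in> measurable M (count_space UNIV)"
  using indep unfolding indep_vars_def by blast

abbreviation "\<mu> \<equiv> edge_rate \<beta> N"

lemma rate_nonneg: "0 \<le> \<mu> j"
  using beta_nonneg by (auto simp: edge_rate_def)

text \<open>
  Only the total multiplicity over the sets of a given size is known to be Poisson. The void
  probability of one of these \<open>N choose j\<close> independent and identically distributed multiplicities is
  a root of that of the total, and its mean and variance are the corresponding fractions; the
  arguments below rest on these facts.
\<close>

lemma edge_distribution:
  assumes "A \<subseteq> V"
  shows "\<P>(w in M. L w A = 0) = exp (- \<mu> (card A))"
    and "integrable M (\<lambda>w. real (L w A))" and "integrable M (\<lambda>w. (real (L w A))\<^sup>2)"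
    and "expectation (\<lambda>w. real (L w A)) = \<mu> (card A)"
    and "variance (\<lambda>w. real (L w A)) = \<mu> (card A)"
proof -
  define j where "j = card A"
  define \<C> where "\<C> = {B \<in> Pow V. card B = j}"
  have A: "A \<in> \<C>" using assms by (auto simp: \<C>_def j_def)
  have C: "B \<subseteq> V" "card B = card A" if "B \<in> \<C>" for B using that by (auto simp: \<C>_def j_def)
  have finC: "finite \<C>" using fin by (auto simp: \<C>_def)
  have cardC: "card \<C> = N choose j"
    using n_subsets[OF fin, of j] card_V by (simp add: \<C>_def Pow_def)
  have jN: "j \<le> N" using card_mono[OF fin assms] card_V by (simp add: j_def)
  have pos: "0 < real (N choose j)" using jN by simp
  let ?S = "\<lambda>w. \<Sum>B\<in>\<C>. L w B"
  have P: "poisson_distributed M (real N * \<beta> j) ?S"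
    using pois[OF jN] by (simp add: \<C>_def)
  note mom = poisson_distributed_moments[OF prob_space_axioms P]
  have indC: "indep_vars (\<lambda>_. count_space UNIV) (\<lambda>B w. L w B) \<C>"
    using indep_vars_subset[OF indep, of \<C>] by (auto simp: \<C>_def)
  have indR: "indep_vars (\<lambda>_. borel) (\<lambda>B w. real (L w B)) \<C>"
    using indep_vars_compose2[OF indC, of "\<lambda>_. real" "\<lambda>_. borel"] by simp
  have trans: "expectation (\<lambda>w. f (L w B)) = expectation (\<lambda>w. f (L w A))" if "B \<in> \<C>" for B and f :: "nat \<Rightarrow> real"
  proof -
    have "(\<integral>x. f x \<partial>distr M (count_space UNIV) (\<lambda>w. L w B)) = (\<integral>x. f x \<partial>distr M (count_space UNIV) (\<lambda>w. L w A))"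
      using exch[OF C(1)[OF that] assms C(2)[OF that]] by simp
    then show ?thesis
      using assms C(1)[OF that] by (subst (asm) (1 2) integral_distr) auto
  qed
  have le: "L w B \<le> ?S w" if "B \<in> \<C>" for B w
    using member_le_sum[OF that, of "L w"] finC by simp
  have int1: "integrable M (\<lambda>w. real (L w B))" if "B \<in> \<C>" for B
    by (rule Bochner_Integration.integrable_bound[OF mom(1)])
      (use C(1)[OF that] le[OF that] in \<open>auto simp flip: of_nat_sum\<close>)
  have int2: "integrable M (\<lambda>w. (real (L w B))\<^sup>2)" if "B \<in> \<C>" for B
    by (rule Bochner_Integration.integrable_bound[OF mom(3)])
      (use C(1)[OF that] le[OF that] in \<open>auto intro!: AE_I2 power_mono simp flip: of_nat_sum\<close>)
  show "integrable M (\<lambda>w. real (L w A))" "integrable M (\<lambda>w. (real (L w A))\<^sup>2)"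
    using int1[OF A] int2[OF A] by auto
  have "real N * \<beta> j = (\<Sum>B\<in>\<C>. expectation (\<lambda>w. real (L w B)))"
    using mom(2) int1 by simp
  also have "\<dots> = real (N choose j) * expectation (\<lambda>w. real (L w A))"
    using trans[of _ real] cardC by simp
  finally show E: "expectation (\<lambda>w. real (L w A)) = \<mu> (card A)"
    using pos by (simp add: edge_rate_def j_def[symmetric] field_simps)
  have v: "variance (\<lambda>w. real (L w B)) = variance (\<lambda>w. real (L w A))" if "B \<in> \<C>" for B
    using trans[OF that, of real] trans[OF that, of "\<lambda>x. (real x - expectation (\<lambda>w. real (L w A)))\<^sup>2"] by simp
  have "real N * \<beta> j = variance (\<lambda>w. \<Sum>B\<in>\<C>. real (L w B))"
    using mom by (subst variance_eq) auto
  also have "\<dots> = (\<Sum>B\<in>\<C>. variance (\<lambda>w. real (L w B)))"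
    by (rule variance_indep_sum(2)[OF finC indR int2])
  also have "\<dots> = real (N choose j) * variance (\<lambda>w. real (L w A))"
    using v cardC by simp
  finally show "variance (\<lambda>w. real (L w A)) = \<mu> (card A)"
    using pos by (simp add: edge_rate_def j_def[symmetric] field_simps)
  have p: "\<P>(w in M. L w B = 0) = \<P>(w in M. L w A = 0)" if "B \<in> \<C>" for B
    using arg_cong[OF exch[OF C(1)[OF that] assms C(2)[OF that]], of "\<lambda>m. measure m {0}"] C(1)[OF that] assms
    by (simp add: measure_distr vimage_def Int_def conj_commute)
  have "exp (- (real N * \<beta> j)) = \<P>(w in M. ?S w = 0)"
    using P by (simp add: poisson_distributed_def)
  also have "{w\<in>space M. ?S w = 0} = (\<Inter>B\<in>\<C>. (\<lambda>w. L w B) -` {0} \<inter> space M)"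
    using A finC by auto
  also have "prob \<dots> = (\<Prod>B\<in>\<C>. prob ((\<lambda>w. L w B) -` {0} \<inter> space M))"
    using A finC by (intro indep_varsD_finite[OF indC]) auto
  also have "\<dots> = \<P>(w in M. L w A = 0) ^ (N choose j)"
    using p cardC by (simp add: vimage_def Int_def conj_commute)
  finally have eq: "\<P>(w in M. L w A = 0) ^ (N choose j) = exp (- (real N * \<beta> j))" by simp
  also have "\<dots> = exp (- \<mu> j) ^ (N choose j)"
    using pos by (simp add: exp_of_nat_mult[symmetric] edge_rate_def)
  finally show "\<P>(w in M. L w A = 0) = exp (- \<mu> (card A))"
    using pos by (subst (asm) power_eq_iff_eq_base) (auto simp: j_def)
qed

lemma indep_real: "\<A> \<subseteq> Pow V \<Longrightarrow> indep_vars (\<lambda>_. borel) (\<lambda>B w. real (L w B)) \<A>"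
  using indep_vars_compose2[OF indep_vars_subset[OF indep], of \<A> "\<lambda>_. real" "\<lambda>_. borel"] by simp

lemma finite_edges: "\<A> \<subseteq> Pow V \<Longrightarrow> finite \<A>"
  using fin by (auto intro: finite_subset)

lemma prob_no_edges:
  assumes "\<A> \<subseteq> Pow V"
  shows "\<P>(w in M. \<forall>A\<in>\<A>. L w A = 0) = exp (- (\<Sum>A\<in>\<A>. \<mu> (card A)))"
proof (cases "\<A> = {}")
  case True
  then show ?thesis by (simp add: prob_space)
next
  case False
  have "{w\<in>space M. \<forall>A\<in>\<A>. L w A = 0} = (\<Inter>B\<in>\<A>. (\<lambda>w. L w B) -` {0} \<inter> space M)"
    using False by auto
  also have "prob \<dots> = (\<Prod>B\<in>\<A>. prob ((\<lambda>w. L w B) -` {0} \<inter> space M))"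
    using False finite_edges[OF assms] by (intro indep_varsD_finite[OF indep_vars_subset[OF indep assms]]) auto
  also have "\<dots> = (\<Prod>B\<in>\<A>. exp (- \<mu> (card B)))"
    using edge_distribution(1) assms by (intro prod.cong) (auto simp: vimage_def Int_def conj_commute)
  also have "\<dots> = exp (- (\<Sum>A\<in>\<A>. \<mu> (card A)))"
    using finite_edges[OF assms] by (simp add: exp_sum sum_negf[symmetric])
  finally show ?thesis .
qed

text \<open>
  The sets by which the inference step would add a vertex of \<open>S - T\<close> to \<open>T\<close>.
\<close>

definition frontier_edges :: "'v set \<Rightarrow> 'v set \<Rightarrow> 'v set set" where
  "frontier_edges S T = (\<lambda>(v, B). insert v B) ` ((S - T) \<times> Pow T)"

lemma frontier_rate:
  assumes "S \<subseteq> V" "T \<subseteq> S"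
  shows "(\<Sum>A\<in>frontier_edges S T. \<mu> (card A)) = hazard \<beta> N (card T) * real (card (S - T))"
proof -
  have finT: "finite T" using assms fin by (meson finite_subset)
  have inj: "inj_on (\<lambda>(v, B). insert v B) ((S - T) \<times> Pow T)"
  proof (rule inj_onI, clarsimp)
    fix v B w C assume *: "v \<in> S" "v \<notin> T" "B \<subseteq> T" "w \<in> S" "w \<notin> T" "C \<subseteq> T" "insert v B = insert w C"
    then have "v = w" by blast
    moreover have "B = insert v B \<inter> T" "C = insert w C \<inter> T" using * by auto
    ultimately show "v = w \<and> B = C" using * by metis
  qed
  have card: "card (insert v B) = Suc (card B)" if "v \<in> S - T" "B \<in> Pow T" for v B
    using that finT by (subst card_insert_disjoint) (auto intro: finite_subset)
  have "(\<Sum>A\<in>frontier_edges S T. \<mu> (card A)) = (\<Sum>(v,B)\<in>(S - T) \<times> Pow T. \<mu> (card (insert v B)))"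
    unfolding frontier_edges_def by (subst sum.reindex[OF inj]) (simp add: case_prod_unfold comp_def)
  also have "\<dots> = (\<Sum>v\<in>S-T. \<Sum>B\<in>Pow T. \<mu> (card (insert v B)))"
    by (simp add: sum.cartesian_product)
  also have "\<dots> = (\<Sum>v\<in>S-T. \<Sum>B\<in>Pow T. \<mu> (Suc (card B)))"
    using card by (intro sum.cong refl) auto
  also have "\<dots> = (\<Sum>v\<in>S-T. hazard \<beta> N (card T))"
    using sum_Pow_card[OF finT, of "\<lambda>i. \<mu> (Suc i)"] by (simp add: hazard_def)
  finally show ?thesis by simp
qed

lemma frontier_subset: "S \<subseteq> V \<Longrightarrow> T \<subseteq> S \<Longrightarrow> frontier_edges S T \<subseteq> Pow V"
  by (auto simp: frontier_edges_def)

lemma frontier_disjoint: "frontier_edges S T \<inter> Pow T = {}"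
  by (auto simp: frontier_edges_def)

definition full_prob :: "'v set \<Rightarrow> real" where
  "full_prob T = \<P>(w in M. identifiable_vertices T (L w) = T)"

lemma identifiable_restrict:
  assumes "T \<subseteq> V" "Pow T \<subseteq> \<A>"
  shows "identifiable_vertices T (restrict (L w) \<A>) = identifiable_vertices T (L w)"
  using assms fin by (intro identifiable_vertices_cong) (auto intro: finite_subset)

lemma identifiable_vertices_measurable[measurable]:
  "S \<subseteq> V \<Longrightarrow> (\<lambda>w. identifiable_vertices S (L w)) \<in> measurable M (count_space UNIV)"
  using measurable_restrict_nat(1)[of "Pow S" L M "identifiable_vertices S" "count_space UNIV"]
    identifiable_restrict[of S "Pow S"] rv finite_edges[of "Pow S"] by (simp add: subset_iff)

text \<open>
  The two conditions of \<open>identifiable_vertices_eq_iff\<close> depend on the disjoint families \<open>Pow T\<close> and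
  \<open>frontier_edges S T\<close>.
\<close>

lemma prob_identifiable_eq:
  assumes "S \<subseteq> V" "T \<subseteq> S"
  shows "\<P>(w in M. identifiable_vertices S (L w) = T) =
    full_prob T * exp (- (hazard \<beta> N (card T) * real (card (S - T))))"
proof -
  have finS: "finite S" and TV: "T \<subseteq> V" using assms fin by (auto intro: finite_subset)
  let ?F = "frontier_edges S T"
  have "{w\<in>space M. identifiable_vertices S (L w) = T} =
    {w\<in>space M. identifiable_vertices T (restrict (L w) (Pow T)) = T \<and> (\<forall>A\<in>?F. restrict (L w) ?F A = 0)}"
    unfolding identifiable_vertices_eq_iff[OF finS assms(2)] identifiable_restrict[OF TV order_refl]
    by (auto simp: frontier_edges_def)
  then have "\<P>(w in M. identifiable_vertices S (L w) = T) =
    \<P>(w in M. identifiable_vertices T (restrict (L w) (Pow T)) = T \<and> (\<forall>A\<in>?F. restrict (L w) ?F A = 0))"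
    by (rule arg_cong)
  also have "\<dots> = \<P>(w in M. identifiable_vertices T (restrict (L w) (Pow T)) = T) *
     \<P>(w in M. \<forall>A\<in>?F. restrict (L w) ?F A = 0)"
    by (rule prob_disjoint_blocks[OF _ indep, where p="\<lambda>x. identifiable_vertices T x = T"
       and q="\<lambda>x. \<forall>A\<in>?F. x A = 0"])
       (use TV frontier_subset[OF assms] frontier_disjoint[of S T] fin in \<open>auto simp: Int_commute\<close>)
  also have "{w\<in>space M. \<forall>A\<in>?F. restrict (L w) ?F A = 0} = {w\<in>space M. \<forall>A\<in>?F. L w A = 0}"
    by auto
  finally show ?thesis
    unfolding prob_no_edges[OF frontier_subset[OF assms]] frontier_rate[OF assms]
        identifiable_restrict[OF TV order_refl] full_prob_def .
qed

lemma full_prob_recursion: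
  assumes "S \<subseteq> V"
  shows "(\<Sum>T\<in>Pow S. full_prob T * exp (- (hazard \<beta> N (card T) * real (card (S - T))))) = 1"
proof -
  have finS: "finite (Pow S)" using assms fin by (auto intro: finite_subset)
  have "1 = prob (\<Union>T\<in>Pow S. {w\<in>space M. identifiable_vertices S (L w) = T})"
    using identifiable_vertices_subset[of S] by (subst prob_space[symmetric], intro arg_cong[where f=prob]) auto
  also have "\<dots> = (\<Sum>T\<in>Pow S. \<P>(w in M. identifiable_vertices S (L w) = T))"
    using finS assms by (intro finite_measure_finite_Union) (auto simp: disjoint_family_on_def)
  also have "\<dots> = (\<Sum>T\<in>Pow S. full_prob T * exp (- (hazard \<beta> N (card T) * real (card (S - T)))))"
    using prob_identifiable_eq[OF assms] by auto
  finally show ?thesis by simp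
qed

text \<open>
  In the identity \<open>full_prob_recursion\<close> the summand for \<open>T = S\<close> is \<open>full_prob S\<close> itself, so the identity
  determines \<open>full_prob\<close> by recursion on the size. Any sequence \<open>a\<close> that solves the recursion for
  sizes therefore describes it; the Renyi walk will provide one.
\<close>

lemma full_prob_eq:
  assumes a: "\<And>n. n \<le> N \<Longrightarrow> (\<Sum>k\<le>n. real (n choose k) * a k * exp (- (hazard \<beta> N k * real (n - k)))) = 1"
    and "S \<subseteq> V"
  shows "full_prob S = a (card S)"
  using assms(2)
proof (induction "card S" arbitrary: S rule: less_induct)
  case less
  have finS: "finite S" using less.prems fin by (auto intro: finite_subset)
  have cS: "card S \<le> N" using card_mono[OF fin less.prems] card_V by simp
  let ?e = "\<lambda>T. exp (- (hazard \<beta> N (card T) * real (card S - card T)))"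
  have cd: "card (S - T) = card S - card T" if "T \<subseteq> S" for T
    using that finite_subset[OF that finS] by (simp add: card_Diff_subset)
  have "1 = (\<Sum>T\<in>Pow S. full_prob T * ?e T)"
    using full_prob_recursion[OF less.prems] cd by (auto intro!: sum.cong)
  also have "\<dots> = full_prob S + (\<Sum>T\<in>Pow S - {S}. full_prob T * ?e T)"
    using finS by (subst sum.remove[of _ S]) auto
  also have "(\<Sum>T\<in>Pow S - {S}. full_prob T * ?e T) = (\<Sum>T\<in>Pow S - {S}. a (card T) * ?e T)"
    using less.hyps less.prems finS by (intro sum.cong refl) (auto intro!: psubset_card_mono)
  also have "\<dots> = (\<Sum>T\<in>Pow S. a (card T) * ?e T) - a (card S)"
    using finS by (subst sum.remove[of "Pow S" S]) auto
  also have "(\<Sum>T\<in>Pow S. a (card T) * ?e T) = 1"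
    using sum_Pow_card[OF finS, of "\<lambda>k. a k * exp (- (hazard \<beta> N k * real (card S - k)))"] a[OF cS]
    by (simp add: mult.assoc)
  finally show ?case by simp
qed

lemma prob_card_identifiable:
  assumes a: "\<And>n. n \<le> N \<Longrightarrow> (\<Sum>k\<le>n. real (n choose k) * a k * exp (- (hazard \<beta> N k * real (n - k)))) = 1"
    and "k \<le> N"
  shows "\<P>(w in M. card (identifiable_vertices V (L w)) = k) =
    real (N choose k) * a k * exp (- (hazard \<beta> N k * real (N - k)))"
proof -
  let ?C = "{T\<in>Pow V. card T = k}"
  have "{w\<in>space M. card (identifiable_vertices V (L w)) = k} =
     (\<Union>T\<in>?C. {w\<in>space M. identifiable_vertices V (L w) = T})"
    using identifiable_vertices_subset[of V] by auto
  also have "prob \<dots> = (\<Sum>T\<in>?C. \<P>(w in M. identifiable_vertices V (L w) = T))"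
    using fin by (intro finite_measure_finite_Union) (auto simp: disjoint_family_on_def)
  also have "\<dots> = (\<Sum>T\<in>?C. a k * exp (- (hazard \<beta> N k * real (N - k))))"
  proof (rule sum.cong[OF refl])
    fix T assume T: "T \<in> ?C"
    then have "card (V - T) = N - k"
      using fin card_V by (subst card_Diff_subset) (auto intro: finite_subset)
    then show "\<P>(w in M. identifiable_vertices V (L w) = T) = a k * exp (- (hazard \<beta> N k * real (N - k)))"
      using T prob_identifiable_eq[of V T] full_prob_eq[OF a, of T] by auto
  qed
  also have "card ?C = N choose k"
    using n_subsets[OF fin, of k] card_V by (simp add: Pow_def)
  then have "(\<Sum>T\<in>?C. a k * exp (- (hazard \<beta> N k * real (N - k)))) = real (N choose k) * a k * exp (- (hazard \<beta> N k * real (N - k)))"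
    by simp
  finally show ?thesis .
qed

end

section \<open>The Renyi walk of exponential variables\<close>

text \<open>
  If the \<open>x i\<close> are independent standard exponential variables, these are the order statistics of a
  sample of \<open>n\<close> such variables (Renyi representation).
\<close>

definition renyi_sum :: "nat \<Rightarrow> nat \<Rightarrow> (nat \<Rightarrow> real) \<Rightarrow> real" where
  "renyi_sum n k x = (\<Sum>i<k. x i / (real n - real i))"

definition below_until :: "(nat \<Rightarrow> real) \<Rightarrow> nat \<Rightarrow> nat \<Rightarrow> (nat \<Rightarrow> real) \<Rightarrow> bool" where
  "below_until h n k x \<longleftrightarrow> (\<forall>j<k. renyi_sum n (Suc j) x \<le> h j)"

text \<open>
  The alternative \<open>k = n\<close> is the value when the barrier \<open>h\<close> is never exceeded. The barrier at \<open>k\<close> is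
  compared with the order statistic of rank \<open>k + 1\<close>.
\<close>

definition stop_index :: "(nat \<Rightarrow> real) \<Rightarrow> nat \<Rightarrow> (nat \<Rightarrow> real) \<Rightarrow> nat" where
  "stop_index h n x = (LEAST k. k = n \<or> h k < renyi_sum n (Suc k) x)"

lemma stop_index_le: "stop_index h n x \<le> n"
  unfolding stop_index_def by (rule Least_le) simp

lemma stop_index_eq_iff:
  assumes "k \<le> n"
  shows "stop_index h n x = k \<longleftrightarrow> below_until h n k x \<and> (k = n \<or> h k < renyi_sum n (Suc k) x)"
proof
  assume eq: "stop_index h n x = k"
  have "k = n \<or> h k < renyi_sum n (Suc k) x"
    using LeastI[of "\<lambda>k. k = n \<or> h k < renyi_sum n (Suc k) x" n] eq by (simp add: stop_index_def)
  moreover have "below_until h n k x"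
    unfolding below_until_def
  proof (intro allI impI)
    fix j assume "j < k"
    then show "renyi_sum n (Suc j) x \<le> h j"
      using not_less_Least[of j "\<lambda>k. k = n \<or> h k < renyi_sum n (Suc k) x"] eq
      by (simp add: stop_index_def not_less)
  qed
  ultimately show "below_until h n k x \<and> (k = n \<or> h k < renyi_sum n (Suc k) x)" by simp
next
  assume *: "below_until h n k x \<and> (k = n \<or> h k < renyi_sum n (Suc k) x)"
  show "stop_index h n x = k"
    unfolding stop_index_def
  proof (rule Least_equality)
    show "k = n \<or> h k < renyi_sum n (Suc k) x" using * by simp
    fix j assume j: "j = n \<or> h j < renyi_sum n (Suc j) x"
    show "k \<le> j"
    proof (rule ccontr)
      assume "\<not> k \<le> j"
      then have "renyi_sum n (Suc j) x \<le> h j" "j \<noteq> n" using * assms by (auto simp: below_until_def)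
      then show False using j by simp
    qed
  qed
qed

lemma renyi_sum_cong: "(\<And>i. i < k \<Longrightarrow> x i = y i) \<Longrightarrow> renyi_sum n k x = renyi_sum n k y"
  by (auto simp: renyi_sum_def)

lemma below_until_cong: "(\<And>i. i < k \<Longrightarrow> x i = y i) \<Longrightarrow> below_until h n k x = below_until h n k y"
  unfolding below_until_def using renyi_sum_cong[of _ x y n] by (metis Suc_leI order_less_le_trans)

lemma below_until_measurable[measurable]:
  "Measurable.pred (PiM {..<k} (\<lambda>_. borel)) (below_until h n k)"
proof -
  have "Measurable.pred (PiM {..<k} (\<lambda>_. borel)) (\<lambda>x. renyi_sum n (Suc j) x \<le> h j)" if "j < k" for j
  proof -
    have [measurable]: "renyi_sum n (Suc j) \<in> borel_measurable (PiM {..<k} (\<lambda>_. borel))"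
      unfolding renyi_sum_def using that by (intro borel_measurable_sum borel_measurable_divide measurable_component_singleton) auto
    show ?thesis by measurable
  qed
  then have "Measurable.pred (PiM {..<k} (\<lambda>_. borel)) (\<lambda>x. \<forall>j\<in>{..<k}. renyi_sum n (Suc j) x \<le> h j)"
    by (intro pred_intros_finite) auto
  moreover have "(\<lambda>x. \<forall>j\<in>{..<k}. renyi_sum n (Suc j) x \<le> h j) = below_until h n k"
    by (rule ext) (auto simp: below_until_def)
  ultimately show ?thesis by metis
qed

lemma renyi_sum_measurable[measurable]:
  "renyi_sum n k \<in> borel_measurable (PiM {..<k} (\<lambda>_. borel))"
  unfolding renyi_sum_def by measurable

locale exp_seq = prob_space M for M :: "'a measure" +
  fixes E :: "nat \<Rightarrow> 'a \<Rightarrow> real"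
  assumes indep_E: "indep_vars (\<lambda>_. borel) E UNIV"
    and exp_E: "\<And>i. distributed M lborel (E i) (exponential_density 1)"
begin

lemma rv_E[measurable]: "E i \<in> borel_measurable M"
  using indep_E by (auto simp: indep_vars_def)

definition X :: "'a \<Rightarrow> nat \<Rightarrow> real" where "X w i = E i w"

lemma renyi_sum_X_measurable[measurable]: "(\<lambda>w. renyi_sum n k (X w)) \<in> borel_measurable M"
  unfolding renyi_sum_def X_def by measurable

lemma below_until_X_measurable[measurable]: "Measurable.pred M (\<lambda>w. below_until h n k (X w))"
  unfolding below_until_def by measurable

lemma stop_index_X_measurable[measurable]: "(\<lambda>w. stop_index h n (X w)) \<in> measurable M (count_space UNIV)"
  unfolding stop_index_def by measurable

text \<open>
  The mean of a function of the walk after \<open>k\<close> steps over the paths that have respected the barrier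
  so far.
\<close>

definition Q :: "(nat \<Rightarrow> real) \<Rightarrow> nat \<Rightarrow> nat \<Rightarrow> (real \<Rightarrow> ennreal) \<Rightarrow> ennreal" where
  "Q h n k \<phi> = (\<integral>\<^sup>+w. \<phi> (renyi_sum n k (X w)) * of_bool (below_until h n k (X w)) \<partial>M)"

text \<open>
  The next exponential variable is independent of the past and can be integrated out first.
\<close>

lemma Q_step_aux:
  assumes [measurable]: "(\<lambda>(s, y). g s y) \<in> borel_measurable (borel \<Otimes>\<^sub>M borel)"
  shows "(\<integral>\<^sup>+w. g (renyi_sum n k (X w)) (E k w) * of_bool (below_until h n k (X w)) \<partial>M) =
    Q h n k (\<lambda>s. \<integral>\<^sup>+y. g s y * ennreal (exponential_density 1 y) \<partial>lborel)"
proof -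
  let ?P = "PiM {..<k} (\<lambda>_. borel :: real measure)"
  let ?Y = "\<lambda>w. restrict (X w) {..<k}"
  let ?P2 = "PiM {k} (\<lambda>_. borel :: real measure)"
  let ?Z = "\<lambda>w. restrict (X w) {k}"
  have "indep_var ?P (\<lambda>w. restrict (\<lambda>i. E i w) {..<k}) (PiM {k} (\<lambda>_. borel)) (\<lambda>w. restrict (\<lambda>i. E i w) {k})"
    by (rule indep_var_restrict[OF indep_E]) auto
  then have ind: "indep_var ?P ?Y ?P2 ?Z"
    by (simp add: X_def[abs_def])
  then have rvY[measurable]: "?Y \<in> measurable M ?P" and rvZ[measurable]: "?Z \<in> measurable M ?P2"
    using indep_var_rv1 indep_var_rv2 by blast+
  have Tc: "renyi_sum n k (?Y w) = renyi_sum n k (X w)" "below_until h n k (?Y w) = below_until h n k (X w)" for w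
    by (auto intro!: renyi_sum_cong below_until_cong)
  let ?G = "\<lambda>(x, y). g (renyi_sum n k x) (y k) * of_bool (below_until h n k x)"
  interpret D1: prob_space "distr M ?P ?Y" by (rule prob_space_distr) (rule rvY)
  interpret D2: prob_space "distr M ?P2 ?Z" by (rule prob_space_distr) (rule rvZ)
  have [measurable]: "(\<lambda>y. y k) \<in> borel_measurable ?P2" by measurable
  have G[measurable]: "?G \<in> borel_measurable (?P \<Otimes>\<^sub>M ?P2)" by measurable
  have G': "?G \<in> borel_measurable (distr M ?P ?Y \<Otimes>\<^sub>M distr M ?P2 ?Z)"
    using G by (simp cong: measurable_cong_sets)
  have "(\<integral>\<^sup>+w. g (renyi_sum n k (X w)) (E k w) * of_bool (below_until h n k (X w)) \<partial>M) =
     (\<integral>\<^sup>+w. ?G (?Y w, ?Z w) \<partial>M)"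
    by (simp add: Tc) (simp add: X_def)
  also have "\<dots> = (\<integral>\<^sup>+z. ?G z \<partial>distr M (?P \<Otimes>\<^sub>M ?P2) (\<lambda>w. (?Y w, ?Z w)))"
    by (rule nn_integral_distr[symmetric]) measurable
  also have "distr M (?P \<Otimes>\<^sub>M ?P2) (\<lambda>w. (?Y w, ?Z w)) = distr M ?P ?Y \<Otimes>\<^sub>M distr M ?P2 ?Z"
    using ind unfolding indep_var_distribution_eq by simp
  also have "(\<integral>\<^sup>+z. ?G z \<partial>(distr M ?P ?Y \<Otimes>\<^sub>M distr M ?P2 ?Z)) = (\<integral>\<^sup>+x. \<integral>\<^sup>+y. ?G (x, y) \<partial>distr M ?P2 ?Z \<partial>distr M ?P ?Y)"
    by (rule D2.nn_integral_fst[OF G', symmetric])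
  also have "\<dots> = (\<integral>\<^sup>+w. \<integral>\<^sup>+y. ?G (?Y w, y) \<partial>distr M ?P2 ?Z \<partial>M)"
  proof -
    have "(\<lambda>x. \<integral>\<^sup>+y. ?G (x, y) \<partial>distr M ?P2 ?Z) \<in> borel_measurable (distr M ?P ?Y)"
      by (rule D2.borel_measurable_nn_integral_fst[OF G'])
    from nn_integral_distr[OF rvY this] show ?thesis .
  qed
  also have "\<dots> = (\<integral>\<^sup>+w. (\<integral>\<^sup>+y. g (renyi_sum n k (X w)) y * ennreal (exponential_density 1 y) \<partial>lborel) * of_bool (below_until h n k (X w)) \<partial>M)"
  proof (rule nn_integral_cong)
    fix w
    have g: "(\<lambda>y. g s y) \<in> borel_measurable borel" for s by measurable
    have "(\<integral>\<^sup>+y. ?G (?Y w, y) \<partial>distr M ?P2 ?Z) = (\<integral>\<^sup>+w'. g (renyi_sum n k (X w)) (E k w') * of_bool (below_until h n k (X w)) \<partial>M)"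
    proof -
      have "(\<lambda>y. ?G (?Y w, y)) \<in> borel_measurable (distr M ?P2 ?Z)"
        using measurable_compose[OF _ g] by (auto intro!: borel_measurable_times_ennreal measurable_compose[OF _ g])
      from nn_integral_distr[OF rvZ this] show ?thesis
        by (simp add: Tc) (simp add: X_def)
    qed
    also have "\<dots> = (\<integral>\<^sup>+w'. g (renyi_sum n k (X w)) (E k w') \<partial>M) * of_bool (below_until h n k (X w))"
      by (rule nn_integral_multc) measurable
    also have "(\<integral>\<^sup>+w'. g (renyi_sum n k (X w)) (E k w') \<partial>M) = (\<integral>\<^sup>+y. g (renyi_sum n k (X w)) y * ennreal (exponential_density 1 y) \<partial>lborel)"
      by (subst distributed_nn_integral[OF exp_E[of k], symmetric]) (use g in \<open>simp_all add: mult.commute\<close>)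
    finally show "(\<integral>\<^sup>+y. ?G (?Y w, y) \<partial>distr M ?P2 ?Z) =
        (\<integral>\<^sup>+y. g (renyi_sum n k (X w)) y * ennreal (exponential_density 1 y) \<partial>lborel) * of_bool (below_until h n k (X w))" .
  qed
  also have "\<dots> = Q h n k (\<lambda>s. \<integral>\<^sup>+y. g s y * ennreal (exponential_density 1 y) \<partial>lborel)"
    unfolding Q_def ..
  finally show ?thesis .
qed

text \<open>
  Given the value \<open>s\<close> after \<open>k\<close> steps, the next value is \<open>s\<close> plus an exponential variable of rate \<open>n - k\<close>;
  respecting the barrier restricts it to \<open>{s..h k}\<close>.
\<close>

lemma Q_Suc:
  assumes [measurable]: "\<phi> \<in> borel_measurable borel" and "k < n"
  shows "Q h n (Suc k) \<phi> = Q h n k (\<lambda>s. \<integral>\<^sup>+t. \<phi> t * indicator {s..h k} t *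
      ennreal ((real n - real k) * exp (- (real n - real k) * (t - s))) \<partial>lborel)"
proof -
  define c where "c = real n - real k"
  have c: "0 < c" using assms by (simp add: c_def)
  have "Q h n (Suc k) \<phi> = (\<integral>\<^sup>+w. (\<phi> (renyi_sum n k (X w) + E k w / c) * of_bool (renyi_sum n k (X w) + E k w / c \<le> h k))
       * of_bool (below_until h n k (X w)) \<partial>M)"
    unfolding Q_def
    by (intro nn_integral_cong)
      (auto simp: below_until_def less_Suc_eq renyi_sum_def X_def c_def)
  also have "\<dots> = Q h n k (\<lambda>s. \<integral>\<^sup>+y. (\<phi> (s + y / c) * of_bool (s + y / c \<le> h k)) * ennreal (exponential_density 1 y) \<partial>lborel)"
    by (rule Q_step_aux) measurable
  also have "\<dots> = Q h n k (\<lambda>s. \<integral>\<^sup>+t. \<phi> t * indicator {s..h k} t * ennreal (c * exp (- c * (t - s))) \<partial>lborel)"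
  proof -
    have "(\<integral>\<^sup>+y. (\<phi> (s + y / c) * of_bool (s + y / c \<le> h k)) * ennreal (exponential_density 1 y) \<partial>lborel)
      = (\<integral>\<^sup>+t. \<phi> t * indicator {s..h k} t * ennreal (c * exp (- c * (t - s))) \<partial>lborel)" for s
    proof -
      have "(\<integral>\<^sup>+t. \<phi> t * indicator {s..h k} t * ennreal (c * exp (- c * (t - s))) \<partial>lborel) =
        ennreal \<bar>1 / c\<bar> * (\<integral>\<^sup>+y. \<phi> (s + 1 / c * y) * indicator {s..h k} (s + 1 / c * y) * ennreal (c * exp (- c * ((s + 1 / c * y) - s))) \<partial>lborel)"
        using c by (intro nn_integral_real_affine) auto
      also have "\<dots> = (\<integral>\<^sup>+y. ennreal (1 / c) * (\<phi> (s + 1 / c * y) * indicator {s..h k} (s + 1 / c * y) * ennreal (c * exp (- c * ((s + 1 / c * y) - s)))) \<partial>lborel)"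
        using c by (subst nn_integral_cmult) auto
      also have "\<dots> = (\<integral>\<^sup>+y. (\<phi> (s + y / c) * of_bool (s + y / c \<le> h k)) * ennreal (exponential_density 1 y) \<partial>lborel)"
      proof (rule nn_integral_cong)
        fix y :: real
        have 1: "ennreal (1 / c) * ennreal (c * exp (- y)) = ennreal (exp (- y))"
          using c by (simp add: ennreal_mult[symmetric])
        have 2: "ennreal (1 / c) * (a * ennreal (c * exp (- y))) = a * ennreal (exp (- y))" for a
          using 1 by (metis mult.assoc mult.commute)
        show "ennreal (1 / c) * (\<phi> (s + 1 / c * y) * indicator {s..h k} (s + 1 / c * y) * ennreal (c * exp (- c * ((s + 1 / c * y) - s)))) =
          (\<phi> (s + y / c) * of_bool (s + y / c \<le> h k)) * ennreal (exponential_density 1 y)"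
        proof (cases "0 \<le> y \<and> s + y / c \<le> h k")
          case True
          then have "indicator {s..h k} (s + 1 / c * y) = (1::ennreal)" using c by auto
          then show ?thesis using True c 2 by (simp add: exponential_density_def)
        next
          case False
          then have "\<not> (s \<le> s + y / c \<and> s + y / c \<le> h k)" using c by (auto simp: field_simps zero_le_divide_iff)
          then have "indicator {s..h k} (s + 1 / c * y) = (0::ennreal)" by auto
          then show ?thesis using False by (auto simp: exponential_density_def)
        qed
      qed
      finally show ?thesis by simp
    qed
    then show ?thesis by simp
  qed
  finally show ?thesis by (simp add: c_def)
qed

lemma Q_cong: "(\<And>s. \<phi> s = \<psi> s) \<Longrightarrow> Q h n k \<phi> = Q h n k \<psi>"
  by (simp add: Q_def)

lemma Q_cmult: "\<phi> \<in> borel_measurable borel \<Longrightarrow> Q h n k (\<lambda>s. c * \<phi> s) = c * Q h n k \<phi>"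
  unfolding Q_def by (subst nn_integral_cmult[symmetric]) (auto simp: mult.assoc)

text \<open>
  The \<open>k\<close> smallest of \<open>n\<close> exponential variables arise by choosing \<open>k\<close> of them and requiring the others
  to exceed the largest chosen one, which has probability \<open>exp (- (n - k) * t)\<close> if that one equals
  \<open>t\<close>. So sample sizes are related by a binomial factor and an exponential weight, with or without a
  barrier. In the induction both sides reduce to the same integral \<open>R c\<close> after one application of
  \<open>Q_Suc\<close>.
\<close>

lemma Q_size:
  assumes "\<phi> \<in> borel_measurable borel" "k \<le> n"
  shows "Q h n k \<phi> = of_nat (n choose k) * Q h k k (\<lambda>t. \<phi> t * ennreal (exp (- (real n - real k) * t)))"
  using assms
proof (induction k arbitrary: n \<phi>)
  case 0
  then show ?case by (simp add: Q_def renyi_sum_def below_until_def emeasure_space_1)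
next
  case (Suc k)
  note [measurable] = Suc.prems(1)
  \<comment> \<open>The part of the one-step integral that does not depend on the sample size.\<close>
  define R where "R c s = (\<integral>\<^sup>+t. \<phi> t * indicator {s..h k} t * ennreal (exp (- c * t)) \<partial>lborel)" for c s
  have R[measurable]: "R c \<in> borel_measurable borel" for c
  proof -
    have "(\<lambda>s. \<integral>\<^sup>+t. \<phi> t * indicator {x. fst x \<le> snd x \<and> snd x \<le> h k} (s, t) * ennreal (exp (- c * t)) \<partial>lborel) \<in> borel_measurable borel"
      by measurable
    moreover have "(\<lambda>s. \<integral>\<^sup>+t. \<phi> t * indicator {x. fst x \<le> snd x \<and> snd x \<le> h k} (s, t) * ennreal (exp (- c * t)) \<partial>lborel) = R c"
      unfolding R_def by (intro ext nn_integral_cong) (auto simp: indicator_def)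
    ultimately show ?thesis by metis
  qed
  have step: "Q h m (Suc k) \<psi> = of_nat ((m choose k) * (m - k)) * Q h k k (R c)"
    if "k < m" "\<psi> \<in> borel_measurable borel" "\<And>t. \<psi> t * ennreal (exp (- (real m - real k) * t)) = \<phi> t * ennreal (exp (- c * t))" for m \<psi> c
  proof -
    note [measurable] = that(2)
    let ?d = "real m - real k"
    have d: "0 < ?d" using that by simp
    let ?K = "\<lambda>s. \<integral>\<^sup>+t. \<psi> t * indicator {s..h k} t * ennreal (?d * exp (- ?d * (t - s))) \<partial>lborel"
    have K: "?K s = ennreal (?d * exp (?d * s)) * R c s" for s
    proof -
      have "?K s = (\<integral>\<^sup>+t. ennreal (?d * exp (?d * s)) * (\<phi> t * indicator {s..h k} t * ennreal (exp (- c * t))) \<partial>lborel)"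
      proof (rule nn_integral_cong)
        fix t
        have "ennreal (?d * exp (- ?d * (t - s))) = ennreal (?d * exp (?d * s)) * ennreal (exp (- ?d * t))"
          using d by (subst ennreal_mult[symmetric]) (auto simp: exp_add[symmetric] algebra_simps)
        then have "\<psi> t * indicator {s..h k} t * ennreal (?d * exp (- ?d * (t - s))) =
            ennreal (?d * exp (?d * s)) * ((\<psi> t * ennreal (exp (- ?d * t))) * indicator {s..h k} t)"
          by (simp only: mult_ac)
        then show "\<psi> t * indicator {s..h k} t * ennreal (?d * exp (- ?d * (t - s))) =
            ennreal (?d * exp (?d * s)) * (\<phi> t * indicator {s..h k} t * ennreal (exp (- c * t)))"
          unfolding that(3) by (simp only: mult_ac)
      qed
      also have "\<dots> = ennreal (?d * exp (?d * s)) * R c s"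
        unfolding R_def by (rule nn_integral_cmult) measurable
      finally show ?thesis .
    qed
    have "Q h m (Suc k) \<psi> = Q h m k (\<lambda>s. ennreal (?d * exp (?d * s)) * R c s)"
      unfolding Q_Suc[OF that(2,1)] K ..
    also have "\<dots> = of_nat (m choose k) * Q h k k (\<lambda>s. (ennreal (?d * exp (?d * s)) * R c s) * ennreal (exp (- ?d * s)))"
      using that by (intro Suc.IH) auto
    also have "Q h k k (\<lambda>s. (ennreal (?d * exp (?d * s)) * R c s) * ennreal (exp (- ?d * s))) = Q h k k (\<lambda>s. ennreal ?d * R c s)"
    proof (rule Q_cong)
      fix s
      have "ennreal (?d * exp (?d * s)) * ennreal (exp (- ?d * s)) = ennreal ?d"
        using d by (subst ennreal_mult[symmetric]) (auto simp: mult.assoc exp_add[symmetric] algebra_simps)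
      then show "(ennreal (?d * exp (?d * s)) * R c s) * ennreal (exp (- ?d * s)) = ennreal ?d * R c s"
        by (metis mult.assoc mult.commute)
    qed
    also have "\<dots> = ennreal ?d * Q h k k (R c)" by (rule Q_cmult) measurable
    also have "ennreal ?d = of_nat (m - k)" using that by (simp add: of_nat_diff ennreal_of_nat_eq_real_of_nat)
    finally show ?thesis by (simp add: mult.assoc)
  qed
  let ?c = "real n - real k"
  have "Q h n (Suc k) \<phi> = of_nat ((n choose k) * (n - k)) * Q h k k (R ?c)"
    using Suc.prems by (intro step) auto
  moreover have "Q h (Suc k) (Suc k) (\<lambda>t. \<phi> t * ennreal (exp (- (real n - real (Suc k)) * t))) =
      of_nat ((Suc k choose k) * (Suc k - k)) * Q h k k (R ?c)"
  proof (rule step)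
    fix t
    have "ennreal (exp (- (real n - real (Suc k)) * t)) * ennreal (exp (- (real (Suc k) - real k) * t)) = ennreal (exp (- ?c * t))"
      by (subst ennreal_mult[symmetric]) (auto simp: exp_add[symmetric] algebra_simps)
    then show "\<phi> t * ennreal (exp (- (real n - real (Suc k)) * t)) * ennreal (exp (- (real (Suc k) - real k) * t)) = \<phi> t * ennreal (exp (- ?c * t))"
      by (simp only: mult.assoc)
  qed auto
  moreover have "(n choose k) * (n - k) = (n choose Suc k) * Suc k"
    using binomial_absorb_comp[of n k] binomial_absorption[of k n] Suc.prems
    by (metis Suc_times_binomial_eq binomial_absorption mult.commute)
  ultimately show ?case by (simp add: mult.assoc[symmetric] of_nat_mult[symmetric] del: of_nat_mult of_nat_Suc)
qed

definition full_run_prob :: "(nat \<Rightarrow> real) \<Rightarrow> nat \<Rightarrow> real" where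
  "full_run_prob h k = \<P>(w in M. below_until h k k (X w))"

lemma Q_const: "Q h k k (\<lambda>s. ennreal c) = ennreal c * ennreal (full_run_prob h k)"
proof -
  have "Q h k k (\<lambda>s. ennreal c) = (\<integral>\<^sup>+w. ennreal c * indicator {w\<in>space M. below_until h k k (X w)} w \<partial>M)"
    unfolding Q_def by (intro nn_integral_cong) (auto simp: indicator_def)
  then show ?thesis
    by (simp add: nn_integral_cmult_indicator full_run_prob_def emeasure_eq_measure)
qed

text \<open>
  Beyond \<open>s\<close>, the next step exceeds \<open>h k\<close> with probability \<open>exp (- (n - k) * (h k - s))\<close>. The weight
  \<open>exp (- (n - k) * s)\<close> of \<open>Q_size\<close> cancels the dependence on \<open>s\<close>, and the probability that a walk of
  size \<open>k\<close> never stops early remains. Monotonicity of \<open>h\<close> guarantees \<open>s \<le> h k\<close>.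
\<close>

lemma prob_stop_index:
  assumes "mono h" "0 \<le> h 0" "k \<le> n"
  shows "\<P>(w in M. stop_index h n (X w) = k) =
    real (n choose k) * full_run_prob h k * exp (- (h k * real (n - k)))"
proof (cases "k = n")
  case True
  then show ?thesis using assms by (simp add: stop_index_eq_iff full_run_prob_def)
next
  case False
  then have kn: "k < n" using assms by simp
  define c where "c = real n - real k"
  have c: "0 < c" using kn by (simp add: c_def)
  have bound: "renyi_sum n k x \<le> h k" if "below_until h n k x" for x
  proof (cases k)
    case 0
    then show ?thesis using assms by (simp add: renyi_sum_def)
  next
    case (Suc j)
    then show ?thesis using that monoD[OF assms(1), of j k] by (auto simp: below_until_def intro: order_trans)
  qed
  have "ennreal (\<P>(w in M. stop_index h n (X w) = k)) = emeasure M {w\<in>space M. stop_index h n (X w) = k}"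
    by (simp add: emeasure_eq_measure)
  also have "\<dots> = (\<integral>\<^sup>+w. indicator {w\<in>space M. stop_index h n (X w) = k} w \<partial>M)"
    by simp
  also have "\<dots> = (\<integral>\<^sup>+w. of_bool (h k < renyi_sum n k (X w) + E k w / c) * of_bool (below_until h n k (X w)) \<partial>M)"
    using stop_index_eq_iff[OF assms(3)] False
    by (intro nn_integral_cong) (auto simp: indicator_def renyi_sum_def X_def c_def)
  also have "\<dots> = Q h n k (\<lambda>s. \<integral>\<^sup>+y. of_bool (h k < s + y / c) * ennreal (exponential_density 1 y) \<partial>lborel)"
    by (rule Q_step_aux) measurable
  also have "\<dots> = Q h n k (\<lambda>s. ennreal (exp (- c * (h k - s))))"
  proof -
    have *: "(\<integral>\<^sup>+y. of_bool (h k < s + y / c) * ennreal (exponential_density 1 y) \<partial>lborel) = ennreal (exp (- c * (h k - s)))"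
      if "s \<le> h k" for s
    proof -
      have a: "0 \<le> c * (h k - s)" using that c by simp
      have "(\<integral>\<^sup>+y. of_bool (h k < s + y / c) * ennreal (exponential_density 1 y) \<partial>lborel)
        = (\<integral>\<^sup>+w. of_bool (h k < s + E 0 w / c) \<partial>M)"
        using distributed_nn_integral[OF exp_E[of 0], of "\<lambda>y. of_bool (h k < s + y / c)"] by (simp add: mult.commute)
      also have "\<dots> = (\<integral>\<^sup>+w. indicator {w\<in>space M. c * (h k - s) < E 0 w} w \<partial>M)"
        using c by (intro nn_integral_cong) (auto simp: indicator_def field_simps)
      also have "\<dots> = ennreal (\<P>(w in M. c * (h k - s) < E 0 w))"
        by (simp add: emeasure_eq_measure)
      also have "\<P>(w in M. c * (h k - s) < E 0 w) = exp (- c * (h k - s))"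
        using exponential_distributedD_gt[OF exp_E[of 0] a] by simp
      finally show ?thesis .
    qed
    show ?thesis
      unfolding Q_def using * bound by (intro nn_integral_cong) auto
  qed
  also have "\<dots> = of_nat (n choose k) * Q h k k (\<lambda>s. ennreal (exp (- c * (h k - s))) * ennreal (exp (- c * s)))"
    using assms by (subst Q_size) (auto simp: c_def)
  also have "Q h k k (\<lambda>s. ennreal (exp (- c * (h k - s))) * ennreal (exp (- c * s))) = Q h k k (\<lambda>s. ennreal (exp (- c * h k)))"
    by (rule Q_cong) (auto simp: ennreal_mult[symmetric] exp_add[symmetric] algebra_simps)
  also have "of_nat (n choose k) * \<dots> = ennreal (real (n choose k) * full_run_prob h k * exp (- c * h k))"
    unfolding Q_const by (simp add: ennreal_of_nat_eq_real_of_nat ennreal_mult[symmetric] full_run_prob_def mult_ac)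
  finally have "\<P>(w in M. stop_index h n (X w) = k) = real (n choose k) * full_run_prob h k * exp (- c * h k)"
    by (subst (asm) ennreal_inj) (auto simp: full_run_prob_def)
  moreover have "- c * h k = - (h k * real (n - k))" using kn by (simp add: c_def of_nat_diff algebra_simps)
  ultimately show ?thesis by simp
qed

text \<open>
  The probabilities of the stopping indices add up to one; this is the recursion of \<open>full_prob_eq\<close>.
\<close>

lemma full_run_prob_recursion:
  assumes "mono h" "0 \<le> h 0"
  shows "(\<Sum>k\<le>n. real (n choose k) * full_run_prob h k * exp (- (h k * real (n - k)))) = 1"
proof -
  have "1 = prob (\<Union>k\<in>{..n}. {w\<in>space M. stop_index h n (X w) = k})"
    using stop_index_le[of h n] by (subst prob_space[symmetric], intro arg_cong[where f=prob]) auto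
  also have "\<dots> = (\<Sum>k\<le>n. \<P>(w in M. stop_index h n (X w) = k))"
    by (intro finite_measure_finite_Union) (auto simp: disjoint_family_on_def)
  also have "\<dots> = (\<Sum>k\<le>n. real (n choose k) * full_run_prob h k * exp (- (h k * real (n - k))))"
    using prob_stop_index[OF assms] by (intro sum.cong) auto
  finally show ?thesis by simp
qed

end

section \<open>Maximal inequality, joint convergence and a weighted central limit theorem\<close>

text \<open>
  Decompose by the first index \<open>k\<close> at which the level \<open>a\<close> is reached. What happens after \<open>k\<close> is
  independent of this and centred, so the second moment of the full sum on the event is at least
  that of the sum up to \<open>k\<close>, hence at least \<open>a\<^sup>2\<close> times its probability.
\<close>

lemma (in prob_space) Kolmogorov_maximal_inequality:
  fixes X :: "nat \<Rightarrow> 'a \<Rightarrow> real"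
  assumes ind: "indep_vars (\<lambda>_. borel) X {..<n}"
    and sq: "\<And>i. i < n \<Longrightarrow> integrable M (\<lambda>w. (X i w)\<^sup>2)"
    and mean: "\<And>i. i < n \<Longrightarrow> expectation (X i) = 0" and a: "0 < a"
  shows "\<P>(w in M. \<exists>k\<le>n. a \<le> \<bar>\<Sum>i<k. X i w\<bar>) \<le> (\<Sum>i<n. expectation (\<lambda>w. (X i w)\<^sup>2)) / a\<^sup>2"
proof -
  have rv[measurable]: "i < n \<Longrightarrow> X i \<in> borel_measurable M" for i
    using ind by (auto simp: indep_vars_def)
  define S where "S k w = (\<Sum>i<k. X i w)" for k w
  have S[measurable]: "k \<le> n \<Longrightarrow> S k \<in> borel_measurable M" for k
    unfolding S_def by (intro borel_measurable_sum rv) auto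
  define p where "p k w \<longleftrightarrow> a \<le> \<bar>S k w\<bar> \<and> (\<forall>j<k. \<bar>S j w\<bar> < a)" for k w
  define A where "A k = {w\<in>space M. p k w}" for k
  have A[measurable]: "A k \<in> events" if "k \<le> n" for k
  proof -
    have "Measurable.pred M (\<lambda>w. \<forall>j\<in>{..<k}. \<bar>S j w\<bar> < a)"
      using that by (intro pred_intros_finite) (auto intro!: borel_measurable_pred_less borel_measurable_abs S)
    moreover have "Measurable.pred M (\<lambda>w. a \<le> \<bar>S k w\<bar>)" using S[OF that] by measurable
    ultimately have "Measurable.pred M (\<lambda>w. a \<le> \<bar>S k w\<bar> \<and> (\<forall>j\<in>{..<k}. \<bar>S j w\<bar> < a))" by measurable
    then have "{w\<in>space M. a \<le> \<bar>S k w\<bar> \<and> (\<forall>j\<in>{..<k}. \<bar>S j w\<bar> < a)} \<in> events" by measurable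
    moreover have "{w\<in>space M. a \<le> \<bar>S k w\<bar> \<and> (\<forall>j\<in>{..<k}. \<bar>S j w\<bar> < a)} = A k"
      by (auto simp: A_def p_def)
    ultimately show ?thesis by simp
  qed
  have sqS: "integrable M (\<lambda>w. (\<Sum>i\<in>I. X i w)\<^sup>2)" if "I \<subseteq> {..<n}" for I
    using that sq mean by (intro second_moment_indep_sum(1) indep_vars_subset[OF ind]) (auto intro: finite_subset)
  have bound: "a\<^sup>2 * prob (A k) \<le> expectation (\<lambda>w. indicator (A k) w * (S n w)\<^sup>2)" if k: "k \<le> n" for k
  proof -
    define D where "D w = (\<Sum>i\<in>{k..<n}. X i w)" for w
    have Sn: "S n w = S k w + D w" for w
      unfolding S_def D_def using k by (metis atLeast0LessThan le0 sum.atLeastLessThan_concat)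
    \<comment> \<open>The sum up to \<open>k\<close> on the event of first passage at \<open>k\<close>, as a function of the first \<open>k\<close>
      variables.\<close>
    define f :: "(nat \<Rightarrow> real) \<Rightarrow> real" where
      "f x = of_bool (a \<le> \<bar>\<Sum>i<k. x i\<bar> \<and> (\<forall>j\<in>{..<k}. \<bar>\<Sum>i<j. x i\<bar> < a)) * (\<Sum>i<k. x i)" for x
    have [measurable]: "(\<lambda>x. \<Sum>i<j. x i) \<in> borel_measurable (PiM {..<k} (\<lambda>_. borel :: real measure))" if "j \<le> k" for j
      using that by (intro borel_measurable_sum measurable_component_singleton) auto
    have fm: "f \<in> borel_measurable (PiM {..<k} (\<lambda>_. borel))"
    proof -
      have "Measurable.pred (PiM {..<k} (\<lambda>_. borel :: real measure)) (\<lambda>x. \<forall>j\<in>{..<k}. \<bar>\<Sum>i<j. x i\<bar> < a)"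
        by (intro pred_intros_finite) (auto intro!: borel_measurable_pred_less borel_measurable_abs borel_measurable_sum measurable_component_singleton)
      then show ?thesis unfolding f_def by measurable
    qed
    have gm: "(\<lambda>x. \<Sum>i\<in>{k..<n}. x i) \<in> borel_measurable (PiM {k..<n} (\<lambda>_. borel :: real measure))"
      by measurable
    have "indep_var borel (f \<circ> (\<lambda>w. restrict (\<lambda>i. X i w) {..<k})) borel ((\<lambda>x. \<Sum>i\<in>{k..<n}. x i) \<circ> (\<lambda>w. restrict (\<lambda>i. X i w) {k..<n}))"
      using k by (intro indep_var_compose[OF indep_var_restrict[OF ind] fm gm]) auto
    moreover have "(\<lambda>x. \<Sum>i\<in>{k..<n}. x i) \<circ> (\<lambda>w. restrict (\<lambda>i. X i w) {k..<n}) = D"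
      by (auto simp: D_def fun_eq_iff)
    moreover define F where "F = f \<circ> (\<lambda>w. restrict (\<lambda>i. X i w) {..<k})"
    ultimately have iFD: "indep_var borel F borel D" by simp
    have F: "F w = of_bool (p k w) * S k w" for w
    proof -
      have "(\<Sum>i<j. restrict (\<lambda>i. X i w) {..<k} i) = S j w" if "j \<le> k" for j
        unfolding S_def using that by (intro sum.cong) auto
      then show ?thesis by (auto simp: F_def f_def p_def)
    qed
    have sqk: "integrable M (\<lambda>w. (S k w)\<^sup>2)" and sqD: "integrable M (\<lambda>w. (D w)\<^sup>2)" and sqn: "integrable M (\<lambda>w. (S n w)\<^sup>2)"
      unfolding S_def D_def using sqS[of "{..<k}"] sqS[of "{..<n}"] k by (auto intro: sqS)
    have Dm[measurable]: "D \<in> borel_measurable M" unfolding D_def by (intro borel_measurable_sum rv) auto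
    have iS: "integrable M (S k)" and iD: "integrable M D"
      using square_integrable_imp_integrable[OF _ sqk] square_integrable_imp_integrable[OF _ sqD] S[OF k] by auto
    have iF: "integrable M F"
      by (rule Bochner_Integration.integrable_bound[OF iS]) (use indep_var_rv1[OF iFD] F in auto)
    have ED: "expectation D = 0"
      unfolding D_def using mean square_integrable_imp_integrable[OF rv sq] by (subst Bochner_Integration.integral_sum) auto
    have cross: "integrable M (\<lambda>w. F w * D w)" "expectation (\<lambda>w. F w * D w) = 0"
      using indep_var_integrable[OF iFD iF iD] indep_var_lebesgue_integral[OF iFD iF iD] ED by auto
    have iA: "integrable M (indicator (A k) :: 'a \<Rightarrow> real)"
      using A[OF k] by (intro integrable_real_indicator) (auto simp: emeasure_eq_measure)
    have "a\<^sup>2 * prob (A k) = expectation (\<lambda>w. indicator (A k) w * a\<^sup>2 + 2 * (F w * D w))"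
      using cross A[OF k] iA by (subst Bochner_Integration.integral_add) auto
    also have "\<dots> \<le> expectation (\<lambda>w. indicator (A k) w * (S n w)\<^sup>2)"
    proof (rule integral_mono)
      show "integrable M (\<lambda>w. indicator (A k) w * a\<^sup>2 + 2 * (F w * D w))"
        using cross iA by auto
      show "integrable M (\<lambda>w. indicator (A k) w * (S n w)\<^sup>2)"
        using integrable_mult_indicator[OF A[OF k] sqn] by simp
      fix w assume "w \<in> space M"
      then have ind: "indicator (A k) w = (of_bool (p k w) :: real)" by (simp add: A_def indicator_def)
      show "indicator (A k) w * a\<^sup>2 + 2 * (F w * D w) \<le> indicator (A k) w * (S n w)\<^sup>2"
      proof (cases "p k w")
        case True
        then have "a\<^sup>2 \<le> (S k w)\<^sup>2" using a by (auto simp: p_def abs_le_square_iff[symmetric])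
        moreover have "(S n w)\<^sup>2 = (S k w)\<^sup>2 + 2 * (S k w * D w) + (D w)\<^sup>2"
          unfolding Sn by (simp add: power2_sum)
        ultimately show ?thesis using True ind F by (simp add: add_increasing2)
      qed (use ind F in simp)
    qed
    finally show ?thesis .
  qed
  have disj: "disjoint_family_on A {..n}"
    unfolding disjoint_family_on_def
  proof (intro ballI impI)
    fix i j :: nat assume "i \<noteq> j"
    then consider "i < j" | "j < i" by linarith
    then show "A i \<inter> A j = {}" by cases (auto simp: A_def p_def not_less[symmetric])
  qed
  have U: "{w\<in>space M. \<exists>k\<le>n. a \<le> \<bar>\<Sum>i<k. X i w\<bar>} = (\<Union>k\<in>{..n}. A k)"
  proof safe
    fix w k assume *: "w \<in> space M" "k \<le> n" "a \<le> \<bar>\<Sum>i<k. X i w\<bar>"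
    define q where "q = (LEAST k. a \<le> \<bar>S k w\<bar>)"
    have ex: "a \<le> \<bar>S k w\<bar>" using * by (simp add: S_def)
    have "a \<le> \<bar>S q w\<bar>" unfolding q_def by (rule LeastI[of "\<lambda>k. a \<le> \<bar>S k w\<bar>", OF ex])
    moreover have "\<bar>S j w\<bar> < a" if "j < q" for j
      using not_less_Least[of j "\<lambda>k. a \<le> \<bar>S k w\<bar>"] that unfolding q_def by linarith
    ultimately have "p q w" unfolding p_def by blast
    moreover have "q \<le> n" using Least_le[of "\<lambda>k. a \<le> \<bar>S k w\<bar>", OF ex] * by (simp add: q_def)
    ultimately show "w \<in> (\<Union>k\<in>{..n}. A k)" using * by (auto simp: A_def)
  qed (auto simp: A_def p_def S_def)
  have "a\<^sup>2 * \<P>(w in M. \<exists>k\<le>n. a \<le> \<bar>\<Sum>i<k. X i w\<bar>) = (\<Sum>k\<le>n. a\<^sup>2 * prob (A k))"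
    unfolding U using disj by (subst finite_measure_finite_Union) (auto simp: sum_distrib_left)
  also have "\<dots> \<le> (\<Sum>k\<le>n. expectation (\<lambda>w. indicator (A k) w * (S n w)\<^sup>2))"
    using bound by (intro sum_mono) auto
  also have "\<dots> = expectation (\<lambda>w. \<Sum>k\<le>n. indicator (A k) w * (S n w)\<^sup>2)"
    using integrable_mult_indicator[OF A sqS[of "{..<n}"]] by (subst Bochner_Integration.integral_sum) (auto simp: S_def)
  also have "\<dots> \<le> expectation (\<lambda>w. (S n w)\<^sup>2)"
  proof (rule integral_mono)
    show "integrable M (\<lambda>w. \<Sum>k\<le>n. indicator (A k) w * (S n w)\<^sup>2)"
      using integrable_mult_indicator[OF A sqS[of "{..<n}"]] by (intro Bochner_Integration.integrable_sum) (auto simp: S_def)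
    show "integrable M (\<lambda>w. (S n w)\<^sup>2)" using sqS[of "{..<n}"] by (simp add: S_def)
    fix w
    have "(\<Sum>k\<le>n. indicator (A k) w * (S n w)\<^sup>2) = indicator (\<Union>k\<in>{..n}. A k) w * (S n w)\<^sup>2"
      using disj by (subst indicator_UN_disjoint) (auto simp: sum_distrib_right)
    also have "\<dots> \<le> (S n w)\<^sup>2" by (auto simp: indicator_def)
    finally show "(\<Sum>k\<le>n. indicator (A k) w * (S n w)\<^sup>2) \<le> (S n w)\<^sup>2" .
  qed
  also have "\<dots> = (\<Sum>i<n. expectation (\<lambda>w. (X i w)\<^sup>2))"
    unfolding S_def using sq mean by (intro second_moment_indep_sum(2)[OF _ ind]) auto
  finally show ?thesis using a by (simp add: field_simps)
qed

lemma indep_vars_PiM_coordinates: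
  assumes "\<And>i. i \<in> I \<Longrightarrow> prob_space (M i)" "I \<noteq> {}"
  shows "prob_space.indep_vars (PiM I M) M (\<lambda>i x. x i) I"
proof -
  interpret prob_space "PiM I M" by (rule prob_space_PiM) (rule assms)
  have "distr (PiM I M) (PiM I M) (\<lambda>x. \<lambda>i\<in>I. x i) = distr (PiM I M) (PiM I M) (\<lambda>x. x)"
    by (intro distr_cong) (auto simp: space_PiM)
  also have "\<dots> = PiM I M" by simp
  also have "\<dots> = PiM I (\<lambda>i. distr (PiM I M) (M i) (\<lambda>x. x i))"
    using assms(1) by (intro PiM_cong) (auto simp: distr_PiM_component)
  finally show ?thesis
    by (subst indep_vars_iff_distr_eq_PiM'[OF assms(2)]) auto
qed

text \<open>
  Skorohod representation realises the convergence of each coordinate almost surely; on the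
  product of the representing spaces the coordinates are independent again and converge together.
  The predicate \<open>R\<close> singles out points at which \<open>P\<close> is stable under small perturbations; since the
  limit satisfies it almost surely, dominated convergence applies to the indicator of \<open>P\<close>.
\<close>

lemma weak_conv_independent_blocks:
  fixes B :: "nat \<Rightarrow> nat \<Rightarrow> 'a \<Rightarrow> real" and C :: "nat \<Rightarrow> 'b \<Rightarrow> real" and P R :: "(nat \<Rightarrow> real) \<Rightarrow> bool"
  assumes "prob_space M" "prob_space M'" and m: "0 < m"
    and B: "\<And>n. prob_space.indep_vars M (\<lambda>_. borel) (B n) {..<m}"
    and C: "prob_space.indep_vars M' (\<lambda>_. borel) C {..<m}"
    and conv: "\<And>l. l < m \<Longrightarrow> weak_conv_m (\<lambda>n. distr M borel (B n l)) (distr M' borel (C l))"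
    and P[measurable]: "Measurable.pred (PiM {..<m} (\<lambda>_. borel)) P"
    and R[measurable]: "Measurable.pred (PiM {..<m} (\<lambda>_. borel)) R"
    and AE_R: "AE w in M'. R (\<lambda>l\<in>{..<m}. C l w)"
    and cont: "\<And>y z. R (restrict z {..<m}) \<Longrightarrow> (\<And>l. l < m \<Longrightarrow> (\<lambda>n. y n l) \<longlonglongrightarrow> z l) \<Longrightarrow>
        \<forall>\<^sub>F n in sequentially. P (restrict (y n) {..<m}) = P (restrict z {..<m})"
  shows "(\<lambda>n. \<P>(w in M. P (\<lambda>l\<in>{..<m}. B n l w))) \<longlonglongrightarrow> \<P>(w in M'. P (\<lambda>l\<in>{..<m}. C l w))"
proof -
  interpret M: prob_space M by fact
  interpret M': prob_space M' by fact
  let ?I = "{..<m}"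
  let ?P = "PiM ?I (\<lambda>_. borel :: real measure)"
  have ne: "?I \<noteq> {}" using m by auto
  have rvB: "B n l \<in> borel_measurable M" if "l < m" for n l using B[of n] that by (auto simp: M.indep_vars_def)
  have rvC: "C l \<in> borel_measurable M'" if "l < m" for l using C that by (auto simp: M'.indep_vars_def)
  \<comment> \<open>The conclusion of the representation theorem as a predicate, so that one space can
    be chosen for each coordinate.\<close>
  define Q where "Q l \<Omega> Ys Y \<longleftrightarrow> prob_space (\<Omega> :: real measure) \<and> (\<forall>n. Ys n \<in> borel_measurable \<Omega>) \<and>
    (\<forall>n. distr \<Omega> borel (Ys n) = distr M borel (B n l)) \<and> Y \<in> measurable \<Omega> lborel \<and>
    distr \<Omega> borel Y = distr M' borel (C l) \<and> (\<forall>x \<in> space \<Omega>. (\<lambda>n. Ys n x :: real) \<longlonglongrightarrow> Y x)" for l \<Omega> Ys Y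
  have "\<exists>\<Omega> Ys Y. Q l \<Omega> Ys Y" if "l < m" for l
    unfolding Q_def using rvB rvC that
    by (intro Skorohod conv M.real_distribution_distr M'.real_distribution_distr) auto
  then obtain \<Omega> Ys Y where Q: "\<And>l. l < m \<Longrightarrow> Q l (\<Omega> l) (Ys l) (Y l)"
    by metis
  have S: "l < m \<Longrightarrow> prob_space (\<Omega> l)"
    "l < m \<Longrightarrow> Ys l n \<in> borel_measurable (\<Omega> l)"
    "l < m \<Longrightarrow> distr (\<Omega> l) borel (Ys l n) = distr M borel (B n l)"
    "l < m \<Longrightarrow> Y l \<in> measurable (\<Omega> l) lborel"
    "l < m \<Longrightarrow> distr (\<Omega> l) borel (Y l) = distr M' borel (C l)"
    "l < m \<Longrightarrow> x \<in> space (\<Omega> l) \<Longrightarrow> (\<lambda>n. Ys l n x) \<longlonglongrightarrow> Y l x" for l n x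
    using Q[of l] unfolding Q_def by blast+
  have Yb: "l < m \<Longrightarrow> Y l \<in> borel_measurable (\<Omega> l)" for l using S(4) by simp
  let ?O = "PiM ?I \<Omega>"
  interpret O: prob_space ?O by (rule prob_space_PiM) (use S in auto)
  have coord: "O.indep_vars \<Omega> (\<lambda>i x. x i) ?I"
    by (rule indep_vars_PiM_coordinates) (use S ne in auto)
  have iYs: "O.indep_vars (\<lambda>_. borel) (\<lambda>l x. Ys l n (x l)) ?I" for n
    by (rule O.indep_vars_compose2[OF coord]) (use S in auto)
  have iY: "O.indep_vars (\<lambda>_. borel) (\<lambda>l x. Y l (x l)) ?I"
    by (rule O.indep_vars_compose2[OF coord]) (use Yb in auto)
  have law: "distr ?O borel (\<lambda>x. g (x l)) = distr (\<Omega> l) borel g" if "l < m" "g \<in> borel_measurable (\<Omega> l)" for l and g :: "real \<Rightarrow> real"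
    using distr_distr[of g "\<Omega> l" borel "\<lambda>x. x l" ?O] distr_PiM_component[of ?I \<Omega> l] S(1) that
    by (auto simp: comp_def)
  have distB: "distr ?O ?P (\<lambda>x. \<lambda>l\<in>?I. Ys l n (x l)) = distr M ?P (\<lambda>w. \<lambda>l\<in>?I. B n l w)" for n
  proof -
    have "distr ?O ?P (\<lambda>x. \<lambda>l\<in>?I. Ys l n (x l)) = PiM ?I (\<lambda>l. distr ?O borel (\<lambda>x. Ys l n (x l)))"
      using iYs[of n] by (subst (asm) O.indep_vars_iff_distr_eq_PiM'[OF ne]) (use S in auto)
    also have "\<dots> = PiM ?I (\<lambda>l. distr M borel (B n l))"
      using law S by (intro PiM_cong) auto
    also have "\<dots> = distr M ?P (\<lambda>w. \<lambda>l\<in>?I. B n l w)"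
      using B[of n] by (subst (asm) M.indep_vars_iff_distr_eq_PiM'[OF ne]) (use rvB in auto)
    finally show ?thesis .
  qed
  have distC: "distr ?O ?P (\<lambda>x. \<lambda>l\<in>?I. Y l (x l)) = distr M' ?P (\<lambda>w. \<lambda>l\<in>?I. C l w)"
  proof -
    have "distr ?O ?P (\<lambda>x. \<lambda>l\<in>?I. Y l (x l)) = PiM ?I (\<lambda>l. distr ?O borel (\<lambda>x. Y l (x l)))"
      using iY by (subst (asm) O.indep_vars_iff_distr_eq_PiM'[OF ne]) (use Yb in auto)
    also have "\<dots> = PiM ?I (\<lambda>l. distr M' borel (C l))"
      using law S Yb by (intro PiM_cong) auto
    also have "\<dots> = distr M' ?P (\<lambda>w. \<lambda>l\<in>?I. C l w)"
      using C by (subst (asm) M'.indep_vars_iff_distr_eq_PiM'[OF ne]) (use rvC in auto)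
    finally show ?thesis .
  qed
  have rYs[measurable]: "(\<lambda>x. \<lambda>l\<in>?I. Ys l n (x l)) \<in> measurable ?O ?P" for n
    using S(2) by (intro measurable_restrict measurable_compose[OF measurable_component_singleton]) auto
  have rY[measurable]: "(\<lambda>x. \<lambda>l\<in>?I. Y l (x l)) \<in> measurable ?O ?P"
    using Yb by (intro measurable_restrict measurable_compose[OF measurable_component_singleton]) auto
  have rB[measurable]: "(\<lambda>w. \<lambda>l\<in>?I. B n l w) \<in> measurable M ?P" for n
    using rvB by (intro measurable_restrict) auto
  have rC[measurable]: "(\<lambda>w. \<lambda>l\<in>?I. C l w) \<in> measurable M' ?P"
    using rvC by (intro measurable_restrict) auto
  have "AE z in distr M' ?P (\<lambda>w. \<lambda>l\<in>?I. C l w). R z"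
    using AE_R by (subst AE_distr_iff) auto
  then have AE_O: "AE x in ?O. R (\<lambda>l\<in>?I. Y l (x l))"
    unfolding distC[symmetric] by (subst (asm) AE_distr_iff) auto
  have "(\<lambda>n. \<integral>x. of_bool (P (\<lambda>l\<in>?I. Ys l n (x l))) \<partial>?O) \<longlonglongrightarrow> (\<integral>x. of_bool (P (\<lambda>l\<in>?I. Y l (x l))) \<partial>?O :: real)"
  proof (rule integral_dominated_convergence[where w="\<lambda>_. 1"])
    show "(\<lambda>x. of_bool (P (\<lambda>l\<in>?I. Y l (x l))) :: real) \<in> borel_measurable ?O" by measurable
    show "(\<lambda>x. of_bool (P (\<lambda>l\<in>?I. Ys l n (x l))) :: real) \<in> borel_measurable ?O" for n by measurable
    show "AE x in ?O. (\<lambda>n. of_bool (P (\<lambda>l\<in>?I. Ys l n (x l)))) \<longlonglongrightarrow> (of_bool (P (\<lambda>l\<in>?I. Y l (x l))) :: real)"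
      using AE_O AE_space
    proof eventually_elim
      fix x assume R: "R (\<lambda>l\<in>?I. Y l (x l))" and x: "x \<in> space ?O"
      have "\<forall>\<^sub>F n in sequentially. P (\<lambda>l\<in>?I. Ys l n (x l)) = P (\<lambda>l\<in>?I. Y l (x l))"
        using cont[of "\<lambda>l. Y l (x l)" "\<lambda>n l. Ys l n (x l)", OF R] S(6) x by (auto simp: space_PiM)
      then show "(\<lambda>n. of_bool (P (\<lambda>l\<in>?I. Ys l n (x l)))) \<longlonglongrightarrow> (of_bool (P (\<lambda>l\<in>?I. Y l (x l))) :: real)"
        by (intro tendsto_eventually) (auto elim: eventually_mono)
    qed
  qed auto
  moreover have "(\<integral>x. of_bool (P (\<lambda>l\<in>?I. Ys l n (x l))) \<partial>?O :: real) = \<P>(w in M. P (\<lambda>l\<in>{..<m}. B n l w))" for n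
  proof -
    have "(\<integral>x. of_bool (P (\<lambda>l\<in>?I. Ys l n (x l))) \<partial>?O :: real) = (\<integral>z. of_bool (P z) \<partial>distr ?O ?P (\<lambda>x. \<lambda>l\<in>?I. Ys l n (x l)))"
      by (rule integral_distr[symmetric]) measurable
    also have "\<dots> = (\<integral>w. of_bool (P (\<lambda>l\<in>{..<m}. B n l w)) \<partial>M)"
      unfolding distB by (rule integral_distr) measurable
    also have "\<dots> = (\<integral>w. indicator {w\<in>space M. P (\<lambda>l\<in>{..<m}. B n l w)} w \<partial>M)"
      by (intro Bochner_Integration.integral_cong) (auto simp: indicator_def)
    also have "\<dots> = \<P>(w in M. P (\<lambda>l\<in>{..<m}. B n l w))" by (simp add: Int_def conj_commute conj_left_commute)
    finally show ?thesis .
  qed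
  moreover have "(\<integral>x. of_bool (P (\<lambda>l\<in>?I. Y l (x l))) \<partial>?O :: real) = \<P>(w in M'. P (\<lambda>l\<in>{..<m}. C l w))"
  proof -
    have "(\<integral>x. of_bool (P (\<lambda>l\<in>?I. Y l (x l))) \<partial>?O :: real) = (\<integral>z. of_bool (P z) \<partial>distr ?O ?P (\<lambda>x. \<lambda>l\<in>?I. Y l (x l)))"
      by (rule integral_distr[symmetric]) measurable
    also have "\<dots> = (\<integral>w. of_bool (P (\<lambda>l\<in>{..<m}. C l w)) \<partial>M')"
      unfolding distC by (rule integral_distr) measurable
    also have "\<dots> = (\<integral>w. indicator {w\<in>space M'. P (\<lambda>l\<in>{..<m}. C l w)} w \<partial>M')"
      by (intro Bochner_Integration.integral_cong) (auto simp: indicator_def)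
    also have "\<dots> = \<P>(w in M'. P (\<lambda>l\<in>{..<m}. C l w))" by (simp add: Int_def conj_commute conj_left_commute)
    finally show ?thesis .
  qed
  ultimately show ?thesis by simp
qed

lemma abs_exp_minus_quadratic:
  fixes y :: real assumes "0 \<le> y"
  shows "\<bar>exp (- y) - (1 - y)\<bar> \<le> y\<^sup>2 / 2"
proof -
  have 1: "1 - y \<le> exp (- y)" using exp_ge_add_one_self[of "- y"] by simp
  have "1 + y + y\<^sup>2 / 2 \<le> exp y" by (rule exp_lower_Taylor_quadratic[OF assms])
  then have "exp (- y) * (1 + y + y\<^sup>2 / 2) \<le> exp (- y) * exp y" by (intro mult_left_mono) auto
  also have "\<dots> = 1" by (simp add: exp_minus)
  also have "1 \<le> (1 - y + y\<^sup>2 / 2) * (1 + y + y\<^sup>2 / 2)"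
  proof -
    have "(1 - y + y\<^sup>2 / 2) * (1 + y + y\<^sup>2 / 2) = 1 + y ^ 4 / 4"
      by (simp add: field_simps power2_eq_square power4_eq_xxxx)
    then show ?thesis by simp
  qed
  finally have "exp (- y) \<le> 1 - y + y\<^sup>2 / 2"
    by (rule mult_right_le_imp_le) (use assms in \<open>simp add: add_pos_nonneg\<close>)
  with 1 show ?thesis by linarith
qed

text \<open>
  The characteristic function of the sum is a product over the summands. Since the third moment is
  finite, each factor differs from the Gaussian one by at most \<open>K * \<bar>t * a n i\<bar> ^ 3\<close>, and these
  errors add up to at most \<open>K * \<bar>t\<bar> ^ 3 * \<delta> n\<close> times the sum of the squared weights.
\<close>

lemma (in prob_space) weighted_central_limit_theorem:
  fixes X :: "nat \<Rightarrow> 'a \<Rightarrow> real" and \<nu> :: "real measure" and a :: "nat \<Rightarrow> nat \<Rightarrow> real" and \<sigma> :: real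
  assumes ind: "indep_vars (\<lambda>_. borel) X UNIV"
    and law: "\<And>i. distr M borel (X i) = \<nu>"
    and mean: "expectation (X 0) = 0" and var: "expectation (\<lambda>w. (X 0 w)\<^sup>2) = 1"
    and int3: "integrable M (\<lambda>w. \<bar>X 0 w\<bar> ^ 3)" and int2: "integrable M (\<lambda>w. (X 0 w)\<^sup>2)"
    and fin: "\<And>n. finite (I n)"
    and sq: "(\<lambda>n. \<Sum>i\<in>I n. (a n i)\<^sup>2) \<longlonglongrightarrow> \<sigma>\<^sup>2"
    and small: "\<And>n i. i \<in> I n \<Longrightarrow> \<bar>a n i\<bar> \<le> \<delta> n" "\<delta> \<longlonglongrightarrow> 0"
  shows "weak_conv_m (\<lambda>n. distr M borel (\<lambda>w. \<Sum>i\<in>I n. a n i * X i w)) (distr std_normal_distribution borel (\<lambda>x. \<sigma> * x))"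
proof -
  have rv[measurable]: "X i \<in> borel_measurable M" for i using ind by (auto simp: indep_vars_def)
  interpret \<nu>: real_distribution \<nu> using real_distribution_distr[OF rv[of 0]] law by simp
  interpret N: prob_space std_normal_distribution by (rule real_distribution.axioms[OF real_dist_normal_dist])
  have int1: "integrable M (X 0)" by (rule square_integrable_imp_integrable[OF rv int2])
  have nu: "integrable \<nu> (\<lambda>x. x)" "\<nu>.expectation (\<lambda>x. x) = 0" "integrable \<nu> (\<lambda>x. x\<^sup>2)"
     "\<nu>.expectation (\<lambda>x. x\<^sup>2) = 1" "integrable \<nu> (\<lambda>x. \<bar>x\<bar> ^ 3)"
    using int1 int2 int3 mean var by (simp_all add: law[of 0, symmetric] integrable_distr_eq integral_distr)
  \<comment> \<open>The Taylor error of the characteristic function, and that of \<open>exp (- u\<^sup>2 / 2)\<close> when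
    \<open>\<bar>u\<bar> \<le> 1\<close>.\<close>
  define K where "K = \<nu>.expectation (\<lambda>x. \<bar>x\<bar> ^ 3) / 6 + 1 / 8"
  have K0: "0 \<le> K" by (simp add: K_def)
  have approx: "cmod (char \<nu> u - exp (- u\<^sup>2 / 2)) \<le> K * \<bar>u\<bar> ^ 3" if "\<bar>u\<bar> \<le> 1" for u
  proof -
    have "cmod (char \<nu> u - (1 - u\<^sup>2 * 1 / 2)) \<le> (u\<^sup>2 / 6) * \<nu>.expectation (\<lambda>x. min (6 * x\<^sup>2) (\<bar>u\<bar> * \<bar>x\<bar> ^ 3))"
      using nu by (intro \<nu>.char_approx3) auto
    also have "\<nu>.expectation (\<lambda>x. min (6 * x\<^sup>2) (\<bar>u\<bar> * \<bar>x\<bar> ^ 3)) \<le> \<nu>.expectation (\<lambda>x. \<bar>u\<bar> * \<bar>x\<bar> ^ 3)"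
    proof (rule integral_mono)
      show "integrable \<nu> (\<lambda>x. \<bar>u\<bar> * \<bar>x\<bar> ^ 3)" using nu by auto
      show "integrable \<nu> (\<lambda>x. min (6 * x\<^sup>2) (\<bar>u\<bar> * \<bar>x\<bar> ^ 3))"
      proof (rule Bochner_Integration.integrable_bound[OF \<open>integrable \<nu> (\<lambda>x. \<bar>u\<bar> * \<bar>x\<bar> ^ 3)\<close>])
        show "(\<lambda>x. min (6 * x\<^sup>2) (\<bar>u\<bar> * \<bar>x\<bar> ^ 3)) \<in> borel_measurable \<nu>" by measurable
        have "norm (min p q) \<le> norm q" if "0 \<le> p" "0 \<le> q" for p q :: real using that by simp
        then show "AE x in \<nu>. norm (min (6 * x\<^sup>2) (\<bar>u\<bar> * \<bar>x\<bar> ^ 3)) \<le> norm (\<bar>u\<bar> * \<bar>x\<bar> ^ 3)" by (intro AE_I2) simp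
      qed
    qed simp
    then have "(u\<^sup>2 / 6) * \<nu>.expectation (\<lambda>x. min (6 * x\<^sup>2) (\<bar>u\<bar> * \<bar>x\<bar> ^ 3)) \<le> (u\<^sup>2 / 6) * \<nu>.expectation (\<lambda>x. \<bar>u\<bar> * \<bar>x\<bar> ^ 3)"
      by (intro mult_left_mono) auto
    also have "\<dots> = \<bar>u\<bar> ^ 3 * (\<nu>.expectation (\<lambda>x. \<bar>x\<bar> ^ 3) / 6)"
      by (simp add: power2_eq_square power3_eq_cube abs_mult_self_eq)
    finally have 1: "cmod (char \<nu> u - (1 - u\<^sup>2 / 2)) \<le> \<bar>u\<bar> ^ 3 * (\<nu>.expectation (\<lambda>x. \<bar>x\<bar> ^ 3) / 6)" by simp
    have "cmod ((1 - u\<^sup>2 / 2) - exp (- u\<^sup>2 / 2)) = \<bar>exp (- (u\<^sup>2 / 2)) - (1 - u\<^sup>2 / 2)\<bar>"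
      unfolding norm_of_real by (simp add: abs_minus_commute)
    also have "\<dots> \<le> (u\<^sup>2 / 2)\<^sup>2 / 2" by (rule abs_exp_minus_quadratic) simp
    also have "\<dots> = \<bar>u\<bar> ^ 3 * \<bar>u\<bar> / 8"
      by (simp add: power2_eq_square power3_eq_cube abs_mult[symmetric] mult.assoc)
    also have "\<dots> \<le> \<bar>u\<bar> ^ 3 * 1 / 8" using that by (intro divide_right_mono mult_left_mono) auto
    finally have 2: "cmod ((1 - u\<^sup>2 / 2) - exp (- u\<^sup>2 / 2)) \<le> \<bar>u\<bar> ^ 3 / 8" by simp
    show ?thesis
      using norm_triangle_ineq[of "char \<nu> u - (1 - u\<^sup>2 / 2)" "(1 - u\<^sup>2 / 2) - exp (- u\<^sup>2 / 2)"] 1 2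
      by (simp add: K_def algebra_simps)
  qed
  show ?thesis
  proof (rule levy_continuity)
    show "real_distribution (distr M borel (\<lambda>w. \<Sum>i\<in>I n. a n i * X i w))" for n
      by (rule real_distribution_distr) measurable
    show "real_distribution (distr std_normal_distribution borel (\<lambda>x. \<sigma> * x))"
      by (rule N.real_distribution_distr) simp
    fix t :: real
    have c1: "char (distr M borel (\<lambda>w. \<Sum>i\<in>I n. a n i * X i w)) t = (\<Prod>i\<in>I n. char \<nu> (t * a n i))" for n
    proof -
      have "indep_vars (\<lambda>_. borel) (\<lambda>i w. a n i * X i w) (I n)"
        by (rule indep_vars_compose2[OF indep_vars_subset[OF ind]]) auto
      then have "char (distr M borel (\<lambda>w. \<Sum>i\<in>I n. a n i * X i w)) t = (\<Prod>i\<in>I n. char (distr M borel (\<lambda>w. a n i * X i w)) t)"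
        by (rule char_distr_sum)
      also have "\<dots> = (\<Prod>i\<in>I n. char \<nu> (t * a n i))"
      proof (rule prod.cong[OF refl])
        fix i
        show "char (distr M borel (\<lambda>w. a n i * X i w)) t = char \<nu> (t * a n i)"
          unfolding char_def law[of i, symmetric] by (simp add: integral_distr mult.assoc)
      qed
      finally show ?thesis .
    qed
    have c2: "char (distr std_normal_distribution borel (\<lambda>x. \<sigma> * x)) t = exp (- (\<sigma> * t)\<^sup>2 / 2)"
    proof -
      have "char (distr std_normal_distribution borel (\<lambda>x. \<sigma> * x)) t = char std_normal_distribution (t * \<sigma>)"
        unfolding char_def by (simp add: integral_distr mult.assoc)
      then show ?thesis by (simp add: char_std_normal_distribution mult.commute)
    qed
    let ?s = "\<lambda>n. \<Sum>i\<in>I n. (a n i)\<^sup>2"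
    have lim: "(\<lambda>n. complex_of_real (exp (- t\<^sup>2 * ?s n / 2))) \<longlonglongrightarrow> complex_of_real (exp (- t\<^sup>2 * \<sigma>\<^sup>2 / 2))"
      using sq by (intro tendsto_intros) auto
    have pr: "complex_of_real (exp (- t\<^sup>2 * ?s n / 2)) = (\<Prod>i\<in>I n. complex_of_real (exp (- (t * a n i)\<^sup>2 / 2)))" for n
    proof -
      have "exp (- t\<^sup>2 * ?s n / 2) = (\<Prod>i\<in>I n. exp (- (t * a n i)\<^sup>2 / 2))"
        by (subst exp_sum[OF fin, symmetric]) (simp add: sum_distrib_left sum_divide_distrib sum_negf power_mult_distrib)
      then show ?thesis by simp
    qed
    have ev: "\<forall>\<^sub>F n in sequentially. cmod (char (distr M borel (\<lambda>w. \<Sum>i\<in>I n. a n i * X i w)) t - exp (- t\<^sup>2 * ?s n / 2)) \<le> K * (\<bar>t\<bar> ^ 3 * \<bar>\<delta> n\<bar> * ?s n)"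
    proof -
      have "(\<lambda>n. \<bar>t\<bar> * \<bar>\<delta> n\<bar>) \<longlonglongrightarrow> \<bar>t\<bar> * \<bar>0\<bar>" by (intro tendsto_intros small)
      then have "\<forall>\<^sub>F n in sequentially. \<bar>t\<bar> * \<bar>\<delta> n\<bar> < 1" by (rule order_tendstoD) simp
      then show ?thesis
      proof eventually_elim
        fix n assume n: "\<bar>t\<bar> * \<bar>\<delta> n\<bar> < 1"
        have b: "\<bar>a n i\<bar> \<le> \<bar>\<delta> n\<bar>" if "i \<in> I n" for i using small(1)[OF that] by simp
        have "cmod ((\<Prod>i\<in>I n. char \<nu> (t * a n i)) - (\<Prod>i\<in>I n. complex_of_real (exp (- (t * a n i)\<^sup>2 / 2))))
          \<le> (\<Sum>i\<in>I n. cmod (char \<nu> (t * a n i) - complex_of_real (exp (- (t * a n i)\<^sup>2 / 2))))"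
          by (rule norm_prod_diff) (auto simp: \<nu>.cmod_char_le_1)
        also have "\<dots> \<le> (\<Sum>i\<in>I n. K * (\<bar>t\<bar> ^ 3 * \<bar>\<delta> n\<bar> * (a n i)\<^sup>2))"
        proof (rule sum_mono)
          fix i assume i: "i \<in> I n"
          have "\<bar>t * a n i\<bar> \<le> \<bar>t\<bar> * \<bar>\<delta> n\<bar>" using b[OF i] by (auto simp: abs_mult intro: mult_left_mono)
          then have "cmod (char \<nu> (t * a n i) - complex_of_real (exp (- (t * a n i)\<^sup>2 / 2))) \<le> K * \<bar>t * a n i\<bar> ^ 3"
            using n approx[of "t * a n i"] by simp
          also have "\<bar>t * a n i\<bar> ^ 3 = \<bar>t\<bar> ^ 3 * \<bar>a n i\<bar> * (a n i)\<^sup>2"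
            unfolding power2_abs[of "a n i", symmetric] abs_mult power_mult_distrib
            by (simp only: power3_eq_cube power2_eq_square mult_ac)
          also have "\<dots> \<le> \<bar>t\<bar> ^ 3 * \<bar>\<delta> n\<bar> * (a n i)\<^sup>2"
            using b[OF i] by (intro mult_right_mono mult_left_mono) auto
          finally show "cmod (char \<nu> (t * a n i) - complex_of_real (exp (- (t * a n i)\<^sup>2 / 2))) \<le> K * (\<bar>t\<bar> ^ 3 * \<bar>\<delta> n\<bar> * (a n i)\<^sup>2)"
            using K0 by (simp add: mult_left_mono)
        qed
        finally show "cmod (char (distr M borel (\<lambda>w. \<Sum>i\<in>I n. a n i * X i w)) t - exp (- t\<^sup>2 * ?s n / 2)) \<le> K * (\<bar>t\<bar> ^ 3 * \<bar>\<delta> n\<bar> * ?s n)"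
          unfolding c1 pr by (simp add: sum_distrib_left)
      qed
    qed
    have "(\<lambda>n. K * (\<bar>t\<bar> ^ 3 * \<bar>\<delta> n\<bar> * ?s n)) \<longlonglongrightarrow> K * (\<bar>t\<bar> ^ 3 * \<bar>0\<bar> * \<sigma>\<^sup>2)"
      by (intro tendsto_intros small sq)
    then have "(\<lambda>n. char (distr M borel (\<lambda>w. \<Sum>i\<in>I n. a n i * X i w)) t - exp (- t\<^sup>2 * ?s n / 2)) \<longlonglongrightarrow> 0"
      by (intro Lim_null_comparison[OF ev]) simp
    from tendsto_add[OF this lim]
    show "(\<lambda>n. char (distr M borel (\<lambda>w. \<Sum>i\<in>I n. a n i * X i w)) t) \<longlonglongrightarrow> char (distr std_normal_distribution borel (\<lambda>x. \<sigma> * x)) t"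
      unfolding c2 by (simp add: power_mult_distrib mult.commute)
  qed
qed

section \<open>The barrier and the zeros of the drift\<close>

definition der_coeff :: "(nat \<Rightarrow> real) \<Rightarrow> nat \<Rightarrow> real" where
  "der_coeff \<beta> i = real (Suc i) * \<beta> (Suc i)"

text \<open>
  Truncations of the derived series are polynomials, hence harmless beyond the radius of
  convergence.
\<close>

definition trunc_der :: "(nat \<Rightarrow> real) \<Rightarrow> nat \<Rightarrow> real \<Rightarrow> real" where
  "trunc_der \<beta> J t = (\<Sum>i<J. der_coeff \<beta> i * t ^ i)"

definition series_der :: "(nat \<Rightarrow> real) \<Rightarrow> real \<Rightarrow> real" where
  "series_der \<beta> t = (\<Sum>i. der_coeff \<beta> i * t ^ i)"

text \<open>
  The height of the barrier above the mean of the walk: \<open>1 / (N - i)\<close> is the mean of the \<open>i\<close>-th term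
  of \<open>renyi_sum\<close>.
\<close>

definition gap :: "(nat \<Rightarrow> real) \<Rightarrow> nat \<Rightarrow> nat \<Rightarrow> real" where
  "gap \<beta> N k = hazard \<beta> N k - (\<Sum>i\<le>k. 1 / (real N - real i))"

lemma summable_cube_geometric:
  fixes q :: real assumes "0 \<le> q" "q < 1"
  shows "summable (\<lambda>i. real i ^ 3 * q ^ i)"
proof -
  define s where "s = sqrt (sqrt q)"
  have s: "0 \<le> s" "s < 1" "s ^ 4 = q"
    using assms by (auto simp: s_def power4_eq_xxxx mult.assoc)
  have "(\<lambda>n. real n * s ^ n) \<longlonglongrightarrow> 0" using powser_times_n_limit_0[of s] s by simp
  then have "Bseq (\<lambda>n. real n * s ^ n)" by (rule convergent_imp_Bseq[OF convergentI])
  then obtain B where B: "0 < B" "\<And>n. real n * s ^ n \<le> B"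
    using s by (auto simp: Bseq_def abs_le_iff)
  have "summable (\<lambda>i. B ^ 3 * s ^ i)" using s by (intro summable_mult summable_geometric) auto
  then show ?thesis
  proof (rule summable_comparison_test'[where N=0])
    fix n :: nat
    have "real n ^ 3 * q ^ n = (real n * s ^ n) ^ 3 * s ^ n"
    proof -
      have "q ^ n = (s ^ n) ^ 3 * s ^ n" by (simp add: s(3)[symmetric] power_mult[symmetric] power_add[symmetric] mult.commute)
      then show ?thesis by (simp add: power_mult_distrib)
    qed
    also have "\<dots> \<le> B ^ 3 * s ^ n" using B s by (intro mult_right_mono power_mono) auto
    finally show "norm (real n ^ 3 * q ^ n) \<le> B ^ 3 * s ^ n" using assms by simp
  qed
qed

text \<open>
  The cube leaves room for the second derivative of the derived series, which enters the error
  bounds.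
\<close>

lemma summable_cubic:
  assumes nonneg: "\<And>j. 0 \<le> \<beta> j" and r: "0 < \<rho>" "ereal \<rho> < conv_radius \<beta>"
  shows "summable (\<lambda>i. real i ^ 3 * \<beta> i * \<rho> ^ i)"
proof -
  obtain r where r': "ereal \<rho> < ereal r" "ereal r < conv_radius \<beta>"
    using ereal_dense2[OF r(2)] by blast
  then have rr: "\<rho> < r" "0 < r" using r by auto
  have "summable (\<lambda>i. \<beta> i * r ^ i)" using r' rr by (intro summable_in_conv_radius) auto
  then have "Bseq (\<lambda>i. \<beta> i * r ^ i)" using summable_LIMSEQ_zero convergentI convergent_imp_Bseq by blast
  then obtain B where B: "0 < B" "\<And>i. \<beta> i * r ^ i \<le> B"
    using rr nonneg by (auto simp: Bseq_def abs_le_iff)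
  have "summable (\<lambda>i. B * (real i ^ 3 * (\<rho> / r) ^ i))"
    using rr r by (intro summable_mult summable_cube_geometric) auto
  then show ?thesis
  proof (rule summable_comparison_test'[where N=0])
    fix n :: nat
    have "real n ^ 3 * \<beta> n * \<rho> ^ n = (\<beta> n * r ^ n) * (real n ^ 3 * (\<rho> / r) ^ n)"
      using rr by (simp add: power_divide)
    also have "\<dots> \<le> B * (real n ^ 3 * (\<rho> / r) ^ n)" using B rr r by (intro mult_right_mono) auto
    finally show "norm (real n ^ 3 * \<beta> n * \<rho> ^ n) \<le> B * (real n ^ 3 * (\<rho> / r) ^ n)"
      using nonneg r by simp
  qed
qed

text \<open>
  Comparison of the falling factorial with the power: each of the \<open>i\<close> factors loses at most a
  fraction \<open>i / k\<close>. The form without division also covers \<open>k < i\<close>.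
\<close>

lemma falling_lower: "real k ^ i * (real k - (real i)\<^sup>2) \<le> real k * (fact i * real (k choose i))"
proof (induction i)
  case (Suc i)
  show ?case
  proof (cases "i < k")
    case True
    have "real (Suc i) * real (k choose Suc i) = real (k - i) * real (k choose i)"
      using binomial_absorb_comp[of k i] binomial_absorption[of i k]
      by (metis Suc_times_binomial_add of_nat_mult binomial_absorption)
    then have "fact i * (real (Suc i) * real (k choose Suc i)) = fact i * (real (k - i) * real (k choose i))"
      by (simp only:)
    then have e: "fact (Suc i) * real (k choose Suc i) = (real k - real i) * (fact i * real (k choose i))"
      unfolding of_nat_diff[OF less_imp_le[OF True]] by (simp only: fact_Suc of_nat_fact mult_ac)
    have "real k ^ Suc i * (real k - (real (Suc i))\<^sup>2) \<le> (real k ^ i * (real k - (real i)\<^sup>2)) * (real k - real i)"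
    proof -
      have "(real k ^ i * (real k - (real i)\<^sup>2)) * (real k - real i) - real k ^ Suc i * (real k - (real (Suc i))\<^sup>2)
        = real k ^ i * (real i ^ 3 + real i * real k + real k)"
        by (simp add: power2_eq_square power3_eq_cube algebra_simps)
      moreover have "0 \<le> \<dots>" by simp
      ultimately show ?thesis by linarith
    qed
    also have "\<dots> \<le> (real k * (fact i * real (k choose i))) * (real k - real i)"
      using Suc True by (intro mult_right_mono) auto
    finally show ?thesis unfolding e by (simp add: mult_ac)
  next
    case False
    then have "k < Suc i" by simp
    then have "real k \<le> real (Suc i)" "1 \<le> real (Suc i)" by auto
    then have "real k * 1 \<le> real (Suc i) * real (Suc i)" by (intro mult_mono) auto
    then have "real k - (real (Suc i))\<^sup>2 \<le> 0" by (simp add: power2_eq_square)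
    then have "real k ^ Suc i * (real k - (real (Suc i))\<^sup>2) \<le> 0" by (intro mult_nonneg_nonpos) auto
    then show ?thesis using \<open>k < Suc i\<close> by (simp add: binomial_eq_0)
  qed
qed simp

lemma binomial_ratio_upper:
  assumes "k \<le> m" "i \<le> m"
  shows "real (k choose i) * real m ^ i \<le> real k ^ i * real (m choose i)"
  using assms(2)
proof (induction i)
  case (Suc i)
  have ab: "real (Suc i) * real (n choose Suc i) = (real n - real i) * real (n choose i)" for n
  proof (cases "i \<le> n")
    case True
    have "Suc i * (n choose Suc i) = (n - i) * (n choose i)"
      by (metis binomial_absorb_comp binomial_absorption)
    then have "real (Suc i * (n choose Suc i)) = real ((n - i) * (n choose i))" by simp
    then show ?thesis by (simp only: of_nat_mult of_nat_diff[OF True])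
  qed (simp add: binomial_eq_0)
  have "real (Suc i) * (real (k choose Suc i) * real m ^ Suc i) = ((real k - real i) * real m) * (real (k choose i) * real m ^ i)"
    using ab[of k] by (simp only: power_Suc mult_ac) (metis mult.assoc mult.commute)
  also have "\<dots> \<le> (real k * (real m - real i)) * (real k ^ i * real (m choose i))"
  proof (cases "i < k")
    case True
    have "real k * real i \<le> real m * real i" using assms by (intro mult_right_mono) auto
    then have "(real k - real i) * real m \<le> real k * (real m - real i)" by (simp add: algebra_simps)
    then show ?thesis
    proof (rule mult_mono)
      show "real (k choose i) * real m ^ i \<le> real k ^ i * real (m choose i)" using Suc by simp
      show "0 \<le> real k * (real m - real i)" using Suc.prems by simp
    qed simp
  next
    case False
    then have "(real k - real i) * real m * (real (k choose i) * real m ^ i) \<le> 0"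
      by (intro mult_nonpos_nonneg) auto
    moreover have "0 \<le> (real k * (real m - real i)) * (real k ^ i * real (m choose i))"
      using Suc.prems by (intro mult_nonneg_nonneg) auto
    ultimately show ?thesis by linarith
  qed
  also have "\<dots> = real (Suc i) * (real k ^ Suc i * real (m choose Suc i))"
    using ab[of m] by (simp only: power_Suc mult_ac) (metis mult.assoc mult.commute)
  finally show ?case by (rule mult_left_le_imp_le) simp
qed simp

lemma ln_succ_bounds:
  fixes x :: real assumes "0 < x"
  shows "1 / (x + 1) \<le> ln (x + 1) - ln x" "ln (x + 1) - ln x \<le> 1 / x"
proof -
  have "ln (x / (x + 1)) \<le> x / (x + 1) - 1" using assms by (intro ln_le_minus_one) simp
  moreover have "x / (x + 1) - 1 = - (1 / (x + 1))" using assms by (simp add: field_simps)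
  ultimately show "1 / (x + 1) \<le> ln (x + 1) - ln x" using assms by (simp add: ln_div)
  have "ln ((x + 1) / x) \<le> (x + 1) / x - 1" using assms by (intro ln_le_minus_one) simp
  moreover have "(x + 1) / x - 1 = 1 / x" using assms by (simp add: field_simps)
  ultimately show "ln (x + 1) - ln x \<le> 1 / x" using assms by (simp add: ln_div)
qed

lemma harmonic_block_upper:
  "Suc k < N \<Longrightarrow> (\<Sum>i\<le>k. 1 / (real N - real i)) \<le> ln (real N) - ln (real N - real k - 1)"
proof (induction k)
  case 0
  then show ?case using ln_succ_bounds(1)[of "real N - 1"] by simp
next
  case (Suc k)
  then show ?case using ln_succ_bounds(1)[of "real N - real (Suc k) - 1"] by (simp add: algebra_simps)
qed

lemma harmonic_block_lower:
  "k < N \<Longrightarrow> ln (real N) - ln (real N - real k) \<le> (\<Sum>i\<le>k. 1 / (real N - real i))"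
proof (induction k)
  case (Suc k)
  then show ?case using ln_succ_bounds(2)[of "real N - real (Suc k)"] by (simp add: algebra_simps)
qed simp

text \<open>
  The condition on \<open>k\<close> keeps \<open>N - k\<close> at least \<open>\<delta> * N\<close>, so that the shift by one in the logarithm costs
  only a multiple of \<open>1 / N\<close>.
\<close>

lemma harmonic_block_upper':
  assumes d: "0 < \<delta>" "2 \<le> \<delta> * real N" "real k \<le> (1 - \<delta>) * real N"
  shows "(\<Sum>i\<le>k. 1 / (real N - real i)) \<le> - ln (1 - real k / real N) + (2 / \<delta>) / real N"
proof -
  have N: "0 < real N" using d by (metis mult_zero_right not_numeral_le_zero of_nat_0_less_iff gr0I of_nat_0)
  have ge: "\<delta> * real N / 2 \<le> real N - real k - 1" using d by (simp add: algebra_simps)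
  have pos: "0 < real N - real k - 1" using ge d by linarith
  then have "Suc k < N" by linarith
  then have A: "(\<Sum>i\<le>k. 1 / (real N - real i)) \<le> ln (real N) - ln (real N - real k - 1)"
    by (rule harmonic_block_upper)
  have B: "ln (real N - real k) - ln (real N - real k - 1) \<le> 1 / (real N - real k - 1)"
    using ln_succ_bounds(2)[OF pos] by simp
  have C: "1 / (real N - real k - 1) \<le> 1 / (\<delta> * real N / 2)"
    using ge d N pos by (intro divide_left_mono mult_pos_pos) auto
  have D: "ln (1 - real k / real N) = ln (real N - real k) - ln (real N)"
  proof -
    have "1 - real k / real N = (real N - real k) / real N" using N by (simp add: field_simps)
    then show ?thesis using N pos by (simp add: ln_div)
  qed
  have E: "1 / (\<delta> * real N / 2) = (2 / \<delta>) / real N" by simp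
  show ?thesis using A B C D unfolding E by linarith
qed

context
  fixes \<beta> :: "nat \<Rightarrow> real"
  assumes nonneg: "\<And>j. 0 \<le> \<beta> j"
begin

lemma der_coeff_nonneg: "0 \<le> der_coeff \<beta> i"
  using nonneg by (simp add: der_coeff_def)

lemma summable_der_square:
  assumes r: "0 < \<rho>" "ereal \<rho> < conv_radius \<beta>"
  shows "summable (\<lambda>i. der_coeff \<beta> i * (real i)\<^sup>2 * \<rho> ^ (i - 1))"
    and "summable (\<lambda>i. der_coeff \<beta> i * real i * \<rho> ^ (i - 1))"
    and "summable (\<lambda>i. der_coeff \<beta> i * \<rho> ^ i)"
proof -
  have h: "summable (\<lambda>i. real (Suc i) ^ 3 * \<beta> (Suc i) * \<rho> ^ Suc i)"
    using summable_cubic[OF nonneg r] by (subst summable_Suc_iff)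
  have s: "summable (\<lambda>i. (real (Suc i) ^ 3 * \<beta> (Suc i) * \<rho> ^ Suc i) / \<rho>\<^sup>2)"
    "summable (\<lambda>i. (real (Suc i) ^ 3 * \<beta> (Suc i) * \<rho> ^ Suc i) / \<rho>)" by (rule summable_divide[OF h])+
  have key: "der_coeff \<beta> i * (real i)\<^sup>2 * \<rho> ^ (i - 1) \<le> (real (Suc i) ^ 3 * \<beta> (Suc i) * \<rho> ^ Suc i) / \<rho>\<^sup>2" for i
  proof (cases i)
    case 0
    then show ?thesis using nonneg r by simp
  next
    case (Suc j)
    have "der_coeff \<beta> i * (real i)\<^sup>2 * \<rho> ^ (i - 1) = (real (Suc i) * (real i)\<^sup>2) * (\<beta> (Suc i) * \<rho> ^ j)"
      by (simp add: der_coeff_def Suc)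
    also have "\<dots> \<le> (real (Suc i) * (real (Suc i))\<^sup>2) * (\<beta> (Suc i) * \<rho> ^ j)"
      using nonneg r by (intro mult_right_mono mult_left_mono power_mono) auto
    also have "\<dots> = (real (Suc i) ^ 3 * \<beta> (Suc i) * \<rho> ^ Suc i) / \<rho>\<^sup>2"
      using r by (simp add: Suc power3_eq_cube power2_eq_square)
    finally show ?thesis .
  qed
  show 1: "summable (\<lambda>i. der_coeff \<beta> i * (real i)\<^sup>2 * \<rho> ^ (i - 1))"
    using key der_coeff_nonneg r by (intro summable_comparison_test'[OF s(1), of 0]) auto
  show "summable (\<lambda>i. der_coeff \<beta> i * real i * \<rho> ^ (i - 1))"
  proof (rule summable_comparison_test'[OF 1, of 0])
    fix n :: nat
    have "real n \<le> (real n)\<^sup>2" by (cases n) (auto simp: power2_eq_square)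
    then show "norm (der_coeff \<beta> n * real n * \<rho> ^ (n - 1)) \<le> der_coeff \<beta> n * (real n)\<^sup>2 * \<rho> ^ (n - 1)"
      using der_coeff_nonneg r by (auto intro!: mult_right_mono mult_left_mono)
  qed
  show "summable (\<lambda>i. der_coeff \<beta> i * \<rho> ^ i)"
  proof (rule summable_comparison_test'[OF s(2), of 0])
    fix i :: nat
    have "der_coeff \<beta> i * \<rho> ^ i = (real (Suc i) * 1) * (\<beta> (Suc i) * \<rho> ^ i)" by (simp add: der_coeff_def)
    also have "\<dots> \<le> (real (Suc i) * (real (Suc i))\<^sup>2) * (\<beta> (Suc i) * \<rho> ^ i)"
      using nonneg r by (intro mult_right_mono mult_left_mono) (auto intro: one_le_power)
    also have "\<dots> = (real (Suc i) ^ 3 * \<beta> (Suc i) * \<rho> ^ Suc i) / \<rho>"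
      using r by (simp add: power3_eq_cube power2_eq_square)
    finally show "norm (der_coeff \<beta> i * \<rho> ^ i) \<le> (real (Suc i) ^ 3 * \<beta> (Suc i) * \<rho> ^ Suc i) / \<rho>"
      using der_coeff_nonneg r by simp
  qed
qed

lemma pos_radius_between:
  assumes "0 \<le> t" "t < b" "ereal t < conv_radius \<beta>"
  obtains \<rho> where "t < \<rho>" "\<rho> < b" "ereal \<rho> < conv_radius \<beta>" "0 < \<rho>"
proof -
  have "ereal t < min (ereal b) (conv_radius \<beta>)" using assms by simp
  then obtain \<rho> where "ereal t < ereal \<rho>" "ereal \<rho> < min (ereal b) (conv_radius \<beta>)"
    using ereal_dense2 by blast
  then show ?thesis using that assms by auto
qed

lemma summable_der:
  assumes "0 \<le> t" "ereal t < conv_radius \<beta>"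
  shows "summable (\<lambda>i. der_coeff \<beta> i * t ^ i)"
proof -
  obtain \<rho> where \<rho>: "t < \<rho>" "ereal \<rho> < conv_radius \<beta>" "0 < \<rho>"
    using pos_radius_between[OF assms(1) _ assms(2), of "t + 1"] by auto
  show ?thesis
    using assms \<rho> der_coeff_nonneg
    by (intro summable_comparison_test'[OF summable_der_square(3)[OF \<rho>(3,2)], of 0]) (auto intro!: mult_left_mono power_mono)
qed

lemma trunc_der_mono: "0 \<le> t \<Longrightarrow> J \<le> J' \<Longrightarrow> trunc_der \<beta> J t \<le> trunc_der \<beta> J' t"
  unfolding trunc_der_def using der_coeff_nonneg by (intro sum_mono2) auto

text \<open>
  Non-negativity of the terms turns the extended real series into a supremum, divergent or not.
\<close>

lemma derived_series_eq_SUP: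
  assumes "0 \<le> t"
  shows "derived_series \<beta> t = (SUP J. ereal (trunc_der \<beta> J t))"
proof -
  let ?f = "\<lambda>j. ereal (real j * \<beta> j * t ^ (j - 1))"
  have f: "0 \<le> ?f j" for j using nonneg assms by simp
  have S: "(\<Sum>j<Suc J. ?f j) = ereal (trunc_der \<beta> J t)" for J
    by (subst sum.lessThan_Suc_shift) (simp add: trunc_der_def der_coeff_def)
  have "derived_series \<beta> t = (SUP n. \<Sum>j<n. ?f j)"
    unfolding derived_series_def by (rule suminf_ereal_eq_SUP[OF f])
  also have "\<dots> = (SUP J. ereal (trunc_der \<beta> J t))"
  proof (rule antisym)
    show "(SUP n. \<Sum>j<n. ?f j) \<le> (SUP J. ereal (trunc_der \<beta> J t))"
    proof (rule SUP_mono)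
      fix n
      show "\<exists>J\<in>UNIV. (\<Sum>j<n. ?f j) \<le> ereal (trunc_der \<beta> J t)"
      proof (cases n)
        case 0
        then show ?thesis by (intro bexI[of _ 0]) (auto simp: trunc_der_def)
      next
        case (Suc J)
        then show ?thesis using S[of J] by (intro bexI[of _ J]) auto
      qed
    qed
    show "(SUP J. ereal (trunc_der \<beta> J t)) \<le> (SUP n. \<Sum>j<n. ?f j)"
    proof (rule SUP_mono)
      fix J
      show "\<exists>n\<in>UNIV. ereal (trunc_der \<beta> J t) \<le> (\<Sum>j<n. ?f j)"
        by (rule bexI[where x="Suc J"]) (subst S, rule order_refl, rule UNIV_I)
    qed
  qed
  finally show ?thesis .
qed

lemma derived_series_finite:
  assumes "0 \<le> t" "ereal t < conv_radius \<beta>"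
  shows "derived_series \<beta> t = ereal (series_der \<beta> t)"
proof -
  have "(\<lambda>J. ereal (trunc_der \<beta> J t)) \<longlonglongrightarrow> ereal (series_der \<beta> t)"
    using summable_LIMSEQ[OF summable_der[OF assms]] by (simp add: trunc_der_def series_der_def)
  moreover have "(\<lambda>J. ereal (trunc_der \<beta> J t)) \<longlonglongrightarrow> (SUP J. ereal (trunc_der \<beta> J t))"
    using trunc_der_mono[OF assms(1)] by (intro LIMSEQ_SUP) (auto simp: incseq_def)
  ultimately show ?thesis unfolding derived_series_eq_SUP[OF assms(1)] by (rule LIMSEQ_unique[rotated])
qed

text \<open>
  A value of the derived series that is finite bounds its terms; so zeros and points of negative
  drift lie in the closed disc.
\<close>

lemma finite_derived_series_radius:
  assumes "0 < t" "derived_series \<beta> t \<noteq> \<infinity>"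
  shows "ereal t \<le> conv_radius \<beta>"
proof -
  have "(SUP J. ereal (trunc_der \<beta> J t)) \<noteq> \<infinity>" using assms derived_series_eq_SUP[of t] by simp
  then obtain x where x: "(SUP J. ereal (trunc_der \<beta> J t)) \<le> ereal x"
    by (metis ereal_less_eq(1) ereal_less_eq(2) linear real_le_ereal_iff order_refl real_of_ereal.elims)
  have b: "trunc_der \<beta> J t \<le> x" for J
  proof -
    have "ereal (trunc_der \<beta> J t) \<le> (SUP J. ereal (trunc_der \<beta> J t))" by (rule SUP_upper) simp
    then show ?thesis using x by (metis ereal_less_eq(3) order_trans)
  qed
  have b': "(\<Sum>i\<le>n. der_coeff \<beta> i * t ^ i) \<le> x" for n
    using b[of "Suc n"] by (simp only: trunc_der_def lessThan_Suc_atMost)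
  have "summable (\<lambda>i. der_coeff \<beta> i * t ^ i)"
    using b' der_coeff_nonneg assms by (intro bounded_imp_summable[of _ x]) auto
  then have s: "summable (\<lambda>i. t * (der_coeff \<beta> i * t ^ i))" by (rule summable_mult)
  have "summable (\<lambda>i. \<beta> (Suc i) * t ^ Suc i)"
  proof (rule summable_comparison_test'[OF s, of 0])
    fix n :: nat
    have "1 * (\<beta> (Suc n) * t ^ Suc n) \<le> real (Suc n) * (\<beta> (Suc n) * t ^ Suc n)"
      using nonneg assms by (intro mult_right_mono) auto
    then show "norm (\<beta> (Suc n) * t ^ Suc n) \<le> t * (der_coeff \<beta> n * t ^ n)"
      using nonneg assms by (simp add: der_coeff_def algebra_simps)
  qed
  then have "summable (\<lambda>i. \<beta> i * t ^ i)" by (subst (asm) summable_Suc_iff)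
  from conv_radius_geI[OF this] show ?thesis using assms by simp
qed

lemma series_der_diff:
  assumes "0 \<le> s" "s \<le> t" "t \<le> \<rho>" "0 < \<rho>" "ereal \<rho> < conv_radius \<beta>"
  shows "series_der \<beta> s \<le> series_der \<beta> t"
    "series_der \<beta> t - series_der \<beta> s \<le> (\<Sum>i. der_coeff \<beta> i * real i * \<rho> ^ (i - 1)) * (t - s)"
proof -
  have rt: "ereal t < conv_radius \<beta>" "ereal s < conv_radius \<beta>"
    using assms by (auto intro: le_less_trans[OF _ assms(5)])
  have st: "summable (\<lambda>i. der_coeff \<beta> i * t ^ i)" "summable (\<lambda>i. der_coeff \<beta> i * s ^ i)"
    using summable_der rt assms by auto
  show "series_der \<beta> s \<le> series_der \<beta> t"
    unfolding series_der_def using st der_coeff_nonneg assms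
    by (intro suminf_le) (auto intro!: mult_left_mono power_mono)
  have pw: "t ^ i - s ^ i \<le> real i * \<rho> ^ (i - 1) * (t - s)" for i
  proof (induction i)
    case (Suc i)
    have "t ^ Suc i - s ^ Suc i = t * (t ^ i - s ^ i) + s ^ i * (t - s)" by (simp add: algebra_simps)
    also have "\<dots> \<le> \<rho> * (real i * \<rho> ^ (i - 1) * (t - s)) + \<rho> ^ i * (t - s)"
    proof (rule add_mono)
      have "0 \<le> t ^ i - s ^ i" using assms by (simp add: power_mono)
      then have "t * (t ^ i - s ^ i) \<le> \<rho> * (t ^ i - s ^ i)" using assms by (intro mult_right_mono) auto
      also have "\<dots> \<le> \<rho> * (real i * \<rho> ^ (i - 1) * (t - s))" using Suc assms by (intro mult_left_mono) auto
      finally show "t * (t ^ i - s ^ i) \<le> \<rho> * (real i * \<rho> ^ (i - 1) * (t - s))" .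
      show "s ^ i * (t - s) \<le> \<rho> ^ i * (t - s)" using assms by (intro mult_right_mono power_mono) auto
    qed
    also have "\<dots> = real (Suc i) * \<rho> ^ (Suc i - 1) * (t - s)" by (cases i) (auto simp: algebra_simps)
    finally show ?case .
  qed simp
  have "series_der \<beta> t - series_der \<beta> s = (\<Sum>i. der_coeff \<beta> i * t ^ i - der_coeff \<beta> i * s ^ i)"
    unfolding series_der_def by (rule suminf_diff[OF st])
  also have "\<dots> \<le> (\<Sum>i. der_coeff \<beta> i * real i * \<rho> ^ (i - 1) * (t - s))"
  proof (rule suminf_le)
    fix n
    have "der_coeff \<beta> n * (t ^ n - s ^ n) \<le> der_coeff \<beta> n * (real n * \<rho> ^ (n - 1) * (t - s))"
      by (rule mult_left_mono[OF pw der_coeff_nonneg])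
    then show "der_coeff \<beta> n * t ^ n - der_coeff \<beta> n * s ^ n \<le> der_coeff \<beta> n * real n * \<rho> ^ (n - 1) * (t - s)"
      by (simp add: algebra_simps)
  qed (use st summable_der_square(2)[OF assms(4,5)] in \<open>auto intro: summable_diff summable_mult2\<close>)
  also have "\<dots> = (\<Sum>i. der_coeff \<beta> i * real i * \<rho> ^ (i - 1)) * (t - s)"
    by (rule suminf_mult2[symmetric]) (rule summable_der_square(2)[OF assms(4,5)])
  finally show "series_der \<beta> t - series_der \<beta> s \<le> (\<Sum>i. der_coeff \<beta> i * real i * \<rho> ^ (i - 1)) * (t - s)" .
qed

text \<open>
  The factor \<open>N\<close> in the rate turns \<open>N choose Suc i\<close> into \<open>(N - 1) choose i\<close>.
\<close>

lemma hazard_term: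
  assumes "i < N"
  shows "real (k choose i) * edge_rate \<beta> N (Suc i) = der_coeff \<beta> i * real (k choose i) / real ((N - 1) choose i)"
proof -
  obtain m where N: "N = Suc m" using assms by (cases N) auto
  have "Suc i * (N choose Suc i) = N * (m choose i)" unfolding N by (metis Suc_times_binomial_eq mult.commute)
  then have "real (Suc i) * real (N choose Suc i) = real N * real (m choose i)"
    by (metis of_nat_mult)
  moreover have "0 < N choose Suc i" "0 < m choose i" using assms N by auto
  ultimately show ?thesis
    unfolding edge_rate_def der_coeff_def N diff_Suc_1
    by (simp add: frac_eq_eq field_simps del: of_nat_Suc binomial_Suc_Suc)
qed

lemma hazard_eq:
  assumes "k < N"
  shows "hazard \<beta> N k = (\<Sum>i\<le>k. der_coeff \<beta> i * real (k choose i) / real ((N - 1) choose i))"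
  unfolding hazard_def using assms by (intro sum.cong refl hazard_term) auto

lemma edge_rate_nonneg: "0 \<le> edge_rate \<beta> N j"
  using nonneg by (simp add: edge_rate_def)

lemma hazard_mono: "mono (hazard \<beta> N)"
proof (rule incseq_SucI)
  fix k
  have "real (k choose i) \<le> real (Suc k choose i)" for i by (cases i) auto
  then have "hazard \<beta> N k \<le> (\<Sum>i\<le>k. real (Suc k choose i) * edge_rate \<beta> N (Suc i))"
    unfolding hazard_def using edge_rate_nonneg by (intro sum_mono mult_right_mono) auto
  also have "\<dots> \<le> hazard \<beta> N (Suc k)"
    unfolding hazard_def using edge_rate_nonneg by (intro sum_mono2) auto
  finally show "hazard \<beta> N k \<le> hazard \<beta> N (Suc k)" .
qed

lemma hazard_0: "0 \<le> hazard \<beta> N 0"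
  using edge_rate_nonneg by (simp add: hazard_def)

lemma hazard_term_lower:
  assumes k: "k < N" and rho: "real k / real N \<le> \<rho>"
  shows "der_coeff \<beta> i * (real k / real N) ^ i - (der_coeff \<beta> i * (real i)\<^sup>2 * \<rho> ^ (i - 1)) / real N
     \<le> der_coeff \<beta> i * real (k choose i) / real ((N - 1) choose i)"
proof -
  let ?\<tau> = "real k / real N"
  have \<tau>: "0 \<le> ?\<tau>" by simp
  have N0: "0 < real N" using k by simp
  have r0: "0 \<le> \<rho>" using \<tau> rho by (rule order_trans)
  have ratio: "?\<tau> ^ i - (real i)\<^sup>2 * \<rho> ^ (i - 1) / real N \<le> real (k choose i) / real ((N - 1) choose i)"
  proof (cases "i = 0")
    case True
    then show ?thesis by simp
  next
    case i0: False
    have pw: "?\<tau> ^ i * (x / real N) = ?\<tau> ^ (i - 1) * (real k / real N) * (x / real N)" for x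
      using i0 by (cases i) auto
    have tp: "?\<tau> ^ (i - 1) \<le> \<rho> ^ (i - 1)" using \<tau> rho by (rule power_mono[rotated])
    show ?thesis
    proof (cases "i \<le> k")
      case False
      then have "real k \<le> real i" "1 \<le> real i" by auto
      then have "real k * 1 \<le> real i * real i" by (intro mult_mono) auto
      then have *: "real k / real N \<le> (real i)\<^sup>2 / real N" using N0 by (simp add: power2_eq_square divide_right_mono)
      have "?\<tau> ^ i = ?\<tau> ^ (i - 1) * ?\<tau>" using i0 by (cases i) auto
      also have "\<dots> \<le> \<rho> ^ (i - 1) * ((real i)\<^sup>2 / real N)"
        using tp * r0 by (intro mult_mono) auto
      finally show ?thesis using False by (simp add: binomial_eq_0 mult.commute)
    next
      case True
      then have k0: "0 < real k" and iN: "i \<le> N - 1" using i0 k by auto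
      have mc: "0 < real ((N - 1) choose i)" using iN by simp
      have "((N - 1) choose i) * fact i \<le> (N - 1) ^ i" by (rule binomial_fact_pow)
      also have "\<dots> \<le> N ^ i" by (intro power_mono) auto
      finally have F: "real ((N - 1) choose i) * fact i \<le> real N ^ i"
        by (metis of_nat_fact of_nat_le_iff of_nat_mult of_nat_power)
      have "?\<tau> ^ i - (real i)\<^sup>2 * \<rho> ^ (i - 1) / real N \<le> ?\<tau> ^ i - (real i)\<^sup>2 * ?\<tau> ^ (i - 1) / real N"
        using tp N0 by (intro diff_left_mono divide_right_mono mult_left_mono) auto
      also have "\<dots> = real k ^ i * (real k - (real i)\<^sup>2) / (real k * real N ^ i)"
        using i0 k0 N0 by (cases i) (auto simp: power_divide field_simps)
      also have "\<dots> \<le> real k * (fact i * real (k choose i)) / (real k * real N ^ i)"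
        using falling_lower[of k i] k0 N0 by (intro divide_right_mono) auto
      also have "\<dots> = fact i * real (k choose i) / real N ^ i" using k0 by simp
      also have "\<dots> \<le> fact i * real (k choose i) / (real ((N - 1) choose i) * fact i)"
        using F mc N0 by (intro divide_left_mono mult_pos_pos) auto
      also have "\<dots> = real (k choose i) / real ((N - 1) choose i)" by simp
      finally show ?thesis .
    qed
  qed
  have "der_coeff \<beta> i * (?\<tau> ^ i - (real i)\<^sup>2 * \<rho> ^ (i - 1) / real N) \<le> der_coeff \<beta> i * (real (k choose i) / real ((N - 1) choose i))"
    by (rule mult_left_mono[OF ratio der_coeff_nonneg])
  then show ?thesis by (simp add: algebra_simps)
qed

lemma hazard_lower:
  assumes k: "k < N" and rho: "real k / real N \<le> \<rho>"
  shows "trunc_der \<beta> J (real k / real N) - (\<Sum>i<J. der_coeff \<beta> i * (real i)\<^sup>2 * \<rho> ^ (i - 1)) / real N \<le> hazard \<beta> N k"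
proof -
  let ?g = "\<lambda>i. der_coeff \<beta> i * real (k choose i) / real ((N - 1) choose i)"
  have g: "0 \<le> ?g i" for i using der_coeff_nonneg by simp
  have "trunc_der \<beta> J (real k / real N) - (\<Sum>i<J. der_coeff \<beta> i * (real i)\<^sup>2 * \<rho> ^ (i - 1)) / real N
    = (\<Sum>i<J. der_coeff \<beta> i * (real k / real N) ^ i - (der_coeff \<beta> i * (real i)\<^sup>2 * \<rho> ^ (i - 1)) / real N)"
    by (simp add: trunc_der_def sum_subtractf sum_divide_distrib)
  also have "\<dots> \<le> (\<Sum>i<J. ?g i)" by (intro sum_mono hazard_term_lower assms)
  also have "\<dots> \<le> (\<Sum>i\<in>{..<J} \<union> {..k}. ?g i)" using g by (intro sum_mono2) auto
  also have "\<dots> = (\<Sum>i\<le>k. ?g i)" by (intro sum.mono_neutral_right) (auto simp: binomial_eq_0)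
  also have "\<dots> = hazard \<beta> N k" using hazard_eq[OF k] by simp
  finally show ?thesis .
qed

lemma hazard_lower_series:
  assumes k: "k < N" and rho: "real k / real N \<le> \<rho>" and r: "0 < \<rho>" "ereal \<rho> < conv_radius \<beta>"
  shows "series_der \<beta> (real k / real N) - (\<Sum>i. der_coeff \<beta> i * (real i)\<^sup>2 * \<rho> ^ (i - 1)) / real N \<le> hazard \<beta> N k"
proof (rule LIMSEQ_le_const2)
  have "ereal (real k / real N) < conv_radius \<beta>" using rho r(2) by (auto intro: le_less_trans[OF _ r(2)])
  then show "(\<lambda>J. trunc_der \<beta> J (real k / real N) - (\<Sum>i<J. der_coeff \<beta> i * (real i)\<^sup>2 * \<rho> ^ (i - 1)) / real N)
     \<longlonglongrightarrow> series_der \<beta> (real k / real N) - (\<Sum>i. der_coeff \<beta> i * (real i)\<^sup>2 * \<rho> ^ (i - 1)) / real N"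
    unfolding trunc_der_def series_der_def using k
    by (intro tendsto_diff tendsto_divide tendsto_const summable_LIMSEQ summable_der summable_der_square r) auto
  show "\<exists>n. \<forall>J\<ge>n. trunc_der \<beta> J (real k / real N) - (\<Sum>i<J. der_coeff \<beta> i * (real i)\<^sup>2 * \<rho> ^ (i - 1)) / real N \<le> hazard \<beta> N k"
    using hazard_lower[OF k rho] by blast
qed

lemma hazard_upper:
  assumes k: "k < N" "2 \<le> N" and r: "ereal (real k / real (N - 1)) < conv_radius \<beta>"
  shows "hazard \<beta> N k \<le> series_der \<beta> (real k / real (N - 1))"
proof -
  let ?m = "N - 1"
  let ?\<tau> = "real k / real ?m"
  have m0: "0 < real ?m" using k by simp
  have "hazard \<beta> N k = (\<Sum>i\<le>k. der_coeff \<beta> i * real (k choose i) / real (?m choose i))"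
    by (rule hazard_eq) fact
  also have "\<dots> \<le> (\<Sum>i\<le>k. der_coeff \<beta> i * ?\<tau> ^ i)"
  proof (rule sum_mono)
    fix i assume "i \<in> {..k}"
    then have "i \<le> ?m" "k \<le> ?m" using k by auto
    then have "real (k choose i) * real ?m ^ i \<le> real k ^ i * real (?m choose i)" "0 < real (?m choose i)"
      by (auto intro: binomial_ratio_upper)
    then have "real (k choose i) / real (?m choose i) \<le> ?\<tau> ^ i"
      using m0 by (simp add: power_divide divide_simps mult.commute)
    from mult_left_mono[OF this der_coeff_nonneg[of i]]
    show "der_coeff \<beta> i * real (k choose i) / real (?m choose i) \<le> der_coeff \<beta> i * ?\<tau> ^ i" by simp
  qed
  also have "\<dots> \<le> series_der \<beta> ?\<tau>"
    unfolding series_der_def using der_coeff_nonneg by (intro sum_le_suminf summable_der r) auto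
  finally show ?thesis .
qed

text \<open>
  Valid on the whole range \<open>k \<le> (1 - \<delta>) * N\<close>, also beyond the radius of convergence, at the price of
  truncating the series. It serves where the drift is bounded away from zero.
\<close>

lemma gap_lower_trunc:
  assumes d: "0 < \<delta>" "2 \<le> \<delta> * real N" "real k \<le> (1 - \<delta>) * real N"
  shows "trunc_der \<beta> J (real k / real N) + ln (1 - real k / real N) -
     ((\<Sum>i<J. der_coeff \<beta> i * (real i)\<^sup>2) + 2 / \<delta>) / real N \<le> gap \<beta> N k"
proof -
  have N: "0 < real N" using d by (metis mult_zero_right not_numeral_le_zero of_nat_0_less_iff gr0I of_nat_0)
  have "0 < \<delta> * real N" using d by linarith
  then have "real k < real N" using d by (simp add: algebra_simps)
  then have "k < N" "real k / real N \<le> 1" using N by auto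
  from hazard_lower[OF this, of J] harmonic_block_upper'[OF d] show ?thesis
    by (simp add: gap_def add_divide_distrib)
qed

text \<open>
  Near a zero of the drift nothing may be lost by truncation, so the full series is kept; inside
  the disc of convergence the error is still a fixed multiple of \<open>1 / N\<close>.
\<close>

lemma gap_lower_series:
  assumes d: "0 < \<delta>" "2 \<le> \<delta> * real N" "real k \<le> (1 - \<delta>) * real N"
    and r: "real k / real N \<le> \<rho>" "0 < \<rho>" "ereal \<rho> < conv_radius \<beta>"
  shows "series_der \<beta> (real k / real N) + ln (1 - real k / real N) -
     ((\<Sum>i. der_coeff \<beta> i * (real i)\<^sup>2 * \<rho> ^ (i - 1)) + 2 / \<delta>) / real N \<le> gap \<beta> N k"
proof -
  have N: "0 < real N" using d by (metis mult_zero_right not_numeral_le_zero of_nat_0_less_iff gr0I of_nat_0)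
  have "0 < \<delta> * real N" using d by linarith
  then have "real k < real N" using d by (simp add: algebra_simps)
  then have "k < N" using N by auto
  from hazard_lower_series[OF this r] harmonic_block_upper'[OF d] show ?thesis
    by (simp add: gap_def add_divide_distrib)
qed

text \<open>
  Rounding down makes \<open>k / (N - 1)\<close> at most slightly larger than \<open>t\<close>, and the derived series is
  Lipschitz near \<open>t\<close>.
\<close>

lemma gap_upper:
  assumes t: "0 \<le> t" "t < 1" "ereal t < conv_radius \<beta>"
  shows "\<exists>C N0. \<forall>N\<ge>N0. gap \<beta> N (nat \<lfloor>t * real N\<rfloor>) \<le> series_der \<beta> t + ln (1 - t) + C / real N"
proof -
  obtain \<rho> where r: "t < \<rho>" "\<rho> < 1" "ereal \<rho> < conv_radius \<beta>" "0 < \<rho>"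
    using pos_radius_between[OF t] .
  define L where "L = (\<Sum>i. der_coeff \<beta> i * real i * \<rho> ^ (i - 1))"
  have L0: "0 \<le> L" unfolding L_def using der_coeff_nonneg r by (intro suminf_nonneg summable_der_square(2)) auto
  define N0 where "N0 = nat \<lceil>2 + 2 / (\<rho> - t)\<rceil>"
  have "gap \<beta> N (nat \<lfloor>t * real N\<rfloor>) \<le> series_der \<beta> t + ln (1 - t) + (2 * L + 1 / (1 - t)) / real N" if "N0 \<le> N" for N
  proof -
    let ?k = "nat \<lfloor>t * real N\<rfloor>"
    have N: "2 + 2 / (\<rho> - t) \<le> real N" using that unfolding N0_def by linarith
    moreover have "0 < 2 / (\<rho> - t)" using r by simp
    ultimately have N2: "2 < real N" by linarith
    have k: "real ?k \<le> t * real N" "t * real N - 1 < real ?k" using t by (auto simp: of_nat_nat)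
    have "t * real N < 1 * real N" using t N2 by (intro mult_strict_right_mono) auto
    then have kN: "?k < N" using k by linarith
    have M: "real (N - 1) = real N - 1" using N2 by (simp add: of_nat_diff)
    have "real ?k / real (N - 1) \<le> t * real N / (real N - 1)"
      unfolding M using k N2 by (intro divide_right_mono) auto
    also have "\<dots> = t + t / (real N - 1)" using N2 by (simp add: field_simps)
    also have "\<dots> \<le> t + 1 / (real N - 1)" using t N2 by (intro add_left_mono divide_right_mono) auto
    also have "1 / (real N - 1) \<le> 2 / real N" using N2 by (simp add: field_simps)
    finally have u: "real ?k / real (N - 1) \<le> t + 2 / real N" by simp
    have "2 \<le> (\<rho> - t) * real N"
    proof -
      have "2 / (\<rho> - t) \<le> real N" using N by simp
      then show ?thesis using r by (simp add: field_simps)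
    qed
    then have v: "t + 2 / real N \<le> \<rho>" using N2 by (simp add: field_simps)
    have rv: "ereal (t + 2 / real N) < conv_radius \<beta>" using v r(3) by (auto intro: le_less_trans[OF _ r(3)])
    have ru: "ereal (real ?k / real (N - 1)) < conv_radius \<beta>" using u by (auto intro: le_less_trans[OF _ rv])
    have "hazard \<beta> N ?k \<le> series_der \<beta> (real ?k / real (N - 1))" using kN N2 ru by (intro hazard_upper) auto
    also have "\<dots> \<le> series_der \<beta> (t + 2 / real N)"
      by (rule series_der_diff(1)[OF _ u v r(4,3)]) simp
    also have "\<dots> \<le> series_der \<beta> t + L * (2 / real N)"
      using series_der_diff(2)[of t "t + 2 / real N" \<rho>] t v r N2 by (simp add: L_def)
    finally have h: "hazard \<beta> N ?k \<le> series_der \<beta> t + 2 * L / real N" by (simp add: mult.commute)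
    have "ln (real N) - ln (real N - real ?k) \<le> (\<Sum>i\<le>?k. 1 / (real N - real i))" by (rule harmonic_block_lower[OF kN])
    moreover have "ln (real N - real ?k) - ln (real N) \<le> ln (1 - t) + 1 / (1 - t) / real N"
    proof -
      have a: "0 < (1 - t) * real N" using t N2 by simp
      have "real N - real ?k \<le> (1 - t) * real N + 1" using k by (simp add: algebra_simps)
      then have "ln (real N - real ?k) \<le> ln ((1 - t) * real N + 1)" using kN a by (subst ln_le_cancel_iff) auto
      also have "\<dots> \<le> ln ((1 - t) * real N) + 1 / ((1 - t) * real N)" using ln_succ_bounds(2)[OF a] by simp
      also have "ln ((1 - t) * real N) = ln (1 - t) + ln (real N)" using t N2 by (simp add: ln_mult)
      finally show ?thesis by simp
    qed
    ultimately show ?thesis using h by (simp add: gap_def add_divide_distrib)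
  qed
  then show ?thesis by blast
qed

end

lemma trunc_der_continuous: "continuous_on A (trunc_der \<beta> J)"
  unfolding trunc_der_def by (intro continuous_intros)

context
  fixes \<beta> :: "nat \<Rightarrow> real"
  assumes nonneg: "\<And>j. 0 \<le> \<beta> j"
begin

lemma drift_finite:
  assumes "0 \<le> t" "ereal t < conv_radius \<beta>"
  shows "drift \<beta> t = ereal (series_der \<beta> t + ln (1 - t))"
  using derived_series_finite[OF nonneg assms] by (simp add: drift_def)

lemma drift_ge_trunc: "0 \<le> t \<Longrightarrow> ereal (trunc_der \<beta> J t + ln (1 - t)) \<le> drift \<beta> t"
proof -
  assume t: "0 \<le> t"
  have "ereal (trunc_der \<beta> J t) \<le> derived_series \<beta> t"
    unfolding derived_series_eq_SUP[OF nonneg t] by (rule SUP_upper) simp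
  then show ?thesis unfolding drift_def by (metis add_right_mono plus_ereal.simps(1))
qed

lemma drift_pos_imp_trunc:
  assumes "0 \<le> t" "ereal x < drift \<beta> t"
  shows "\<exists>J. x < trunc_der \<beta> J t + ln (1 - t)"
proof -
  have "ereal (x - ln (1 - t)) < derived_series \<beta> t"
    using assms(2) unfolding drift_def by (cases "derived_series \<beta> t") auto
  then obtain J where "ereal (x - ln (1 - t)) < ereal (trunc_der \<beta> J t)"
    unfolding derived_series_eq_SUP[OF nonneg assms(1)] less_SUP_iff by blast
  then show ?thesis by (intro exI[of _ J]) simp
qed

lemma drift_0: "drift \<beta> 0 = ereal (\<beta> 1)"
proof -
  have "trunc_der \<beta> J 0 = (if J = 0 then 0 else \<beta> 1)" for J
    unfolding trunc_der_def by (cases J) (auto simp: sum.lessThan_Suc_shift der_coeff_def)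
  then have "(SUP J. ereal (trunc_der \<beta> J 0)) = ereal (\<beta> 1)"
    using nonneg[of 1] by (intro antisym SUP_least SUP_upper2[of "1::nat"]) auto
  then show ?thesis using derived_series_eq_SUP[OF nonneg, of 0] by (simp add: drift_def)
qed

text \<open>
  The truncated drifts are continuous and increase to the drift, so compactness gives one
  truncation and one lower bound for all of \<open>K\<close> (as in the theorem of Dini), even where the drift is
  infinite.
\<close>

lemma uniform_drift_lower:
  assumes K: "compact K" "K \<subseteq> {0..<1}" and pos: "\<And>t. t \<in> K \<Longrightarrow> 0 < drift \<beta> t"
  shows "\<exists>J c. 0 < c \<and> (\<forall>t\<in>K. c \<le> trunc_der \<beta> J t + ln (1 - t))"
proof -
  define U where "U n = {t\<in>{..<1}. 1 / real (Suc n) < trunc_der \<beta> n t + ln (1 - t)}" for n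
  have op: "open (U n)" for n
  proof -
    have "continuous_on {..<1} (\<lambda>t. trunc_der \<beta> n t + ln (1 - t))"
      by (intro continuous_intros trunc_der_continuous) auto
    from continuous_on_open_vimage[THEN iffD1, OF _ this, rule_format, of "{1 / real (Suc n)<..}"]
    have "open ((\<lambda>t. trunc_der \<beta> n t + ln (1 - t)) -` {1 / real (Suc n)<..} \<inter> {..<1})" by simp
    moreover have "(\<lambda>t. trunc_der \<beta> n t + ln (1 - t)) -` {1 / real (Suc n)<..} \<inter> {..<1} = U n"
      by (rule set_eqI) (simp add: U_def conj_commute del: of_nat_Suc)
    ultimately show ?thesis by simp
  qed
  have cov: "K \<subseteq> (\<Union>n\<in>UNIV. U n)"
  proof
    fix t assume t: "t \<in> K"
    then have t0: "0 \<le> t" "t < 1" using K by auto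
    obtain J where J: "0 < trunc_der \<beta> J t + ln (1 - t)"
      using drift_pos_imp_trunc[OF t0(1), of 0] pos[OF t] by (auto simp: zero_ereal_def)
    obtain n where n: "1 / real (Suc n) < trunc_der \<beta> J t + ln (1 - t)" using nat_approx_posE[OF J] by blast
    have "1 / real (Suc (max n J)) \<le> 1 / real (Suc n)" by (intro divide_left_mono) auto
    moreover have "trunc_der \<beta> J t \<le> trunc_der \<beta> (max n J) t" by (intro trunc_der_mono nonneg t0) simp
    ultimately have "t \<in> U (max n J)" using n t0 by (auto simp: U_def)
    then show "t \<in> (\<Union>n\<in>UNIV. U n)" by blast
  qed
  obtain D where D: "finite D" "K \<subseteq> (\<Union>n\<in>D. U n)"
    by (rule compactE_image[OF K(1) op cov])
  define m where "m = Max (insert 0 D)"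
  have "1 / real (Suc m) \<le> trunc_der \<beta> m t + ln (1 - t)" if t: "t \<in> K" for t
  proof -
    obtain n where n: "n \<in> D" "t \<in> U n" using D t by blast
    then have nm: "n \<le> m" using D by (simp add: m_def)
    have "1 / real (Suc m) \<le> 1 / real (Suc n)" using nm by (intro divide_left_mono) auto
    moreover have "trunc_der \<beta> n t \<le> trunc_der \<beta> m t" using t K nm by (intro trunc_der_mono nonneg) auto
    ultimately show ?thesis using n by (auto simp: U_def)
  qed
  then show ?thesis by (intro exI[of _ m] exI[of _ "1 / real (Suc m)"]) auto
qed

lemma z_star_le_1: "z_star \<beta> \<le> 1" and z_star_nonneg: "0 \<le> z_star \<beta>"
  and z_star_lower: "0 \<le> t \<Longrightarrow> t < 1 \<Longrightarrow> drift \<beta> t < 0 \<Longrightarrow> z_star \<beta> \<le> t"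
proof -
  let ?S = "insert 1 {t. 0 \<le> t \<and> t < 1 \<and> drift \<beta> t < 0}"
  have bdd: "bdd_below ?S" by (auto intro!: bdd_belowI[of _ 0])
  show "z_star \<beta> \<le> 1" "0 \<le> t \<Longrightarrow> t < 1 \<Longrightarrow> drift \<beta> t < 0 \<Longrightarrow> z_star \<beta> \<le> t" for t
    unfolding z_star_def by (rule cInf_lower[OF _ bdd], simp)+
  show "0 \<le> z_star \<beta>" unfolding z_star_def by (rule cInf_greatest) auto
qed

lemma drift_nonneg: "0 \<le> t \<Longrightarrow> t < z_star \<beta> \<Longrightarrow> 0 \<le> drift \<beta> t"
  using z_star_lower[of t] z_star_le_1 by (meson leD less_le_trans not_le)

lemma z_star_approx:
  assumes "z_star \<beta> < y" "y \<le> 1"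
  shows "\<exists>t. z_star \<beta> \<le> t \<and> t < y \<and> t < 1 \<and> drift \<beta> t < 0"
proof -
  obtain t where "t \<in> insert 1 {t. 0 \<le> t \<and> t < 1 \<and> drift \<beta> t < 0}" "t < y"
    using cInf_lessD[OF _ assms(1)[unfolded z_star_def]] by blast
  then show ?thesis using assms z_star_lower[of t] by auto
qed

text \<open>
  At \<open>0\<close> the drift is \<open>\<beta> 1\<close>. If it were negative at \<open>z* > 0\<close>, it would be negative slightly to the left,
  because the derived series does not increase to the left and the logarithm is continuous.
\<close>

lemma drift_z_star_nonneg:
  assumes "z_star \<beta> < 1"
  shows "0 \<le> drift \<beta> (z_star \<beta>)"
proof (rule ccontr)
  let ?z = "z_star \<beta>"
  assume neg: "\<not> 0 \<le> drift \<beta> ?z"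
  then have z0: "0 < ?z" using drift_0 nonneg[of 1] z_star_nonneg by (cases "?z = 0") auto
  then obtain x where x: "derived_series \<beta> ?z = ereal x"
    using neg derived_series_eq_SUP[OF nonneg, of ?z] SUP_upper[of 0 UNIV "\<lambda>J. ereal (trunc_der \<beta> J ?z)"]
    by (cases "derived_series \<beta> ?z") (auto simp: drift_def trunc_der_def)
  then have xn: "x + ln (1 - ?z) < 0" using neg by (simp add: drift_def)
  have "isCont (\<lambda>s. x + ln (1 - s)) ?z" using assms by (intro continuous_intros) auto
  then have "\<forall>\<^sub>F s in at ?z. x + ln (1 - s) < 0" using xn by (simp add: isCont_def order_tendstoD)
  then have "\<forall>\<^sub>F s in at_left ?z. x + ln (1 - s) < 0" by (simp add: eventually_at_split)
  moreover have "\<forall>\<^sub>F s in at_left ?z. 0 < s \<and> s < ?z"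
    using eventually_at_left_real[OF z0] by (auto elim: eventually_mono)
  ultimately obtain s where s: "x + ln (1 - s) < 0" "0 < s" "s < ?z"
    using eventually_happens'[OF trivial_limit_at_left_real] by (metis (mono_tags, lifting) eventually_conj)
  have "derived_series \<beta> s \<le> derived_series \<beta> ?z"
    using s nonneg by (simp add: derived_series_eq_SUP[OF nonneg]) 
      (auto intro!: SUP_mono' simp: trunc_der_def der_coeff_def intro!: sum_mono mult_left_mono power_mono)
  then have "drift \<beta> s \<le> ereal (x + ln (1 - s))" unfolding drift_def x
    by (metis add_right_mono plus_ereal.simps(1))
  also have "\<dots> < 0" using s by simp
  finally show False using drift_nonneg[of s] s by simp
qed

text \<open>
  Negative drift forces the derived series to be finite; points of negative drift close to the
  right of \<open>z*\<close> therefore show that \<open>z*\<close> lies strictly inside the disc of convergence.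
\<close>

lemma z_star_right:
  assumes "z_star \<beta> < y" "y \<le> 1"
  shows "\<exists>t. z_star \<beta> < t \<and> t < y \<and> drift \<beta> t < 0 \<and> ereal t \<le> conv_radius \<beta>"
proof -
  obtain t where t: "z_star \<beta> \<le> t" "t < y" "t < 1" "drift \<beta> t < 0" using z_star_approx[OF assms] by blast
  then have "t \<noteq> z_star \<beta>" using drift_z_star_nonneg by fastforce
  then have t': "z_star \<beta> < t" "0 < t" using t z_star_nonneg by auto
  have "derived_series \<beta> t \<noteq> \<infinity>" using t(4) by (auto simp: drift_def)
  then show ?thesis using t t' finite_derived_series_radius[OF nonneg t'(2)] by auto
qed

lemma z_star_radius: "z_star \<beta> < 1 \<Longrightarrow> ereal (z_star \<beta>) < conv_radius \<beta>"
  using z_star_right[of 1] by (auto intro: less_le_trans[of _ "ereal _"])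

lemma series_der_isCont:
  assumes "0 \<le> t" "ereal t < conv_radius \<beta>"
  shows "isCont (series_der \<beta>) t"
proof -
  obtain \<rho> where r: "t < \<rho>" "ereal \<rho> < conv_radius \<beta>"
    using pos_radius_between[OF nonneg assms(1) _ assms(2), of "t+1"] by auto
  show ?thesis unfolding series_der_def
    by (rule isCont_powser[where K=\<rho>]) (use assms r summable_der[OF nonneg, of \<rho>] in auto)
qed

lemma drift_z_star:
  assumes "z_star \<beta> < 1"
  shows "drift \<beta> (z_star \<beta>) = 0"
proof -
  let ?z = "z_star \<beta>"
  let ?f = "\<lambda>t. series_der \<beta> t + ln (1 - t)"
  have z: "0 \<le> ?z" "ereal ?z < conv_radius \<beta>" using z_star_nonneg z_star_radius[OF assms] by auto
  have fz: "0 \<le> ?f ?z" using drift_z_star_nonneg[OF assms] drift_finite[OF z] by simp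
  have "\<not> 0 < ?f ?z"
  proof
    assume "0 < ?f ?z"
    moreover have "isCont ?f ?z" using assms z by (intro continuous_intros series_der_isCont) auto
    ultimately have "\<forall>\<^sub>F s in at ?z. 0 < ?f s" by (simp add: isCont_def order_tendstoD)
    then obtain d where d: "0 < d" "\<And>s. s \<noteq> ?z \<Longrightarrow> dist s ?z < d \<Longrightarrow> 0 < ?f s"
      by (auto simp: eventually_at)
    obtain \<rho> where r: "?z < \<rho>" "\<rho> < 1" "ereal \<rho> < conv_radius \<beta>"
      using pos_radius_between[OF nonneg z(1) assms z(2)] .
    obtain t where t: "?z < t" "t < min (?z + d) \<rho>" "drift \<beta> t < 0"
    proof -
      have "?z < min (?z + d) \<rho>" "min (?z + d) \<rho> \<le> 1" using d(1) r by auto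
      then show ?thesis using z_star_right that by blast
    qed
    then have "0 < ?f t" using d(2)[of t] by (auto simp: dist_real_def)
    moreover have "ereal t < conv_radius \<beta>" using t by (auto intro: le_less_trans[OF _ r(3)])
    then have "drift \<beta> t = ereal (?f t)" using t z by (intro drift_finite) auto
    ultimately show False using t by simp
  qed
  then show ?thesis using fz drift_finite[OF z] by simp
qed

context
  assumes radius: "conv_radius \<beta> \<notin> ereal ` zero_set \<beta>" and zero: "0 \<notin> zero_set \<beta>"
begin

text \<open>
  This is where the hypothesis on the radius of convergence enters: a zero lies in the closed disc
  of convergence and is not its radius.
\<close>

lemma zero_set_props:
  assumes "z \<in> zero_set \<beta>"
  shows "0 < z" "z < z_star \<beta>" "z < 1" "ereal z < conv_radius \<beta>" "series_der \<beta> z + ln (1 - z) = 0"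
proof -
  show z: "0 < z" "z < z_star \<beta>" using assms zero by (auto simp: zero_set_def order.order_iff_strict)
  then show "z < 1" using z_star_le_1 by simp
  have "drift \<beta> z = 0" using assms by (simp add: zero_set_def)
  then have "derived_series \<beta> z \<noteq> \<infinity>" by (auto simp: drift_def)
  then have "ereal z \<le> conv_radius \<beta>" using finite_derived_series_radius[OF nonneg z(1)] by simp
  moreover have "ereal z \<noteq> conv_radius \<beta>" using radius assms by (metis image_eqI)
  ultimately show r: "ereal z < conv_radius \<beta>" by simp
  show "series_der \<beta> z + ln (1 - z) = 0"
    using drift_finite[of z] z r \<open>drift \<beta> z = 0\<close> by simp
qed

text \<open>
  The only possible obstruction is a radius of convergence \<open>R\<close> below \<open>1\<close>, at which zeros might
  accumulate. If \<open>R < z*\<close>, then \<open>R\<close> is not a zero, so the drift is positive at \<open>R\<close>; some truncated drift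
  is positive there, hence in a neighbourhood of \<open>R\<close>, which contains no zero.
\<close>

lemma zeros_below_radius:
  assumes "r < 1" and z0: "z0 \<in> zero_set \<beta>"
  shows "\<exists>r'. 0 \<le> r' \<and> r' < 1 \<and> ereal r' < conv_radius \<beta> \<and> {z\<in>zero_set \<beta>. z \<le> r} \<subseteq> {0..r'}"
proof -
  have pos0: "0 \<le> z" "z \<le> z_star \<beta>" if "z \<in> zero_set \<beta>" for z
    using zero_set_props(1,2)[OF that] by auto
  show ?thesis
  proof (cases "conv_radius \<beta>")
  case (real R)
  show ?thesis
  proof (cases "max r 0 < R")
    case True
    then show ?thesis using assms real pos0 by (intro exI[of _ "max r 0"]) (auto simp: le_max_iff_disj)
  next
    case False
    show ?thesis
    proof (cases "z_star \<beta> < 1")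
      case True
      then show ?thesis using z_star_radius[OF True] z_star_nonneg pos0
        by (intro exI[of _ "z_star \<beta>"]) auto
    next
      case zs: False
      have R0: "0 < R" using zero_set_props(1,4)[OF z0] real by auto
      have R1: "R < 1" using \<open>\<not> max r 0 < R\<close> assms R0 by auto
        then have "R < z_star \<beta>" using zs by simp
        then have "0 \<le> drift \<beta> R" using R0 by (intro drift_nonneg) auto
        moreover have "drift \<beta> R \<noteq> 0" using radius real \<open>R < z_star \<beta>\<close> R0 by (auto simp: zero_set_def image_iff)
        ultimately obtain J where J: "0 < trunc_der \<beta> J R + ln (1 - R)"
          using drift_pos_imp_trunc[of R 0] R0 by (auto simp: zero_ereal_def order.order_iff_strict)
        have "isCont (\<lambda>t. trunc_der \<beta> J t + ln (1 - t)) R"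
          unfolding trunc_der_def using R1 by (intro continuous_intros) auto
        then have "\<forall>\<^sub>F t in at R. 0 < trunc_der \<beta> J t + ln (1 - t)" using J by (simp add: isCont_def order_tendstoD)
        then obtain d where d: "0 < d" "\<And>t. t \<noteq> R \<Longrightarrow> dist t R < d \<Longrightarrow> 0 < trunc_der \<beta> J t + ln (1 - t)"
          by (auto simp: eventually_at)
        define r' where "r' = max 0 (R - d / 2)"
        have "z \<le> r'" if z: "z \<in> zero_set \<beta>" for z
        proof (rule ccontr)
          assume "\<not> z \<le> r'"
          then have "z \<noteq> R" "dist z R < d" using zero_set_props(4)[OF z] real d by (auto simp: r'_def dist_real_def)
          then have "0 < trunc_der \<beta> J z + ln (1 - z)" by (rule d(2))
          then show False using drift_ge_trunc[of z J] z zero_set_props(1)[OF z] by (auto simp: zero_set_def zero_ereal_def)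
        qed
        then show ?thesis using R0 R1 real pos0 d
          by (intro exI[of _ r']) (auto simp: r'_def)
    qed
  qed
next
  case PInf
  then show ?thesis using assms pos0 by (intro exI[of _ "max r 0"]) (auto simp: max_def; fastforce)
next
  case MInf
  then show ?thesis using conv_radius_nonneg[of \<beta>] by simp
  qed
qed

text \<open>
  The drift extends to a holomorphic function on a disc that contains the zeros in question in a
  compact part. It is not constant, since it vanishes at a zero but not at \<open>0\<close>, so its zeros in the
  compact part are finitely many.
\<close>

lemma finite_zeros:
  assumes "r < 1"
  shows "finite {z\<in>zero_set \<beta>. z \<le> r}"
proof (cases "zero_set \<beta> = {}")
  case False
  then obtain z0 where z0: "z0 \<in> zero_set \<beta>" by auto
  obtain r' where r': "0 \<le> r'" "r' < 1" "ereal r' < conv_radius \<beta>" "{z\<in>zero_set \<beta>. z \<le> max r z0} \<subseteq> {0..r'}"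
    using zeros_below_radius[OF _ z0, of "max r z0"] assms zero_set_props(3)[OF z0] by auto
  obtain \<rho> where p: "r' < \<rho>" "\<rho> < 1" "ereal \<rho> < conv_radius \<beta>" "0 < \<rho>"
    using pos_radius_between[OF nonneg r'(1,2,3)] .
  define c where "c i = complex_of_real (der_coeff \<beta> i)" for i
  define F where "F w = (\<Sum>i. c i * w ^ i)" for w
  \<comment> \<open>The holomorphic extension of the drift.\<close>
  define f where "f w = F w + Ln (1 - w)" for w
  have sm: "summable (\<lambda>i. c i * complex_of_real \<rho> ^ i)"
  proof -
    have "summable (\<lambda>i. complex_of_real (der_coeff \<beta> i * \<rho> ^ i))"
      using summable_der_square(3)[OF nonneg p(4,3)] by (rule summable_of_real)
    then show ?thesis by (simp add: c_def)
  qed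
  have sums: "(\<lambda>i. c i * (w - 0) ^ i) sums F w" if "w \<in> ball 0 \<rho>" for w
    using powser_inside[OF sm, of w] that p by (auto simp: F_def intro!: summable_sums)
  have Fh: "F holomorphic_on ball 0 \<rho>"
    by (rule power_series_holomorphic) (rule sums)
  have re: "1 - w \<notin> \<real>\<^sub>\<le>\<^sub>0" if "w \<in> ball 0 \<rho>" for w :: complex
  proof -
    have "Re w \<le> norm w" by (rule complex_Re_le_cmod)
    then have "0 < Re (1 - w)" using that p by simp
    then show ?thesis by (auto simp: complex_nonpos_Reals_iff)
  qed
  have fh: "f holomorphic_on ball 0 \<rho>"
    unfolding f_def using re by (intro holomorphic_intros Fh) auto
  have f_real: "f (complex_of_real t) = complex_of_real (series_der \<beta> t + ln (1 - t))" if "0 \<le> t" "t < \<rho>" for t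
  proof -
    have "ereal t < conv_radius \<beta>" using that by (auto intro: le_less_trans[OF _ p(3)])
    from suminf_of_real[OF summable_der[OF nonneg that(1) this], where ?'a=complex]
    have "F (complex_of_real t) = complex_of_real (series_der \<beta> t)"
      by (simp add: F_def c_def series_der_def)
    moreover have "Ln (1 - complex_of_real t) = complex_of_real (ln (1 - t))"
      using Ln_of_real[of "1 - t"] that p by simp
    ultimately show ?thesis by (simp add: f_def)
  qed
  have zr: "z \<le> r'" "z < \<rho>" if "z \<in> zero_set \<beta>" "z \<le> max r z0" for z
    using r'(4) that p by auto
  have "\<not> f constant_on ball 0 \<rho>"
  proof
    assume "f constant_on ball 0 \<rho>"
    then have "f (complex_of_real 0) = f (complex_of_real z0)"
      using p zr[OF z0] zero_set_props(1)[OF z0] by (auto simp: constant_on_def dist_norm)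
    then have "series_der \<beta> 0 + ln (1 - 0) = series_der \<beta> z0 + ln (1 - z0)"
      using f_real[of 0] f_real[of z0] zr[OF z0] zero_set_props(1)[OF z0] p by (simp only: of_real_eq_iff)
    then have "drift \<beta> 0 = 0" using zero_set_props(5)[OF z0] r'
      by (subst drift_finite) (auto intro: le_less_trans[OF _ r'(3)])
    then show False using zero zero_set_props(1,2)[OF z0] by (auto simp: zero_set_def)
  qed
  have "cball 0 r' \<subseteq> (ball 0 \<rho> :: complex set)" using p by (simp add: cball_subset_ball_iff)
  with holomorphic_compact_finite_zeros[OF fh _ _ _ _ \<open>\<not> f constant_on ball 0 \<rho>\<close>, of "cball 0 r'"]
  have "finite {w \<in> cball 0 r'. f w = 0}" by auto
  then have "finite (Re ` {w \<in> cball 0 r'. f w = 0})" by simp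
  moreover have "{z\<in>zero_set \<beta>. z \<le> r} \<subseteq> Re ` {w \<in> cball 0 r'. f w = 0}"
  proof
    fix z assume z: "z \<in> {z\<in>zero_set \<beta>. z \<le> r}"
    then have zz: "z \<in> zero_set \<beta>" "z \<le> max r z0" by auto
    then have "f (complex_of_real z) = 0" using f_real[of z] zero_set_props(1,5)[of z] zr by simp
    moreover have "complex_of_real z \<in> cball 0 r'" using zr(1)[OF zz] zero_set_props(1)[OF zz(1)] by simp
    ultimately show "z \<in> Re ` {w \<in> cball 0 r'. f w = 0}" by (intro image_eqI[of _ _ "complex_of_real z"]) auto
  qed
  ultimately show ?thesis by (rule finite_subset[rotated])
qed simp

lemma countable_zeros: "countable (zero_set \<beta>)"
proof -
  have "zero_set \<beta> \<subseteq> (\<Union>n. {z\<in>zero_set \<beta>. z \<le> 1 - 1 / real (Suc n)})"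
  proof
    fix z assume z: "z \<in> zero_set \<beta>"
    then obtain n where "1 / real (Suc n) < 1 - z" using nat_approx_posE[of "1 - z"] zero_set_props(3)[OF z] by auto
    then show "z \<in> (\<Union>n. {z\<in>zero_set \<beta>. z \<le> 1 - 1 / real (Suc n)})" using z by (intro UN_I[of n]) auto
  qed
  moreover have "countable (\<Union>n. {z\<in>zero_set \<beta>. z \<le> 1 - 1 / real (Suc n)})"
    by (rule countable_UN) (auto intro!: countable_finite finite_zeros)
  ultimately show ?thesis by (rule countable_subset)
qed

end

end

section \<open>The Brownian limit of the noise\<close>

context exp_seq begin

definition xi :: "nat \<Rightarrow> 'a \<Rightarrow> real" where "xi i w = 1 - E i w"

text \<open>
  The fluctuation of the walk about its mean, with the sign reversed, at the scale at which it has
  a limit.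
\<close>

definition noise :: "nat \<Rightarrow> nat \<Rightarrow> 'a \<Rightarrow> real" where
  "noise N n w = (\<Sum>i<n. sqrt (real N) / (real N - real i) * xi i w)"

lemma xi_indep: "indep_vars (\<lambda>_. borel) xi UNIV"
  unfolding xi_def[abs_def] by (rule indep_vars_compose2[OF indep_E]) simp

lemma xi_rv[measurable]: "xi i \<in> borel_measurable M"
  unfolding xi_def[abs_def] by measurable

lemma noise_rv[measurable]: "noise N n \<in> borel_measurable M"
  unfolding noise_def[abs_def] by measurable

lemma E_power_integrable: "integrable M (\<lambda>w. E i w ^ k)"
  using erlang_ith_moment_integrable[OF _ exp_E[of i], of k] by simp

lemma E_integrable: "integrable M (E i)"
  using E_power_integrable[of i 1] by simp

lemma xi_mean: "expectation (xi i) = 0"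
proof -
  have "expectation (E i) = 1" using exponential_distributed_expectation[OF _ exp_E[of i]] by simp
  then show ?thesis unfolding xi_def[abs_def] using E_integrable[of i] by (simp add: prob_space)
qed

lemma xi_square: "integrable M (\<lambda>w. (xi i w)\<^sup>2)" "expectation (\<lambda>w. (xi i w)\<^sup>2) = 1"
proof -
  have e: "(xi i w)\<^sup>2 = (E i w - 1)\<^sup>2" for w by (simp add: xi_def power2_commute)
  have 1: "expectation (E i) = 1" using exponential_distributed_expectation[OF _ exp_E[of i]] by simp
  have "variance (E i) = 1" using exponential_distributed_variance[OF _ exp_E[of i]] by simp
  then show "expectation (\<lambda>w. (xi i w)\<^sup>2) = 1" unfolding e 1 .
  have "integrable M (\<lambda>w. 1 - 2 * E i w + (E i w) ^ 2)" using E_integrable E_power_integrable by auto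
  moreover have "(xi i w)\<^sup>2 = 1 - 2 * E i w + (E i w) ^ 2" for w by (simp add: xi_def power2_eq_square algebra_simps)
  ultimately show "integrable M (\<lambda>w. (xi i w)\<^sup>2)" by simp
qed

lemma xi_cube: "integrable M (\<lambda>w. \<bar>xi i w\<bar> ^ 3)"
proof -
  have "integrable M (\<lambda>w. \<bar>1 - 3 * E i w + 3 * (E i w) ^ 2 - (E i w) ^ 3\<bar>)" using E_integrable E_power_integrable by auto
  moreover have "\<bar>xi i w\<bar> ^ 3 = \<bar>1 - 3 * E i w + 3 * (E i w) ^ 2 - (E i w) ^ 3\<bar>" for w
    unfolding power_abs[symmetric] xi_def by (simp add: power2_eq_square power3_eq_cube algebra_simps)
  ultimately show ?thesis by simp
qed

lemma xi_law: "distr M borel (xi i) = distr M borel (xi 0)"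
proof -
  have "distr M borel (E j) = density lborel (exponential_density 1)" for j
    using distributed_distr_eq_density[OF exp_E[of j]] by (simp cong: distr_cong)
  then have "distr (distr M borel (E i)) borel (\<lambda>x. 1 - x) = distr (distr M borel (E 0)) borel (\<lambda>x. 1 - x)" by simp
  then show ?thesis by (simp add: distr_distr comp_def xi_def[abs_def])
qed

text \<open>
  Kolmogorov's inequality for the increments from index \<open>p\<close> on: up to index \<open>r * N\<close> each has variance
  at most \<open>1 / ((1 - r)\<^sup>2 * N)\<close>.
\<close>

lemma noise_oscillation:
  assumes N: "0 < N" and pq: "p \<le> q" and r: "r < 1" "real q \<le> r * real N + 1" and g: "0 < \<gamma>"
  shows "\<P>(w in M. \<exists>n. p \<le> n \<and> n \<le> q \<and> \<gamma> \<le> \<bar>noise N n w - noise N p w\<bar>) \<le>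
    (real q - real p) / ((1 - r)\<^sup>2 * real N * \<gamma>\<^sup>2)"
proof -
  define c where "c i = (if i < p then 0 else sqrt (real N) / (real N - real i))" for i
  define Y where "Y i w = c i * xi i w" for i w
  have ind: "indep_vars (\<lambda>_. borel) Y {..<q}"
    unfolding Y_def[abs_def] by (rule indep_vars_compose2[OF indep_vars_subset[OF xi_indep]]) auto
  have Y2: "(Y i w)\<^sup>2 = (c i)\<^sup>2 * (xi i w)\<^sup>2" for i w by (simp add: Y_def power_mult_distrib)
  have sq: "integrable M (\<lambda>w. (Y i w)\<^sup>2)" "expectation (\<lambda>w. (Y i w)\<^sup>2) = (c i)\<^sup>2" for i
    unfolding Y2 using xi_square[of i] by auto
  have mean: "expectation (Y i) = 0" for i
    unfolding Y_def[abs_def] using xi_mean[of i] by simp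
  have sum: "(\<Sum>i<n. Y i w) = noise N n w - noise N p w" if "p \<le> n" for n w
    using that
  proof (induction n rule: dec_induct)
    case base
    have "(\<Sum>i<p. Y i w) = (\<Sum>i<p. 0)" by (intro sum.cong) (auto simp: Y_def c_def)
    then show ?case by simp
  next
    case (step n)
    then show ?case by (simp add: noise_def Y_def c_def)
  qed
  have "\<P>(w in M. \<exists>n. p \<le> n \<and> n \<le> q \<and> \<gamma> \<le> \<bar>noise N n w - noise N p w\<bar>) \<le> \<P>(w in M. \<exists>k\<le>q. \<gamma> \<le> \<bar>\<Sum>i<k. Y i w\<bar>)"
  proof (rule finite_measure_mono)
    show "{w\<in>space M. \<exists>n. p \<le> n \<and> n \<le> q \<and> \<gamma> \<le> \<bar>noise N n w - noise N p w\<bar>} \<subseteq> {w\<in>space M. \<exists>k\<le>q. \<gamma> \<le> \<bar>\<Sum>i<k. Y i w\<bar>}"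
      using sum by force
    have [measurable]: "Y i \<in> borel_measurable M" for i unfolding Y_def[abs_def] by measurable
    show "{w\<in>space M. \<exists>k\<le>q. \<gamma> \<le> \<bar>\<Sum>i<k. Y i w\<bar>} \<in> events" by measurable
  qed
  also have "\<dots> \<le> (\<Sum>i<q. expectation (\<lambda>w. (Y i w)\<^sup>2)) / \<gamma>\<^sup>2"
    by (rule Kolmogorov_maximal_inequality[OF ind sq(1) mean g])
  also have "(\<Sum>i<q. expectation (\<lambda>w. (Y i w)\<^sup>2)) \<le> (real q - real p) * (1 / ((1 - r)\<^sup>2 * real N))"
  proof -
    have "(\<Sum>i<q. expectation (\<lambda>w. (Y i w)\<^sup>2)) = (\<Sum>i\<in>{p..<q}. (c i)\<^sup>2)"
      unfolding sq(2) by (intro sum.mono_neutral_right) (auto simp: c_def)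
    also have "\<dots> \<le> (\<Sum>i\<in>{p..<q}. 1 / ((1 - r)\<^sup>2 * real N))"
    proof (rule sum_mono)
      fix i assume i: "i \<in> {p..<q}"
      then have "real i + 1 \<le> real q" by auto
      then have ge: "(1 - r) * real N \<le> real N - real i" using r by (simp add: algebra_simps)
      have pos: "0 < (1 - r) * real N" using r N by simp
      have iN: "i < N" using ge pos by linarith
      have "(c i)\<^sup>2 = real N / (real N - real i)\<^sup>2" using i by (simp add: c_def power_divide)
      also have "\<dots> \<le> real N / ((1 - r) * real N)\<^sup>2"
        using ge pos N r iN by (intro divide_left_mono power_mono mult_pos_pos zero_less_power) auto
      also have "\<dots> = 1 / ((1 - r)\<^sup>2 * real N)" using N by (simp add: power_mult_distrib power2_eq_square)
      finally show "(c i)\<^sup>2 \<le> 1 / ((1 - r)\<^sup>2 * real N)" .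
    qed
    also have "\<dots> = (real q - real p) * (1 / ((1 - r)\<^sup>2 * real N))" using pq by (simp add: of_nat_diff)
    finally show ?thesis .
  qed
  then have "(\<Sum>i<q. expectation (\<lambda>w. (Y i w)\<^sup>2)) / \<gamma>\<^sup>2 \<le> ((real q - real p) * (1 / ((1 - r)\<^sup>2 * real N))) / \<gamma>\<^sup>2"
    by (rule divide_right_mono) simp
  also have "\<dots> = (real q - real p) / ((1 - r)\<^sup>2 * real N * \<gamma>\<^sup>2)" by simp
  finally show ?thesis .
qed

end

text \<open>
  The stopping condition at \<open>k = \<lfloor>z * N\<rfloor>\<close> involves the noise after \<open>k + 1\<close> terms, hence the successor.
\<close>

definition level_index :: "real \<Rightarrow> nat \<Rightarrow> nat" where
  "level_index z N = Suc (nat \<lfloor>z * real N\<rfloor>)"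

lemma level_index_bounds:
  assumes "0 \<le> z"
  shows "z * real N < real (level_index z N)" "real (level_index z N) \<le> z * real N + 1"
proof -
  have "0 \<le> z * real N" using assms by simp
  then show "z * real N < real (level_index z N)" "real (level_index z N) \<le> z * real N + 1"
    unfolding level_index_def by linarith+
qed

lemma level_index_mono: "z \<le> z' \<Longrightarrow> level_index z N \<le> level_index z' N"
  unfolding level_index_def by (intro Suc_le_mono[THEN iffD2] nat_mono floor_mono mult_right_mono) auto

lemma level_index_le: assumes "0 \<le> z" "z < 1" "0 < N" shows "level_index z N \<le> N"
proof -
  have "z * real N < 1 * real N" using assms by (intro mult_strict_right_mono) auto
  then have "real (level_index z N) < real N + 1" using level_index_bounds(2)[OF assms(1), of N] by simp
  then show ?thesis by linarith
qed

lemma tendsto_level_index: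
  assumes z: "0 \<le> z" "z < 1"
  shows "(\<lambda>N. real N / (real N - real (level_index z N))) \<longlonglongrightarrow> 1 / (1 - z)"
    "(\<lambda>N. real N / (real N - real (level_index z N) + 1)) \<longlonglongrightarrow> 1 / (1 - z)"
proof -
  have b: "z \<le> real (level_index z N) / real N \<and> real (level_index z N) / real N \<le> z + 1 / real N" if "0 < N" for N
    using level_index_bounds[OF z(1), of N] that by (simp add: field_simps)
  have l: "(\<lambda>N. real (level_index z N) / real N) \<longlonglongrightarrow> z"
  proof (rule tendsto_sandwich[where f="\<lambda>_. z" and h="\<lambda>N. z + 1 / real N"])
    show "\<forall>\<^sub>F N in sequentially. z \<le> real (level_index z N) / real N"
      by (rule eventually_mono[OF eventually_gt_at_top[of 0]]) (use b in blast)
    show "\<forall>\<^sub>F N in sequentially. real (level_index z N) / real N \<le> z + 1 / real N"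
      by (rule eventually_mono[OF eventually_gt_at_top[of 0]]) (use b in blast)
    show "(\<lambda>N. z + 1 / real N) \<longlonglongrightarrow> z" using tendsto_add[OF tendsto_const lim_1_over_n, of z] by simp
  qed simp
  have 1: "(\<lambda>N. 1 / (1 - real (level_index z N) / real N)) \<longlonglongrightarrow> 1 / (1 - z)"
    using z by (intro tendsto_intros l) auto
  have 2: "(\<lambda>N. 1 / (1 - real (level_index z N) / real N + 1 / real N)) \<longlonglongrightarrow> 1 / (1 - z + 0)"
    using z by (intro tendsto_intros l lim_1_over_n) auto
  show "(\<lambda>N. real N / (real N - real (level_index z N))) \<longlonglongrightarrow> 1 / (1 - z)"
    by (rule Lim_transform_eventually[OF 1], rule eventually_mono[OF eventually_gt_at_top[of 0]]) (simp add: divide_simps)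
  show "(\<lambda>N. real N / (real N - real (level_index z N) + 1)) \<longlonglongrightarrow> 1 / (1 - z)"
    by (rule Lim_transform_eventually[OF 2[simplified]], rule eventually_mono[OF eventually_gt_at_top[of 0]]) (simp add: divide_simps)
qed

text \<open>
  Comparison of \<open>1 / m\<^sup>2\<close> with the telescoping terms \<open>1 / (m - 1) - 1 / m\<close> and \<open>1 / m - 1 / (m + 1)\<close>.
\<close>

lemma inverse_square_block:
  assumes "a \<le> b" "b < N"
  shows "(\<Sum>i\<in>{a..<b}. 1 / (real N - real i)\<^sup>2) \<le> 1 / (real N - real b) - 1 / (real N - real a)"
    "1 / (real N - real b + 1) - 1 / (real N - real a + 1) \<le> (\<Sum>i\<in>{a..<b}. 1 / (real N - real i)\<^sup>2)"
proof -
  have "(\<Sum>i\<in>{a..<b}. 1 / (real N - real i)\<^sup>2) \<le> 1 / (real N - real b) - 1 / (real N - real a)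
    \<and> 1 / (real N - real b + 1) - 1 / (real N - real a + 1) \<le> (\<Sum>i\<in>{a..<b}. 1 / (real N - real i)\<^sup>2)"
    using assms
  proof (induction b rule: dec_induct)
    case (step b)
    define x where "x = real N - real b"
    have x: "1 < x" using step.prems by (simp add: x_def)
    have e: "1 / (x - 1) - 1 / x = 1 / (x * (x - 1))" "1 / x - 1 / (x + 1) = 1 / (x * (x + 1))"
      using x by (simp_all add: divide_simps)
    have u: "1 / x\<^sup>2 \<le> 1 / (x - 1) - 1 / x" "1 / x - 1 / (x + 1) \<le> 1 / x\<^sup>2"
      unfolding e power2_eq_square using x by (auto intro!: divide_left_mono mult_left_mono mult_pos_pos)
    have S: "(\<Sum>i\<in>{a..<Suc b}. 1 / (real N - real i)\<^sup>2) = (\<Sum>i\<in>{a..<b}. 1 / (real N - real i)\<^sup>2) + 1 / x\<^sup>2"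
      using step.hyps by (simp add: x_def)
    have IH: "(\<Sum>i\<in>{a..<b}. 1 / (real N - real i)\<^sup>2) \<le> 1 / x - 1 / (real N - real a)"
      "1 / (x + 1) - 1 / (real N - real a + 1) \<le> (\<Sum>i\<in>{a..<b}. 1 / (real N - real i)\<^sup>2)"
      using step.IH step.prems by (auto simp: x_def)
    have i: "real N - real (Suc b) = x - 1" "x - 1 + 1 = x" by (auto simp: x_def)
    show ?case unfolding S i using IH u by linarith
  qed simp
  then show "(\<Sum>i\<in>{a..<b}. 1 / (real N - real i)\<^sup>2) \<le> 1 / (real N - real b) - 1 / (real N - real a)"
    "1 / (real N - real b + 1) - 1 / (real N - real a + 1) \<le> (\<Sum>i\<in>{a..<b}. 1 / (real N - real i)\<^sup>2)" by auto
qed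

text \<open>
  The index \<open>0\<close> stands for the start of the walk, and the levels are \<open>z 1 < z 2 < ...\<close>; \<open>block_time\<close>
  below follows the same convention.
\<close>

definition block_end :: "(nat \<Rightarrow> real) \<Rightarrow> nat \<Rightarrow> nat \<Rightarrow> nat" where
  "block_end z N l = (if l = 0 then 0 else level_index (z l) N)"

text \<open>
  The limit of the variance \<open>N * (\<Sum>i<n. 1 / (N - i)\<^sup>2)\<close> of the noise as \<open>n / N\<close> tends to \<open>z\<close>.
\<close>

definition bm_time :: "real \<Rightarrow> real" where "bm_time z = z / (1 - z)"

lemma bm_time_alt: "z < 1 \<Longrightarrow> bm_time z = 1 / (1 - z) - 1"
  by (simp add: bm_time_def divide_simps)

lemma bm_time_less: "z < z' \<Longrightarrow> z' < 1 \<Longrightarrow> bm_time z < bm_time z'"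
  by (auto simp: bm_time_alt intro!: divide_strict_left_mono mult_pos_pos)

lemma bm_time_pos: "0 < z \<Longrightarrow> z < 1 \<Longrightarrow> 0 < bm_time z"
  by (simp add: bm_time_def)

definition block_time :: "(nat \<Rightarrow> real) \<Rightarrow> nat \<Rightarrow> real" where
  "block_time z l = (if l = 0 then 0 else bm_time (z l))"

context exp_seq begin

text \<open>
  The weights are uniformly of order \<open>1 / sqrt N\<close>, and their squares add up to the difference of the
  times \<open>z / (1 - z)\<close> in the limit.
\<close>

lemma noise_block_weak_conv:
  assumes z: "\<And>j. 1 \<le> j \<Longrightarrow> j \<le> m \<Longrightarrow> 0 < z j \<and> z j < 1" "\<And>j. 1 \<le> j \<Longrightarrow> j < m \<Longrightarrow> z j < z (Suc j)" and l: "l < m"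
  shows "weak_conv_m (\<lambda>N. distr M borel (\<lambda>w. noise N (block_end z N (Suc l)) w - noise N (block_end z N l) w))
    (distr std_normal_distribution borel (\<lambda>x. sqrt (block_time z (Suc l) - block_time z l) * x))"
proof -
  let ?a = "\<lambda>N. block_end z N l" let ?b = "\<lambda>N. block_end z N (Suc l)"
  let ?v = "block_time z (Suc l) - block_time z l"
  define zb where "zb = z (Suc l)"
  define za where "za = (if l = 0 then 0 else z l)"
  have zb: "0 < zb" "zb < 1" using z(1)[of "Suc l"] l by (auto simp: zb_def)
  have za: "0 \<le> za" "za < zb" using z(1)[of l] z(2)[of l] l zb by (auto simp: za_def zb_def)
  have b_eq: "?b N = level_index zb N" for N by (simp add: block_end_def zb_def)
  have ab: "?a N \<le> ?b N" for N using za level_index_mono[of za zb N] by (auto simp: block_end_def za_def zb_def)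
  have v: "?v = 1 / (1 - zb) - 1 / (1 - za)"
    using za zb bm_time_alt[of zb] bm_time_alt[of za] by (cases "l = 0") (auto simp: block_time_def za_def zb_def)
  have v0: "0 \<le> ?v" unfolding v using za zb by (auto intro!: divide_left_mono mult_pos_pos)
  have bN: "real (?b N) \<le> zb * real N + 1" "?b N \<le> N \<or> N = 0" for N
    using level_index_bounds(2)[of zb N] level_index_le[of zb N] zb by (auto simp: b_eq)
  define \<delta> where "\<delta> N = sqrt (real N) / (real N - real (?b N) + 1)" for N
  have weq: "noise N (?b N) w - noise N (?a N) w = (\<Sum>i\<in>{?a N..<?b N}. sqrt (real N) / (real N - real i) * xi i w)" for N w
    unfolding noise_def using ab[of N] by (simp add: lessThan_atLeast0 sum_diff_nat_ivl)
  have sq: "(\<lambda>N. \<Sum>i\<in>{?a N..<?b N}. (sqrt (real N) / (real N - real i))\<^sup>2) \<longlonglongrightarrow> (sqrt ?v)\<^sup>2"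
  proof -
    have e: "(\<Sum>i\<in>{?a N..<?b N}. (sqrt (real N) / (real N - real i))\<^sup>2) = real N * (\<Sum>i\<in>{?a N..<?b N}. 1 / (real N - real i)\<^sup>2)" for N
      by (simp add: power_divide sum_distrib_left)
    have tb: "(\<lambda>N. real N / (real N - real (?b N))) \<longlonglongrightarrow> 1 / (1 - zb)" "(\<lambda>N. real N / (real N - real (?b N) + 1)) \<longlonglongrightarrow> 1 / (1 - zb)"
      unfolding b_eq using zb by (auto intro!: tendsto_level_index)
    have ta: "(\<lambda>N. real N / (real N - real (?a N))) \<longlonglongrightarrow> 1 / (1 - za)" "(\<lambda>N. real N / (real N - real (?a N) + 1)) \<longlonglongrightarrow> 1 / (1 - za)"
    proof -
      show "(\<lambda>N. real N / (real N - real (?a N))) \<longlonglongrightarrow> 1 / (1 - za)"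
      proof (cases "l = 0")
        case True
        have "\<forall>\<^sub>F N in sequentially. 1 = real N / (real N - real (?a N))"
          using eventually_gt_at_top[of 0] by eventually_elim (simp add: True block_end_def)
        then show ?thesis using True by (auto simp: za_def intro: Lim_transform_eventually[OF tendsto_const])
      next
        case False
        then show ?thesis using tendsto_level_index(1)[of za] za zb by (simp add: block_end_def za_def)
      qed
      show "(\<lambda>N. real N / (real N - real (?a N) + 1)) \<longlonglongrightarrow> 1 / (1 - za)"
      proof (cases "l = 0")
        case True
        have "(\<lambda>N. 1 - 1 / (real N + 1)) \<longlonglongrightarrow> 1 - 0"
          by (intro tendsto_diff tendsto_const) (use LIMSEQ_inverse_real_of_nat in \<open>simp add: inverse_eq_divide add.commute\<close>)
        moreover have "1 - 1 / (real N + 1) = real N / (real N - real (?a N) + 1)" for N by (simp add: True block_end_def field_simps)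
        ultimately show ?thesis using True by (simp add: za_def)
      next
        case False
        then show ?thesis using tendsto_level_index(2)[of za] za zb by (simp add: block_end_def za_def)
      qed
    qed
    have small: "\<forall>\<^sub>F N in sequentially. ?b N < N"
    proof -
      have "\<forall>\<^sub>F N in sequentially. 1 / (1 - zb) < real N" by (rule filterlim_real_sequentially[THEN filterlim_at_top_dense[THEN iffD1], rule_format])
      then show ?thesis
      proof eventually_elim
        case (elim N)
        then have "zb * real N + 1 < real N" using zb by (simp add: field_simps)
        then show ?case using bN(1)[of N] by linarith
      qed
    qed
    show ?thesis unfolding e
    proof (rule tendsto_sandwich)
      show "\<forall>\<^sub>F N in sequentially. real N / (real N - real (?b N) + 1) - real N / (real N - real (?a N) + 1) \<le> real N * (\<Sum>i\<in>{?a N..<?b N}. 1 / (real N - real i)\<^sup>2)"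
        using small
      proof eventually_elim
        case (elim N)
        from mult_left_mono[OF inverse_square_block(2)[OF ab elim], of "real N"] show ?case by (simp add: algebra_simps)
      qed
      show "\<forall>\<^sub>F N in sequentially. real N * (\<Sum>i\<in>{?a N..<?b N}. 1 / (real N - real i)\<^sup>2) \<le> real N / (real N - real (?b N)) - real N / (real N - real (?a N))"
        using small
      proof eventually_elim
        case (elim N)
        from mult_left_mono[OF inverse_square_block(1)[OF ab elim], of "real N"] show ?case by (simp add: algebra_simps)
      qed
      show "(\<lambda>N. real N / (real N - real (?b N) + 1) - real N / (real N - real (?a N) + 1)) \<longlonglongrightarrow> (sqrt ?v)\<^sup>2"
        using tendsto_diff[OF tb(2) ta(2)] v v0 by simp
      show "(\<lambda>N. real N / (real N - real (?b N)) - real N / (real N - real (?a N))) \<longlonglongrightarrow> (sqrt ?v)\<^sup>2"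
        using tendsto_diff[OF tb(1) ta(1)] v v0 by simp
    qed
  qed
  have dl: "\<delta> \<longlonglongrightarrow> 0"
  proof -
    have "(\<lambda>N. real N / (real N - real (?b N) + 1) * (1 / sqrt (real N))) \<longlonglongrightarrow> 1 / (1 - zb) * 0"
      unfolding b_eq using zb
      by (intro tendsto_mult tendsto_level_index tendsto_divide_0[OF tendsto_const] filterlim_at_top_imp_at_infinity
          filterlim_compose[OF sqrt_at_top filterlim_real_sequentially]) auto
    moreover have "real N / (real N - real (?b N) + 1) * (1 / sqrt (real N)) = \<delta> N" for N
      by (cases "N = 0") (auto simp: \<delta>_def real_div_sqrt field_simps real_sqrt_mult_self)
    ultimately show ?thesis by simp
  qed
  have bound: "\<bar>sqrt (real N) / (real N - real i)\<bar> \<le> \<delta> N" if i: "i \<in> {?a N..<?b N}" for N i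
  proof (cases "N = 0")
    case False
    then have "real (?b N) \<le> real N" "real i + 1 \<le> real (?b N)" using bN(2)[of N] i by auto
    then show ?thesis unfolding \<delta>_def by (auto simp: abs_of_nonneg intro!: divide_left_mono mult_pos_pos)
  qed (simp add: \<delta>_def)
  show ?thesis
    unfolding weq
    by (rule weighted_central_limit_theorem[OF xi_indep xi_law xi_mean xi_square(2) xi_cube xi_square(1) _ sq bound dl]) simp
qed

lemma noise_blocks_indep:
  assumes "\<And>j. 1 \<le> j \<Longrightarrow> j < m \<Longrightarrow> z j < z (Suc j)"
  shows "indep_vars (\<lambda>_. borel) (\<lambda>l w. noise N (block_end z N (Suc l)) w - noise N (block_end z N l) w) {..<m}"
proof -
  let ?a = "block_end z N"
  let ?K = "\<lambda>l. {?a l..<?a (Suc l)}"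
  have step: "?a l \<le> ?a (Suc l)" if "l < m" for l
    using assms[of l] that level_index_mono[of "z l" "z (Suc l)" N] by (cases "l = 0") (auto simp: block_end_def)
  have mono: "?a l \<le> ?a l'" if "l \<le> l'" "l' \<le> m" for l l'
    using that
  proof (induction l' rule: dec_induct)
    case (step n)
    then show ?case using \<open>\<And>l. l < m \<Longrightarrow> ?a l \<le> ?a (Suc l)\<close>[of n] by auto
  qed simp
  have disj: "disjoint_family_on ?K {..<m}"
    unfolding disjoint_family_on_def
  proof (intro ballI impI)
    fix i j assume ij: "i \<in> {..<m}" "j \<in> {..<m}" "i \<noteq> j"
    then consider "Suc i \<le> j" | "Suc j \<le> i" by linarith
    then show "?K i \<inter> ?K j = {}"
    proof cases
      case 1 then have "?a (Suc i) \<le> ?a j" using ij by (intro mono) auto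
      then show ?thesis by auto
    next
      case 2 then have "?a (Suc j) \<le> ?a i" using ij by (intro mono) auto
      then show ?thesis by auto
    qed
  qed
  have "indep_vars (\<lambda>l. PiM (?K l) (\<lambda>_. borel)) (\<lambda>l w. restrict (\<lambda>i. xi i w) (?K l)) {..<m}"
    by (rule indep_vars_restrict[OF xi_indep _ disj]) simp
  from indep_vars_compose2[OF this, where Y="\<lambda>l x. \<Sum>i\<in>?K l. sqrt (real N) / (real N - real i) * x i" and N="\<lambda>_. borel"]
  have ind: "indep_vars (\<lambda>_. borel) (\<lambda>l w. \<Sum>i\<in>?K l. sqrt (real N) / (real N - real i) * restrict (\<lambda>i. xi i w) (?K l) i) {..<m}"
    by simp
  show ?thesis
  proof (rule indep_vars_cong[THEN iffD1, OF refl _ refl ind])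
    fix l assume l: "l \<in> {..<m}"
    show "(\<lambda>w. \<Sum>i\<in>?K l. sqrt (real N) / (real N - real i) * restrict (\<lambda>i. xi i w) (?K l) i) = (\<lambda>w. noise N (?a (Suc l)) w - noise N (?a l) w)"
    proof
      fix w
      have "noise N (?a (Suc l)) w - noise N (?a l) w = (\<Sum>i\<in>?K l. sqrt (real N) / (real N - real i) * xi i w)"
        unfolding noise_def using step[of l] l by (simp add: lessThan_atLeast0 sum_diff_nat_ivl)
      then show "(\<Sum>i\<in>?K l. sqrt (real N) / (real N - real i) * restrict (\<lambda>i. xi i w) (?K l) i) = noise N (?a (Suc l)) w - noise N (?a l) w"
        by simp
    qed
  qed
qed

end

lemma normal_increment_distr:
  assumes "prob_space M" and v: "0 < v" and X: "distributed M lborel X (normal_density 0 (sqrt v))"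
  shows "distr M borel X = distr std_normal_distribution borel (\<lambda>x. sqrt v * x)"
proof -
  interpret prob_space M by fact
  have Y: "distributed M lborel (\<lambda>x. X x / sqrt v) std_normal_density"
    using normal_standard_normal_convert[of "sqrt v" X 0] X v by simp
  have m: "(\<lambda>x. X x / sqrt v) \<in> borel_measurable M" using distributed_measurable[OF Y] by simp
  have "distr M borel (\<lambda>x. X x / sqrt v) = distr M lborel (\<lambda>x. X x / sqrt v)" by (rule distr_cong) auto
  also have "\<dots> = std_normal_distribution" using distributed_distr_eq_density[OF Y] by simp
  finally have "distr std_normal_distribution borel (\<lambda>x. sqrt v * x) = distr (distr M borel (\<lambda>x. X x / sqrt v)) borel (\<lambda>x. sqrt v * x)" by simp
  also have "\<dots> = distr M borel (\<lambda>x. sqrt v * (X x / sqrt v))" using m by (subst distr_distr) (auto simp: comp_def)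
  also have "\<dots> = distr M borel X" using v by (intro distr_cong) auto
  finally show ?thesis by simp
qed

context
  fixes MW :: "'b measure" and W :: "real \<Rightarrow> 'b \<Rightarrow> real"
  assumes bm: "brownian_motion MW W"
begin

lemma bm_prob_space: "prob_space MW" and bm_rv: "0 \<le> t \<Longrightarrow> W t \<in> borel_measurable MW"
  and bm_start: "AE w in MW. W 0 w = 0"
  and bm_normal: "0 \<le> s \<Longrightarrow> s < t \<Longrightarrow> distributed MW lborel (\<lambda>w. W t w - W s w) (normal_density 0 (sqrt (t - s)))"
  and bm_indep: "0 \<le> \<tau> 0 \<Longrightarrow> (\<And>i. i < n \<Longrightarrow> \<tau> i \<le> \<tau> (Suc i)) \<Longrightarrow>
        prob_space.indep_vars MW (\<lambda>_. borel) (\<lambda>i w. W (\<tau> (Suc i)) w - W (\<tau> i) w) {..<n}" for n :: nat and \<tau>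
  using bm unfolding brownian_motion_def by blast+

text \<open>
  A normal law has no atoms; so the signs and levels compared below are almost surely decided.
\<close>

lemma bm_not_atom:
  assumes "0 < t"
  shows "AE w in MW. W t w - W 0 w \<noteq> x"
proof -
  interpret MW: prob_space MW by (rule bm_prob_space)
  have D: "distributed MW lborel (\<lambda>w. W t w - W 0 w) (normal_density 0 (sqrt (t - 0)))"
    by (rule bm_normal) (use assms in auto)
  have s: "AE y in lborel. y \<noteq> x" by (rule AE_lborel_singleton)
  show ?thesis
  proof (rule iffD2[OF MW.distributed_AE2[OF D, where P="\<lambda>y. y \<noteq> x"]])
    show "Measurable.pred lborel (\<lambda>y. y \<noteq> x)" by measurable
    show "AE y in lborel. 0 < ennreal (normal_density 0 (sqrt (t - 0)) y) \<longrightarrow> y \<noteq> x"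
      using s by eventually_elim simp
  qed
qed

lemma sum_increments: "(\<Sum>l<j. W (block_time z (Suc l)) w - W (block_time z l) w) = W (block_time z j) w - W 0 w"
  using sum_lessThan_telescope[of "\<lambda>l. W (block_time z l) w" j] by (simp add: block_time_def)

text \<open>
  Increments of the noise over disjoint blocks and increments of Brownian motion are independent,
  so convergence of single blocks suffices.
\<close>

lemma noise_joint_conv:
  assumes E: "exp_seq M E" and m: "0 < m"
    and z: "\<And>j. 1 \<le> j \<Longrightarrow> j \<le> m \<Longrightarrow> 0 < z j \<and> z j < 1" "\<And>j. 1 \<le> j \<Longrightarrow> j < m \<Longrightarrow> z j < z (Suc j)"
    and P: "Measurable.pred (PiM {..<m} (\<lambda>_. borel)) P"
    and R: "Measurable.pred (PiM {..<m} (\<lambda>_. borel)) R"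
    and AE_R: "AE w in MW. R (\<lambda>l\<in>{..<m}. W (block_time z (Suc l)) w - W (block_time z l) w)"
    and cont: "\<And>y z. R (restrict z {..<m}) \<Longrightarrow> (\<And>l. l < m \<Longrightarrow> (\<lambda>n. y n l) \<longlonglongrightarrow> z l) \<Longrightarrow>
        \<forall>\<^sub>F n in sequentially. P (restrict (y n) {..<m}) = P (restrict z {..<m})"
  shows "(\<lambda>N. \<P>(w in M. P (\<lambda>l\<in>{..<m}. exp_seq.noise E N (block_end z N (Suc l)) w - exp_seq.noise E N (block_end z N l) w))) \<longlonglongrightarrow>
    \<P>(w in MW. P (\<lambda>l\<in>{..<m}. W (block_time z (Suc l)) w - W (block_time z l) w))"
proof -
  interpret exp_seq M E by fact
  have time: "0 \<le> block_time z l \<and> block_time z l < block_time z (Suc l)" if "l < m" for l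
    using z(1)[of l] z(1)[of "Suc l"] z(2)[of l] that bm_time_pos[of "z l"] bm_time_pos[of "z (Suc l)"] bm_time_less[of "z l" "z (Suc l)"]
    by (cases "l = 0") (auto simp: block_time_def)
  show ?thesis
  proof (rule weak_conv_independent_blocks[OF prob_space_axioms bm_prob_space m _ _ _ P R AE_R cont])
    show "indep_vars (\<lambda>_. borel) (\<lambda>l w. noise n (block_end z n (Suc l)) w - noise n (block_end z n l) w) {..<m}" for n
      by (rule noise_blocks_indep) (rule z)
    show "prob_space.indep_vars MW (\<lambda>_. borel) (\<lambda>l w. W (block_time z (Suc l)) w - W (block_time z l) w) {..<m}"
    proof (rule bm_indep)
      show "0 \<le> block_time z 0" by (simp add: block_time_def)
      show "block_time z i \<le> block_time z (Suc i)" if "i < m" for i using time[OF that] by simp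
    qed
    show "weak_conv_m (\<lambda>n. distr M borel (\<lambda>w. noise n (block_end z n (Suc l)) w - noise n (block_end z n l) w))
        (distr MW borel (\<lambda>w. W (block_time z (Suc l)) w - W (block_time z l) w))" if "l < m" for l
      unfolding normal_increment_distr[OF bm_prob_space _ bm_normal, of "block_time z (Suc l)" "block_time z l"]
      using noise_block_weak_conv[of m z l, OF z that] normal_increment_distr[OF bm_prob_space _ bm_normal, of "block_time z (Suc l)" "block_time z l"] time[OF that]
      by simp
  qed
qed

lemma sorted_enumeration:
  fixes F :: "real set"
  assumes "finite F"
  obtains z where "z ` {1..card F} = F" "\<And>j. 1 \<le> j \<Longrightarrow> j < card F \<Longrightarrow> z j < z (Suc j)"
proof
  let ?L = "sorted_list_of_set F"
  have len: "length ?L = card F" by simp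
  let ?z = "\<lambda>j. ?L ! (j - 1)"
  have "?z ` {1..card F} = (\<lambda>i. ?L ! i) ` {..<card F}"
  proof -
    have "(\<lambda>j. j - 1) ` {1..card F} = {..<card F}"
      by (auto simp: image_iff intro!: bexI[of _ "Suc _"])
    then show ?thesis by (metis (no_types, lifting) image_cong image_image)
  qed
  also have "\<dots> = set ?L" unfolding len[symmetric] by (auto simp: set_conv_nth)
  finally show "?z ` {1..card F} = F" using assms by simp
  show "?z j < ?z (Suc j)" if "1 \<le> j" "j < card F" for j
    using strict_sorted_list_of_set[of F] that len
    by (intro sorted_wrt_nth_less[of "(<)" ?L]) auto
qed

lemma noise_blocks_sum:
  assumes "exp_seq M E"
  shows "(\<Sum>l<j. exp_seq.noise E N (block_end z N (Suc l)) w - exp_seq.noise E N (block_end z N l) w) = exp_seq.noise E N (block_end z N j) w"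
proof -
  interpret exp_seq M E by fact
  have "noise N 0 w = 0" by (simp add: noise_def)
  then show ?thesis using sum_lessThan_telescope[of "\<lambda>l. noise N (block_end z N l) w" j] by (simp add: block_end_def)
qed

lemma partial_sum_measurable:
  fixes j m :: nat
  shows "j \<le> m \<Longrightarrow> (\<lambda>b. \<Sum>l<j. b l :: real) \<in> borel_measurable (PiM {..<m} (\<lambda>_. borel))"
  by (intro borel_measurable_sum measurable_component_singleton) (auto dest: less_le_trans)

text \<open>
  The pattern of levels at which the noise satisfies \<open>\<phi>\<close> converges in law, if \<open>\<phi>\<close> is locally constant
  off two points. It is used for the sign (with \<open>c = 0\<close>) and for being within \<open>c\<close> of zero.
\<close>

lemma noise_levels_conv:
  fixes \<phi> :: "real \<Rightarrow> bool" and G :: "real set" and c :: real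
  assumes E: "exp_seq M E" and F: "finite F" "F \<subseteq> {0<..<1}"
    and \<phi>: "{x. \<phi> x} \<in> sets borel" "\<And>x. x \<noteq> c \<Longrightarrow> x \<noteq> - c \<Longrightarrow> \<forall>\<^sub>F y in nhds x. \<phi> y = \<phi> x"
  shows "(\<lambda>N. \<P>(w in M. {z\<in>F. \<phi> (exp_seq.noise E N (level_index z N) w)} = G)) \<longlonglongrightarrow>
    \<P>(w in MW. {z\<in>F. \<phi> (W (bm_time z) w - W 0 w)} = G)"
proof -
  interpret exp_seq M E by fact
  interpret MW: prob_space MW by (rule bm_prob_space)
  define m where "m = card F"
  obtain z where z: "z ` {1..m} = F" "\<And>j. 1 \<le> j \<Longrightarrow> j < m \<Longrightarrow> z j < z (Suc j)"
    using sorted_enumeration[OF F(1)] unfolding m_def by blast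
  have z01: "0 < z j \<and> z j < 1" if "1 \<le> j" "j \<le> m" for j
  proof -
    have "z j \<in> F" using z(1) that by auto
    then show ?thesis using F by auto
  qed
  consider "\<not> G \<subseteq> F" | "G \<subseteq> F" "m = 0" | "G \<subseteq> F" "0 < m" by auto
  then show ?thesis
  proof cases
    case 1
    then have e: "{w\<in>space M. {z\<in>F. \<phi> (noise N (level_index z N) w)} = G} = {}"
      "{w\<in>space MW. {z\<in>F. \<phi> (W (bm_time z) w - W 0 w)} = G} = {}" for N by auto
    show ?thesis unfolding e by simp
  next
    case 2
    then have "F = {}" "G = {}" using z(1) by auto
    then show ?thesis using prob_space MW.prob_space by simp
  next
    case 3
    define P where "P b \<longleftrightarrow> (\<forall>j\<in>{1..m}. \<phi> (\<Sum>l<j. b l :: real) = (z j \<in> G))" for b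
    define R where "R b \<longleftrightarrow> (\<forall>j\<in>{1..m}. (\<Sum>l<j. b l :: real) \<noteq> c \<and> (\<Sum>l<j. b l :: real) \<noteq> - c)" for b
    have iff: "{x\<in>F. \<phi> (f x)} = G \<longleftrightarrow> (\<forall>j\<in>{1..m}. \<phi> (f (z j)) = (z j \<in> G))" for f
    proof -
      have "{x\<in>F. \<phi> (f x)} = G \<longleftrightarrow> (\<forall>x\<in>F. \<phi> (f x) = (x \<in> G))" using 3 by blast
      then show ?thesis unfolding z(1)[symmetric] by simp
    qed
    have pm: "(\<lambda>b. \<Sum>l<j. b l :: real) \<in> borel_measurable (PiM {..<m} (\<lambda>_. borel))" if "j \<in> {1..m}" for j
      using that by (intro partial_sum_measurable) auto
    have "(\<lambda>N. \<P>(w in M. P (\<lambda>l\<in>{..<m}. noise N (block_end z N (Suc l)) w - noise N (block_end z N l) w))) \<longlonglongrightarrow>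
      \<P>(w in MW. P (\<lambda>l\<in>{..<m}. W (block_time z (Suc l)) w - W (block_time z l) w))"
    proof (rule noise_joint_conv[where z=z and m=m and P=P and R=R, OF E 3(2) z01 z(2)])
      have \<phi>': "Measurable.pred borel \<phi>" using \<phi>(1) by (simp add: pred_def)
      show "Measurable.pred (PiM {..<m} (\<lambda>_. borel)) P"
        unfolding P_def
      proof (rule pred_intros_finite)
        fix j assume j: "j \<in> {1..m}"
        have "Measurable.pred (PiM {..<m} (\<lambda>_. borel)) (\<lambda>b. \<phi> (\<Sum>l<j. b l))"
          by (rule measurable_compose[OF pm[OF j] \<phi>'])
        then show "Measurable.pred (PiM {..<m} (\<lambda>_. borel)) (\<lambda>b. \<phi> (\<Sum>l<j. b l) = (z j \<in> G))" by measurable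
      qed simp
      show "Measurable.pred (PiM {..<m} (\<lambda>_. borel)) R"
        unfolding R_def
      proof (rule pred_intros_finite)
        fix j assume j: "j \<in> {1..m}"
        note [measurable] = pm[OF j]
        show "Measurable.pred (PiM {..<m} (\<lambda>_. borel)) (\<lambda>b. (\<Sum>l<j. b l) \<noteq> c \<and> (\<Sum>l<j. b l) \<noteq> - c)" by measurable
      qed simp
      have "AE w in MW. \<forall>j\<in>{1..m}. W (block_time z j) w - W 0 w \<noteq> c \<and> W (block_time z j) w - W 0 w \<noteq> - c"
      proof (intro AE_finite_allI AE_conjI)
        fix j assume "j \<in> {1..m}"
        then have bt: "0 < block_time z j" using z01[of j] bm_time_pos[of "z j"] by (auto simp: block_time_def)
        show "AE w in MW. W (block_time z j) w - W 0 w \<noteq> c" by (rule bm_not_atom[OF bt])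
        show "AE w in MW. W (block_time z j) w - W 0 w \<noteq> - c" by (rule bm_not_atom[OF bt])
      qed simp
      then show "AE w in MW. R (\<lambda>l\<in>{..<m}. W (block_time z (Suc l)) w - W (block_time z l) w)"
      proof eventually_elim
        case (elim w)
        have "(\<Sum>l<j. (\<lambda>l\<in>{..<m}. W (block_time z (Suc l)) w - W (block_time z l) w) l) = W (block_time z j) w - W 0 w" if "j \<in> {1..m}" for j
          unfolding sum_increments[symmetric] using that by (intro sum.cong) auto
        then show ?case using elim unfolding R_def by simp
      qed
      fix y :: "nat \<Rightarrow> nat \<Rightarrow> real" and x :: "nat \<Rightarrow> real"
      assume Rx: "R (restrict x {..<m})" and lim: "\<And>l. l < m \<Longrightarrow> (\<lambda>n. y n l) \<longlonglongrightarrow> x l"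
      have "\<forall>\<^sub>F n in sequentially. \<forall>j\<in>{1..m}. \<phi> (\<Sum>l<j. restrict (y n) {..<m} l) = \<phi> (\<Sum>l<j. restrict x {..<m} l)"
      proof (intro eventually_ball_finite ballI)
        fix j assume j: "j \<in> {1..m}"
        have l: "(\<lambda>n. \<Sum>l<j. restrict (y n) {..<m} l) \<longlonglongrightarrow> (\<Sum>l<j. restrict x {..<m} l)"
          using j lim by (intro tendsto_sum) auto
        have e: "\<forall>\<^sub>F y in nhds (\<Sum>l<j. restrict x {..<m} l). \<phi> y = \<phi> (\<Sum>l<j. restrict x {..<m} l)"
          using Rx j by (intro \<phi>(2)) (auto simp: R_def)
        show "\<forall>\<^sub>F n in sequentially. \<phi> (\<Sum>l<j. restrict (y n) {..<m} l) = \<phi> (\<Sum>l<j. restrict x {..<m} l)"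
          by (rule eventually_compose_filterlim[OF e l])
      qed simp
      then show "\<forall>\<^sub>F n in sequentially. P (restrict (y n) {..<m}) = P (restrict x {..<m})"
        by eventually_elim (simp add: P_def)
    qed
    moreover have "P (\<lambda>l\<in>{..<m}. noise N (block_end z N (Suc l)) w - noise N (block_end z N l) w) \<longleftrightarrow>
       {x\<in>F. \<phi> (noise N (level_index x N) w)} = G" for N w
    proof -
      have "(\<Sum>l<j. (\<lambda>l\<in>{..<m}. noise N (block_end z N (Suc l)) w - noise N (block_end z N l) w) l) = noise N (level_index (z j) N) w" if "j \<in> {1..m}" for j
      proof -
        have "(\<Sum>l<j. (\<lambda>l\<in>{..<m}. noise N (block_end z N (Suc l)) w - noise N (block_end z N l) w) l) =
          (\<Sum>l<j. noise N (block_end z N (Suc l)) w - noise N (block_end z N l) w)"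
          using that by (intro sum.cong) auto
        also have "\<dots> = noise N (block_end z N j) w" by (rule noise_blocks_sum[OF E])
        finally show ?thesis using that by (simp add: block_end_def)
      qed
      then show ?thesis unfolding iff P_def by simp
    qed
    moreover have "P (\<lambda>l\<in>{..<m}. W (block_time z (Suc l)) w - W (block_time z l) w) \<longleftrightarrow>
       {x\<in>F. \<phi> (W (bm_time x) w - W 0 w)} = G" for w
    proof -
      have "(\<Sum>l<j. (\<lambda>l\<in>{..<m}. W (block_time z (Suc l)) w - W (block_time z l) w) l) = W (bm_time (z j)) w - W 0 w" if "j \<in> {1..m}" for j
      proof -
        have "(\<Sum>l<j. (\<lambda>l\<in>{..<m}. W (block_time z (Suc l)) w - W (block_time z l) w) l) = W (block_time z j) w - W 0 w"
          unfolding sum_increments[symmetric] using that by (intro sum.cong) auto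
        then show ?thesis using that by (simp add: block_time_def)
      qed
      then show ?thesis unfolding iff P_def by simp
    qed
    ultimately show ?thesis by simp
  qed
qed

lemma bm_levels_away:
  assumes F: "finite F" "F \<subseteq> {0<..<1}" and "0 < \<eta>"
  shows "\<exists>c>0. \<P>(w in MW. \<exists>z\<in>F. \<bar>W (bm_time z) w - W 0 w\<bar> \<le> c) < \<eta>"
proof -
  interpret MW: prob_space MW by (rule bm_prob_space)
  let ?A = "\<lambda>n. {w\<in>space MW. \<exists>z\<in>F. \<bar>W (bm_time z) w - W 0 w\<bar> \<le> 1 / real (Suc n)}"
  have rv: "W (bm_time z) \<in> borel_measurable MW" if "z \<in> F" for z
    using that F bm_time_pos[of z] by (intro bm_rv) (auto intro: less_imp_le)
  have rv0: "W 0 \<in> borel_measurable MW" by (rule bm_rv) simp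
  have A: "?A n \<in> sets MW" for n
  proof -
    have "?A n = (\<Union>z\<in>F. {w\<in>space MW. \<bar>W (bm_time z) w - W 0 w\<bar> \<le> 1 / real (Suc n)})" by auto
    then show ?thesis using F(1) rv rv0 by (auto intro!: sets.finite_UN borel_measurable_le borel_measurable_abs borel_measurable_diff)
  qed
  have dec: "decseq ?A"
  proof (rule decseq_SucI, clarify)
    fix n w z assume *: "z \<in> F" "\<bar>W (bm_time z) w - W 0 w\<bar> \<le> 1 / real (Suc (Suc n))"
    have "1 / real (Suc (Suc n)) \<le> 1 / real (Suc n)" by (intro divide_left_mono) auto
    then show "\<exists>z\<in>F. \<bar>W (bm_time z) w - W 0 w\<bar> \<le> 1 / real (Suc n)" using * by (intro bexI[of _ z]) auto
  qed
  have "(\<lambda>n. measure MW (?A n)) \<longlonglongrightarrow> measure MW (\<Inter>n. ?A n)"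
    using A dec by (intro MW.finite_Lim_measure_decseq) auto
  moreover have "measure MW (\<Inter>n. ?A n) = 0"
  proof -
    have "AE w in MW. \<forall>z\<in>F. W (bm_time z) w - W 0 w \<noteq> 0"
      using bm_not_atom[of "bm_time _" 0] F bm_time_pos by (intro AE_finite_allI) auto
    then have "AE w in MW. w \<notin> (\<Inter>n. ?A n)"
    proof eventually_elim
      case (elim w)
      show ?case
      proof
        assume in_all: "w \<in> (\<Inter>n. ?A n)"
        then have ne: "F \<noteq> {}" by auto
        define d where "d = Min ((\<lambda>z. \<bar>W (bm_time z) w - W 0 w\<bar>) ` F)"
        have d: "0 < d" using F ne elim by (simp add: d_def)
        then obtain n where "1 / real (Suc n) < d" using nat_approx_posE by blast
        moreover obtain z where "z \<in> F" "\<bar>W (bm_time z) w - W 0 w\<bar> \<le> 1 / real (Suc n)" using in_all by auto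
        moreover have "d \<le> \<bar>W (bm_time z) w - W 0 w\<bar>" using F \<open>z \<in> F\<close> by (simp add: d_def)
        ultimately show False by linarith
      qed
    qed
    then show ?thesis using A by (subst MW.prob_eq_0) auto
  qed
  ultimately have "\<forall>\<^sub>F n in sequentially. measure MW (?A n) < \<eta>" using assms(3) by (simp add: order_tendstoD)
  then obtain n where "measure MW (?A n) < \<eta>" by (auto simp: eventually_sequentially)
  then show ?thesis by (intro exI[of _ "1 / real (Suc n)"]) auto
qed

end

section \<open>The limit law of the stopping index\<close>

text \<open>
  The mean of the walk is moved from the walk to the barrier, and both sides are multiplied by
  \<open>- sqrt N\<close>.
\<close>

lemma (in exp_seq) stop_condition_iff:
  assumes "0 < N"
  shows "hazard \<beta> N k < renyi_sum N (Suc k) (X w) \<longleftrightarrow> noise N (Suc k) w < - (sqrt (real N) * gap \<beta> N k)"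
proof -
  have s: "0 < sqrt (real N)" using assms by simp
  have "noise N (Suc k) w = sqrt (real N) * ((\<Sum>i\<le>k. 1 / (real N - real i)) - renyi_sum N (Suc k) (X w))"
    unfolding noise_def renyi_sum_def X_def xi_def lessThan_Suc_atMost sum_subtractf[symmetric] sum_distrib_left
    by (intro sum.cong) (auto simp: algebra_simps diff_divide_distrib)
  also have "\<dots> = - (sqrt (real N) * gap \<beta> N k) + sqrt (real N) * (hazard \<beta> N k - renyi_sum N (Suc k) (X w))"
    by (simp add: gap_def algebra_simps)
  finally show ?thesis using s by (simp add: mult_less_0_iff)
qed

lemma sqrt_mult_divide:
  assumes "0 < (N::nat)"
  shows "sqrt (real N) * (C / real N) = C / sqrt (real N)"
proof -
  have s: "0 < sqrt (real N)" "real N = sqrt (real N) * sqrt (real N)" using assms by auto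
  have "sqrt (real N) * (C / (sqrt (real N) * sqrt (real N))) = C / sqrt (real N)" using s(1) by (simp del: real_sqrt_mult_self)
  then show ?thesis using s(2) by simp
qed

lemma eventually_const_div_less:
  fixes C \<epsilon> :: real assumes "0 < \<epsilon>"
  shows "\<forall>\<^sub>F N in sequentially. C / real N \<le> \<epsilon>" "\<forall>\<^sub>F N in sequentially. C / sqrt (real N) \<le> \<epsilon>"
proof -
  have "(\<lambda>N. C / real N) \<longlonglongrightarrow> 0" by (rule lim_const_over_n)
  then have "\<forall>\<^sub>F N in sequentially. C / real N < \<epsilon>" using assms by (rule order_tendstoD)
  then show "\<forall>\<^sub>F N in sequentially. C / real N \<le> \<epsilon>" by eventually_elim simp
  have "(\<lambda>N. C / sqrt (real N)) \<longlonglongrightarrow> 0"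
    by (intro tendsto_divide_0[OF tendsto_const] filterlim_at_top_imp_at_infinity filterlim_compose[OF sqrt_at_top filterlim_real_sequentially])
  then have "\<forall>\<^sub>F N in sequentially. C / sqrt (real N) < \<epsilon>" using assms by (rule order_tendstoD)
  then show "\<forall>\<^sub>F N in sequentially. C / sqrt (real N) \<le> \<epsilon>" by eventually_elim simp
qed

lemma eventually_large: "\<forall>\<^sub>F N in sequentially. C \<le> real N" "0 < \<epsilon> \<Longrightarrow> \<forall>\<^sub>F N in sequentially. C \<le> \<epsilon> * sqrt (real N)" for C \<epsilon> :: real
proof -
  show "\<forall>\<^sub>F N in sequentially. C \<le> real N"
    using filterlim_real_sequentially by (simp add: filterlim_at_top)
  assume e: "0 < \<epsilon>"
  have "filterlim (\<lambda>N. sqrt (real N)) at_top sequentially" by (rule filterlim_compose[OF sqrt_at_top filterlim_real_sequentially])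
  then have "\<forall>\<^sub>F N in sequentially. C / \<epsilon> \<le> sqrt (real N)" by (simp add: filterlim_at_top)
  then show "\<forall>\<^sub>F N in sequentially. C \<le> \<epsilon> * sqrt (real N)" by eventually_elim (use e in \<open>simp add: field_simps\<close>)
qed

context
  fixes \<beta> :: "nat \<Rightarrow> real"
  assumes nonneg: "\<And>j. 0 \<le> \<beta> j"
    and radius: "conv_radius \<beta> \<notin> ereal ` zero_set \<beta>" and zero: "0 \<notin> zero_set \<beta>"
begin

lemmas zprops = zero_set_props[OF nonneg radius zero]

lemma zeros_finite: "r < 1 \<Longrightarrow> finite {z\<in>zero_set \<beta>. z \<le> r}"
  by (rule finite_zeros[OF nonneg radius zero])

text \<open>
  The points at distance at least \<open>\<delta>\<close> from the zeros form a compact set on which the drift is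
  positive, so the gap is bounded below there and \<open>sqrt N\<close> carries it beyond any level.
\<close>

lemma barrier_away_from_zeros:
  assumes b: "0 \<le> b" "b < z_star \<beta>" and d: "0 < \<delta>"
  shows "\<forall>\<^sub>F N in sequentially. \<forall>k. real k \<le> b * real N \<longrightarrow> (\<forall>z\<in>{z\<in>zero_set \<beta>. z \<le> b}. \<delta> \<le> \<bar>real k / real N - z\<bar>) \<longrightarrow>
      L \<le> sqrt (real N) * gap \<beta> N k"
proof -
  let ?F = "{z\<in>zero_set \<beta>. z \<le> b}"
  have b1: "b < 1" using b z_star_le_1[where \<beta>=\<beta>, OF nonneg] by (meson less_le_trans)
  define Kc where "Kc = {0..b} - (\<Union>z\<in>?F. {z - \<delta><..<z + \<delta>})"
  have cK: "compact Kc" unfolding Kc_def by (intro compact_diff) auto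
  have sK: "Kc \<subseteq> {0..<1}" using b1 by (auto simp: Kc_def)
  have pK: "0 < drift \<beta> t" if t: "t \<in> Kc" for t
  proof -
    have t0: "0 \<le> t" "t \<le> b" using t by (auto simp: Kc_def)
    have "0 \<le> drift \<beta> t" using t0 b by (intro drift_nonneg nonneg) auto
    moreover have "drift \<beta> t \<noteq> 0"
    proof
      assume "drift \<beta> t = 0"
      then have "t \<in> ?F" using t0 b by (auto simp: zero_set_def)
      then have "t \<in> (\<Union>z\<in>?F. {z - \<delta><..<z + \<delta>})" using d by (intro UN_I[of t]) auto
      then show False using t by (simp add: Kc_def)
    qed
    ultimately show ?thesis by simp
  qed
  from uniform_drift_lower[OF nonneg cK sK pK]
  obtain J c where c: "0 < c" "\<And>t. t \<in> Kc \<Longrightarrow> c \<le> trunc_der \<beta> J t + ln (1 - t)" by blast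
  let ?C = "(\<Sum>i<J. der_coeff \<beta> i * (real i)\<^sup>2) + 2 / (1 - b)"
  have "0 < c / 2" using c by simp
  from eventually_const_div_less(1)[OF this, of ?C] eventually_large(1)[of "2 / (1 - b)"] eventually_large(2)[OF this, of L] eventually_gt_at_top[of 0]
  show ?thesis
  proof eventually_elim
    fix N assume N: "?C / real N \<le> c / 2" "2 / (1 - b) \<le> real N" "L \<le> c / 2 * sqrt (real N)" "0 < N"
    show "\<forall>k. real k \<le> b * real N \<longrightarrow> (\<forall>z\<in>?F. \<delta> \<le> \<bar>real k / real N - z\<bar>) \<longrightarrow> L \<le> sqrt (real N) * gap \<beta> N k"
    proof (intro allI impI)
      fix k assume k: "real k \<le> b * real N" "\<forall>z\<in>?F. \<delta> \<le> \<bar>real k / real N - z\<bar>"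
      have "real k / real N \<le> b" using k(1) N(4) by (simp add: field_simps)
      then have "real k / real N \<in> Kc" using k(2) by (force simp: Kc_def abs_if split: if_splits)
      then have "c \<le> trunc_der \<beta> J (real k / real N) + ln (1 - real k / real N)" by (rule c(2))
      moreover have "trunc_der \<beta> J (real k / real N) + ln (1 - real k / real N) - ?C / real N \<le> gap \<beta> N k"
        by (rule gap_lower_trunc[OF nonneg]) (use b1 N(2) k(1) in \<open>auto simp: field_simps\<close>)
      ultimately have "c / 2 \<le> gap \<beta> N k" using N(1) by linarith
      then have "sqrt (real N) * (c / 2) \<le> sqrt (real N) * gap \<beta> N k" by (intro mult_left_mono) auto
      then show "L \<le> sqrt (real N) * gap \<beta> N k" using N(3) by (simp add: mult.commute)
    qed
  qed
qed

text \<open>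
  Before \<open>z*\<close> the drift is non-negative, so the gap is negative at most by its error term of order
  \<open>1 / N\<close>, which vanishes at the scale \<open>1 / sqrt N\<close>.
\<close>

lemma barrier_near_zeros:
  assumes b: "0 \<le> b" "b < z_star \<beta>" and \<rho>: "0 < \<rho>" "ereal \<rho> < conv_radius \<beta>" and c: "0 < c"
  shows "\<forall>\<^sub>F N in sequentially. \<forall>k. real k \<le> b * real N \<longrightarrow> real k / real N \<le> \<rho> \<longrightarrow> - c \<le> sqrt (real N) * gap \<beta> N k"
proof -
  have b1: "b < 1" using b z_star_le_1[where \<beta>=\<beta>, OF nonneg] by (meson less_le_trans)
  let ?C = "(\<Sum>i. der_coeff \<beta> i * (real i)\<^sup>2 * \<rho> ^ (i - 1)) + 2 / (1 - b)"
  from eventually_const_div_less(2)[OF c, of ?C] eventually_large(1)[of "2 / (1 - b)"] eventually_gt_at_top[of 0]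
  show ?thesis
  proof eventually_elim
    fix N assume N: "?C / sqrt (real N) \<le> c" "2 / (1 - b) \<le> real N" "0 < N"
    show "\<forall>k. real k \<le> b * real N \<longrightarrow> real k / real N \<le> \<rho> \<longrightarrow> - c \<le> sqrt (real N) * gap \<beta> N k"
    proof (intro allI impI)
      fix k assume k: "real k \<le> b * real N" "real k / real N \<le> \<rho>"
      let ?t = "real k / real N"
      have t: "0 \<le> ?t" "?t \<le> b" using k(1) N(3) by (auto simp: field_simps)
      have tr: "ereal ?t < conv_radius \<beta>" using k(2) by (auto intro: le_less_trans[OF _ \<rho>(2)])
      have "0 \<le> drift \<beta> ?t" using t b by (intro drift_nonneg nonneg) auto
      then have "0 \<le> series_der \<beta> ?t + ln (1 - ?t)" using drift_finite[OF nonneg t(1) tr] by simp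
      moreover have "series_der \<beta> ?t + ln (1 - ?t) - ?C / real N \<le> gap \<beta> N k"
        by (rule gap_lower_series[OF nonneg]) (use b1 N(2) k \<rho> in \<open>auto simp: field_simps\<close>)
      ultimately have "- (?C / real N) \<le> gap \<beta> N k" by linarith
      then have "sqrt (real N) * - (?C / real N) \<le> sqrt (real N) * gap \<beta> N k" by (intro mult_left_mono) auto
      moreover have "sqrt (real N) * (?C / real N) = ?C / sqrt (real N)"
        by (rule sqrt_mult_divide[OF N(3)])
      ultimately show "- c \<le> sqrt (real N) * gap \<beta> N k" using N(1) by simp
    qed
  qed
qed

text \<open>
  For a zero \<open>t\<close> this is used with \<open>d = 0\<close>; for a point of negative drift, with \<open>d > 0\<close>.
\<close>

lemma scaled_gap_at_level:
  assumes t: "0 \<le> t" "t < 1" "ereal t < conv_radius \<beta>" and d: "series_der \<beta> t + ln (1 - t) \<le> - d" and c: "0 < c"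
  shows "\<forall>\<^sub>F N in sequentially. sqrt (real N) * gap \<beta> N (nat \<lfloor>t * real N\<rfloor>) \<le> c - d * sqrt (real N)"
proof -
  obtain C N0 where C: "\<And>N. N0 \<le> N \<Longrightarrow> gap \<beta> N (nat \<lfloor>t * real N\<rfloor>) \<le> series_der \<beta> t + ln (1 - t) + C / real N"
    using gap_upper[OF nonneg t] by blast
  from eventually_const_div_less(2)[OF c, of C] eventually_ge_at_top[of N0] eventually_gt_at_top[of 0]
  show ?thesis
  proof eventually_elim
    fix N assume N: "C / sqrt (real N) \<le> c" "N0 \<le> N" "0 < N"
    have s: "0 < sqrt (real N)" "real N = sqrt (real N) * sqrt (real N)" using N(3) by auto
    have "gap \<beta> N (nat \<lfloor>t * real N\<rfloor>) \<le> - d + C / real N" using C[OF N(2)] d by linarith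
    then have "sqrt (real N) * gap \<beta> N (nat \<lfloor>t * real N\<rfloor>) \<le> sqrt (real N) * (- d + C / real N)" using s by (intro mult_left_mono) auto
    also have "\<dots> = - d * sqrt (real N) + sqrt (real N) * (C / real N)" by (simp add: algebra_simps)
    also have "sqrt (real N) * (C / real N) = C / sqrt (real N)"
      by (rule sqrt_mult_divide[OF N(3)])
    finally show "sqrt (real N) * gap \<beta> N (nat \<lfloor>t * real N\<rfloor>) \<le> c - d * sqrt (real N)" using N(1) by simp
  qed
qed

end

context exp_seq begin

lemma noise_bounded:
  assumes b: "0 \<le> b" "b < 1" and "0 < \<eta>"
  shows "\<exists>L>0. \<forall>N>0. \<P>(w in M. \<exists>n. n \<le> level_index b N \<and> L \<le> \<bar>noise N n w\<bar>) \<le> \<eta>"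
proof -
  define L where "L = sqrt (2 / ((1 - b)\<^sup>2 * \<eta>))"
  have L: "0 < L" "L\<^sup>2 = 2 / ((1 - b)\<^sup>2 * \<eta>)" using assms by (auto simp: L_def)
  have "\<P>(w in M. \<exists>n. n \<le> level_index b N \<and> L \<le> \<bar>noise N n w\<bar>) \<le> \<eta>" if N: "0 < N" for N
  proof -
    let ?q = "level_index b N"
    have q: "real ?q \<le> b * real N + 1" by (rule level_index_bounds(2)[OF b(1)])
    have "\<P>(w in M. \<exists>n. 0 \<le> n \<and> n \<le> ?q \<and> L \<le> \<bar>noise N n w - noise N 0 w\<bar>) \<le> (real ?q - real 0) / ((1 - b)\<^sup>2 * real N * L\<^sup>2)"
      by (rule noise_oscillation[OF N le0 b(2) q L(1)])
    also have "\<dots> \<le> (2 * real N) / ((1 - b)\<^sup>2 * real N * L\<^sup>2)"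
    proof (rule divide_right_mono)
      have "b * real N \<le> 1 * real N" using b by (intro mult_right_mono) auto
      then show "real ?q - real 0 \<le> 2 * real N" using q N by linarith
    qed simp
    also have "\<dots> = \<eta>" unfolding L(2) using N assms by (simp add: field_simps)
    finally show ?thesis by (simp add: noise_def)
  qed
  then show ?thesis using L by blast
qed

text \<open>
  The oscillation of the noise over a window of width \<open>2 * \<delta>\<close> about \<open>z\<close>; the constant \<open>3\<close> absorbs
  rounding.
\<close>

lemma noise_window:
  assumes b: "z \<le> b" "b < 1" "0 \<le> z" and d: "0 < \<delta>" and N: "1 \<le> \<delta> * real N" and g: "0 < \<gamma>"
  shows "\<P>(w in M. \<exists>n. level_index (z - \<delta>) N \<le> n \<and> n \<le> level_index (min b (z + \<delta>)) N \<and>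
        \<gamma> \<le> \<bar>noise N n w - noise N (level_index (z - \<delta>) N) w\<bar>) \<le> 3 * \<delta> / ((1 - b)\<^sup>2 * \<gamma>\<^sup>2)"
proof -
  let ?p = "level_index (z - \<delta>) N" and ?q = "level_index (min b (z + \<delta>)) N"
  have N0: "0 < N" using N by (cases N) auto
  have m0: "0 \<le> min b (z + \<delta>)" using b d by auto
  have pq: "?p \<le> ?q" using b d by (intro level_index_mono) auto
  have q: "real ?q \<le> min b (z + \<delta>) * real N + 1" by (rule level_index_bounds(2)[OF m0])
  have "min b (z + \<delta>) * real N \<le> b * real N" "min b (z + \<delta>) * real N \<le> (z + \<delta>) * real N" by (intro mult_right_mono; simp)+
  then have q1: "real ?q \<le> b * real N + 1" "real ?q \<le> (z + \<delta>) * real N + 1" using q by auto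
  have p: "(z - \<delta>) * real N \<le> real ?p" unfolding level_index_def by linarith
  have "\<P>(w in M. \<exists>n. ?p \<le> n \<and> n \<le> ?q \<and> \<gamma> \<le> \<bar>noise N n w - noise N ?p w\<bar>) \<le> (real ?q - real ?p) / ((1 - b)\<^sup>2 * real N * \<gamma>\<^sup>2)"
    by (rule noise_oscillation[OF N0 pq b(2) q1(1) g])
  also have "\<dots> \<le> (3 * \<delta> * real N) / ((1 - b)\<^sup>2 * real N * \<gamma>\<^sup>2)"
    using q1(2) p N by (intro divide_right_mono) (auto simp: algebra_simps)
  also have "\<dots> = 3 * \<delta> / ((1 - b)\<^sup>2 * \<gamma>\<^sup>2)" using N0 by simp
  finally show ?thesis .
qed

end

locale stopping = exp_seq M E for M :: "'a measure" and E +
  fixes \<beta> :: "nat \<Rightarrow> real" and MW :: "'b measure" and W :: "real \<Rightarrow> 'b \<Rightarrow> real"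
  assumes nonneg: "\<And>j. 0 \<le> \<beta> j"
    and radius: "conv_radius \<beta> \<notin> ereal ` zero_set \<beta>" and zero: "0 \<notin> zero_set \<beta>"
    and bm: "brownian_motion MW W"
begin

sublocale MW: prob_space MW by (rule bm_prob_space[OF bm])

definition stopped :: "nat \<Rightarrow> 'a \<Rightarrow> nat" where
  "stopped N w = stop_index (hazard \<beta> N) N (X w)"

lemma stopped_rv[measurable]: "stopped N \<in> measurable M (count_space UNIV)"
  unfolding stopped_def[abs_def] by measurable

definition zeros_upto :: "real \<Rightarrow> real set" where "zeros_upto b = {z\<in>zero_set \<beta>. z \<le> b}"

text \<open>
  The zeros at which the noise would let the walk stop; the discrete counterpart of the zeros with
  negative Brownian motion in the definition of \<open>Z\<close>.
\<close>

definition negative_levels :: "real \<Rightarrow> nat \<Rightarrow> 'a \<Rightarrow> real set" where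
  "negative_levels b N w = {z\<in>zeros_upto b. noise N (level_index z N) w < 0}"

lemma zeros_upto_props:
  "b < 1 \<Longrightarrow> finite (zeros_upto b)" "zeros_upto b \<subseteq> {0<..<1}"
proof -
  show "b < 1 \<Longrightarrow> finite (zeros_upto b)"
    unfolding zeros_upto_def by (rule zeros_finite[OF nonneg radius zero])
  show "zeros_upto b \<subseteq> {0<..<1}"
  proof
    fix z assume "z \<in> zeros_upto b"
    then have "z \<in> zero_set \<beta>" by (simp add: zeros_upto_def)
    then show "z \<in> {0<..<1}" using zprops(1,3)[OF nonneg radius zero] by simp
  qed
qed

text \<open>
  Outside an event of probability at most \<open>\<eta>\<close>, the walk stops close to the first zero with negative
  noise, if there is one up to \<open>b\<close>, and passes \<open>b\<close> otherwise. The exceptional event has three parts of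
  probability at most \<open>\<eta> / 3\<close>: the noise at some zero is within \<open>c\<close> of zero; the noise oscillates by \<open>\<gamma>\<close>
  near some zero; the noise exceeds \<open>L\<close> somewhere. Off this event the barrier cannot be reached away
  from the zeros, and near a zero \<open>z\<close> the noise keeps the sign it has at \<open>z\<close>.
\<close>

lemma stopped_stays:
  assumes b: "b < z_star \<beta>" and d: "0 < \<delta>" and \<eta>: "0 < \<eta>"
  shows "\<forall>\<^sub>F N in sequentially. \<exists>G\<in>events. prob (space M - G) \<le> \<eta> \<and> (\<forall>w\<in>G.
    (negative_levels b N w \<noteq> {} \<longrightarrow> \<bar>real (stopped N w) / real N - Min (negative_levels b N w)\<bar> \<le> \<delta>) \<and>
    (negative_levels b N w = {} \<longrightarrow> b * real N < real (stopped N w)))"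
proof (cases "0 \<le> b")
  case False
  have "zeros_upto b = {}" using zeros_upto_props(2)[of b] False by (force simp: zeros_upto_def)
  then have "negative_levels b N w = {}" for N w by (simp add: negative_levels_def)
  note empty = this
  show ?thesis
  proof (rule eventually_mono[OF eventually_gt_at_top[of 0]])
    fix N :: nat assume "0 < N"
    then have "b * real N < 0" using False by (simp add: mult_neg_pos)
    then have "b * real N < real (stopped N w)" for w by (rule less_le_trans) simp
    then show "\<exists>G\<in>events. prob (space M - G) \<le> \<eta> \<and> (\<forall>w\<in>G.
      (negative_levels b N w \<noteq> {} \<longrightarrow> \<bar>real (stopped N w) / real N - Min (negative_levels b N w)\<bar> \<le> \<delta>) \<and>
      (negative_levels b N w = {} \<longrightarrow> b * real N < real (stopped N w)))"
      using \<eta> empty by (intro bexI[of _ "space M"]) simp_all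
  qed
next
  case b0: True
  let ?F = "zeros_upto b"
  have b1: "b < 1" using b z_star_le_1[where \<beta>=\<beta>, OF nonneg] by (meson less_le_trans)
  have F: "finite ?F" "?F \<subseteq> {0<..<1}" using zeros_upto_props b1 by auto
  have Fz: "z \<in> zero_set \<beta>" "z \<le> b" "0 < z" "z < 1" "ereal z < conv_radius \<beta>" "series_der \<beta> z + ln (1 - z) = 0" if "z \<in> ?F" for z
  proof -
    show z: "z \<in> zero_set \<beta>" "z \<le> b" using that by (simp_all add: zeros_upto_def)
    show "0 < z" "z < 1" "ereal z < conv_radius \<beta>" "series_der \<beta> z + ln (1 - z) = 0"
      using zprops(1,3,4,5)[OF nonneg radius zero z(1)] .
  qed
  obtain c where c: "0 < c" "\<P>(w in MW. \<exists>z\<in>?F. \<bar>W (bm_time z) w - W 0 w\<bar> \<le> c) < \<eta> / 3"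
    using bm_levels_away[OF bm F, of "\<eta> / 3"] \<eta> by auto
  obtain L where L: "0 < L" "\<And>N. 0 < N \<Longrightarrow> \<P>(w in M. \<exists>n. n \<le> level_index b N \<and> L \<le> \<bar>noise N n w\<bar>) \<le> \<eta> / 3"
    using noise_bounded[OF b0 b1, of "\<eta> / 3"] \<eta> by auto
  obtain \<rho> where \<rho>: "?F \<noteq> {} \<Longrightarrow> 0 < \<rho> \<and> ereal \<rho> < conv_radius \<beta>" "\<And>z. z \<in> ?F \<Longrightarrow> z < \<rho>"
  proof (cases "?F = {}")
    case True
    then show ?thesis using that[of 0] by simp
  next
    case False
    then have m: "Max ?F \<in> ?F" using F by simp
    have nn: "0 \<le> Max ?F" "Max ?F < 1" "ereal (Max ?F) < conv_radius \<beta>" using Fz(3,4,5)[OF m] by auto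
    obtain \<rho> where "Max ?F < \<rho>" "\<rho> < 1" "ereal \<rho> < conv_radius \<beta>" "0 < \<rho>"
      using pos_radius_between[where \<beta>=\<beta>, OF nonneg nn] .
    then show ?thesis using that[of \<rho>] F by (auto simp: Max_less_iff[OF F(1) False])
  qed
  \<comment> \<open>At a zero the noise exceeds \<open>c\<close> in size; nearby it may vary by \<open>2 * \<gamma> = c / 2\<close>, and the
    barrier may rise by \<open>c / 2\<close>.\<close>
  define \<gamma> where "\<gamma> = c / 4"
  have \<gamma>: "0 < \<gamma>" using c by (simp add: \<gamma>_def)
  \<comment> \<open>The width for which the oscillation bounds at all zeros add up to at most \<open>\<eta> / 3\<close>.\<close>
  define \<delta>1 where "\<delta>1 = (\<eta> / 3) * ((1 - b)\<^sup>2 * \<gamma>\<^sup>2) / (3 * (real (card ?F) + 1))"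
  have \<delta>1: "0 < \<delta>1" using \<eta> \<gamma> b1 by (auto simp: \<delta>1_def)
  \<comment> \<open>The windows about the zeros must also stay inside the disc of convergence, hence
    below \<open>\<rho>\<close>.\<close>
  define \<delta>' where "\<delta>' = Min ({\<delta>, \<delta>1} \<union> (\<lambda>z. \<rho> - z) ` ?F)"
  have \<delta>': "0 < \<delta>'" "\<delta>' \<le> \<delta>" "\<delta>' \<le> \<delta>1" "\<And>z. z \<in> ?F \<Longrightarrow> z + \<delta>' \<le> \<rho>"
  proof -
    have fin: "finite ({\<delta>, \<delta>1} \<union> (\<lambda>z. \<rho> - z) ` ?F)" using F by simp
    show "0 < \<delta>'" unfolding \<delta>'_def using fin d \<delta>1 \<rho>(2) by (subst Min_gr_iff) auto
    show "\<delta>' \<le> \<delta>" "\<delta>' \<le> \<delta>1" unfolding \<delta>'_def by (rule Min_le[OF fin], simp)+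
    fix z assume "z \<in> ?F"
    then have "\<delta>' \<le> \<rho> - z" unfolding \<delta>'_def by (intro Min_le[OF fin]) simp
    then show "z + \<delta>' \<le> \<rho>" by simp
  qed
  have wsum: "real (card ?F) * (3 * \<delta>' / ((1 - b)\<^sup>2 * \<gamma>\<^sup>2)) \<le> \<eta> / 3"
  proof -
    have k: "0 < (1 - b)\<^sup>2 * \<gamma>\<^sup>2" using \<gamma> b1 by auto
    have "real (card ?F) * (3 * \<delta>' / ((1 - b)\<^sup>2 * \<gamma>\<^sup>2)) \<le> (real (card ?F) + 1) * (3 * \<delta>1 / ((1 - b)\<^sup>2 * \<gamma>\<^sup>2))"
      using k \<delta>' by (intro mult_mono divide_right_mono) auto
    also have "\<dots> = \<eta> / 3"
    proof -
      have "m * (3 * (\<eta> / 3 * x / (3 * m)) / x) = \<eta> / 3" if "0 < m" "0 < x" for m x :: real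
        using that by (simp add: field_simps)
      from this[of "real (card ?F) + 1", OF _ k] show ?thesis unfolding \<delta>1_def by simp
    qed
    finally show ?thesis .
  qed
  have e1: "\<forall>\<^sub>F N in sequentially. \<P>(w in M. \<exists>z\<in>?F. \<bar>noise N (level_index z N) w\<bar> \<le> c) \<le> \<eta> / 3"
  proof -
    have "(\<lambda>N. \<P>(w in M. {z\<in>?F. \<bar>noise N (level_index z N) w\<bar> \<le> c} = {})) \<longlonglongrightarrow>
      \<P>(w in MW. {z\<in>?F. \<bar>W (bm_time z) w - W 0 w\<bar> \<le> c} = {})"
    proof (rule noise_levels_conv[OF bm exp_seq_axioms F, where c=c])
      show "{x::real. \<bar>x\<bar> \<le> c} \<in> sets borel" by measurable
      fix x :: real assume x: "x \<noteq> c" "x \<noteq> - c"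
      show "\<forall>\<^sub>F y in nhds x. (\<bar>y\<bar> \<le> c) = (\<bar>x\<bar> \<le> c)"
      proof (cases "\<bar>x\<bar> < c")
        case True
        then have "\<forall>\<^sub>F y in nhds x. y \<in> {-c<..<c}" by (intro eventually_nhds_in_open) auto
        then show ?thesis using True by (auto elim!: eventually_mono)
      next
        case False
        then have "\<forall>\<^sub>F y in nhds x. y \<in> {..<-c} \<union> {c<..}" using x by (intro eventually_nhds_in_open) auto
        then show ?thesis using False x by (auto elim!: eventually_mono)
      qed
    qed
    moreover have "1 - \<eta> / 3 < \<P>(w in MW. {z\<in>?F. \<bar>W (bm_time z) w - W 0 w\<bar> \<le> c} = {})"
    proof -
      have rv: "W (bm_time z) \<in> borel_measurable MW" if "z \<in> ?F" for z
        using that F bm_time_pos[of z] by (intro bm_rv[OF bm]) (auto intro: less_imp_le)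
      have rv0: "W 0 \<in> borel_measurable MW" by (rule bm_rv[OF bm]) simp
      have ev: "{w\<in>space MW. \<exists>z\<in>?F. \<bar>W (bm_time z) w - W 0 w\<bar> \<le> c} \<in> MW.events"
      proof -
        have "{w\<in>space MW. \<exists>z\<in>?F. \<bar>W (bm_time z) w - W 0 w\<bar> \<le> c} = (\<Union>z\<in>?F. {w\<in>space MW. \<bar>W (bm_time z) w - W 0 w\<bar> \<le> c})" by auto
        then show ?thesis using F(1) rv rv0 by (auto intro!: sets.finite_UN borel_measurable_le borel_measurable_abs borel_measurable_diff)
      qed
      have "{w\<in>space MW. {z\<in>?F. \<bar>W (bm_time z) w - W 0 w\<bar> \<le> c} = {}} = space MW - {w\<in>space MW. \<exists>z\<in>?F. \<bar>W (bm_time z) w - W 0 w\<bar> \<le> c}" by auto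
      then show ?thesis using MW.prob_compl[OF ev] c(2) by simp
    qed
    ultimately have "\<forall>\<^sub>F N in sequentially. 1 - \<eta> / 3 < \<P>(w in M. {z\<in>?F. \<bar>noise N (level_index z N) w\<bar> \<le> c} = {})"
      by (rule order_tendstoD)
    then show ?thesis
    proof eventually_elim
      fix N assume a: "1 - \<eta> / 3 < \<P>(w in M. {z\<in>?F. \<bar>noise N (level_index z N) w\<bar> \<le> c} = {})"
      have ev: "{w\<in>space M. \<exists>z\<in>?F. \<bar>noise N (level_index z N) w\<bar> \<le> c} \<in> events"
      proof -
        have "{w\<in>space M. \<exists>z\<in>?F. \<bar>noise N (level_index z N) w\<bar> \<le> c} = (\<Union>z\<in>?F. {w\<in>space M. \<bar>noise N (level_index z N) w\<bar> \<le> c})" by auto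
        then show ?thesis using F(1) by (auto intro!: sets.finite_UN)
      qed
      have "{w\<in>space M. {z\<in>?F. \<bar>noise N (level_index z N) w\<bar> \<le> c} = {}} = space M - {w\<in>space M. \<exists>z\<in>?F. \<bar>noise N (level_index z N) w\<bar> \<le> c}" by auto
      then show "\<P>(w in M. \<exists>z\<in>?F. \<bar>noise N (level_index z N) w\<bar> \<le> c) \<le> \<eta> / 3" using prob_compl[OF ev] a by simp
    qed
  qed
  have e2: "\<forall>\<^sub>F N in sequentially. 1 \<le> \<delta>' * real N"
    using eventually_large(1)[of "1 / \<delta>'"] by eventually_elim (use \<delta>' in \<open>simp add: field_simps\<close>)
  have e3: "\<forall>\<^sub>F N in sequentially. \<forall>k. real k \<le> b * real N \<longrightarrow> (\<forall>z\<in>?F. \<delta>' \<le> \<bar>real k / real N - z\<bar>) \<longrightarrow> L \<le> sqrt (real N) * gap \<beta> N k"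
    using barrier_away_from_zeros[OF nonneg radius zero b0 b \<delta>'(1), of L] by (simp add: zeros_upto_def)
  have e4: "\<forall>\<^sub>F N in sequentially. \<forall>k. real k \<le> b * real N \<longrightarrow> (\<exists>z\<in>?F. \<bar>real k / real N - z\<bar> < \<delta>') \<longrightarrow> - (c / 2) \<le> sqrt (real N) * gap \<beta> N k"
  proof (cases "?F = {}")
    case False
    have "0 < c / 2" using c by simp
    from barrier_near_zeros[OF nonneg radius zero b0 b _ _ this, of \<rho>] \<rho>(1)[OF False]
    have "\<forall>\<^sub>F N in sequentially. \<forall>k. real k \<le> b * real N \<longrightarrow> real k / real N \<le> \<rho> \<longrightarrow> - (c / 2) \<le> sqrt (real N) * gap \<beta> N k" by blast
    then show ?thesis
    proof eventually_elim
      case (elim N)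
      show ?case
      proof (intro allI impI, elim bexE)
        fix k z assume k: "real k \<le> b * real N" and z: "z \<in> ?F" "\<bar>real k / real N - z\<bar> < \<delta>'"
        have "real k / real N \<le> \<rho>" using z(2) \<delta>'(4)[OF z(1)] by linarith
        then show "- (c / 2) \<le> sqrt (real N) * gap \<beta> N k" using elim k by blast
      qed
    qed
  qed simp
  have e5: "\<forall>\<^sub>F N in sequentially. \<forall>z\<in>?F. sqrt (real N) * gap \<beta> N (nat \<lfloor>z * real N\<rfloor>) \<le> c"
  proof (intro eventually_ball_finite ballI F(1))
    fix z assume z: "z \<in> ?F"
    from scaled_gap_at_level[OF nonneg radius zero _ Fz(4,5)[OF z] _ c(1), of 0] Fz(3,6)[OF z]
    show "\<forall>\<^sub>F N in sequentially. sqrt (real N) * gap \<beta> N (nat \<lfloor>z * real N\<rfloor>) \<le> c" by simp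
  qed
  from e1 e2 e3 e4 e5 eventually_gt_at_top[of 0]
  show ?thesis
  proof eventually_elim
    fix N
    assume n1: "\<P>(w in M. \<exists>z\<in>?F. \<bar>noise N (level_index z N) w\<bar> \<le> c) \<le> \<eta> / 3"
      and n2: "1 \<le> \<delta>' * real N"
      and n3: "\<forall>k. real k \<le> b * real N \<longrightarrow> (\<forall>z\<in>?F. \<delta>' \<le> \<bar>real k / real N - z\<bar>) \<longrightarrow> L \<le> sqrt (real N) * gap \<beta> N k"
      and n4: "\<forall>k. real k \<le> b * real N \<longrightarrow> (\<exists>z\<in>?F. \<bar>real k / real N - z\<bar> < \<delta>') \<longrightarrow> - (c / 2) \<le> sqrt (real N) * gap \<beta> N k"
      and n5: "\<forall>z\<in>?F. sqrt (real N) * gap \<beta> N (nat \<lfloor>z * real N\<rfloor>) \<le> c" and N: "0 < N"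
    let ?p = "\<lambda>z. level_index (z - \<delta>') N" and ?q = "\<lambda>z. level_index (min b (z + \<delta>')) N"
    define B1 where "B1 = {w\<in>space M. \<exists>z\<in>?F. \<bar>noise N (level_index z N) w\<bar> \<le> c}"
    define B2 where "B2 z = {w\<in>space M. \<exists>n. ?p z \<le> n \<and> n \<le> ?q z \<and> \<gamma> \<le> \<bar>noise N n w - noise N (?p z) w\<bar>}" for z
    define B3 where "B3 = {w\<in>space M. \<exists>n. n \<le> level_index b N \<and> L \<le> \<bar>noise N n w\<bar>}"
    have m1: "B1 \<in> events"
    proof -
      have "B1 = (\<Union>z\<in>?F. {w\<in>space M. \<bar>noise N (level_index z N) w\<bar> \<le> c})" by (auto simp: B1_def)
      then show ?thesis using F(1) by (auto intro!: sets.finite_UN)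
    qed
    have m2: "B2 z \<in> events" for z unfolding B2_def by measurable
    have m3: "B3 \<in> events" unfolding B3_def by measurable
    let ?B = "B1 \<union> (\<Union>z\<in>?F. B2 z) \<union> B3"
    have mB: "(\<Union>z\<in>?F. B2 z) \<in> events" using m2 F by auto
    have "prob ?B \<le> prob (B1 \<union> (\<Union>z\<in>?F. B2 z)) + prob B3" using m1 m3 mB by (intro measure_Un_le) auto
    also have "\<dots> \<le> (prob B1 + prob (\<Union>z\<in>?F. B2 z)) + prob B3" using m1 mB by (intro add_right_mono measure_Un_le)
    also have "prob (\<Union>z\<in>?F. B2 z) \<le> (\<Sum>z\<in>?F. prob (B2 z))" using F m2 by (intro finite_measure_subadditive_finite) auto
    also have "\<dots> \<le> (\<Sum>z\<in>?F. 3 * \<delta>' / ((1 - b)\<^sup>2 * \<gamma>\<^sup>2))"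
      unfolding B2_def using Fz b1 \<delta>' \<gamma> n2 by (intro sum_mono noise_window) (auto intro: less_imp_le)
    also have "\<dots> \<le> \<eta> / 3" using wsum by simp
    finally have "prob ?B \<le> \<eta>" using n1 L(2)[OF N] unfolding B1_def B3_def by simp
    moreover have "space M - (space M - ?B) = ?B" by (auto simp: B1_def B2_def B3_def)
    moreover have good: "(negative_levels b N w \<noteq> {} \<longrightarrow> \<bar>real (stopped N w) / real N - Min (negative_levels b N w)\<bar> \<le> \<delta>) \<and>
        (negative_levels b N w = {} \<longrightarrow> b * real N < real (stopped N w))" if w: "w \<in> space M - ?B" for w
    proof -
      let ?J = "negative_levels b N w"
      let ?K = "stopped N w"
      have g1: "c < \<bar>noise N (level_index z N) w\<bar>" if "z \<in> ?F" for z using w that by (auto simp: B1_def not_le)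
      have g2: "\<bar>noise N n w - noise N (level_index z N) w\<bar> < 2 * \<gamma>" if z: "z \<in> ?F" and n: "?p z \<le> n" "n \<le> ?q z" for z n
      proof -
        have nB: "\<forall>n. ?p z \<le> n \<longrightarrow> n \<le> ?q z \<longrightarrow> \<not> \<gamma> \<le> \<bar>noise N n w - noise N (?p z) w\<bar>"
          using w z unfolding B2_def by blast
        have "?p z \<le> level_index z N" "level_index z N \<le> ?q z" using Fz(2)[OF z] \<delta>'(1) by (auto intro!: level_index_mono)
        then have "\<bar>noise N (level_index z N) w - noise N (?p z) w\<bar> < \<gamma>" "\<bar>noise N n w - noise N (?p z) w\<bar> < \<gamma>"
          using nB n by (auto simp: not_le)
        then show ?thesis by linarith
      qed
      have g3: "\<bar>noise N n w\<bar> < L" if "n \<le> level_index b N" for n 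
      proof -
        have "\<not> L \<le> \<bar>noise N n w\<bar>" using w that unfolding B3_def by blast
        then show ?thesis by simp
      qed
      have stopcond: "noise N (Suc ?K) w < - (sqrt (real N) * gap \<beta> N ?K)" if "?K \<noteq> N"
        using stop_index_eq_iff[OF stop_index_le, of "hazard \<beta> N" N "X w"] that stop_condition_iff[OF N, of \<beta> ?K w]
        by (auto simp: stopped_def)
      have KbN: "?K \<noteq> N" if "real ?K \<le> b * real N"
      proof -
        have "b * real N < 1 * real N" using b1 N by (intro mult_strict_right_mono) auto
        then show ?thesis using that by auto
      qed
      \<comment> \<open>A walk that stops up to \<open>b\<close> does so near some zero, and the noise there is
        negative.\<close>
      have found: "\<exists>z\<in>?J. \<bar>real ?K / real N - z\<bar> < \<delta>'" if K: "real ?K \<le> b * real N"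
      proof -
        have st: "noise N (Suc ?K) w < - (sqrt (real N) * gap \<beta> N ?K)" using stopcond KbN[OF K] by blast
        have "Suc ?K \<le> level_index b N" unfolding level_index_def using K by (simp add: le_nat_floor)
        then have "- L < noise N (Suc ?K) w" using g3[of "Suc ?K"] by linarith
        then have "\<not> (\<forall>z\<in>?F. \<delta>' \<le> \<bar>real ?K / real N - z\<bar>)" using n3 K st by fastforce
        then obtain z where z: "z \<in> ?F" "\<bar>real ?K / real N - z\<bar> < \<delta>'" by (auto simp: not_le)
        have "(z - \<delta>') * real N < real ?K" "real ?K < (z + \<delta>') * real N"
          using z(2) N by (auto simp: abs_less_iff field_simps)
        then have "?p z \<le> Suc ?K" "Suc ?K \<le> ?q z"
        proof -
          assume a: "(z - \<delta>') * real N < real ?K" "real ?K < (z + \<delta>') * real N"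
          show "?p z \<le> Suc ?K" unfolding level_index_def using a(1) by (simp add: nat_le_iff floor_le_iff)
          have "real ?K \<le> min b (z + \<delta>') * real N" using a(2) K by (auto simp: min_def)
          then show "Suc ?K \<le> ?q z" unfolding level_index_def by (simp add: le_nat_floor)
        qed
        from g2[OF z(1) this] have close: "\<bar>noise N (Suc ?K) w - noise N (level_index z N) w\<bar> < c / 2" by (simp add: \<gamma>_def)
        have "- (c / 2) \<le> sqrt (real N) * gap \<beta> N ?K" using n4 K z by blast
        then have "noise N (Suc ?K) w < c / 2" using st by linarith
        then have "noise N (level_index z N) w < c" using close by linarith
        then have "noise N (level_index z N) w < 0" using g1[OF z(1)] by linarith
        then show ?thesis using z by (auto simp: negative_levels_def)
      qed
      have finJ: "finite ?J" using F by (simp add: negative_levels_def)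
      show ?thesis
      proof (intro conjI impI)
        assume ne: "?J \<noteq> {}"
        let ?m = "Min ?J"
        have m: "?m \<in> ?J" using finJ ne by simp
        then have mF: "?m \<in> ?F" "noise N (level_index ?m N) w < 0" by (auto simp: negative_levels_def)
        then have "noise N (level_index ?m N) w < - c" using g1[OF mF(1)] by linarith
        then have "noise N (Suc (nat \<lfloor>?m * real N\<rfloor>)) w < - (sqrt (real N) * gap \<beta> N (nat \<lfloor>?m * real N\<rfloor>))"
          using n5 mF(1) by (force simp: level_index_def)
        then have "hazard \<beta> N (nat \<lfloor>?m * real N\<rfloor>) < renyi_sum N (Suc (nat \<lfloor>?m * real N\<rfloor>)) (X w)"
          using stop_condition_iff[OF N] by blast
        then have "?K \<le> nat \<lfloor>?m * real N\<rfloor>" unfolding stopped_def stop_index_def by (intro Least_le) simp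
        then have K1: "real ?K \<le> ?m * real N"
        proof -
          have "real (nat \<lfloor>?m * real N\<rfloor>) \<le> ?m * real N" using Fz(3)[OF mF(1)] by (intro of_nat_floor) simp
          then show ?thesis using \<open>?K \<le> nat \<lfloor>?m * real N\<rfloor>\<close> by linarith
        qed
        also have "\<dots> \<le> b * real N" using Fz(2)[OF mF(1)] by (intro mult_right_mono) auto
        finally obtain z where z: "z \<in> ?J" "\<bar>real ?K / real N - z\<bar> < \<delta>'" using found by blast
        have "?m \<le> z" using finJ z(1) by simp
        moreover have "real ?K / real N \<le> ?m" using K1 N by (simp add: field_simps)
        ultimately show "\<bar>real ?K / real N - ?m\<bar> \<le> \<delta>" using z(2) \<delta>'(2) by linarith
      next
        assume "?J = {}"
        then show "b * real N < real ?K" using found by (force simp: not_le[symmetric])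
      qed
    qed
    ultimately show "\<exists>G\<in>events. prob (space M - G) \<le> \<eta> \<and> (\<forall>w\<in>G.
      (negative_levels b N w \<noteq> {} \<longrightarrow> \<bar>real (stopped N w) / real N - Min (negative_levels b N w)\<bar> \<le> \<delta>) \<and>
      (negative_levels b N w = {} \<longrightarrow> b * real N < real (stopped N w)))"
      using m1 mB m3 by (intro bexI[of _ "space M - ?B"]) auto
  qed
qed

text \<open>
  Take \<open>t\<close> with negative drift slightly to the right of \<open>z*\<close>. There the barrier, at scale \<open>sqrt N\<close>, lies
  above any level that the noise stays below, so the walk has stopped by \<open>t * N\<close>.
\<close>

lemma stopped_crosses:
  assumes z: "z_star \<beta> < 1" and d: "0 < \<delta>" and \<eta>: "0 < \<eta>"
  shows "\<forall>\<^sub>F N in sequentially. \<P>(w in M. z_star \<beta> + \<delta> \<le> real (stopped N w) / real N) \<le> \<eta>"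
proof -
  let ?z = "z_star \<beta>"
  have z0: "0 \<le> ?z" "ereal ?z < conv_radius \<beta>" using z_star_nonneg[OF nonneg] z_star_radius[OF nonneg z] by auto
  obtain \<rho> where r: "?z < \<rho>" "\<rho> < 1" "ereal \<rho> < conv_radius \<beta>"
    using pos_radius_between[OF nonneg z0(1) z z0(2)] .
  have "?z < min (?z + \<delta>) \<rho>" "min (?z + \<delta>) \<rho> \<le> 1" using r d by auto
  from z_star_right[OF nonneg this] obtain t where t: "?z < t" "t < min (?z + \<delta>) \<rho>" "drift \<beta> t < 0" by blast
  have t1: "0 \<le> t" "t < 1" "t < ?z + \<delta>" using t z0 r by auto
  have tr: "ereal t < conv_radius \<beta>" using t r(3) by (auto intro: less_trans[OF _ r(3)])
  \<comment> \<open>The drift at \<open>t\<close> is \<open>- e\<close>.\<close>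
  define e where "e = - (series_der \<beta> t + ln (1 - t))"
  have e: "0 < e" using t(3) drift_finite[OF nonneg t1(1) tr] by (simp add: e_def)
  obtain L where L: "0 < L" "\<And>N. 0 < N \<Longrightarrow> \<P>(w in M. \<exists>n. n \<le> level_index t N \<and> L \<le> \<bar>noise N n w\<bar>) \<le> \<eta>"
    using noise_bounded[OF t1(1,2) \<eta>] by auto
  have "series_der \<beta> t + ln (1 - t) \<le> - e" by (simp add: e_def)
  from scaled_gap_at_level[OF nonneg radius zero t1(1,2) tr this zero_less_one] eventually_large(2)[OF e, of "L + 1"] eventually_gt_at_top[of 0]
  have "\<forall>\<^sub>F N in sequentially. sqrt (real N) * gap \<beta> N (nat \<lfloor>t * real N\<rfloor>) \<le> - L \<and> 0 < N"
    by eventually_elim linarith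
  then show ?thesis
  proof eventually_elim
    fix N assume N: "sqrt (real N) * gap \<beta> N (nat \<lfloor>t * real N\<rfloor>) \<le> - L \<and> 0 < N"
    then have N0: "0 < N" by simp
    have "\<P>(w in M. ?z + \<delta> \<le> real (stopped N w) / real N) \<le> \<P>(w in M. \<exists>n. n \<le> level_index t N \<and> L \<le> \<bar>noise N n w\<bar>)"
    proof (rule finite_measure_mono, safe)
      fix w assume K: "?z + \<delta> \<le> real (stopped N w) / real N"
      show "\<exists>n\<le>level_index t N. L \<le> \<bar>noise N n w\<bar>"
      proof (rule ccontr)
        assume "\<not> ?thesis"
        then have "noise N (level_index t N) w < L" by (force simp: not_le)
        then have "noise N (Suc (nat \<lfloor>t * real N\<rfloor>)) w < - (sqrt (real N) * gap \<beta> N (nat \<lfloor>t * real N\<rfloor>))"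
          using N by (simp add: level_index_def)
        then have "hazard \<beta> N (nat \<lfloor>t * real N\<rfloor>) < renyi_sum N (Suc (nat \<lfloor>t * real N\<rfloor>)) (X w)"
          using stop_condition_iff[OF N0] by blast
        then have "stopped N w \<le> nat \<lfloor>t * real N\<rfloor>" unfolding stopped_def stop_index_def by (intro Least_le) simp
        then have "real (stopped N w) \<le> t * real N" using level_index_bounds(2)[OF t1(1), of N] by (simp add: level_index_def)
        then have "real (stopped N w) / real N \<le> t" using N0 by (simp add: field_simps)
        then show False using K t1 by linarith
      qed
    qed measurable
    also have "\<dots> \<le> \<eta>" by (rule L(2)[OF N0])
    finally show "\<P>(w in M. ?z + \<delta> \<le> real (stopped N w) / real N) \<le> \<eta>" .
  qed
qed

lemma Z_limit_lower:
  assumes "b < z_star \<beta>" and e: "{z\<in>zeros_upto b. w (bm_time z) < 0} = {}"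
  shows "b \<le> Z_limit \<beta> w"
  unfolding Z_limit_def
proof (rule cInf_greatest)
  fix x assume "x \<in> insert (z_star \<beta>) {z \<in> zero_set \<beta>. w (z / (1 - z)) < 0}"
  then consider "x = z_star \<beta>" | "x \<in> zero_set \<beta>" "w (bm_time x) < 0" by (auto simp: bm_time_def)
  then show "b \<le> x"
  proof cases
    case 2
    show ?thesis
    proof (rule ccontr)
      assume "\<not> b \<le> x"
      then have "x \<in> {z\<in>zeros_upto b. w (bm_time z) < 0}" using 2 by (simp add: zeros_upto_def)
      then show False using e by blast
    qed
  qed (use assms in simp)
qed simp

text \<open>
  Only finitely many zeros lie below \<open>b\<close>, so the infimum is attained.
\<close>

lemma Z_limit_eq_Min:
  assumes b: "b < z_star \<beta>" and ne: "{z\<in>zeros_upto b. w (bm_time z) < 0} \<noteq> {}"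
  shows "Z_limit \<beta> w = Min {z\<in>zeros_upto b. w (bm_time z) < 0}"
  unfolding Z_limit_def
proof (rule cInf_eq_minimum)
  let ?A = "{z\<in>zeros_upto b. w (bm_time z) < 0}"
  have b1: "b < 1" using b z_star_le_1[where \<beta>=\<beta>, OF nonneg] by simp
  have fin: "finite ?A" using zeros_upto_props(1)[OF b1] by simp
  then have m: "Min ?A \<in> ?A" using ne by (rule Min_in)
  then show "Min ?A \<in> insert (z_star \<beta>) {z \<in> zero_set \<beta>. w (z / (1 - z)) < 0}" by (simp add: zeros_upto_def bm_time_def)
  have mb: "Min ?A \<le> b" using m by (simp add: zeros_upto_def)
  fix x assume "x \<in> insert (z_star \<beta>) {z \<in> zero_set \<beta>. w (z / (1 - z)) < 0}"
  then consider "x = z_star \<beta>" | "x \<in> zero_set \<beta>" "w (bm_time x) < 0" by (auto simp: bm_time_def)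
  then show "Min ?A \<le> x"
  proof cases
    case 2
    show ?thesis
    proof (cases "x \<le> b")
      case True
      then have "x \<in> ?A" using 2 by (simp add: zeros_upto_def)
      then show ?thesis using fin by (rule Min_le[rotated])
    qed (use mb in simp)
  qed (use mb b in simp)
qed

abbreviation Z :: "'b \<Rightarrow> real" where "Z w \<equiv> Z_limit \<beta> (\<lambda>t. W t w)"

lemma Z_limit_no_negative: "{z\<in>zero_set \<beta>. w (bm_time z) < 0} = {} \<Longrightarrow> Z_limit \<beta> w = z_star \<beta>"
proof -
  assume "{z\<in>zero_set \<beta>. w (bm_time z) < 0} = {}"
  then have "{z\<in>zero_set \<beta>. w (z / (1 - z)) < 0} = {}" by (simp add: bm_time_def)
  then show ?thesis unfolding Z_limit_def by (simp only: cInf_singleton)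
qed

lemma W_rv: "z \<in> zero_set \<beta> \<Longrightarrow> W (bm_time z) \<in> borel_measurable MW"
  using zprops(1,3)[OF nonneg radius zero, of z] bm_time_pos[of z] by (intro bm_rv[OF bm]) simp

lemma Z_rv[measurable]: "Z \<in> borel_measurable MW"
proof -
  let ?I = "insert (z_star \<beta>) (zero_set \<beta>)"
  let ?f = "\<lambda>z w. if z \<in> zero_set \<beta> \<and> W (bm_time z) w < 0 then z else z_star \<beta>"
  have "countable ?I" using countable_zeros[OF nonneg radius zero] by simp
  moreover have "?f z \<in> borel_measurable MW" for z
  proof (cases "z \<in> zero_set \<beta>")
    case True
    note [measurable] = W_rv[OF True]
    show ?thesis by measurable
  qed simp
  moreover have bdd: "bdd_below ((\<lambda>z. ?f z w) ` ?I)" for w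
    using zprops(1)[OF nonneg radius zero] z_star_nonneg[OF nonneg] by (intro bdd_belowI2[of _ 0]) (auto intro: less_imp_le)
  ultimately have "(\<lambda>w. INF z\<in>?I. ?f z w) \<in> borel_measurable MW"
    by (intro borel_measurable_cINF) auto
  moreover have "(INF z\<in>?I. ?f z w) = Z w" for w
  proof -
    have "z_star \<beta> \<notin> zero_set \<beta>" by (simp add: zero_set_def)
    then have "(\<lambda>z. ?f z w) ` ?I = insert (z_star \<beta>) {z \<in> zero_set \<beta>. W (z / (1 - z)) w < 0}"
      by (auto simp: bm_time_def image_iff)
    then show ?thesis by (simp add: Z_limit_def)
  qed
  ultimately show ?thesis by simp
qed

lemma negative_levels_eq_event:
  assumes b: "b < 1"
  shows "{w\<in>space M. negative_levels b N w = G} \<in> events"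
proof -
  let ?F = "zeros_upto b"
  have F: "finite ?F" using zeros_upto_props b by auto
  have "{w\<in>space M. negative_levels b N w = G} = (if G \<subseteq> ?F then {w\<in>space M. \<forall>z\<in>?F. (noise N (level_index z N) w < 0) = (z \<in> G)} else {})"
    by (auto simp: negative_levels_def)
  moreover have "{w\<in>space M. \<forall>z\<in>?F. (noise N (level_index z N) w < 0) = (z \<in> G)} \<in> events"
    using F by measurable
  ultimately show ?thesis by simp
qed

text \<open>
  The subsets of \<open>zeros_upto b\<close> are finitely many, so it suffices to treat one pattern of signs.
  Brownian motion starts from zero only almost surely, whence the passage from increments to
  values.
\<close>

lemma negative_levels_conv:
  assumes b: "b < 1"
  shows "(\<lambda>N. \<P>(w in M. negative_levels b N w \<in> \<G>)) \<longlonglongrightarrow>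
    \<P>(w in MW. {z\<in>zeros_upto b. W (bm_time z) w < 0} \<in> \<G>)"
proof -
  let ?F = "zeros_upto b"
  have F: "finite ?F" "?F \<subseteq> {0<..<1}" using zeros_upto_props b by auto
  let ?\<G> = "\<G> \<inter> Pow ?F"
  have finG: "finite ?\<G>" using F by simp
  have FW: "z \<in> zero_set \<beta>" if "z \<in> ?F" for z using that by (simp add: zeros_upto_def)
  have one: "(\<lambda>N. \<P>(w in M. negative_levels b N w = G)) \<longlonglongrightarrow> \<P>(w in MW. {z\<in>?F. W (bm_time z) w - W 0 w < 0} = G)" for G
    unfolding negative_levels_def
  proof (rule noise_levels_conv[OF bm exp_seq_axioms F, where c=0])
    show "{x::real. x < 0} \<in> sets borel" by measurable
    fix x :: real assume x: "x \<noteq> 0"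
    show "\<forall>\<^sub>F y in nhds x. (y < 0) = (x < 0)"
    proof (cases "x < 0")
      case True
      then have "\<forall>\<^sub>F y in nhds x. y \<in> {..<0}" by (intro eventually_nhds_in_open) auto
      then show ?thesis using True by (auto elim!: eventually_mono)
    next
      case False
      then have "\<forall>\<^sub>F y in nhds x. y \<in> {0<..}" using x by (intro eventually_nhds_in_open) auto
      then show ?thesis using False by (auto elim!: eventually_mono)
    qed
  qed
  note evM = negative_levels_eq_event[OF b]
  have rv0: "W 0 \<in> borel_measurable MW" by (rule bm_rv[OF bm]) simp
  have evW: "{w\<in>space MW. {z\<in>?F. W (bm_time z) w - W 0 w < 0} = G} \<in> MW.events" "{w\<in>space MW. {z\<in>?F. W (bm_time z) w < 0} = G} \<in> MW.events" for G
  proof -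
    have m: "{w\<in>space MW. \<forall>z\<in>?F. (f z w < 0) = (z \<in> G)} \<in> MW.events" if "\<And>z. z \<in> ?F \<Longrightarrow> f z \<in> borel_measurable MW" for f :: "real \<Rightarrow> 'b \<Rightarrow> real"
    proof -
      have "Measurable.pred MW (\<lambda>w. \<forall>z\<in>?F. (f z w < 0) = (z \<in> G))"
      proof (rule pred_intros_finite(3)[OF F(1)] )
        fix z assume "z \<in> ?F"
        note [measurable] = that[OF this]
        show "Measurable.pred MW (\<lambda>w. (f z w < 0) = (z \<in> G))" by measurable
      qed
      then show ?thesis by (simp add: pred_def)
    qed
    have e: "{w\<in>space MW. {z\<in>?F. f z w < 0} = G} = (if G \<subseteq> ?F then {w\<in>space MW. \<forall>z\<in>?F. (f z w < 0) = (z \<in> G)} else {})" for f :: "real \<Rightarrow> 'b \<Rightarrow> real"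
      by auto
    show "{w\<in>space MW. {z\<in>?F. W (bm_time z) w - W 0 w < 0} = G} \<in> MW.events"
      unfolding e[of "\<lambda>z w. W (bm_time z) w - W 0 w"] using m[of "\<lambda>z w. W (bm_time z) w - W 0 w"] W_rv FW rv0 by auto
    show "{w\<in>space MW. {z\<in>?F. W (bm_time z) w < 0} = G} \<in> MW.events"
      unfolding e[of "\<lambda>z w. W (bm_time z) w"] using m[of "\<lambda>z w. W (bm_time z) w"] W_rv FW by auto
  qed
  have ae: "\<P>(w in MW. {z\<in>?F. W (bm_time z) w - W 0 w < 0} = G) = \<P>(w in MW. {z\<in>?F. W (bm_time z) w < 0} = G)" for G
    using evW bm_start[OF bm] by (intro MW.finite_measure_eq_AE) (auto elim!: eventually_mono)
  have sumM: "\<P>(w in M. negative_levels b N w \<in> \<G>) = (\<Sum>G\<in>?\<G>. \<P>(w in M. negative_levels b N w = G))" for N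
  proof -
    have "{w\<in>space M. negative_levels b N w \<in> \<G>} = (\<Union>G\<in>?\<G>. {w\<in>space M. negative_levels b N w = G})"
      by (auto simp: negative_levels_def)
    then show ?thesis using finG evM by (simp only:) (intro finite_measure_finite_Union, auto simp: disjoint_family_on_def)
  qed
  have sumW: "\<P>(w in MW. {z\<in>?F. W (bm_time z) w < 0} \<in> \<G>) = (\<Sum>G\<in>?\<G>. \<P>(w in MW. {z\<in>?F. W (bm_time z) w < 0} = G))"
  proof -
    have "{w\<in>space MW. {z\<in>?F. W (bm_time z) w < 0} \<in> \<G>} = (\<Union>G\<in>?\<G>. {w\<in>space MW. {z\<in>?F. W (bm_time z) w < 0} = G})"
      by auto
    then show ?thesis using finG evW by (simp only:) (intro MW.finite_measure_finite_Union, auto simp: disjoint_family_on_def)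
  qed
  show ?thesis unfolding sumM sumW ae[symmetric] by (intro tendsto_sum one)
qed

lemma negative_levels_event:
  assumes b: "b < 1"
  shows "{w\<in>space M. negative_levels b N w \<in> \<G>} \<in> events"
proof -
  have "{w\<in>space M. negative_levels b N w \<in> \<G>} = (\<Union>G\<in>\<G> \<inter> Pow (zeros_upto b). {w\<in>space M. negative_levels b N w = G})"
    by (auto simp: negative_levels_def)
  moreover have "finite (\<G> \<inter> Pow (zeros_upto b))" using zeros_upto_props(1)[OF b] by simp
  ultimately show ?thesis using negative_levels_eq_event[OF b] by (simp only:) (intro sets.finite_UN, auto)
qed

text \<open>
  For a level \<open>b\<close> between \<open>z\<close> and \<open>z*\<close>, both \<open>Z = z\<close> and stopping near \<open>z\<close> mean that \<open>z\<close> is the first zero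
  with a negative sign; the signs converge in law.
\<close>

lemma stopped_near_zero:
  assumes z: "z \<in> zero_set \<beta>"
  shows "\<exists>\<delta>0>0. \<forall>\<delta>. 0 < \<delta> \<longrightarrow> \<delta> < \<delta>0 \<longrightarrow>
    (\<lambda>N. \<P>(w in M. \<bar>real (stopped N w) / real N - z\<bar> < \<delta>)) \<longlonglongrightarrow> \<P>(w in MW. Z w = z)"
proof -
  define b where "b = (z + z_star \<beta>) / 2"
  have b: "z < b" "b < z_star \<beta>" using zprops(2)[OF nonneg radius zero z] by (auto simp: b_def)
  have b1: "b < 1" using b z_star_le_1[where \<beta>=\<beta>, OF nonneg] by simp
  let ?F = "zeros_upto b"
  have F: "finite ?F" using zeros_upto_props b1 by auto
  have zF: "z \<in> ?F" using z b by (simp add: zeros_upto_def)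
  define \<delta>0 where "\<delta>0 = Min (insert (b - z) ((\<lambda>x. \<bar>x - z\<bar> / 2) ` (?F - {z})))"
  have fin: "finite (insert (b - z) ((\<lambda>x. \<bar>x - z\<bar> / 2) ` (?F - {z})))" using F by simp
  have d0: "0 < \<delta>0" unfolding \<delta>0_def using fin b by (subst Min_gr_iff) auto
  have d1: "\<delta>0 \<le> b - z" unfolding \<delta>0_def by (rule Min_le[OF fin]) simp
  have d2: "\<delta>0 \<le> \<bar>x - z\<bar> / 2" if "x \<in> ?F" "x \<noteq> z" for x
    unfolding \<delta>0_def using that by (intro Min_le[OF fin]) auto
  define \<G> where "\<G> = {G :: real set. G \<noteq> {} \<and> Min G = z}"
  have ZG: "Z w = z \<longleftrightarrow> {z\<in>?F. W (bm_time z) w < 0} \<in> \<G>" for w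
  proof (cases "{z\<in>?F. W (bm_time z) w < 0} = {}")
    case True
    from Z_limit_lower[OF b(2), of "\<lambda>t. W t w", OF this] b(1) True show ?thesis unfolding \<G>_def by auto
  next
    case False
    from Z_limit_eq_Min[OF b(2), of "\<lambda>t. W t w", OF this] False show ?thesis unfolding \<G>_def by auto
  qed
  have "(\<lambda>N. \<P>(w in M. \<bar>real (stopped N w) / real N - z\<bar> < \<delta>)) \<longlonglongrightarrow> \<P>(w in MW. Z w = z)"
    if \<delta>: "0 < \<delta>" "\<delta> < \<delta>0" for \<delta>
  proof -
    let ?A = "\<lambda>N. {w\<in>space M. \<bar>real (stopped N w) / real N - z\<bar> < \<delta>}"
    let ?B = "\<lambda>N. {w\<in>space M. negative_levels b N w \<in> \<G>}"
    have lim: "(\<lambda>N. prob (?B N)) \<longlonglongrightarrow> \<P>(w in MW. Z w = z)"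
      unfolding ZG by (rule negative_levels_conv[OF b1])
    have "(\<lambda>N. prob (?A N) - prob (?B N)) \<longlonglongrightarrow> 0"
    proof (rule LIMSEQ_I)
      fix r :: real assume r: "0 < r"
      then have "0 < r / 2" "0 < \<delta> / 2" using \<delta> by auto
      from stopped_stays[OF b(2) this(2,1)]
      have "\<forall>\<^sub>F N in sequentially. norm (prob (?A N) - prob (?B N) - 0) < r"
      proof eventually_elim
        case (elim N)
        then obtain G where G: "G \<in> events" "prob (space M - G) \<le> r / 2"
          "\<And>w. w \<in> G \<Longrightarrow> negative_levels b N w \<noteq> {} \<Longrightarrow> \<bar>real (stopped N w) / real N - Min (negative_levels b N w)\<bar> \<le> \<delta> / 2"
          "\<And>w. w \<in> G \<Longrightarrow> negative_levels b N w = {} \<Longrightarrow> b * real N < real (stopped N w)" by blast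
        have mA: "?A N \<in> events" by measurable
        have mB: "?B N \<in> events" by (rule negative_levels_event[OF b1])
        have iff: "w \<in> ?A N \<longleftrightarrow> w \<in> ?B N" if w: "w \<in> G" for w
        proof -
          have sp: "w \<in> space M" using G(1) w sets.sets_into_space by blast
          show ?thesis
          proof (cases "negative_levels b N w = {}")
            case True
            have "b \<le> real (stopped N w) / real N \<or> N = 0"
              using G(4)[OF w True] by (cases "N = 0") (auto simp: field_simps)
            moreover have "N \<noteq> 0"
            proof
              assume "N = 0"
              then show False using G(4)[OF w True] stop_index_le[of "hazard \<beta> 0" 0 "X w"] by (simp add: stopped_def)
            qed
            ultimately have "b \<le> real (stopped N w) / real N" by simp
            then have "w \<notin> ?A N" using \<delta> d1 by auto
            then show ?thesis using True by (simp add: \<G>_def)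
          next
            case False
            have finJ: "finite (negative_levels b N w)" using F by (simp add: negative_levels_def)
            then have "Min (negative_levels b N w) \<in> negative_levels b N w" using False by simp
            then have mF: "Min (negative_levels b N w) \<in> ?F" by (simp add: negative_levels_def)
            have close: "\<bar>real (stopped N w) / real N - Min (negative_levels b N w)\<bar> \<le> \<delta> / 2" by (rule G(3)[OF w False])
            show ?thesis
            proof
              assume "w \<in> ?A N"
              then have "\<bar>real (stopped N w) / real N - z\<bar> < \<delta>" by simp
              then have "\<bar>Min (negative_levels b N w) - z\<bar> < 2 * \<delta>0" using close \<delta> by linarith
              then have "Min (negative_levels b N w) = z" using d2[OF mF] by fastforce
              then show "w \<in> ?B N" using False sp by (simp add: \<G>_def)
            next
              assume "w \<in> ?B N"
              then have "Min (negative_levels b N w) = z" by (simp add: \<G>_def)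
              then show "w \<in> ?A N" using close \<delta> sp by auto
            qed
          qed
        qed
        have sub: "?A N \<subseteq> ?B N \<union> (space M - G)" "?B N \<subseteq> ?A N \<union> (space M - G)" using iff by blast+
        have "prob (?A N) \<le> prob (?B N \<union> (space M - G))" "prob (?B N) \<le> prob (?A N \<union> (space M - G))"
          using sub mA mB G(1) by (auto intro!: finite_measure_mono)
        moreover have "prob (?B N \<union> (space M - G)) \<le> prob (?B N) + prob (space M - G)" "prob (?A N \<union> (space M - G)) \<le> prob (?A N) + prob (space M - G)"
          using mA mB G(1) by (auto intro!: measure_Un_le)
        ultimately show "norm (prob (?A N) - prob (?B N) - 0) < r" using G(2) r by (simp add: abs_less_iff)
      qed
      then show "\<exists>no. \<forall>n\<ge>no. norm (prob (?A n) - prob (?B n) - 0) < r" by (simp add: eventually_sequentially)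
    qed
    from tendsto_add[OF this lim] show ?thesis by simp
  qed
  then show ?thesis using d0 by blast
qed

lemma stopped_elsewhere:
  assumes b: "b < z_star \<beta>" and \<delta>: "0 < \<delta>"
  shows "(\<lambda>N. \<P>(w in M. real (stopped N w) / real N \<le> b \<and> (\<forall>z\<in>zeros_upto b. \<delta> \<le> \<bar>real (stopped N w) / real N - z\<bar>))) \<longlonglongrightarrow> 0"
proof (rule LIMSEQ_I)
  fix r :: real assume r: "0 < r"
  have b1: "b < 1" using b z_star_le_1[where \<beta>=\<beta>, OF nonneg] by simp
  have F: "finite (zeros_upto b)" using zeros_upto_props b1 by auto
  let ?A = "\<lambda>N. {w\<in>space M. real (stopped N w) / real N \<le> b \<and> (\<forall>z\<in>zeros_upto b. \<delta> \<le> \<bar>real (stopped N w) / real N - z\<bar>)}"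
  from r have "0 < r / 2" "0 < \<delta> / 2" using \<delta> by auto
  from stopped_stays[OF b this(2,1)] eventually_gt_at_top[of 0]
  have "\<forall>\<^sub>F N in sequentially. norm (prob (?A N) - 0) < r"
  proof eventually_elim
    case (elim N)
    then obtain G where G: "G \<in> events" "prob (space M - G) \<le> r / 2"
      "\<And>w. w \<in> G \<Longrightarrow> negative_levels b N w \<noteq> {} \<Longrightarrow> \<bar>real (stopped N w) / real N - Min (negative_levels b N w)\<bar> \<le> \<delta> / 2"
      "\<And>w. w \<in> G \<Longrightarrow> negative_levels b N w = {} \<Longrightarrow> b * real N < real (stopped N w)" by blast
    have "w \<notin> ?A N" if w: "w \<in> G" for w
    proof (cases "negative_levels b N w = {}")
      case True
      then show ?thesis using G(4)[OF w True] elim(2) by (auto simp: field_simps)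
    next
      case False
      have "finite (negative_levels b N w)" using F by (simp add: negative_levels_def)
      then have "Min (negative_levels b N w) \<in> negative_levels b N w" using False by simp
      then have mF: "Min (negative_levels b N w) \<in> zeros_upto b" by (simp add: negative_levels_def)
      show ?thesis
      proof
        assume "w \<in> ?A N"
        then have "\<delta> \<le> \<bar>real (stopped N w) / real N - Min (negative_levels b N w)\<bar>" using mF by blast
        then show False using G(3)[OF w False] \<delta> by linarith
      qed
    qed
    then have "?A N \<subseteq> space M - G" by blast
    then have "prob (?A N) \<le> prob (space M - G)" using G(1) by (intro finite_measure_mono) auto
    then show "norm (prob (?A N) - 0) < r" using G(2) r by simp
  qed
  then show "\<exists>no. \<forall>n\<ge>no. norm (prob (?A n) - 0) < r" by (simp add: eventually_sequentially)
qed

lemma stopped_beyond: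
  assumes z: "z_star \<beta> < 1" and d: "0 < \<delta>"
  shows "(\<lambda>N. \<P>(w in M. z_star \<beta> + \<delta> \<le> real (stopped N w) / real N)) \<longlonglongrightarrow> 0"
proof (rule LIMSEQ_I)
  fix r :: real assume "0 < r"
  then have "0 < r / 2" by simp
  from stopped_crosses[OF z d this]
  have "\<forall>\<^sub>F N in sequentially. norm (\<P>(w in M. z_star \<beta> + \<delta> \<le> real (stopped N w) / real N) - 0) < r"
    by eventually_elim (use \<open>0 < r\<close> in simp)
  then show "\<exists>no. \<forall>n\<ge>no. norm (\<P>(w in M. z_star \<beta> + \<delta> \<le> real (stopped n w) / real n) - 0) < r"
    by (simp add: eventually_sequentially)
qed

end

section \<open>Counting the identified hyperedges\<close>

text \<open>
  The fraction of the \<open>j\<close>-subsets of an \<open>N\<close>-set with at most one element outside a given \<open>k\<close>-subset.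
\<close>

definition reach_frac :: "nat \<Rightarrow> nat \<Rightarrow> nat \<Rightarrow> real" where
  "reach_frac N k j = (real (k choose j) + (if j = 0 then 0 else real (k choose (j - 1)) * real (N - k))) / real (N choose j)"

text \<open>
  The probability that at most one of \<open>j\<close> independent points falls outside a set of measure \<open>t\<close>.
\<close>

definition reach_lim :: "nat \<Rightarrow> real \<Rightarrow> real" where
  "reach_lim j t = t ^ j + real j * t ^ (j - 1) * (1 - t)"

lemma binomial_ratio_bounds:
  assumes "k \<le> m" "i \<le> m" "0 < m"
  shows "(real k / real m) ^ i - (real i)\<^sup>2 / real m \<le> real (k choose i) / real (m choose i)"
    "real (k choose i) / real (m choose i) \<le> (real k / real m) ^ i"
proof -
  have m0: "0 < real m" and c0: "0 < real (m choose i)" using assms by auto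
  show "real (k choose i) / real (m choose i) \<le> (real k / real m) ^ i"
    using binomial_ratio_upper[OF assms(1,2)] m0 c0 by (simp add: power_divide divide_simps mult.commute)
  have tau: "0 \<le> real k / real m" "real k / real m \<le> 1" using assms by auto
  show "(real k / real m) ^ i - (real i)\<^sup>2 / real m \<le> real (k choose i) / real (m choose i)"
  proof (cases "k = 0 \<or> i = 0")
    case True
    then show ?thesis using m0 by (cases "i = 0") (auto simp: power_0_left binomial_eq_0)
  next
    case False
    then have k0: "0 < real k" by simp
    have "(m choose i) * fact i \<le> m ^ i" by (rule binomial_fact_pow)
    then have F: "real (m choose i) * fact i \<le> real m ^ i" by (metis of_nat_fact of_nat_le_iff of_nat_mult of_nat_power)
    have "(real k / real m) ^ (i - 1) * (real i)\<^sup>2 / real m \<le> 1 * (real i)\<^sup>2 / real m"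
      using tau by (intro divide_right_mono mult_right_mono power_le_one) auto
    then have "(real k / real m) ^ i - (real i)\<^sup>2 / real m \<le> (real k / real m) ^ i - (real k / real m) ^ (i - 1) * (real i)\<^sup>2 / real m" by simp
    also have "\<dots> = real k ^ i * (real k - (real i)\<^sup>2) / (real k * real m ^ i)"
      using False k0 m0 by (cases i) (auto simp: power_divide field_simps)
    also have "\<dots> \<le> real k * (fact i * real (k choose i)) / (real k * real m ^ i)"
      using falling_lower[of k i] k0 m0 by (intro divide_right_mono) auto
    also have "\<dots> = fact i * real (k choose i) / real m ^ i" using k0 by simp
    also have "\<dots> \<le> fact i * real (k choose i) / (real (m choose i) * fact i)"
      using F c0 m0 by (intro divide_left_mono mult_pos_pos) auto
    also have "\<dots> = real (k choose i) / real (m choose i)" by simp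
    finally show ?thesis .
  qed
qed

lemma reach_frac_split:
  assumes "0 < j" "j \<le> N"
  shows "reach_frac N k j = real (k choose j) / real (N choose j) +
     real j * (real (N - k) / real N) * (real (k choose (j - 1)) / real ((N - 1) choose (j - 1)))"
proof -
  obtain i where j: "j = Suc i" using assms by (cases j) auto
  obtain m where N: "N = Suc m" using assms by (cases N) auto
  have "real (Suc i) * real (N choose Suc i) = real N * real (m choose i)"
    unfolding N by (metis Suc_times_binomial_eq mult.commute of_nat_mult)
  moreover have "0 < real (N choose Suc i)" "0 < real (m choose i)" "0 < real N" using assms by (auto simp: N j simp del: binomial_Suc_Suc)
  ultimately have "1 / real (N choose Suc i) = real (Suc i) / (real N * real (m choose i))"
    by (simp add: divide_simps del: of_nat_Suc binomial_Suc_Suc)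
  then have "real (k choose i) * real (N - k) * (1 / real (N choose Suc i)) = real (k choose i) * real (N - k) * (real (Suc i) / (real N * real (m choose i)))" by simp
  then show ?thesis unfolding reach_frac_def j N by (simp add: add_divide_distrib mult_ac del: of_nat_Suc binomial_Suc_Suc)
qed

lemma reach_frac_approx:
  assumes "k \<le> N" "j \<le> N" "2 \<le> N"
  shows "\<bar>reach_frac N k j - reach_lim j (real k / real N)\<bar> \<le> ((real j)\<^sup>2 + real j * (2 * (real j)\<^sup>2 + real j)) / real N"
proof (cases "j = 0")
  case True
  then show ?thesis by (simp add: reach_frac_def reach_lim_def)
next
  case False
  let ?t = "real k / real N"
  have N0: "0 < real N" using assms by simp
  have t: "0 \<le> ?t" "?t \<le> 1" using assms by auto
  have a: "\<bar>real (k choose j) / real (N choose j) - ?t ^ j\<bar> \<le> (real j)\<^sup>2 / real N"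
    using binomial_ratio_bounds[of k N j] assms by (simp add: abs_le_iff)
  have d: "real (N - k) / real N = 1 - ?t" using assms by (simp add: of_nat_diff diff_divide_distrib)
  define R where "R = real (k choose (j - 1)) / real ((N - 1) choose (j - 1))"
  have b: "\<bar>(1 - ?t) * (R - ?t ^ (j - 1))\<bar> \<le> (2 * (real j)\<^sup>2 + real j) / real N"
  proof (cases "k = N")
    case True
    then show ?thesis using N0 by simp
  next
    case kN: False
    let ?i = "j - 1" and ?m = "N - 1"
    let ?u = "real k / real ?m"
    have km: "k \<le> ?m" "?i \<le> ?m" "0 < ?m" using kN assms by auto
    have m: "real ?m = real N - 1" using assms by (simp add: of_nat_diff)
    have u: "0 \<le> ?u" "?u \<le> 1" using km by auto
    have ij: "real ?i \<le> real j" by simp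
    have "\<bar>R - ?u ^ ?i\<bar> \<le> (real ?i)\<^sup>2 / real ?m"
      using binomial_ratio_bounds[OF km] by (simp add: R_def abs_le_iff)
    also have "\<dots> \<le> (real j)\<^sup>2 / (real N / 2)"
      using ij km assms by (intro frac_le power_mono) (auto simp: m)
    finally have 1: "\<bar>R - ?u ^ ?i\<bar> \<le> 2 * (real j)\<^sup>2 / real N" by (simp add: mult.commute)
    have "\<bar>?u ^ ?i - ?t ^ ?i\<bar> \<le> real ?i * \<bar>?u - ?t\<bar>"
      using norm_power_diff[of ?u ?t ?i] u t by simp
    also have "\<bar>?u - ?t\<bar> = ?u * (1 / real N)"
    proof -
      have "?u - ?t = ?u * (1 / real N)" using N0 km by (simp add: m divide_simps) (simp add: algebra_simps)
      then show ?thesis using u N0 by (metis abs_of_nonneg mult_nonneg_nonneg zero_le_divide_1_iff less_imp_le)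
    qed
    also have "real ?i * (?u * (1 / real N)) \<le> real j * (1 * (1 / real N))"
      using ij u N0 by (intro mult_mono) auto
    finally have 2: "\<bar>?u ^ ?i - ?t ^ ?i\<bar> \<le> real j / real N" by simp
    have "\<bar>R - ?t ^ ?i\<bar> \<le> 2 * (real j)\<^sup>2 / real N + real j / real N" using 1 2 by linarith
    moreover have "\<bar>(1 - ?t) * (R - ?t ^ ?i)\<bar> \<le> 1 * \<bar>R - ?t ^ ?i\<bar>"
      unfolding abs_mult using t by (intro mult_right_mono) auto
    ultimately show ?thesis by (simp add: add_divide_distrib)
  qed
  define A where "A = real (k choose j) / real (N choose j) - ?t ^ j"
  define B where "B = real j * ((1 - ?t) * (R - ?t ^ (j - 1)))"
  have e: "reach_frac N k j - reach_lim j ?t = A + B"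
  proof -
    have "reach_frac N k j = real (k choose j) / real (N choose j) + real j * (1 - ?t) * R"
      using reach_frac_split[OF _ assms(2), of k] False unfolding d R_def by simp
    moreover have "x + c * (1 - t) * r - (y + c * q * (1 - t)) = (x - y) + c * ((1 - t) * (r - q))" for x y c t r q :: real
      by (simp add: algebra_simps)
    ultimately show ?thesis unfolding reach_lim_def A_def B_def by simp
  qed
  have "\<bar>B\<bar> = real j * \<bar>(1 - ?t) * (R - ?t ^ (j - 1))\<bar>" unfolding B_def by (simp add: abs_mult)
  also have "\<dots> \<le> real j * ((2 * (real j)\<^sup>2 + real j) / real N)" by (rule mult_left_mono[OF b]) simp
  finally have "\<bar>A + B\<bar> \<le> (real j)\<^sup>2 / real N + real j * ((2 * (real j)\<^sup>2 + real j) / real N)"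
    using abs_triangle_ineq[of A B] a unfolding A_def by linarith
  also have "\<dots> = ((real j)\<^sup>2 + real j * (2 * (real j)\<^sup>2 + real j)) / real N" by (subst add_divide_distrib) simp
  finally show ?thesis unfolding e .
qed

text \<open>
  Unlike \<open>reach_frac_approx\<close>, this bound is summable over all sizes \<open>j\<close> against \<open>\<beta> j\<close>.
\<close>

lemma reach_frac_upper:
  assumes "k \<le> N" "j \<le> N" "2 \<le> N" and r: "real k \<le> \<rho> * (real N - 1)" "0 \<le> \<rho>"
  shows "reach_frac N k j \<le> \<rho> ^ j + real j * \<rho> ^ (j - 1)"
proof (cases "j = 0")
  case True
  then show ?thesis by (simp add: reach_frac_def)
next
  case False
  have m: "real (N - 1) = real N - 1" "0 < real N - 1" using assms by (auto simp: of_nat_diff)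
  have kr: "real k / real N \<le> \<rho>"
  proof -
    have "\<rho> * (real N - 1) \<le> \<rho> * real N" using r by (intro mult_left_mono) auto
    then show ?thesis using r m by (simp add: field_simps)
  qed
  have 1: "real (k choose j) / real (N choose j) \<le> \<rho> ^ j"
    using binomial_ratio_bounds(2)[of k N j] power_mono[OF kr, of j] assms by auto
  have 2: "real (N - k) / real N * (real (k choose (j - 1)) / real ((N - 1) choose (j - 1))) \<le> 1 * \<rho> ^ (j - 1)"
  proof (cases "k = N")
    case True
    then show ?thesis using r by simp
  next
    case kN: False
    have "real k / real (N - 1) \<le> \<rho>" using r m by (simp add: field_simps)
    then have "real (k choose (j - 1)) / real ((N - 1) choose (j - 1)) \<le> \<rho> ^ (j - 1)"
    proof -
      have km: "k \<le> N - 1" "j - 1 \<le> N - 1" "0 < N - 1" using assms kN by auto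
      show ?thesis using \<open>real k / real (N - 1) \<le> \<rho>\<close>
        by (intro order_trans[OF binomial_ratio_bounds(2)[OF km]] power_mono) auto
    qed
    then show ?thesis using assms r by (intro mult_mono) auto
  qed
  have "real j * (real (N - k) / real N * (real (k choose (j - 1)) / real ((N - 1) choose (j - 1)))) \<le> real j * \<rho> ^ (j - 1)"
    using mult_left_mono[OF 2, of "real j"] by simp
  then show ?thesis using reach_frac_split[of j N k] False assms 1 by (simp add: mult.assoc)
qed

context poisson_hg
begin

definition Vs :: "'a \<Rightarrow> 'v set" where "Vs w = identifiable_vertices V (L w)"

definition inner_edges :: "nat \<Rightarrow> 'v set \<Rightarrow> 'v set set" where "inner_edges j S = {A\<in>Pow S. card A = j}"

text \<open>
  For \<open>S\<close> the identifiable set, these are the hyperedges about which the identification reveals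
  nothing.
\<close>

definition outer_edges :: "nat \<Rightarrow> 'v set \<Rightarrow> 'v set set" where "outer_edges j S = {A\<in>Pow V. card A = j \<and> 2 \<le> card (A - S)}"

lemma Vs_subset: "Vs w \<subseteq> V" unfolding Vs_def by (rule identifiable_vertices_subset)

lemma Vs_rv[measurable]: "Vs \<in> measurable M (count_space UNIV)"
  unfolding Vs_def[abs_def] by measurable

text \<open>
  A set has no vertex, exactly one vertex, or at least two vertices outside \<open>S\<close>.
\<close>

lemma edges_split:
  assumes "S \<subseteq> V"
  shows "(\<Sum>A\<in>inner_edges j V. f A) = (\<Sum>A\<in>inner_edges j S. f A) + (\<Sum>A\<in>{A\<in>frontier_edges V S. card A = j}. f A) + (\<Sum>A\<in>outer_edges j S. f A :: real)"
proof -
  have finS: "finite S" using assms fin by (rule finite_subset)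
  have fr: "A \<in> frontier_edges V S \<longleftrightarrow> A \<subseteq> V \<and> card (A - S) = 1" for A
  proof
    assume "A \<in> frontier_edges V S"
    then obtain v B where A: "A = insert v B" "v \<in> V" "v \<notin> S" "B \<subseteq> S" by (auto simp: frontier_edges_def)
    then have "A - S = {v}" by auto
    then show "A \<subseteq> V \<and> card (A - S) = 1" using A assms by auto
  next
    assume a: "A \<subseteq> V \<and> card (A - S) = 1"
    then obtain v where v: "A - S = {v}" by (auto simp: card_1_singleton_iff)
    then have "A = insert v (A \<inter> S)" "v \<in> V - S" "A \<inter> S \<in> Pow S" using a by auto
    then show "A \<in> frontier_edges V S" unfolding frontier_edges_def by (intro image_eqI[of _ _ "(v, A \<inter> S)"]) auto
  qed
  have c0: "card (A - S) = 0 \<longleftrightarrow> A \<subseteq> S" if "A \<subseteq> V" for A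
    using that fin finite_subset[of A V] by auto
  have sub0: "card (A - S) = 0" if "A \<subseteq> S" for A
  proof -
    have "A - S = {}" using that by blast
    then show ?thesis by (simp only: card.empty)
  qed
  have tri: "card (A - S) = 0 \<or> card (A - S) = 1 \<or> 2 \<le> card (A - S)" for A by linarith
  have "inner_edges j V = (inner_edges j S \<union> {A\<in>frontier_edges V S. card A = j}) \<union> outer_edges j S"
    unfolding inner_edges_def outer_edges_def fr using tri c0 assms by auto
  moreover have "(inner_edges j S \<union> {A\<in>frontier_edges V S. card A = j}) \<inter> outer_edges j S = {}"
    "inner_edges j S \<inter> {A\<in>frontier_edges V S. card A = j} = {}"
    unfolding inner_edges_def outer_edges_def fr using assms by (auto dest: sub0)
  moreover have "finite (inner_edges j S)" "finite {A\<in>frontier_edges V S. card A = j}" "finite (outer_edges j S)"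
    using fin finS frontier_subset[OF order_refl assms] finite_edges by (auto simp: inner_edges_def outer_edges_def)
  ultimately show ?thesis by (simp add: sum.union_disjoint)
qed

lemma frontier_empty:
  assumes "Vs w = S" "A \<in> frontier_edges V S"
  shows "L w A = 0"
  using assms identifiable_vertices_eq_iff[OF fin Vs_subset[of w], of "L w"]
  by (auto simp: frontier_edges_def Vs_def)

lemma rate_total: "j \<le> N \<Longrightarrow> \<mu> j * real (N choose j) = real N * \<beta> j"
  by (simp add: edge_rate_def)

lemma card_inner: "S \<subseteq> V \<Longrightarrow> card (inner_edges j S) = card S choose j"
  using n_subsets[of S j] fin finite_subset[of S V] by (simp add: inner_edges_def Pow_def)

lemma card_frontier_size:
  assumes "S \<subseteq> V"
  shows "real (card {A\<in>frontier_edges V S. card A = j}) = (if j = 0 then 0 else real (card S choose (j - 1)) * real (N - card S))"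
proof (cases j)
  case 0
  have emp: "{A\<in>frontier_edges V S. card A = 0} = {}"
  proof -
    have "card (insert v B) \<noteq> 0" if "B \<subseteq> S" for v B
      using that assms fin by (metis card_eq_0_iff finite.insertI finite_subset insert_not_empty)
    then show ?thesis by (auto simp: frontier_edges_def)
  qed
  show ?thesis unfolding 0 emp by simp
next
  case (Suc i)
  have finS: "finite S" using assms fin by (rule finite_subset)
  have e: "{A\<in>frontier_edges V S. card A = j} = (\<lambda>(v, B). insert v B) ` ((V - S) \<times> {B\<in>Pow S. card B = i})"
  proof -
    have "card (insert v B) = Suc (card B)" if "v \<in> V - S" "B \<in> Pow S" for v B
      using that finS by (subst card_insert_disjoint) (auto intro: finite_subset)
    then have "{x \<in> (V - S) \<times> Pow S. card (case x of (v, B) \<Rightarrow> insert v B) = j} = (V - S) \<times> {B\<in>Pow S. card B = i}"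
      using Suc by auto
    moreover have "{A\<in>frontier_edges V S. card A = j} = (\<lambda>(v, B). insert v B) ` {x \<in> (V - S) \<times> Pow S. card (case x of (v, B) \<Rightarrow> insert v B) = j}"
      unfolding frontier_edges_def by blast
    ultimately show ?thesis by simp
  qed
  have inj: "inj_on (\<lambda>(v, B). insert v B) ((V - S) \<times> {B\<in>Pow S. card B = i})"
  proof (rule inj_onI, clarsimp)
    fix v B w C assume *: "v \<in> V" "v \<notin> S" "B \<subseteq> S" "w \<in> V" "w \<notin> S" "C \<subseteq> S" "insert v B = insert w C"
    then have "v = w" by blast
    moreover have "B = insert v B \<inter> S" "C = insert w C \<inter> S" using * by auto
    ultimately show "v = w \<and> B = C" using * by metis
  qed
  have "card {A\<in>frontier_edges V S. card A = j} = card (V - S) * (card S choose i)"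
    unfolding e card_image[OF inj] card_cartesian_product using n_subsets[OF finS, of i] by (simp add: Pow_def)
  moreover have "card (V - S) = N - card S" using card_Diff_subset[OF finS assms] card_V by simp
  ultimately show ?thesis using Suc by simp
qed

text \<open>
  In size \<open>j\<close>, the sets with at most one vertex outside \<open>S\<close> are the fraction \<open>reach_frac\<close> of all.
\<close>

lemma outer_mean:
  assumes S: "S \<subseteq> V" and j: "j \<le> N"
  shows "(\<Sum>A\<in>outer_edges j S. \<mu> (card A)) = real N * \<beta> j * (1 - reach_frac N (card S) j)"
proof -
  have "(\<Sum>A\<in>outer_edges j S. \<mu> (card A)) = (\<Sum>A\<in>inner_edges j V. \<mu> (card A)) - (\<Sum>A\<in>inner_edges j S. \<mu> (card A)) - (\<Sum>A\<in>{A\<in>frontier_edges V S. card A = j}. \<mu> (card A))"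
    using edges_split[OF S, of "\<lambda>A. \<mu> (card A)" j] by simp
  also have "(\<Sum>A\<in>inner_edges j V. \<mu> (card A)) = real (N choose j) * \<mu> j"
    using card_inner[of V j] card_V by (simp add: inner_edges_def)
  also have "(\<Sum>A\<in>inner_edges j S. \<mu> (card A)) = real (card S choose j) * \<mu> j"
    using card_inner[OF S, of j] by (simp add: inner_edges_def)
  also have "(\<Sum>A\<in>{A\<in>frontier_edges V S. card A = j}. \<mu> (card A)) = (if j = 0 then 0 else real (card S choose (j - 1)) * real (N - card S)) * \<mu> j"
    using card_frontier_size[OF S, of j] by simp
  also have "real (N choose j) * \<mu> j - real (card S choose j) * \<mu> j - (if j = 0 then 0 else real (card S choose (j - 1)) * real (N - card S)) * \<mu> j
     = \<mu> j * real (N choose j) - \<mu> j * (real (card S choose j) + (if j = 0 then 0 else real (card S choose (j - 1)) * real (N - card S)))"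
    by (simp add: algebra_simps)
  also have "\<dots> = \<mu> j * real (N choose j) * (1 - reach_frac N (card S) j)"
    using j by (simp add: reach_frac_def right_diff_distrib)
  finally show ?thesis unfolding rate_total[OF j] .
qed

text \<open>
  The event \<open>V* = S\<close> is decided by the hyperedges with at most one vertex outside \<open>S\<close>.
\<close>

lemma Vs_eq_function:
  assumes S: "S \<subseteq> V"
  shows "Vs w = S \<longleftrightarrow> (\<lambda>x. identifiable_vertices S x = S \<and> (\<forall>A\<in>frontier_edges V S. x A = 0)) (restrict (L w) (Pow S \<union> frontier_edges V S))"
proof -
  have "identifiable_vertices S (restrict (L w) (Pow S \<union> frontier_edges V S)) = identifiable_vertices S (L w)"
    by (rule identifiable_restrict[OF S]) simp
  then show ?thesis
    unfolding Vs_def identifiable_vertices_eq_iff[OF fin S] by (auto simp: frontier_edges_def)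
qed

lemma outer_disjoint: "(Pow S \<union> frontier_edges V S) \<inter> outer_edges j S = {}" if "S \<subseteq> V"
proof -
  have "A \<notin> outer_edges j S" if "A \<in> Pow S \<union> frontier_edges V S" for A
  proof
    assume "A \<in> outer_edges j S"
    then have "2 \<le> card (A - S)" by (simp add: outer_edges_def)
    moreover have "card (A - S) \<le> 1"
    proof (cases "A \<in> Pow S")
      case True then have "A - S = {}" by auto
      then show ?thesis by (metis card.empty zero_le_one)
    next
      case False
      then have "A \<in> frontier_edges V S" using that by blast
      then obtain v B where "A = insert v B" "B \<subseteq> S" unfolding frontier_edges_def by auto
      then have "A - S \<subseteq> {v}" by auto
      then have "card (A - S) \<le> card {v}" by (intro card_mono) auto
      then show ?thesis by simp
    qed
    ultimately show False by simp
  qed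
  then show ?thesis by blast
qed

lemma outer_independent_prob:
  assumes S: "S \<subseteq> V" and O: "\<O> \<subseteq> Pow V" "(Pow S \<union> frontier_edges V S) \<inter> \<O> = {}"
  shows "\<P>(w in M. Vs w = S \<and> q (restrict (L w) \<O>)) = \<P>(w in M. Vs w = S) * \<P>(w in M. q (restrict (L w) \<O>))"
  unfolding Vs_eq_function[OF S]
  by (rule prob_disjoint_blocks[OF _ indep]) (use O S fin frontier_subset[OF order_refl S] in auto)

lemma outer_expectation:
  assumes S: "S \<subseteq> V" and j: "j \<le> N"
  shows "expectation (\<lambda>w. of_bool (Vs w = S) * (\<Sum>A\<in>outer_edges j S. real (L w A))) = \<P>(w in M. Vs w = S) * (real N * \<beta> j * (1 - reach_frac N (card S) j))"
    (is "expectation ?f = _")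
    and "integrable M (\<lambda>w. of_bool (Vs w = S) * (\<Sum>A\<in>outer_edges j S. real (L w A)))"
proof -
  let ?O = "outer_edges j S" and ?I = "Pow S \<union> frontier_edges V S"
  let ?p = "\<lambda>x. identifiable_vertices S x = S \<and> (\<forall>A\<in>frontier_edges V S. x A = 0)"
  have O: "?O \<subseteq> Pow V" "?I \<inter> ?O = {}" using outer_disjoint[OF S] by (auto simp: outer_edges_def)
  have ind: "indep_var borel (\<lambda>w. of_bool (?p (restrict (L w) ?I)) :: real) borel (\<lambda>w. (\<Sum>A\<in>?O. real (restrict (L w) ?O A)))"
    by (rule indep_var_disjoint_blocks[OF _ indep, where f="\<lambda>x. of_bool (?p x)" and g="\<lambda>x. \<Sum>A\<in>?O. real (x A)"])
      (use O S fin frontier_subset[OF order_refl S] in auto)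
  have e1: "of_bool (?p (restrict (L w) ?I)) = (of_bool (Vs w = S) :: real)" for w
    using Vs_eq_function[OF S, of w] by simp
  have e2: "(\<Sum>A\<in>?O. real (restrict (L w) ?O A)) = (\<Sum>A\<in>?O. real (L w A))" for w by (intro sum.cong) auto
  note ind' = ind[unfolded e1 e2]
  have i1: "integrable M (\<lambda>w. of_bool (Vs w = S) :: real)"
    by (intro integrable_const_bound[of _ 1]) auto
  have i2: "integrable M (\<lambda>w. \<Sum>A\<in>?O. real (L w A))"
    using edge_distribution(2) O by (intro Bochner_Integration.integrable_sum) auto
  show "integrable M ?f" by (rule indep_var_integrable[OF ind' i1 i2])
  have "expectation ?f = expectation (\<lambda>w. of_bool (Vs w = S)) * expectation (\<lambda>w. \<Sum>A\<in>?O. real (L w A))"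
    by (rule indep_var_lebesgue_integral[OF ind' i1 i2])
  also have "expectation (\<lambda>w. of_bool (Vs w = S)) = \<P>(w in M. Vs w = S)"
  proof -
    have "expectation (\<lambda>w. of_bool (Vs w = S)) = expectation (\<lambda>w. indicator {w\<in>space M. Vs w = S} w)"
      by (intro Bochner_Integration.integral_cong) (auto simp: indicator_def)
    also have "\<dots> = \<P>(w in M. Vs w = S)" by (simp add: Int_def conj_commute conj_left_commute)
    finally show ?thesis .
  qed
  also have "expectation (\<lambda>w. \<Sum>A\<in>?O. real (L w A)) = (\<Sum>A\<in>?O. \<mu> (card A))"
    using edge_distribution(2,4) O by (subst Bochner_Integration.integral_sum) (auto intro!: sum.cong)
  also have "\<dots> = real N * \<beta> j * (1 - reach_frac N (card S) j)" by (rule outer_mean[OF S j])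
  finally show "expectation ?f = \<P>(w in M. Vs w = S) * (real N * \<beta> j * (1 - reach_frac N (card S) j))" .
qed

lemma Chebyshev_edges:
  assumes O: "\<O> \<subseteq> Pow V" and a: "0 < a"
  shows "\<P>(w in M. a \<le> \<bar>(\<Sum>A\<in>\<O>. real (L w A)) - (\<Sum>A\<in>\<O>. \<mu> (card A))\<bar>) \<le> (\<Sum>A\<in>\<O>. \<mu> (card A)) / a\<^sup>2"
proof -
  have e: "(\<Sum>A\<in>\<O>. expectation (\<lambda>w. real (L w A))) = (\<Sum>A\<in>\<O>. \<mu> (card A))" "(\<Sum>A\<in>\<O>. variance (\<lambda>w. real (L w A))) = (\<Sum>A\<in>\<O>. \<mu> (card A))"
    using O edge_distribution(4,5) by (auto intro!: sum.cong)
  show ?thesis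
    using Chebyshev_indep_sum[OF finite_edges[OF O] indep_real[OF O] _ a] edge_distribution(3) O unfolding e by auto
qed

definition edges_upto :: "nat \<Rightarrow> 'a \<Rightarrow> real" where
  "edges_upto J w = (\<Sum>j\<le>J. \<Sum>A\<in>inner_edges j (Vs w). real (L w A))"

lemma sum_over_sizes:
  fixes f :: "'v set \<Rightarrow> real"
  assumes "\<And>j. finite (F j)" "\<And>j A. A \<in> F j \<Longrightarrow> card A = j" "finite I"
  shows "(\<Sum>j\<in>I. \<Sum>A\<in>F j. f A) = (\<Sum>A\<in>(\<Union>j\<in>I. F j). f A)"
  using assms by (subst sum.UNION_disjoint) (auto, blast)

text \<open>
  The identified hyperedges of size at most \<open>J\<close> are all hyperedges of these sizes minus those with
  at least two vertices outside \<open>V*\<close>. The total is concentrated by Chebyshev's inequality. The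
  subtracted number is treated separately on each event \<open>V* = S\<close>, of which it is independent; the
  bounds obtained are multiples of the probabilities of these events and add up.
\<close>

lemma edges_upto_concentration:
  assumes J: "J \<le> N" and a: "0 < a" and N: "0 < N"
  shows "\<P>(w in M. 2 * a * real N \<le> \<bar>edges_upto J w - (\<Sum>j\<le>J. real N * \<beta> j * reach_frac N (card (Vs w)) j)\<bar>)
    \<le> 2 * (\<Sum>j\<le>J. \<beta> j) / (a\<^sup>2 * real N)"
proof -
  let ?aN = "a * real N"
  have aN: "0 < ?aN" using a N by simp
  define T where "T = (\<Union>j\<in>{..J}. inner_edges j V)"
  define Out where "Out S = (\<Union>j\<in>{..J}. outer_edges j S)" for S
  have T: "T \<subseteq> Pow V" by (auto simp: T_def inner_edges_def)
  have OV: "Out S \<subseteq> Pow V" for S by (auto simp: Out_def outer_edges_def)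
  have fi: "finite (inner_edges j V)" "finite (outer_edges j S)" for j S
    using fin by (auto simp: inner_edges_def outer_edges_def)
  have sT: "(\<Sum>A\<in>T. f A) = (\<Sum>j\<le>J. \<Sum>A\<in>inner_edges j V. f A)" for f :: "'v set \<Rightarrow> real"
    unfolding T_def by (rule sum_over_sizes[symmetric]) (use fi in \<open>auto simp: inner_edges_def\<close>)
  have sO: "(\<Sum>A\<in>Out S. f A) = (\<Sum>j\<le>J. \<Sum>A\<in>outer_edges j S. f A)" for f :: "'v set \<Rightarrow> real" and S
    unfolding Out_def by (rule sum_over_sizes[symmetric]) (use fi in \<open>auto simp: outer_edges_def\<close>)
  have mT: "(\<Sum>A\<in>T. \<mu> (card A)) = (\<Sum>j\<le>J. real N * \<beta> j)"
    unfolding sT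
  proof (rule sum.cong[OF refl])
    fix j assume "j \<in> {..J}"
    then have "j \<le> N" using J by simp
    then show "(\<Sum>A\<in>inner_edges j V. \<mu> (card A)) = real N * \<beta> j"
      using card_inner[of V j] card_V rate_total[of j] by (simp add: inner_edges_def mult.commute)
  qed
  have mO: "(\<Sum>A\<in>Out S. \<mu> (card A)) = (\<Sum>j\<le>J. real N * \<beta> j) - (\<Sum>j\<le>J. real N * \<beta> j * reach_frac N (card S) j)" if "S \<subseteq> V" for S
  proof -
    have "(\<Sum>A\<in>Out S. \<mu> (card A)) = (\<Sum>j\<le>J. real N * \<beta> j * (1 - reach_frac N (card S) j))"
      unfolding sO using J that by (intro sum.cong refl outer_mean) auto
    then show ?thesis by (simp add: right_diff_distrib sum_subtractf)
  qed
  have OT: "(\<Sum>A\<in>Out S. \<mu> (card A)) \<le> (\<Sum>A\<in>T. \<mu> (card A))" for S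
    using fin rate_nonneg by (intro sum_mono2) (auto simp: T_def Out_def inner_edges_def outer_edges_def)
  define B1 where "B1 = {w\<in>space M. ?aN \<le> \<bar>(\<Sum>A\<in>T. real (L w A)) - (\<Sum>A\<in>T. \<mu> (card A))\<bar>}"
  define B2 where "B2 S = {w\<in>space M. Vs w = S \<and> ?aN \<le> \<bar>(\<Sum>A\<in>Out S. real (L w A)) - (\<Sum>A\<in>Out S. \<mu> (card A))\<bar>}" for S
  have msum: "(\<lambda>w. \<Sum>A\<in>\<A>. real (L w A)) \<in> borel_measurable M" if "\<A> \<subseteq> Pow V" for \<A>
    using that by (intro borel_measurable_sum) (auto intro!: measurable_compose[OF rv])
  have m1: "B1 \<in> events" unfolding B1_def using msum[OF T] by measurable
  have m2: "B2 S \<in> events" for S unfolding B2_def using msum[OF OV[of S]] by measurable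
  have mU: "(\<Union>S\<in>Pow V. B2 S) \<in> events" using m2 fin by (intro sets.finite_UN) auto
  have p1: "prob B1 \<le> (\<Sum>j\<le>J. \<beta> j) / (a\<^sup>2 * real N)"
  proof -
    have "prob B1 \<le> (\<Sum>A\<in>T. \<mu> (card A)) / ?aN\<^sup>2" unfolding B1_def by (rule Chebyshev_edges[OF T aN])
    also have "\<dots> = (\<Sum>j\<le>J. \<beta> j) / (a\<^sup>2 * real N)" unfolding mT sum_distrib_left[symmetric] using N by (simp add: power_mult_distrib power2_eq_square)
    finally show ?thesis .
  qed
  have p2: "prob (B2 S) \<le> \<P>(w in M. Vs w = S) * ((\<Sum>j\<le>J. \<beta> j) / (a\<^sup>2 * real N))" if S: "S \<subseteq> V" for S
  proof -
    let ?q = "\<lambda>x. ?aN \<le> \<bar>(\<Sum>A\<in>Out S. real (x A)) - (\<Sum>A\<in>Out S. \<mu> (card A))\<bar>"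
    have r: "?q (restrict (L w) (Out S)) = ?q (L w)" for w by simp
    have "(Pow S \<union> frontier_edges V S) \<inter> Out S = {}" using outer_disjoint[OF S] by (auto simp: Out_def)
    from outer_independent_prob[OF S OV this, of ?q]
    have "prob (B2 S) = \<P>(w in M. Vs w = S) * \<P>(w in M. ?q (L w))" unfolding r B2_def .
    also have "\<P>(w in M. ?q (L w)) \<le> (\<Sum>A\<in>Out S. \<mu> (card A)) / ?aN\<^sup>2" by (rule Chebyshev_edges[OF OV aN])
    also have "\<dots> \<le> (\<Sum>A\<in>T. \<mu> (card A)) / ?aN\<^sup>2" by (intro divide_right_mono OT) simp
    also have "\<dots> = (\<Sum>j\<le>J. \<beta> j) / (a\<^sup>2 * real N)" unfolding mT sum_distrib_left[symmetric] using N by (simp add: power_mult_distrib power2_eq_square)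
    finally show ?thesis by (simp add: mult_left_mono)
  qed
  have sumS: "(\<Sum>S\<in>Pow V. \<P>(w in M. Vs w = S)) = 1"
  proof -
    have "1 = prob (\<Union>S\<in>Pow V. {w\<in>space M. Vs w = S})"
      using Vs_subset by (subst prob_space[symmetric], intro arg_cong[where f=prob]) auto
    also have "\<dots> = (\<Sum>S\<in>Pow V. \<P>(w in M. Vs w = S))"
      using fin by (intro finite_measure_finite_Union) (auto simp: disjoint_family_on_def)
    finally show ?thesis by simp
  qed
  have "{w\<in>space M. 2 * a * real N \<le> \<bar>edges_upto J w - (\<Sum>j\<le>J. real N * \<beta> j * reach_frac N (card (Vs w)) j)\<bar>} \<subseteq> B1 \<union> (\<Union>S\<in>Pow V. B2 S)"
  proof
    fix w assume w: "w \<in> {w\<in>space M. 2 * a * real N \<le> \<bar>edges_upto J w - (\<Sum>j\<le>J. real N * \<beta> j * reach_frac N (card (Vs w)) j)\<bar>}"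
    have split: "(\<Sum>A\<in>T. real (L w A)) = edges_upto J w + (\<Sum>A\<in>Out (Vs w). real (L w A))"
    proof -
      have "(\<Sum>A\<in>inner_edges j V. real (L w A)) = (\<Sum>A\<in>inner_edges j (Vs w). real (L w A)) + (\<Sum>A\<in>outer_edges j (Vs w). real (L w A))" for j
        using edges_split[OF Vs_subset[of w], of "\<lambda>A. real (L w A)" j] frontier_empty[OF refl, of _ w] by simp
      then show ?thesis unfolding sT sO edges_upto_def by (simp add: sum.distrib)
    qed
    show "w \<in> B1 \<union> (\<Union>S\<in>Pow V. B2 S)"
    proof (rule ccontr)
      assume n: "w \<notin> B1 \<union> (\<Union>S\<in>Pow V. B2 S)"
      have "\<bar>(\<Sum>A\<in>T. real (L w A)) - (\<Sum>A\<in>T. \<mu> (card A))\<bar> < ?aN" using n w by (auto simp: B1_def not_le)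
      moreover have "w \<notin> B2 (Vs w)" using n Vs_subset[of w] by blast
      then have "\<bar>(\<Sum>A\<in>Out (Vs w). real (L w A)) - (\<Sum>A\<in>Out (Vs w). \<mu> (card A))\<bar> < ?aN" using w by (auto simp: B2_def not_le)
      ultimately have "\<bar>edges_upto J w - (\<Sum>j\<le>J. real N * \<beta> j * reach_frac N (card (Vs w)) j)\<bar> < 2 * ?aN"
        unfolding split mO[OF Vs_subset[of w]] mT by linarith
      then show False using w by simp
    qed
  qed
  then have "\<P>(w in M. 2 * a * real N \<le> \<bar>edges_upto J w - (\<Sum>j\<le>J. real N * \<beta> j * reach_frac N (card (Vs w)) j)\<bar>) \<le> prob (B1 \<union> (\<Union>S\<in>Pow V. B2 S))"
    using m1 mU by (intro finite_measure_mono sets.Un)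
  also have "\<dots> \<le> prob B1 + prob (\<Union>S\<in>Pow V. B2 S)" using m1 mU by (intro measure_Un_le)
  also have "prob (\<Union>S\<in>Pow V. B2 S) \<le> (\<Sum>S\<in>Pow V. prob (B2 S))" using m2 fin by (intro finite_measure_subadditive_finite) auto
  also have "\<dots> \<le> (\<Sum>S\<in>Pow V. \<P>(w in M. Vs w = S) * ((\<Sum>j\<le>J. \<beta> j) / (a\<^sup>2 * real N)))" by (intro sum_mono p2) auto
  also have "\<dots> = (\<Sum>j\<le>J. \<beta> j) / (a\<^sup>2 * real N)" unfolding sum_distrib_right[symmetric] sumS by simp
  finally show ?thesis using p1 by simp
qed

definition tail_edges :: "nat \<Rightarrow> 'a \<Rightarrow> real" where
  "tail_edges J w = (\<Sum>j\<in>{J<..N}. \<Sum>A\<in>inner_edges j (Vs w). real (L w A))"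

definition found_edges :: "'a \<Rightarrow> real" where
  "found_edges w = real (num_hyperedges V (identifiable_hypergraph V (L w)))"

lemma found_edges_eq: "found_edges w = (\<Sum>A\<in>Pow (Vs w). real (L w A))"
proof -
  have "num_hyperedges V (identifiable_hypergraph V (L w)) = (\<Sum>A\<in>Pow V. if A \<subseteq> Vs w then L w A else 0)"
    by (simp add: num_hyperedges_def identifiable_hypergraph_def Vs_def)
  also have "\<dots> = (\<Sum>A\<in>Pow (Vs w). L w A)"
    using Vs_subset[of w] fin by (intro sum.mono_neutral_cong_right) auto
  finally show ?thesis by (simp add: found_edges_def)
qed

lemma card_Vs_le: "card (Vs w) \<le> N"
  using card_mono[OF fin Vs_subset] card_V by simp

lemma found_edges_split:
  assumes "J \<le> N"
  shows "found_edges w = edges_upto J w + tail_edges J w"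
proof -
  have "finite (Vs w)" by (rule finite_subset[OF Vs_subset fin])
  then have fi: "finite (inner_edges j (Vs w))" for j
    by (simp add: inner_edges_def)
  have e: "Pow (Vs w) = (\<Union>j\<in>{..N}. inner_edges j (Vs w))"
  proof -
    have "card A \<le> N" if "A \<subseteq> Vs w" for A
      using that Vs_subset[of w] card_mono[OF fin, of A] card_V by auto
    then show ?thesis by (auto simp: inner_edges_def)
  qed
  have "found_edges w = (\<Sum>A\<in>(\<Union>j\<in>{..N}. inner_edges j (Vs w)). real (L w A))"
    unfolding found_edges_eq e ..
  also have "\<dots> = (\<Sum>j\<in>{..N}. \<Sum>A\<in>inner_edges j (Vs w). real (L w A))"
    by (rule sum_over_sizes[symmetric]) (use fi in \<open>auto simp: inner_edges_def\<close>)
  also have "{..N} = {..J} \<union> {J<..N}" using assms by auto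
  finally show ?thesis unfolding edges_upto_def tail_edges_def by (subst (asm) sum.union_disjoint) auto
qed

lemma edges_upto_le_found: "J \<le> N \<Longrightarrow> edges_upto J w \<le> found_edges w"
  unfolding found_edges_split tail_edges_def by (simp add: sum_nonneg)

lemma edge_inner_measurable: "(\<lambda>w. \<Sum>A\<in>inner_edges j (Vs w). real (L w A)) \<in> borel_measurable M"
proof -
  have "(\<Sum>A\<in>inner_edges j (Vs w). real (L w A)) = (\<Sum>A\<in>inner_edges j V. of_bool (A \<subseteq> Vs w) * real (L w A))" for w
    using fin Vs_subset[of w] by (intro sum.mono_neutral_cong_left) (auto simp: inner_edges_def)
  moreover have "(\<lambda>w. \<Sum>A\<in>inner_edges j V. of_bool (A \<subseteq> Vs w) * real (L w A)) \<in> borel_measurable M"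
  proof (intro borel_measurable_sum borel_measurable_times)
    fix A assume A: "A \<in> inner_edges j V"
    show "(\<lambda>w. of_bool (A \<subseteq> Vs w) :: real) \<in> borel_measurable M"
      by (rule measurable_compose[OF Vs_rv]) simp
    show "(\<lambda>w. real (L w A)) \<in> borel_measurable M"
      using A by (intro measurable_compose[OF rv]) (auto simp: inner_edges_def)
  qed
  ultimately show ?thesis by simp
qed

lemma edges_upto_measurable[measurable]: "edges_upto J \<in> borel_measurable M"
  unfolding edges_upto_def[abs_def] by (intro borel_measurable_sum edge_inner_measurable)

lemma tail_edges_measurable[measurable]: "tail_edges J \<in> borel_measurable M"
  unfolding tail_edges_def[abs_def] by (intro borel_measurable_sum edge_inner_measurable)

lemma found_edges_measurable[measurable]: "found_edges \<in> borel_measurable M"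
  using found_edges_split[of 0] by (simp add: fun_eq_iff[symmetric] cong: measurable_cong)

text \<open>
  Given all other multiplicities, the indicator of a small identifiable set is a decreasing
  function of the multiplicity of \<open>A\<close>, so the covariance is at most zero (the one-variable case of
  the inequality of Harris). The proof compares with the configuration in which that multiplicity
  is replaced by a constant near its mean.
\<close>

lemma edge_negatively_correlated:
  assumes A: "A \<subseteq> V"
  shows "expectation (\<lambda>w. real (L w A) * of_bool (card (Vs w) \<le> k0)) \<le> \<mu> (card A) * \<P>(w in M. card (Vs w) \<le> k0)"
proof -
  let ?m = "\<mu> (card A)"
  \<comment> \<open>With \<open>n\<close> the mean rounded up, \<open>n \<le> L w A\<close> decides the sign of \<open>L w A\<close> minus the mean.\<close>
  define n where "n = nat \<lceil>?m\<rceil>"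
  let ?R = "Pow V - {A}"
  define g where "g x = (of_bool (card (identifiable_vertices V (x :: 'v set \<Rightarrow> nat)) \<le> k0) :: real)" for x
  have gmono: "g y \<le> g x" if "\<And>B. x B \<le> y B" for x y
  proof -
    have "card (identifiable_vertices V x) \<le> card (identifiable_vertices V y)"
      using identifiable_vertices_mono[OF fin that] identifiable_vertices_subset[of V y] fin by (intro card_mono) (auto intro: finite_subset)
    then show ?thesis by (auto simp: g_def)
  qed
  have gloc: "g ((restrict (L w) ?R)(A := n)) = g ((L w)(A := n))" for w
    unfolding g_def by (subst identifiable_vertices_cong[OF fin, of _ "(L w)(A := n)"]) auto
  let ?g' = "\<lambda>w. g ((L w)(A := n))"
  have pw: "(real (L w A) - ?m) * g (L w) \<le> (real (L w A) - ?m) * ?g' w" for w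
  proof (cases "n \<le> L w A")
    case True
    then have "g (L w) \<le> ?g' w" by (intro gmono) auto
    moreover have "?m \<le> real (L w A)" using True unfolding n_def by linarith
    ultimately show ?thesis by (intro mult_left_mono) auto
  next
    case False
    then have "?g' w \<le> g (L w)" by (intro gmono) auto
    moreover have "real (L w A) \<le> ?m" using False unfolding n_def by linarith
    ultimately show ?thesis by (intro mult_left_mono_neg) auto
  qed
  have ind: "indep_var borel (\<lambda>w. real (restrict (L w) {A} A) - ?m) borel (\<lambda>w. g ((restrict (L w) ?R)(A := n)))"
    by (rule indep_var_disjoint_blocks[OF _ indep, where f="\<lambda>x. real (x A) - ?m" and g="\<lambda>x. g (x(A := n))"]) (use A fin in auto)
  have r: "restrict (L w) {A} A = L w A" for w by simp
  note ind' = ind[unfolded gloc r]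
  have i1: "integrable M (\<lambda>w. real (L w A) - ?m)" using edge_distribution(2)[OF A] by simp
  have i2: "integrable M ?g'" by (intro integrable_const_bound[of _ 1]) (use indep_var_rv2[OF ind'] in \<open>auto simp: g_def\<close>)
  have gVs: "g (L w) = of_bool (card (Vs w) \<le> k0)" for w by (simp add: g_def Vs_def)
  have i3: "integrable M (\<lambda>w. g (L w))" unfolding gVs by (intro integrable_const_bound[of _ 1]) auto
  have i4: "integrable M (\<lambda>w. real (L w A) * g (L w))"
    by (rule Bochner_Integration.integrable_bound[OF edge_distribution(2)[OF A]]) (use rv[OF A] in \<open>auto simp: gVs\<close>)
  have "expectation (\<lambda>w. (real (L w A) - ?m) * g (L w)) \<le> expectation (\<lambda>w. (real (L w A) - ?m) * ?g' w)"
  proof (rule integral_mono)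
    show "integrable M (\<lambda>w. (real (L w A) - ?m) * g (L w))" using i3 i4 by (simp add: left_diff_distrib)
    show "integrable M (\<lambda>w. (real (L w A) - ?m) * ?g' w)" by (rule indep_var_integrable[OF ind' i1 i2])
  qed (rule pw)
  also have "\<dots> = expectation (\<lambda>w. real (L w A) - ?m) * expectation ?g'" by (rule indep_var_lebesgue_integral[OF ind' i1 i2])
  also have "expectation (\<lambda>w. real (L w A) - ?m) = 0" using edge_distribution(2,4)[OF A] by (simp add: prob_space)
  finally have "expectation (\<lambda>w. real (L w A) * g (L w)) \<le> ?m * expectation (\<lambda>w. g (L w))"
    using i3 i4 by (simp add: left_diff_distrib)
  also have "expectation (\<lambda>w. g (L w)) = \<P>(w in M. card (Vs w) \<le> k0)"
  proof -
    have "expectation (\<lambda>w. g (L w)) = expectation (\<lambda>w. indicator {w\<in>space M. card (Vs w) \<le> k0} w)"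
      unfolding gVs by (intro Bochner_Integration.integral_cong) (auto simp: indicator_def)
    also have "\<dots> = \<P>(w in M. card (Vs w) \<le> k0)" by (simp add: Int_def conj_commute conj_left_commute)
    finally show ?thesis .
  qed
  finally show ?thesis by (simp add: gVs)
qed

text \<open>
  On the event \<open>V* = S\<close> the inner hyperedges are all hyperedges minus the outer ones. The first term
  is bounded by the correlation inequality and the second is known by independence, so the
  difference is governed by \<open>reach_frac\<close>.
\<close>

lemma expected_inner_edges:
  assumes j: "j \<le> N" and c: "\<And>k. k \<le> k0 \<Longrightarrow> k \<le> N \<Longrightarrow> reach_frac N k j \<le> c" "0 \<le> c"
  shows "expectation (\<lambda>w. of_bool (card (Vs w) \<le> k0) * (\<Sum>A\<in>inner_edges j (Vs w). real (L w A))) \<le> real N * \<beta> j * c"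
    and "integrable M (\<lambda>w. of_bool (card (Vs w) \<le> k0) * (\<Sum>A\<in>inner_edges j (Vs w). real (L w A)))"
proof -
  let ?b = "\<lambda>w. of_bool (card (Vs w) \<le> k0) :: real"
  let ?T = "\<lambda>w. \<Sum>A\<in>inner_edges j V. real (L w A) * ?b w"
  let ?\<S> = "{S\<in>Pow V. card S \<le> k0}"
  let ?U = "\<lambda>w. \<Sum>S\<in>?\<S>. of_bool (Vs w = S) * (\<Sum>A\<in>outer_edges j S. real (L w A))"
  have finS: "finite ?\<S>" using fin by simp
  have IV: "A \<subseteq> V" "card A = j" if "A \<in> inner_edges j V" for A using that by (auto simp: inner_edges_def)
  have iA: "integrable M (\<lambda>w. real (L w A) * ?b w)" if "A \<in> inner_edges j V" for A
    by (rule Bochner_Integration.integrable_bound[OF edge_distribution(2)[OF IV(1)[OF that]]]) (use rv[OF IV(1)[OF that]] in auto)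
  have iT: "integrable M ?T" by (rule Bochner_Integration.integrable_sum) (rule iA)
  have iU: "integrable M ?U" using outer_expectation(2)[OF _ j] by (intro Bochner_Integration.integrable_sum) auto
  have eq: "?b w * (\<Sum>A\<in>inner_edges j (Vs w). real (L w A)) = ?T w - ?U w" for w
  proof -
    have U: "?U w = ?b w * (\<Sum>A\<in>outer_edges j (Vs w). real (L w A))"
    proof (cases "card (Vs w) \<le> k0")
      case True
      have "?U w = (\<Sum>S\<in>?\<S>. if Vs w = S then (\<Sum>A\<in>outer_edges j S. real (L w A)) else 0)" by (intro sum.cong) auto
      also have "\<dots> = (if Vs w \<in> ?\<S> then (\<Sum>A\<in>outer_edges j (Vs w). real (L w A)) else 0)" by (rule sum.delta'[OF finS])
      finally show ?thesis using True Vs_subset[of w] by simp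
    next
      case False
      have "?U w = (\<Sum>S\<in>?\<S>. 0)" using False by (intro sum.cong) auto
      then show ?thesis using False by simp
    qed
    have "?T w = ?b w * (\<Sum>A\<in>inner_edges j V. real (L w A))" by (simp add: sum_distrib_left mult.commute)
    also have "(\<Sum>A\<in>inner_edges j V. real (L w A)) = (\<Sum>A\<in>inner_edges j (Vs w). real (L w A)) + (\<Sum>A\<in>outer_edges j (Vs w). real (L w A))"
      using edges_split[OF Vs_subset[of w], of "\<lambda>A. real (L w A)" j] frontier_empty[OF refl, of _ w] by simp
    finally show ?thesis unfolding U by (simp add: distrib_left)
  qed
  show "integrable M (\<lambda>w. ?b w * (\<Sum>A\<in>inner_edges j (Vs w). real (L w A)))" unfolding eq using iT iU by simp
  have P: "\<P>(w in M. card (Vs w) \<le> k0) = (\<Sum>S\<in>?\<S>. \<P>(w in M. Vs w = S))"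
  proof -
    have "{w\<in>space M. card (Vs w) \<le> k0} = (\<Union>S\<in>?\<S>. {w\<in>space M. Vs w = S})" using Vs_subset by auto
    then show ?thesis using finS by (simp only:) (intro finite_measure_finite_Union, auto simp: disjoint_family_on_def)
  qed
  have P1: "(\<Sum>S\<in>?\<S>. \<P>(w in M. Vs w = S)) \<le> 1" unfolding P[symmetric] by simp
  have "expectation (\<lambda>w. ?b w * (\<Sum>A\<in>inner_edges j (Vs w). real (L w A))) = expectation ?T - expectation ?U"
    unfolding eq using iT iU by simp
  also have "expectation ?T = (\<Sum>A\<in>inner_edges j V. expectation (\<lambda>w. real (L w A) * ?b w))"
    using iA by (rule Bochner_Integration.integral_sum)
  also have "\<dots> \<le> (\<Sum>A\<in>inner_edges j V. \<mu> j * \<P>(w in M. card (Vs w) \<le> k0))"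
  proof (rule sum_mono)
    fix A assume "A \<in> inner_edges j V"
    then show "expectation (\<lambda>w. real (L w A) * ?b w) \<le> \<mu> j * \<P>(w in M. card (Vs w) \<le> k0)"
      using edge_negatively_correlated[of A k0] IV[of A] by simp
  qed
  also have "\<dots> = real N * \<beta> j * \<P>(w in M. card (Vs w) \<le> k0)"
  proof -
    have c: "card (inner_edges j V) = N choose j" using card_inner[of V j] card_V by simp
    have "real (N choose j) * (\<mu> j * p) = (\<mu> j * real (N choose j)) * p" for p by (simp only: mult_ac)
    then show ?thesis unfolding sum_constant c rate_total[OF j] .
  qed
  also have "expectation ?U = (\<Sum>S\<in>?\<S>. \<P>(w in M. Vs w = S) * (real N * \<beta> j * (1 - reach_frac N (card S) j)))"
    using outer_expectation[OF _ j] by (subst Bochner_Integration.integral_sum) (auto intro!: sum.cong)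
  finally have "expectation (\<lambda>w. ?b w * (\<Sum>A\<in>inner_edges j (Vs w). real (L w A))) \<le>
     real N * \<beta> j * (\<Sum>S\<in>?\<S>. \<P>(w in M. Vs w = S)) - (\<Sum>S\<in>?\<S>. \<P>(w in M. Vs w = S) * (real N * \<beta> j * (1 - reach_frac N (card S) j)))"
    unfolding P by simp
  also have "\<dots> = (\<Sum>S\<in>?\<S>. (real N * \<beta> j) * (\<P>(w in M. Vs w = S) * reach_frac N (card S) j))"
    unfolding sum_distrib_left sum_subtractf[symmetric] by (intro sum.cong refl) (simp add: algebra_simps)
  also have "\<dots> \<le> (\<Sum>S\<in>?\<S>. (real N * \<beta> j) * (\<P>(w in M. Vs w = S) * c))"
    using c beta_nonneg card_mono[OF fin] card_V by (intro sum_mono mult_left_mono) auto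
  also have "\<dots> = (real N * \<beta> j) * ((\<Sum>S\<in>?\<S>. \<P>(w in M. Vs w = S)) * c)"
    by (simp add: sum_distrib_left sum_distrib_right)
  also have "\<dots> \<le> (real N * \<beta> j) * (1 * c)" using P1 c(2) beta_nonneg by (intro mult_left_mono mult_right_mono) auto
  finally show "expectation (\<lambda>w. ?b w * (\<Sum>A\<in>inner_edges j (Vs w). real (L w A))) \<le> real N * \<beta> j * c" by simp
qed

text \<open>
  Markov's inequality for \<open>expected_inner_edges\<close>, summed over the sizes beyond \<open>J\<close>.
\<close>

lemma tail_edges_small:
  assumes N: "2 \<le> N" and r: "0 \<le> \<rho>" "real k0 \<le> \<rho> * (real N - 1)" and a: "0 < a"
  shows "\<P>(w in M. card (Vs w) \<le> k0 \<and> a * real N \<le> tail_edges J w) \<le> (\<Sum>j\<in>{J<..N}. \<beta> j * (\<rho> ^ j + real j * \<rho> ^ (j - 1))) / a"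
proof -
  let ?b = "\<lambda>w. of_bool (card (Vs w) \<le> k0) :: real"
  let ?f = "\<lambda>w. \<Sum>j\<in>{J<..N}. ?b w * (\<Sum>A\<in>inner_edges j (Vs w). real (L w A))"
  have b: "expectation (\<lambda>w. ?b w * (\<Sum>A\<in>inner_edges j (Vs w). real (L w A))) \<le> real N * \<beta> j * (\<rho> ^ j + real j * \<rho> ^ (j - 1))"
    "integrable M (\<lambda>w. ?b w * (\<Sum>A\<in>inner_edges j (Vs w). real (L w A)))" if "j \<in> {J<..N}" for j
  proof -
    have jN: "j \<le> N" using that by simp
    have c: "reach_frac N k j \<le> \<rho> ^ j + real j * \<rho> ^ (j - 1)" if "k \<le> k0" "k \<le> N" for k
      using that r by (intro reach_frac_upper[OF _ jN N]) auto
    have c0: "0 \<le> \<rho> ^ j + real j * \<rho> ^ (j - 1)" using r by simp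
    show "expectation (\<lambda>w. ?b w * (\<Sum>A\<in>inner_edges j (Vs w). real (L w A))) \<le> real N * \<beta> j * (\<rho> ^ j + real j * \<rho> ^ (j - 1))"
      "integrable M (\<lambda>w. ?b w * (\<Sum>A\<in>inner_edges j (Vs w). real (L w A)))"
      by (rule expected_inner_edges[OF jN c c0]; assumption)+
  qed
  have aN: "0 < a * real N" using a N by simp
  have i: "integrable M ?f" using b by (intro Bochner_Integration.integrable_sum) auto
  have "\<P>(w in M. card (Vs w) \<le> k0 \<and> a * real N \<le> tail_edges J w) \<le> \<P>(w in M. a * real N \<le> ?f w)"
  proof (rule finite_measure_mono)
    show "{w\<in>space M. card (Vs w) \<le> k0 \<and> a * real N \<le> tail_edges J w} \<subseteq> {w\<in>space M. a * real N \<le> ?f w}"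
      by (auto simp: tail_edges_def)
    have "?f \<in> borel_measurable M" using i by simp
    then show "{w\<in>space M. a * real N \<le> ?f w} \<in> events" by measurable
  qed
  also have "\<dots> \<le> expectation ?f / (a * real N)"
    by (rule integral_Markov_inequality_measure[where A="{}", OF i]) (use aN in \<open>auto intro!: sum_nonneg mult_nonneg_nonneg\<close>)
  also have "expectation ?f \<le> (\<Sum>j\<in>{J<..N}. real N * \<beta> j * (\<rho> ^ j + real j * \<rho> ^ (j - 1)))"
    using b by (subst Bochner_Integration.integral_sum) (auto intro!: sum_mono)
  then have "expectation ?f / (a * real N) \<le> (\<Sum>j\<in>{J<..N}. real N * \<beta> j * (\<rho> ^ j + real j * \<rho> ^ (j - 1))) / (a * real N)"
    using aN by (intro divide_right_mono) auto
  also have "\<dots> = (\<Sum>j\<in>{J<..N}. \<beta> j * (\<rho> ^ j + real j * \<rho> ^ (j - 1))) / a"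
    using N by (simp add: mult.assoc sum_distrib_left[symmetric])
  finally show ?thesis .
qed

lemma found_edges_upper:
  assumes N: "0 < N" and a: "0 < a"
  shows "\<P>(w in M. ((\<Sum>j\<le>N. \<beta> j) + a) * real N \<le> found_edges w) \<le> (\<Sum>j\<le>N. \<beta> j) / (a\<^sup>2 * real N)"
proof -
  let ?aN = "a * real N"
  have aN: "0 < ?aN" using a N by simp
  have m: "(\<Sum>A\<in>Pow V. \<mu> (card A)) = real N * (\<Sum>j\<le>N. \<beta> j)"
  proof -
    have "(\<Sum>A\<in>Pow V. \<mu> (card A)) = (\<Sum>j\<le>N. real (N choose j) * \<mu> j)" using sum_Pow_card[OF fin, of \<mu>] card_V by simp
    also have "\<dots> = (\<Sum>j\<le>N. real N * \<beta> j)" using rate_total by (intro sum.cong) (auto simp: mult.commute)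
    finally show ?thesis by (simp add: sum_distrib_left)
  qed
  have le: "found_edges w \<le> (\<Sum>A\<in>Pow V. real (L w A))" for w
    unfolding found_edges_eq using fin Vs_subset[of w] by (intro sum_mono2) auto
  have "\<P>(w in M. ((\<Sum>j\<le>N. \<beta> j) + a) * real N \<le> found_edges w) \<le> \<P>(w in M. ?aN \<le> \<bar>(\<Sum>A\<in>Pow V. real (L w A)) - (\<Sum>A\<in>Pow V. \<mu> (card A))\<bar>)"
  proof (rule finite_measure_mono)
    show "{w\<in>space M. ((\<Sum>j\<le>N. \<beta> j) + a) * real N \<le> found_edges w} \<subseteq> {w\<in>space M. ?aN \<le> \<bar>(\<Sum>A\<in>Pow V. real (L w A)) - (\<Sum>A\<in>Pow V. \<mu> (card A))\<bar>}"
    proof safe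
      fix w assume "((\<Sum>j\<le>N. \<beta> j) + a) * real N \<le> found_edges w"
      then show "?aN \<le> \<bar>(\<Sum>A\<in>Pow V. real (L w A)) - (\<Sum>A\<in>Pow V. \<mu> (card A))\<bar>"
        using le[of w] unfolding m by (simp add: algebra_simps)
    qed
    have "(\<lambda>w. \<Sum>A\<in>Pow V. real (L w A)) \<in> borel_measurable M"
      by (intro borel_measurable_sum) (auto intro!: measurable_compose[OF rv])
    then show "{w\<in>space M. ?aN \<le> \<bar>(\<Sum>A\<in>Pow V. real (L w A)) - (\<Sum>A\<in>Pow V. \<mu> (card A))\<bar>} \<in> events" by measurable
  qed
  also have "\<dots> \<le> (\<Sum>A\<in>Pow V. \<mu> (card A)) / ?aN\<^sup>2" by (rule Chebyshev_edges[OF order_refl aN])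
  also have "\<dots> = (\<Sum>j\<le>N. \<beta> j) / (a\<^sup>2 * real N)" unfolding m using N by (simp add: power_mult_distrib power2_eq_square)
  finally show ?thesis .
qed

end

section \<open>Convergence of functionals of the identified fraction\<close>

lemma exp_seq_exists:
  "exp_seq (PiM UNIV (\<lambda>_. density lborel (exponential_density 1))) (\<lambda>i w. w (i::nat))"
proof -
  let ?D = "density lborel (exponential_density 1) :: real measure"
  let ?M = "PiM (UNIV :: nat set) (\<lambda>_. ?D)"
  have D: "prob_space ?D" by (rule prob_space_exponential_density) simp
  interpret prob_space ?M by (rule prob_space_PiM) (rule D)
  have "indep_vars (\<lambda>_. ?D) (\<lambda>i x. x i) UNIV" by (rule indep_vars_PiM_coordinates) (use D in auto)
  then have "indep_vars (\<lambda>_. borel) (\<lambda>i x. x i) UNIV"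
    by (rule indep_vars_compose2[where Y="\<lambda>_ x. x", simplified]) simp
  moreover have "distributed ?M lborel (\<lambda>x. x i) (exponential_density 1)" for i
  proof -
    have "distr ?M lborel (\<lambda>x. x i) = distr ?M ?D (\<lambda>x. x i)" by (rule distr_cong) auto
    also have "\<dots> = ?D" by (rule distr_PiM_component) (use D in auto)
    finally show ?thesis unfolding distributed_def by (auto simp: measurable_component_singleton)
  qed
  ultimately show ?thesis by unfold_locales auto
qed

text \<open>
  Both laws are given by the same formula, and \<open>full_run_prob\<close> solves the recursion that
  characterises \<open>full_prob\<close>.
\<close>

lemma card_identifiable_law:
  assumes "poisson_hg M' V \<beta> L N" "exp_seq M E"
  shows "\<P>(w in M'. card (identifiable_vertices V (L w)) \<in> Q) =
    \<P>(w in M. stop_index (hazard \<beta> N) N (exp_seq.X E w) \<in> Q)"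
proof -
  interpret H: poisson_hg M' V \<beta> L N by fact
  interpret E: exp_seq M E by fact
  have mono: "mono (hazard \<beta> N)" and h0: "0 \<le> hazard \<beta> N 0"
    by (rule hazard_mono hazard_0, rule H.beta_nonneg)+
  note rec = E.full_run_prob_recursion[OF mono h0]
  have [measurable]: "(\<lambda>w. identifiable_vertices V (L w)) \<in> measurable M' (count_space UNIV)" by measurable
  have cN: "card (identifiable_vertices V (L w)) \<le> N" for w
    using H.card_Vs_le by (simp add: H.Vs_def)
  have "{w\<in>space M'. card (identifiable_vertices V (L w)) \<in> Q} = (\<Union>k\<in>Q \<inter> {..N}. {w\<in>space M'. card (identifiable_vertices V (L w)) = k})"
    using cN by auto
  then have "\<P>(w in M'. card (identifiable_vertices V (L w)) \<in> Q) = (\<Sum>k\<in>Q \<inter> {..N}. \<P>(w in M'. card (identifiable_vertices V (L w)) = k))"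
    by (simp only:) (intro H.finite_measure_finite_Union, auto simp: disjoint_family_on_def)
  also have "\<dots> = (\<Sum>k\<in>Q \<inter> {..N}. \<P>(w in M. stop_index (hazard \<beta> N) N (E.X w) = k))"
    using H.prob_card_identifiable[OF rec] E.prob_stop_index[OF mono h0] by (intro sum.cong) auto
  also have "\<dots> = measure M (\<Union>k\<in>Q \<inter> {..N}. {w\<in>space M. stop_index (hazard \<beta> N) N (E.X w) = k})"
    by (intro E.finite_measure_finite_Union[symmetric]) (auto simp: disjoint_family_on_def)
  also have "(\<Union>k\<in>Q \<inter> {..N}. {w\<in>space M. stop_index (hazard \<beta> N) N (E.X w) = k}) = {w\<in>space M. stop_index (hazard \<beta> N) N (E.X w) \<in> Q}"
    using stop_index_le by auto
  finally show ?thesis .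
qed

lemma finite_common_radius:
  assumes "finite F" "\<And>z. z \<in> F \<Longrightarrow> \<exists>d>0. \<forall>\<delta>. 0 < \<delta> \<longrightarrow> \<delta> < d \<longrightarrow> Pr z (\<delta>::real)"
  shows "\<exists>d>0. \<forall>\<delta>. 0 < \<delta> \<longrightarrow> \<delta> < d \<longrightarrow> (\<forall>z\<in>F. Pr z \<delta>)"
  using assms
proof (induction F rule: finite_induct)
  case empty
  then show ?case by (intro exI[of _ 1]) auto
next
  case (insert z F)
  then obtain d1 where d1: "d1 > 0" "\<forall>\<delta>. 0 < \<delta> \<longrightarrow> \<delta> < d1 \<longrightarrow> (\<forall>z\<in>F. Pr z \<delta>)" by auto
  obtain d2 where d2: "d2 > 0" "\<forall>\<delta>. 0 < \<delta> \<longrightarrow> \<delta> < d2 \<longrightarrow> Pr z \<delta>" using insert.prems by blast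
  show ?case using d1 d2 by (intro exI[of _ "min d1 d2"]) auto
qed

locale large_hypergraphs =
  fixes \<beta> :: "nat \<Rightarrow> real" and MW :: "'b measure" and W :: "real \<Rightarrow> 'b \<Rightarrow> real"
    and P :: "nat \<Rightarrow> 'a measure" and V :: "nat \<Rightarrow> 'v set" and \<Lambda> :: "nat \<Rightarrow> 'a \<Rightarrow> 'v set \<Rightarrow> nat"
  assumes nonneg: "\<And>j. 0 \<le> \<beta> j"
    and radius: "conv_radius \<beta> \<notin> ereal ` zero_set \<beta>" and zero: "0 \<notin> zero_set \<beta>"
    and bm: "brownian_motion MW W"
    and card_V: "\<And>N. card (V N) = N"
    and hypergraph: "\<And>N. poisson_hypergraph (P N) (V N) \<beta> (\<Lambda> N)"
begin

lemma hypergraph_locale: "poisson_hg (P N) (V N) \<beta> (\<Lambda> N) N"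
proof (rule poisson_hg.intro)
  show "prob_space (P N)" using hypergraph[of N] by (simp add: poisson_hypergraph_def)
  show "poisson_hg_axioms (P N) (V N) \<beta> (\<Lambda> N) N"
    by (rule poisson_hg_axioms.intro[OF hypergraph nonneg card_V])
qed

sublocale HG: poisson_hg "P N" "V N" \<beta> "\<Lambda> N" N for N
  by (rule hypergraph_locale)

abbreviation "ME \<equiv> PiM (UNIV :: nat set) (\<lambda>_. density lborel (exponential_density 1) :: real measure)"

sublocale ST: stopping ME "\<lambda>i w. w i" \<beta> MW W
  by (rule stopping.intro[OF exp_seq_exists], unfold_locales) (use nonneg radius zero bm in auto)

definition ratio :: "nat \<Rightarrow> 'a \<Rightarrow> real" where "ratio N w = real (card (HG.Vs N w)) / real N"

abbreviation Z :: "'b \<Rightarrow> real" where "Z w \<equiv> Z_limit \<beta> (\<lambda>t. W t w)"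

lemma ratio_rv[measurable]: "ratio N \<in> borel_measurable (P N)"
  using measurable_compose[OF HG.Vs_rv, of "\<lambda>S. real (card S) / real N" borel N] by (simp add: ratio_def[abs_def])

lemma ratio_le_1: "ratio N w \<le> 1"
  using HG.card_Vs_le[of N w] by (auto simp: ratio_def divide_le_eq)

lemma ratio_law:
  "\<P>(w in P N. Q (ratio N w)) = \<P>(w in ME. Q (real (ST.stopped N w) / real N))"
  using card_identifiable_law[OF HG.poisson_hg_axioms exp_seq_exists, of N "{k. Q (real k / real N)}"]
  by (simp add: ratio_def HG.Vs_def ST.stopped_def)

lemma ratio_near_zero:
  "z \<in> zero_set \<beta> \<Longrightarrow> \<exists>\<delta>0>0. \<forall>\<delta>. 0 < \<delta> \<longrightarrow> \<delta> < \<delta>0 \<longrightarrow>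
    (\<lambda>N. \<P>(w in P N. \<bar>ratio N w - z\<bar> < \<delta>)) \<longlonglongrightarrow> \<P>(w in MW. Z w = z)"
  using ST.stopped_near_zero[of z] unfolding ratio_law[where Q="\<lambda>x. \<bar>x - z\<bar> < _"] .

lemma ratio_elsewhere:
  "b < z_star \<beta> \<Longrightarrow> 0 < \<delta> \<Longrightarrow>
   (\<lambda>N. \<P>(w in P N. ratio N w \<le> b \<and> (\<forall>z\<in>ST.zeros_upto b. \<delta> \<le> \<bar>ratio N w - z\<bar>))) \<longlonglongrightarrow> 0"
  using ST.stopped_elsewhere[of b \<delta>] unfolding ratio_law[where Q="\<lambda>x. x \<le> b \<and> (\<forall>z\<in>ST.zeros_upto b. \<delta> \<le> \<bar>x - z\<bar>)"] .

lemma ratio_beyond: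
  "z_star \<beta> < 1 \<Longrightarrow> 0 < \<delta> \<Longrightarrow> (\<lambda>N. \<P>(w in P N. z_star \<beta> + \<delta> \<le> ratio N w)) \<longlonglongrightarrow> 0"
  using ST.stopped_beyond[of \<delta>] unfolding ratio_law[where Q="\<lambda>x. z_star \<beta> + \<delta> \<le> x"] .

lemma zeros_upto_finite: "b < 1 \<Longrightarrow> finite (ST.zeros_upto b)"
  by (rule ST.zeros_upto_props(1))

lemma z_star_le: "z_star \<beta> \<le> 1"
  by (rule z_star_le_1) (rule nonneg)

text \<open>
  The infimum that defines \<open>Z\<close> is one of its elements, because the zeros accumulate at most at \<open>1\<close>.
\<close>

lemma Z_values: "Z w \<in> insert (z_star \<beta>) (zero_set \<beta>)"
proof (cases "{z\<in>zero_set \<beta>. W (bm_time z) w < 0} = {}")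
  case True
  from ST.Z_limit_no_negative[of "\<lambda>t. W t w", OF True] show ?thesis by simp
next
  case False
  then obtain z where z: "z \<in> zero_set \<beta>" "W (bm_time z) w < 0" by auto
  have zs: "z < z_star \<beta>" using z by (simp add: zero_set_def)
  let ?A = "{x\<in>ST.zeros_upto z. W (bm_time x) w < 0}"
  have ne: "?A \<noteq> {}" using z by (auto simp: ST.zeros_upto_def)
  have "finite ?A" using zeros_upto_finite[of z] zs z_star_le by simp
  then have "Min ?A \<in> ?A" using ne by (rule Min_in)
  moreover have "Z w = Min ?A" by (rule ST.Z_limit_eq_Min[OF zs ne])
  ultimately show ?thesis by (auto simp: ST.zeros_upto_def)
qed

lemma Z_discrete: "Z \<in> measurable MW (count_space (insert (z_star \<beta>) (zero_set \<beta>)))"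
proof (subst measurable_count_space_eq_countable)
  show "countable (insert (z_star \<beta>) (zero_set \<beta>))" using countable_zeros[OF nonneg radius zero] by simp
  have "{w\<in>space MW. Z w = a} \<in> sets MW" for a using ST.Z_rv by measurable
  then have "Z -` {a} \<inter> space MW \<in> sets MW" for a by (simp add: vimage_def Int_def conj_commute)
  then show "Z \<in> space MW \<rightarrow> insert (z_star \<beta>) (zero_set \<beta>) \<and> (\<forall>a\<in>insert (z_star \<beta>) (zero_set \<beta>). Z -` {a} \<inter> space MW \<in> sets MW)"
    using Z_values by auto
qed

text \<open>
  Since \<open>Z\<close> has countably many values, every function of it is measurable; in particular \<open>edge_limit\<close>.
\<close>

lemma Z_compose_rv: "space N = UNIV \<Longrightarrow> (\<lambda>w. \<phi> (Z w)) \<in> measurable MW N"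
  by (rule measurable_compose[OF Z_discrete]) simp

text \<open>
  Suppose that \<open>g N\<close> is close to \<open>\<phi> z\<close> with high probability when the identified fraction is close to
  a possible value \<open>z\<close> of \<open>Z\<close>. Choose \<open>b < z*\<close> so that beyond \<open>b\<close> everything is close to \<open>\<phi> z*\<close>. Up to \<open>b\<close>
  there are finitely many zeros, and the identified fraction is either near one of them, with the
  probability that \<open>Z\<close> equals it in the limit, or beyond \<open>b\<close>. So both integrals are close to the same
  finite sum. At \<open>z* = 1\<close> zeros may accumulate, whence the uniform condition \<open>H2\<close>.
\<close>

lemma functional_limit:
  fixes g :: "nat \<Rightarrow> 'a \<Rightarrow> real" and \<phi> :: "real \<Rightarrow> real"
  assumes g_rv[measurable]: "\<And>N. g N \<in> borel_measurable (P N)" and gB: "\<And>N w. \<bar>g N w\<bar> \<le> B" and \<phi>B: "\<And>z. \<bar>\<phi> z\<bar> \<le> B"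
    and H1: "\<And>z \<eta>. z \<in> zero_set \<beta> \<or> (z = z_star \<beta> \<and> z < 1) \<Longrightarrow> 0 < \<eta> \<Longrightarrow>
      \<exists>d>0. (\<lambda>N. \<P>(w in P N. \<bar>ratio N w - z\<bar> < d \<and> \<eta> < \<bar>g N w - \<phi> z\<bar>)) \<longlonglongrightarrow> 0"
    and H2: "\<And>\<eta>. z_star \<beta> = 1 \<Longrightarrow> 0 < \<eta> \<Longrightarrow>
      \<exists>r<1. (\<lambda>N. \<P>(w in P N. r < ratio N w \<and> \<eta> < \<bar>g N w - \<phi> 1\<bar>)) \<longlonglongrightarrow> 0 \<and>
        (\<forall>z\<in>zero_set \<beta>. r < z \<longrightarrow> \<bar>\<phi> z - \<phi> 1\<bar> \<le> \<eta>)"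
  shows "(\<lambda>N. \<integral>w. g N w \<partial>P N) \<longlonglongrightarrow> (\<integral>w. \<phi> (Z w) \<partial>MW)"
proof (rule LIMSEQ_I)
  fix r0 :: real assume r0: "0 < r0"
  define \<eta> where "\<eta> = r0 / 5"
  have \<eta>: "0 < \<eta>" using r0 by (simp add: \<eta>_def)
  let ?zs = "z_star \<beta>"
  have B0: "0 \<le> B" using \<phi>B[of 0] by simp
  have "\<exists>b<?zs. (\<lambda>N. \<P>(w in P N. b < ratio N w \<and> \<eta> < \<bar>g N w - \<phi> ?zs\<bar>)) \<longlonglongrightarrow> 0 \<and>
     (\<forall>z\<in>zero_set \<beta>. b < z \<longrightarrow> \<bar>\<phi> z - \<phi> ?zs\<bar> \<le> \<eta>)"
  proof (cases "?zs = 1")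
    case True
    then show ?thesis using H2[OF True \<eta>] by simp
  next
    case False
    then have zs1: "?zs < 1" using z_star_le by simp
    obtain d where d: "0 < d" "(\<lambda>N. \<P>(w in P N. \<bar>ratio N w - ?zs\<bar> < d \<and> \<eta> < \<bar>g N w - \<phi> ?zs\<bar>)) \<longlonglongrightarrow> 0"
      using H1[of ?zs, OF _ \<eta>] zs1 by blast
    have "zero_set \<beta> = ST.zeros_upto ?zs" by (auto simp: ST.zeros_upto_def zero_set_def)
    then have fin: "finite (zero_set \<beta>)" using zeros_upto_finite[OF zs1] by simp
    define b where "b = Max (insert (?zs - d / 2) (zero_set \<beta>))"
    have b: "b < ?zs" "?zs - d < b" "\<And>z. z \<in> zero_set \<beta> \<Longrightarrow> z \<le> b"
    proof -
      show "b < ?zs" unfolding b_def using fin d(1) by (subst Max_less_iff) (auto simp: zero_set_def)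
      have "?zs - d / 2 \<le> b" unfolding b_def using fin by (intro Max_ge) auto
      then show "?zs - d < b" using d(1) by linarith
      show "z \<le> b" if "z \<in> zero_set \<beta>" for z unfolding b_def using fin that by (intro Max_ge) auto
    qed
    have "(\<lambda>N. \<P>(w in P N. \<bar>ratio N w - ?zs\<bar> < d \<and> \<eta> < \<bar>g N w - \<phi> ?zs\<bar>) + \<P>(w in P N. ?zs + d \<le> ratio N w)) \<longlonglongrightarrow> 0 + 0"
      by (rule tendsto_add[OF d(2) ratio_beyond[OF zs1 d(1)]])
    then have lim: "(\<lambda>N. \<P>(w in P N. \<bar>ratio N w - ?zs\<bar> < d \<and> \<eta> < \<bar>g N w - \<phi> ?zs\<bar>) + \<P>(w in P N. ?zs + d \<le> ratio N w)) \<longlonglongrightarrow> 0" by simp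
    have "(\<lambda>N. \<P>(w in P N. b < ratio N w \<and> \<eta> < \<bar>g N w - \<phi> ?zs\<bar>)) \<longlonglongrightarrow> 0"
    proof (rule Lim_null_comparison[OF always_eventually lim], rule allI)
      fix N
      let ?A = "{w\<in>space (P N). \<bar>ratio N w - ?zs\<bar> < d \<and> \<eta> < \<bar>g N w - \<phi> ?zs\<bar>}" and ?B = "{w\<in>space (P N). ?zs + d \<le> ratio N w}"
      have "\<P>(w in P N. b < ratio N w \<and> \<eta> < \<bar>g N w - \<phi> ?zs\<bar>) \<le> measure (P N) (?A \<union> ?B)"
        by (rule HG.finite_measure_mono) (use b(2) in \<open>auto simp: abs_less_iff\<close>)
      also have "\<dots> \<le> measure (P N) ?A + measure (P N) ?B" by (rule measure_Un_le) measurable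
      finally show "norm (\<P>(w in P N. b < ratio N w \<and> \<eta> < \<bar>g N w - \<phi> ?zs\<bar>)) \<le> measure (P N) ?A + measure (P N) ?B" by simp
    qed
    then show ?thesis using b by (intro exI[of _ b]) fastforce
  qed
  then obtain b where b: "b < ?zs" and T1: "(\<lambda>N. \<P>(w in P N. b < ratio N w \<and> \<eta> < \<bar>g N w - \<phi> ?zs\<bar>)) \<longlonglongrightarrow> 0"
     and T2: "\<And>z. z \<in> zero_set \<beta> \<Longrightarrow> b < z \<Longrightarrow> \<bar>\<phi> z - \<phi> ?zs\<bar> \<le> \<eta>" by blast
  let ?F = "ST.zeros_upto b"
  have F: "finite ?F" using zeros_upto_finite b z_star_le by simp
  have Fz: "z \<in> zero_set \<beta>" if "z \<in> ?F" for z using that by (simp add: ST.zeros_upto_def)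
  define Pr where "Pr z \<delta> \<longleftrightarrow>
     (\<lambda>N. \<P>(w in P N. \<bar>ratio N w - z\<bar> < \<delta>)) \<longlonglongrightarrow> \<P>(w in MW. Z w = z) \<and>
     (\<lambda>N. \<P>(w in P N. \<bar>ratio N w - z\<bar> < \<delta> \<and> \<eta> < \<bar>g N w - \<phi> z\<bar>)) \<longlonglongrightarrow> 0 \<and>
     (\<forall>x\<in>?F. x \<noteq> z \<longrightarrow> 2 * \<delta> < \<bar>x - z\<bar>)" for z \<delta>
  have "\<exists>d>0. \<forall>\<delta>. 0 < \<delta> \<longrightarrow> \<delta> < d \<longrightarrow> Pr z \<delta>" if z: "z \<in> ?F" for z
  proof -
    obtain d1 where d1: "0 < d1" "\<And>\<delta>. 0 < \<delta> \<Longrightarrow> \<delta> < d1 \<Longrightarrow> (\<lambda>N. \<P>(w in P N. \<bar>ratio N w - z\<bar> < \<delta>)) \<longlonglongrightarrow> \<P>(w in MW. Z w = z)"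
      using ratio_near_zero[OF Fz[OF z]] by blast
    obtain d2 where d2: "0 < d2" "(\<lambda>N. \<P>(w in P N. \<bar>ratio N w - z\<bar> < d2 \<and> \<eta> < \<bar>g N w - \<phi> z\<bar>)) \<longlonglongrightarrow> 0"
      using H1[of z, OF _ \<eta>] Fz[OF z] by blast
    define d3 where "d3 = Min (insert 1 ((\<lambda>x. \<bar>x - z\<bar> / 2) ` (?F - {z})))"
    have fin: "finite (insert 1 ((\<lambda>x. \<bar>x - z\<bar> / 2) ` (?F - {z})))" using F by simp
    have d3: "0 < d3" unfolding d3_def using fin by (subst Min_gr_iff) auto
    have d3': "d3 \<le> \<bar>x - z\<bar> / 2" if "x \<in> ?F" "x \<noteq> z" for x
      unfolding d3_def using that by (intro Min_le[OF fin]) auto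
    have "Pr z \<delta>" if \<delta>: "0 < \<delta>" "\<delta> < min d1 (min d2 d3)" for \<delta>
      unfolding Pr_def
    proof (intro conjI ballI impI)
      show "(\<lambda>N. \<P>(w in P N. \<bar>ratio N w - z\<bar> < \<delta>)) \<longlonglongrightarrow> \<P>(w in MW. Z w = z)"
        using d1(2) \<delta> by simp
      show "(\<lambda>N. \<P>(w in P N. \<bar>ratio N w - z\<bar> < \<delta> \<and> \<eta> < \<bar>g N w - \<phi> z\<bar>)) \<longlonglongrightarrow> 0"
      proof (rule Lim_null_comparison[OF always_eventually d2(2)], rule allI)
        fix N
        show "norm (\<P>(w in P N. \<bar>ratio N w - z\<bar> < \<delta> \<and> \<eta> < \<bar>g N w - \<phi> z\<bar>)) \<le> \<P>(w in P N. \<bar>ratio N w - z\<bar> < d2 \<and> \<eta> < \<bar>g N w - \<phi> z\<bar>)"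
          using \<delta> by (auto intro!: HG.finite_measure_mono)
      qed
      show "2 * \<delta> < \<bar>x - z\<bar>" if "x \<in> ?F" "x \<noteq> z" for x using d3'[OF that] \<delta> by simp
    qed
    then show ?thesis using d1(1) d2(1) d3 by (intro exI[of _ "min d1 (min d2 d3)"]) auto
  qed
  from finite_common_radius[of ?F Pr, OF F this]
  obtain d where "0 < d" "\<And>\<delta>. 0 < \<delta> \<Longrightarrow> \<delta> < d \<Longrightarrow> \<forall>z\<in>?F. Pr z \<delta>" by blast
  then obtain \<delta> where \<delta>: "0 < \<delta>" "\<And>z. z \<in> ?F \<Longrightarrow> Pr z \<delta>" using dense[of 0 d] by blast
  \<comment> \<open>\<open>A\<close> locates the fraction near \<open>z\<close>; \<open>Bz\<close>, \<open>Bt\<close> and \<open>Be\<close> are the exceptional events near a zero,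
    beyond \<open>b\<close>, and between the zeros.\<close>
  define A where "A N z = {w\<in>space (P N). \<bar>ratio N w - z\<bar> < \<delta>}" for N z
  define Bz where "Bz N z = {w\<in>space (P N). \<bar>ratio N w - z\<bar> < \<delta> \<and> \<eta> < \<bar>g N w - \<phi> z\<bar>}" for N z
  define Bt where "Bt N = {w\<in>space (P N). b < ratio N w \<and> \<eta> < \<bar>g N w - \<phi> ?zs\<bar>}" for N
  define Be where "Be N = {w\<in>space (P N). ratio N w \<le> b \<and> (\<forall>z\<in>?F. \<delta> \<le> \<bar>ratio N w - z\<bar>)}" for N
  have mA[measurable]: "A N z \<in> sets (P N)" "Bz N z \<in> sets (P N)" "Bt N \<in> sets (P N)" for N z
    unfolding A_def Bz_def Bt_def by measurable
  have mBe[measurable]: "Be N \<in> sets (P N)" for N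
    unfolding Be_def using F by measurable
  have LA: "(\<lambda>N. measure (P N) (A N z)) \<longlonglongrightarrow> \<P>(w in MW. Z w = z)" if "z \<in> ?F" for z
    using \<delta>(2)[OF that] by (simp add: Pr_def A_def)
  have LB: "(\<lambda>N. measure (P N) (Bz N z)) \<longlonglongrightarrow> 0" if "z \<in> ?F" for z
    using \<delta>(2)[OF that] by (simp add: Pr_def Bz_def)
  have sep: "2 * \<delta> < \<bar>x - z\<bar>" if "z \<in> ?F" "x \<in> ?F" "x \<noteq> z" for x z
    using \<delta>(2)[OF that(1)] that by (simp add: Pr_def)
  have LBe: "(\<lambda>N. measure (P N) (Be N)) \<longlonglongrightarrow> 0" unfolding Be_def by (rule ratio_elsewhere[OF b \<delta>(1)])
  define bad where "bad N = (\<Sum>z\<in>?F. measure (P N) (Bz N z)) + measure (P N) (Bt N) + measure (P N) (Be N)" for N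
  have Lbad: "bad \<longlonglongrightarrow> 0"
  proof -
    have "(\<lambda>N. (\<Sum>z\<in>?F. measure (P N) (Bz N z)) + measure (P N) (Bt N) + measure (P N) (Be N)) \<longlonglongrightarrow> (\<Sum>z\<in>?F. 0) + 0 + 0"
      by (intro tendsto_add tendsto_sum LB LBe T1[folded Bt_def])
    then show ?thesis by (simp add: bad_def[abs_def])
  qed
  define S where "S p = (\<Sum>z\<in>?F. p z * (\<phi> z - \<phi> ?zs)) + \<phi> ?zs" for p :: "real \<Rightarrow> real"
  have LS: "(\<lambda>N. S (\<lambda>z. measure (P N) (A N z))) \<longlonglongrightarrow> S (\<lambda>z. \<P>(w in MW. Z w = z))"
    unfolding S_def by (intro tendsto_intros LA)
  have unique: "(\<Sum>z\<in>?F. of_bool (Q z) * (\<phi> z - \<phi> ?zs)) + \<phi> ?zs = \<phi> y"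
    if "y \<in> ?F" "Q y" "\<And>z. z \<in> ?F \<Longrightarrow> Q z \<Longrightarrow> z = y" for Q y
  proof -
    have "(\<Sum>z\<in>?F. of_bool (Q z) * (\<phi> z - \<phi> ?zs)) = (\<Sum>z\<in>?F. if z = y then \<phi> y - \<phi> ?zs else 0)"
    proof (rule sum.cong[OF refl])
      fix z assume z: "z \<in> ?F"
      show "of_bool (Q z) * (\<phi> z - \<phi> ?zs) = (if z = y then \<phi> y - \<phi> ?zs else 0)"
      proof (cases "z = y")
        case True
        then show ?thesis using that(2) by simp
      next
        case False
        then have "\<not> Q z" using that(3)[OF z] by blast
        then show ?thesis using False by simp
      qed
    qed
    also have "\<dots> = \<phi> y - \<phi> ?zs" using F that(1) by simp
    finally show ?thesis by simp
  qed
  have first: "\<bar>(\<integral>w. g N w \<partial>P N) - S (\<lambda>z. measure (P N) (A N z))\<bar> \<le> \<eta> + 2 * B * bad N" for N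
  proof -
    let ?h = "\<lambda>w. (\<Sum>z\<in>?F. indicator (A N z) w * (\<phi> z - \<phi> ?zs)) + \<phi> ?zs :: real"
    let ?e = "\<lambda>w. \<eta> + 2 * B * ((\<Sum>z\<in>?F. indicator (Bz N z) w) + indicator (Bt N) w + indicator (Be N) w)"
    have ig: "integrable (P N) (g N)" using gB by (intro HG.integrable_const_bound[of _ B]) auto
    have ii: "integrable (P N) (\<lambda>w. indicator X w * c :: real)" "integrable (P N) (indicator X :: _ \<Rightarrow> real)" if "X \<in> sets (P N)" for X c
      using that by (auto intro!: integrable_mult_left HG.integrable_const_bound[of _ 1] simp: indicator_def)
    have ih: "integrable (P N) ?h" using ii mA by auto
    have ie: "integrable (P N) ?e" using ii mA mBe by auto
    have eh: "(\<integral>w. ?h w \<partial>P N) = S (\<lambda>z. measure (P N) (A N z))"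
    proof -
      have "(\<integral>w. ?h w \<partial>P N) = (\<Sum>z\<in>?F. (\<integral>w. indicator (A N z) w * (\<phi> z - \<phi> ?zs) \<partial>P N)) + \<phi> ?zs"
        using ii mA by (subst Bochner_Integration.integral_add) (auto simp: HG.prob_space)
      also have "\<dots> = S (\<lambda>z. measure (P N) (A N z))"
        unfolding S_def using mA sets.sets_into_space[OF mA(1)] by (auto intro!: sum.cong simp: Int_absorb2)
      finally show ?thesis .
    qed
    have ee: "(\<integral>w. ?e w \<partial>P N) = \<eta> + 2 * B * bad N"
    proof -
      have "(\<integral>w. ?e w \<partial>P N) = \<eta> + 2 * B * (\<integral>w. (\<Sum>z\<in>?F. indicator (Bz N z) w) + indicator (Bt N) w + indicator (Be N) w \<partial>P N)"
        using ii mA mBe by (subst Bochner_Integration.integral_add) (auto simp: HG.prob_space)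
      also have "(\<integral>w. (\<Sum>z\<in>?F. indicator (Bz N z) w) + indicator (Bt N) w + indicator (Be N) w \<partial>P N) = bad N"
        unfolding bad_def using ii mA mBe sets.sets_into_space[OF mA(2)] sets.sets_into_space[OF mA(3)] sets.sets_into_space[OF mBe]
        by (simp add: Int_absorb2)
      finally show ?thesis .
    qed
    have pw: "\<bar>g N w - ?h w\<bar> \<le> ?e w" if w: "w \<in> space (P N)" for w
    proof -
      have hB: "\<exists>y. ?h w = \<phi> y \<and> (y \<in> ?F \<and> w \<in> A N y \<or> y = ?zs \<and> (\<forall>z\<in>?F. w \<notin> A N z))"
      proof (cases "\<exists>y\<in>?F. w \<in> A N y")
        case True
        then obtain y where y: "y \<in> ?F" "w \<in> A N y" by blast
        have "z = y" if "z \<in> ?F" "w \<in> A N z" for z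
        proof (rule ccontr)
          assume "z \<noteq> y"
          then have "2 * \<delta> < \<bar>z - y\<bar>" by (rule sep[OF y(1) that(1)])
          moreover have "\<bar>ratio N w - z\<bar> < \<delta>" "\<bar>ratio N w - y\<bar> < \<delta>" using that(2) y(2) by (simp_all add: A_def)
          ultimately show False by linarith
        qed
        then have "?h w = \<phi> y" unfolding indicator_def by (intro unique y)
        then show ?thesis using y by blast
      next
        case False
        then have "?h w = \<phi> ?zs" by simp
        then show ?thesis using False by blast
      qed
      then obtain y where y: "?h w = \<phi> y" "y \<in> ?F \<and> w \<in> A N y \<or> y = ?zs \<and> (\<forall>z\<in>?F. w \<notin> A N z)" by blast
      let ?s = "(\<Sum>z\<in>?F. indicator (Bz N z) w) + indicator (Bt N) w + indicator (Be N) w :: real"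
      have s0: "0 \<le> (\<Sum>z\<in>?F. indicator (Bz N z) w :: real)" by (intro sum_nonneg) simp
      have le2B: "\<bar>g N w - ?h w\<bar> \<le> 2 * B" using gB[of N w] \<phi>B[of y] y(1) by linarith
      show ?thesis
      proof (cases "\<bar>g N w - \<phi> y\<bar> \<le> \<eta>")
        case True
        have "0 \<le> 2 * B * ?s" using B0 s0 by (intro mult_nonneg_nonneg) auto
        then show ?thesis using True y(1) by simp
      next
        case False
        have "1 \<le> ?s"
          using y(2)
        proof
          assume a: "y \<in> ?F \<and> w \<in> A N y"
          then have "w \<in> Bz N y" using False by (simp add: A_def Bz_def)
          then have "1 \<le> (\<Sum>z\<in>?F. indicator (Bz N z) w :: real)"
            using member_le_sum[of y ?F "\<lambda>z. indicator (Bz N z) w :: real"] a F by simp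
          then show ?thesis by (simp add: add_increasing2)
        next
          assume a: "y = ?zs \<and> (\<forall>z\<in>?F. w \<notin> A N z)"
          show ?thesis
          proof (cases "b < ratio N w")
            case True
            then have "w \<in> Bt N" using a False w by (simp add: Bt_def)
            then show ?thesis using s0 by simp
          next
            case f: False
            then have "w \<in> Be N" using a w by (auto simp: Be_def A_def not_less)
            then show ?thesis using s0 by simp
          qed
        qed
        then have "2 * B * 1 \<le> 2 * B * ?s" using B0 by (intro mult_left_mono) auto
        then show ?thesis using le2B \<eta> by linarith
      qed
    qed
    have "\<bar>(\<integral>w. g N w \<partial>P N) - (\<integral>w. ?h w \<partial>P N)\<bar> = \<bar>\<integral>w. g N w - ?h w \<partial>P N\<bar>"
      using ig ih by simp
    also have "\<dots> \<le> (\<integral>w. \<bar>g N w - ?h w\<bar> \<partial>P N)" by (rule integral_abs_bound)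
    also have "\<dots> \<le> (\<integral>w. ?e w \<partial>P N)" using ig ih ie pw by (intro integral_mono) auto
    finally show ?thesis unfolding eh ee .
  qed
  have second: "\<bar>(\<integral>w. \<phi> (Z w) \<partial>MW) - S (\<lambda>z. \<P>(w in MW. Z w = z))\<bar> \<le> \<eta>"
  proof -
    let ?C = "\<lambda>z. {w\<in>space MW. Z w = z}"
    let ?h = "\<lambda>w. (\<Sum>z\<in>?F. indicator (?C z) w * (\<phi> z - \<phi> ?zs)) + \<phi> ?zs :: real"
    have mC: "?C z \<in> sets MW" for z using ST.Z_rv by measurable
    have ig: "integrable MW (\<lambda>w. \<phi> (Z w))" using \<phi>B Z_compose_rv[of borel \<phi>] by (intro ST.MW.integrable_const_bound[of _ B]) auto
    have ii: "integrable MW (\<lambda>w. indicator (?C z) w * c :: real)" for z c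
      using mC by (auto intro!: integrable_mult_left ST.MW.integrable_const_bound[of _ 1] simp: indicator_def)
    have isum: "integrable MW (\<lambda>w. \<Sum>z\<in>?F. indicator (?C z) w * (\<phi> z - \<phi> ?zs))"
      by (intro Bochner_Integration.integrable_sum ii)
    have ih: "integrable MW ?h" by (intro Bochner_Integration.integrable_add isum ST.MW.integrable_const)
    have eh: "(\<integral>w. ?h w \<partial>MW) = S (\<lambda>z. measure MW (?C z))"
    proof -
      have "(\<integral>w. ?h w \<partial>MW) = (\<Sum>z\<in>?F. (\<integral>w. indicator (?C z) w * (\<phi> z - \<phi> ?zs) \<partial>MW)) + \<phi> ?zs"
        using Bochner_Integration.integral_add[OF isum ST.MW.integrable_const]
          Bochner_Integration.integral_sum[of ?F MW "\<lambda>z w. indicator (?C z) w * (\<phi> z - \<phi> ?zs)", OF ii]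
        by (simp add: ST.MW.prob_space)
      also have "\<dots> = S (\<lambda>z. measure MW (?C z))"
        unfolding S_def using mC sets.sets_into_space[OF mC] by (auto intro!: sum.cong simp: Int_absorb2)
      finally show ?thesis .
    qed
    have pw: "\<bar>\<phi> (Z w) - ?h w\<bar> \<le> \<eta>" if w: "w \<in> space MW" for w
    proof (cases "Z w \<in> ?F")
      case True
      have "?h w = \<phi> (Z w)" unfolding indicator_def by (intro unique True) (use w in simp_all)
      then show ?thesis using \<eta> by simp
    next
      case False
      then have "(\<Sum>z\<in>?F. indicator (?C z) w * (\<phi> z - \<phi> ?zs)) = (\<Sum>z\<in>?F. 0)" by (intro sum.cong refl) (auto simp: indicator_def)
      then have h: "?h w = \<phi> ?zs" by simp
      show ?thesis
      proof (cases "Z w = ?zs")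
        case True
        then show ?thesis using h \<eta> by simp
      next
        case ne: False
        then have z: "Z w \<in> zero_set \<beta>" using Z_values[of w] by simp
        then have "b < Z w" using False by (simp add: ST.zeros_upto_def)
        then show ?thesis unfolding h by (rule T2[OF z])
      qed
    qed
    have "\<bar>(\<integral>w. \<phi> (Z w) \<partial>MW) - (\<integral>w. ?h w \<partial>MW)\<bar> = \<bar>\<integral>w. \<phi> (Z w) - ?h w \<partial>MW\<bar>"
      using ig ih by simp
    also have "\<dots> \<le> (\<integral>w. \<bar>\<phi> (Z w) - ?h w\<bar> \<partial>MW)" by (rule integral_abs_bound)
    also have "\<dots> \<le> (\<integral>w. \<eta> \<partial>MW)" using ig ih pw by (intro integral_mono) auto
    also have "\<dots> = \<eta>" by (simp add: ST.MW.prob_space)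
    finally show ?thesis unfolding eh .
  qed
  have "(\<lambda>N. 2 * B * bad N) \<longlonglongrightarrow> 2 * B * 0" by (intro tendsto_intros Lbad)
  then have "\<forall>\<^sub>F N in sequentially. 2 * B * bad N < \<eta>" using \<eta> by (intro order_tendstoD) auto
  moreover have "\<forall>\<^sub>F N in sequentially. dist (S (\<lambda>z. measure (P N) (A N z))) (S (\<lambda>z. \<P>(w in MW. Z w = z))) < \<eta>"
    by (rule tendstoD[OF LS \<eta>])
  ultimately have "\<forall>\<^sub>F N in sequentially. norm ((\<integral>w. g N w \<partial>P N) - (\<integral>w. \<phi> (Z w) \<partial>MW)) < r0"
  proof eventually_elim
    fix N assume "2 * B * bad N < \<eta>" "dist (S (\<lambda>z. measure (P N) (A N z))) (S (\<lambda>z. \<P>(w in MW. Z w = z))) < \<eta>"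
    moreover have "r0 = 5 * \<eta>" by (simp add: \<eta>_def)
    ultimately show "norm ((\<integral>w. g N w \<partial>P N) - (\<integral>w. \<phi> (Z w) \<partial>MW)) < r0"
      using first[of N] second \<eta> unfolding real_norm_def dist_real_def by linarith
  qed
  then show "\<exists>no. \<forall>N\<ge>no. norm ((\<integral>w. g N w \<partial>P N) - (\<integral>w. \<phi> (Z w) \<partial>MW)) < r0"
    by (simp add: eventually_sequentially)
qed

lemma ratio_limit:
  fixes f :: "real \<Rightarrow> real"
  assumes f: "\<And>x. isCont f x" and fB: "\<And>x. \<bar>f x\<bar> \<le> B"
  shows "(\<lambda>N. \<integral>w. f (ratio N w) \<partial>P N) \<longlonglongrightarrow> (\<integral>w. f (Z w) \<partial>MW)"
proof (rule functional_limit[where B=B])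
  have [measurable]: "f \<in> borel_measurable borel" using f by (intro borel_measurable_continuous_onI continuous_at_imp_continuous_on) auto
  show "(\<lambda>w. f (ratio N w)) \<in> borel_measurable (P N)" for N by measurable
  have ne: "\<exists>d>0. \<forall>y. \<bar>y - x\<bar> < d \<longrightarrow> \<bar>f y - f x\<bar> \<le> \<eta>" if "0 < \<eta>" for x \<eta>
  proof -
    obtain d where d: "0 < d" "\<forall>y. dist y x < d \<longrightarrow> dist (f y) (f x) < \<eta>"
      using f[of x] \<open>0 < \<eta>\<close> unfolding continuous_at_eps_delta by blast
    have "\<bar>f y - f x\<bar> \<le> \<eta>" if "\<bar>y - x\<bar> < d" for y
      using d(2)[unfolded dist_real_def, rule_format, OF that] by (rule less_imp_le)
    then show ?thesis using d(1) by blast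
  qed
  fix z \<eta> :: real assume "0 < \<eta>"
  then obtain d where d: "0 < d" "\<And>y. \<bar>y - z\<bar> < d \<Longrightarrow> \<bar>f y - f z\<bar> \<le> \<eta>" using ne by blast
  have "{w\<in>space (P N). \<bar>ratio N w - z\<bar> < d \<and> \<eta> < \<bar>f (ratio N w) - f z\<bar>} = {}" for N
    using d(2) by (force simp: not_less[symmetric])
  then have e: "\<P>(w in P N. \<bar>ratio N w - z\<bar> < d \<and> \<eta> < \<bar>f (ratio N w) - f z\<bar>) = 0" for N
    by (simp only: measure_empty)
  show "\<exists>d>0. (\<lambda>N. \<P>(w in P N. \<bar>ratio N w - z\<bar> < d \<and> \<eta> < \<bar>f (ratio N w) - f z\<bar>)) \<longlonglongrightarrow> 0"
    by (intro exI[of _ d] conjI d(1)) (simp only: e tendsto_const)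
next
  fix \<eta> :: real assume "0 < \<eta>"
  then obtain d where d: "0 < d" "\<And>y. dist y 1 < d \<Longrightarrow> dist (f y) (f 1) < \<eta>" using f[of 1] unfolding continuous_at_eps_delta by blast
  have e: "{w\<in>space (P N). 1 - d < ratio N w \<and> \<eta> < \<bar>f (ratio N w) - f 1\<bar>} = {}" for N
  proof -
    have "\<bar>f (ratio N w) - f 1\<bar> < \<eta>" if "1 - d < ratio N w" for w
      using d(2)[of "ratio N w"] that ratio_le_1[of N w] by (simp add: dist_real_def abs_if)
    then show ?thesis by force
  qed
  have "\<bar>f z - f 1\<bar> \<le> \<eta>" if "z \<in> zero_set \<beta>" "1 - d < z" for z
  proof -
    have "z < 1" using that(1) z_star_le by (simp add: zero_set_def)
    then show ?thesis using d(2)[of z] that(2) by (simp add: dist_real_def abs_if)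
  qed
  then show "\<exists>r<1. (\<lambda>N. \<P>(w in P N. r < ratio N w \<and> \<eta> < \<bar>f (ratio N w) - f 1\<bar>)) \<longlonglongrightarrow> 0 \<and> (\<forall>z\<in>zero_set \<beta>. r < z \<longrightarrow> \<bar>f z - f 1\<bar> \<le> \<eta>)"
    using d(1) by (intro exI[of _ "1 - d"]) (simp only: e measure_empty tendsto_const, simp)
qed (use fB in auto)

end

section \<open>The limits in distribution\<close>

definition reach_sum :: "(nat \<Rightarrow> real) \<Rightarrow> nat \<Rightarrow> real \<Rightarrow> real" where
  "reach_sum \<beta> J t = (\<Sum>j\<le>J. \<beta> j * reach_lim j t)"

definition reach_series :: "(nat \<Rightarrow> real) \<Rightarrow> real \<Rightarrow> real" where
  "reach_series \<beta> t = (\<Sum>j. \<beta> j * reach_lim j t)"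

text \<open>
  The upper bound by one follows from \<open>1 - t ^ j = (1 - t) * (\<Sum>i<j. t ^ i)\<close>.
\<close>

lemma reach_lim_bounds:
  assumes "0 \<le> t" "t \<le> 1"
  shows "0 \<le> reach_lim j t" "reach_lim j t \<le> 1" "reach_lim j t \<le> t ^ j + real j * t ^ (j - 1)"
proof -
  show "0 \<le> reach_lim j t" using assms by (simp add: reach_lim_def)
  have "real j * t ^ (j - 1) = (\<Sum>i<j. t ^ (j - 1))" by simp
  also have "\<dots> \<le> (\<Sum>i<j. t ^ i)" using assms by (intro sum_mono power_decreasing) auto
  finally have "(1 - t) * (real j * t ^ (j - 1)) \<le> (1 - t) * (\<Sum>i<j. t ^ i)" using assms by (intro mult_left_mono) auto
  also have "\<dots> = 1 - t ^ j" by (rule one_diff_power_eq[symmetric])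
  finally show "reach_lim j t \<le> 1" by (simp add: reach_lim_def mult.commute)
  have "real j * t ^ (j - 1) * (1 - t) \<le> real j * t ^ (j - 1) * 1" using assms by (intro mult_left_mono) auto
  then show "reach_lim j t \<le> t ^ j + real j * t ^ (j - 1)" by (simp add: reach_lim_def)
qed

lemma reach_sum_isCont: "isCont (reach_sum \<beta> J) t"
  unfolding reach_sum_def[abs_def] reach_lim_def by (intro continuous_intros)

lemma reach_sum_1: "reach_sum \<beta> J 1 = (\<Sum>j\<le>J. \<beta> j)"
  by (simp add: reach_sum_def reach_lim_def)

context
  fixes \<beta> :: "nat \<Rightarrow> real"
  assumes nonneg: "\<And>j. 0 \<le> \<beta> j"
begin

lemma reach_weight_summable:
  assumes r: "0 \<le> \<rho>" "ereal \<rho> < conv_radius \<beta>"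
  shows "summable (\<lambda>j. \<beta> j * (\<rho> ^ j + real j * \<rho> ^ (j - 1)))"
    and "(\<lambda>j. \<beta> j * (\<rho> ^ j + real j * \<rho> ^ (j - 1))) sums ((\<Sum>j. \<beta> j * \<rho> ^ j) + series_der \<beta> \<rho>)"
    and "(\<lambda>j. \<beta> j * reach_lim j \<rho>) sums ((\<Sum>j. \<beta> j * \<rho> ^ j) + (1 - \<rho>) * series_der \<beta> \<rho>)"
proof -
  have a: "(\<lambda>j. \<beta> j * \<rho> ^ j) sums (\<Sum>j. \<beta> j * \<rho> ^ j)"
    using r by (intro summable_sums summable_in_conv_radius) simp
  have b: "(\<lambda>j. real j * \<beta> j * \<rho> ^ (j - 1)) sums series_der \<beta> \<rho>"
  proof -
    have "(\<lambda>i. der_coeff \<beta> i * \<rho> ^ i) sums series_der \<beta> \<rho>"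
      unfolding series_der_def by (rule summable_sums[OF summable_der[OF nonneg r]])
    then show ?thesis
      using sums_Suc[of "\<lambda>j. real j * \<beta> j * \<rho> ^ (j - 1)" "series_der \<beta> \<rho>"] by (simp add: der_coeff_def)
  qed
  have "(\<lambda>j. \<beta> j * \<rho> ^ j + real j * \<beta> j * \<rho> ^ (j - 1)) sums ((\<Sum>j. \<beta> j * \<rho> ^ j) + series_der \<beta> \<rho>)"
    by (rule sums_add[OF a b])
  then show s: "(\<lambda>j. \<beta> j * (\<rho> ^ j + real j * \<rho> ^ (j - 1))) sums ((\<Sum>j. \<beta> j * \<rho> ^ j) + series_der \<beta> \<rho>)"
    by (simp add: distrib_left mult_ac)
  then show "summable (\<lambda>j. \<beta> j * (\<rho> ^ j + real j * \<rho> ^ (j - 1)))" by (rule sums_summable)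
  have "(\<lambda>j. \<beta> j * \<rho> ^ j + (1 - \<rho>) * (real j * \<beta> j * \<rho> ^ (j - 1))) sums ((\<Sum>j. \<beta> j * \<rho> ^ j) + (1 - \<rho>) * series_der \<beta> \<rho>)"
    by (rule sums_add[OF a sums_mult[OF b]])
  then show "(\<lambda>j. \<beta> j * reach_lim j \<rho>) sums ((\<Sum>j. \<beta> j * \<rho> ^ j) + (1 - \<rho>) * series_der \<beta> \<rho>)"
    by (simp add: reach_lim_def distrib_left mult_ac)
qed

lemma reach_sum_mono:
  assumes "0 \<le> t" "t \<le> 1" "J \<le> J'"
  shows "reach_sum \<beta> J t \<le> reach_sum \<beta> J' t"
  unfolding reach_sum_def using assms nonneg reach_lim_bounds(1)[OF assms(1,2)] by (intro sum_mono2) auto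

lemma reach_sum_le_series:
  assumes "0 \<le> t" "t \<le> 1" "ereal t < conv_radius \<beta>"
  shows "reach_sum \<beta> J t \<le> reach_series \<beta> t"
  unfolding reach_sum_def reach_series_def
  using reach_weight_summable(3)[OF assms(1,3)] nonneg reach_lim_bounds(1)[OF assms(1,2)]
  by (intro sum_le_suminf) (auto simp: sums_iff)

lemma reach_sum_diff:
  assumes "0 \<le> t" "t \<le> \<rho>" "\<rho> \<le> 1" "J \<le> J'"
  shows "reach_sum \<beta> J' t - reach_sum \<beta> J t \<le> (\<Sum>j\<in>{J<..J'}. \<beta> j * (\<rho> ^ j + real j * \<rho> ^ (j - 1)))"
proof -
  have "{..J'} = {..J} \<union> {J<..J'}" using assms(4) by auto
  then have "reach_sum \<beta> J' t = reach_sum \<beta> J t + (\<Sum>j\<in>{J<..J'}. \<beta> j * reach_lim j t)"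
    unfolding reach_sum_def by (simp only:) (rule sum.union_disjoint, auto)
  moreover have "(\<Sum>j\<in>{J<..J'}. \<beta> j * reach_lim j t) \<le> (\<Sum>j\<in>{J<..J'}. \<beta> j * (\<rho> ^ j + real j * \<rho> ^ (j - 1)))"
  proof (intro sum_mono mult_left_mono nonneg)
    fix j
    have "reach_lim j t \<le> t ^ j + real j * t ^ (j - 1)" using assms by (intro reach_lim_bounds) auto
    also have "\<dots> \<le> \<rho> ^ j + real j * \<rho> ^ (j - 1)" using assms by (intro add_mono mult_left_mono power_mono) auto
    finally show "reach_lim j t \<le> \<rho> ^ j + real j * \<rho> ^ (j - 1)" .
  qed
  ultimately show ?thesis by simp
qed

lemma weight_tail:
  assumes r: "0 \<le> \<rho>" "ereal \<rho> < conv_radius \<beta>" and e: "0 < \<epsilon>"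
  shows "\<exists>J0. \<forall>J\<ge>J0. \<forall>J'. (\<Sum>j\<in>{J<..J'}. \<beta> j * (\<rho> ^ j + real j * \<rho> ^ (j - 1))) \<le> \<epsilon>"
proof -
  let ?w = "\<lambda>j. \<beta> j * (\<rho> ^ j + real j * \<rho> ^ (j - 1))"
  obtain J0 where J0: "\<And>m n. J0 \<le> m \<Longrightarrow> norm (sum ?w {m..<n}) < \<epsilon>"
    using reach_weight_summable(1)[OF r] e unfolding summable_Cauchy by blast
  have "sum ?w {J<..J'} \<le> \<epsilon>" if "J0 \<le> J" for J J'
  proof -
    have "{J<..J'} = {Suc J..<Suc J'}" by auto
    then show ?thesis using J0[of "Suc J" "Suc J'"] that by simp
  qed
  then show ?thesis by blast
qed

text \<open>
  The series sums to \<open>\<beta> z + (1 - z) * \<beta>' z\<close>, and the drift vanishes at \<open>z\<close>.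
\<close>

lemma edge_limit_at_zero:
  assumes z: "0 \<le> z" "z < 1" "ereal z < conv_radius \<beta>" and zero: "series_der \<beta> z + ln (1 - z) = 0"
  shows "edge_limit \<beta> z = ereal (reach_series \<beta> z)"
proof -
  have "gen_series \<beta> z = ereal (\<Sum>j. \<beta> j * z ^ j)"
    unfolding gen_series_def using z by (intro suminf_ereal' summable_in_conv_radius) simp
  moreover have "reach_series \<beta> z = (\<Sum>j. \<beta> j * z ^ j) + (1 - z) * series_der \<beta> z"
    unfolding reach_series_def by (rule sums_unique[symmetric, OF reach_weight_summable(3)[OF z(1,3)]])
  moreover have "series_der \<beta> z = - ln (1 - z)" using zero by simp
  ultimately show ?thesis by (simp add: edge_limit_def)
qed

lemma edge_limit_1: "edge_limit \<beta> 1 = (SUP J. ereal (\<Sum>j<J. \<beta> j))"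
  unfolding edge_limit_def gen_series_def using nonneg by (subst suminf_ereal_eq_SUP) auto

end

context large_hypergraphs
begin

lemma ratio_nonneg: "0 \<le> ratio N w"
  by (simp add: ratio_def)

text \<open>
  Concentration given the identified set, together with the limit of \<open>reach_frac\<close>, both for
  boundedly many sizes.
\<close>

lemma edges_upto_limit:
  assumes \<nu>: "0 < \<nu>"
  shows "(\<lambda>N. \<P>(w in P N. \<nu> \<le> \<bar>HG.edges_upto N J w / real N - reach_sum \<beta> J (ratio N w)\<bar>)) \<longlonglongrightarrow> 0"
proof -
  define C where "C = (\<Sum>j\<le>J. \<beta> j * ((real j)\<^sup>2 + real j * (2 * (real j)\<^sup>2 + real j)))"
  define B where "B = 2 * (\<Sum>j\<le>J. \<beta> j) / ((\<nu> / 4)\<^sup>2)"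
  have lim: "(\<lambda>N. B / real N) \<longlonglongrightarrow> 0" by (rule lim_const_over_n)
  have "(\<lambda>N. C / real N) \<longlonglongrightarrow> 0" by (rule lim_const_over_n)
  then have evC: "\<forall>\<^sub>F N in sequentially. C / real N < \<nu> / 2" using \<nu> by (intro order_tendstoD) auto
  show ?thesis
  proof (rule Lim_null_comparison[OF _ lim])
    show "\<forall>\<^sub>F N in sequentially. norm (\<P>(w in P N. \<nu> \<le> \<bar>HG.edges_upto N J w / real N - reach_sum \<beta> J (ratio N w)\<bar>)) \<le> B / real N"
      using evC eventually_ge_at_top[of "max 2 J"]
    proof eventually_elim
      fix N assume CN: "C / real N < \<nu> / 2" and N: "max 2 J \<le> N"
      let ?R = "\<lambda>w. \<Sum>j\<le>J. real N * \<beta> j * reach_frac N (card (HG.Vs N w)) j"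
      have N0: "0 < real N" using N by simp
      have sub: "{w\<in>space (P N). \<nu> \<le> \<bar>HG.edges_upto N J w / real N - reach_sum \<beta> J (ratio N w)\<bar>}
        \<subseteq> {w\<in>space (P N). 2 * (\<nu> / 4) * real N \<le> \<bar>HG.edges_upto N J w - ?R w\<bar>}"
      proof safe
        fix w assume w: "\<nu> \<le> \<bar>HG.edges_upto N J w / real N - reach_sum \<beta> J (ratio N w)\<bar>"
        have "\<bar>?R w / real N - reach_sum \<beta> J (ratio N w)\<bar> = \<bar>\<Sum>j\<le>J. \<beta> j * (reach_frac N (card (HG.Vs N w)) j - reach_lim j (ratio N w))\<bar>"
          using N0 by (simp add: reach_sum_def sum_divide_distrib right_diff_distrib sum_subtractf)
        also have "\<dots> \<le> (\<Sum>j\<le>J. \<bar>\<beta> j * (reach_frac N (card (HG.Vs N w)) j - reach_lim j (ratio N w))\<bar>)" by (rule sum_abs)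
        also have "\<dots> \<le> (\<Sum>j\<le>J. \<beta> j * (((real j)\<^sup>2 + real j * (2 * (real j)\<^sup>2 + real j)) / real N))"
        proof (rule sum_mono)
          fix j assume "j \<in> {..J}"
          then have "\<bar>reach_frac N (card (HG.Vs N w)) j - reach_lim j (ratio N w)\<bar> \<le> ((real j)\<^sup>2 + real j * (2 * (real j)\<^sup>2 + real j)) / real N"
            unfolding ratio_def using N by (intro reach_frac_approx HG.card_Vs_le) auto
          then show "\<bar>\<beta> j * (reach_frac N (card (HG.Vs N w)) j - reach_lim j (ratio N w))\<bar> \<le> \<beta> j * (((real j)\<^sup>2 + real j * (2 * (real j)\<^sup>2 + real j)) / real N)"
            unfolding abs_mult abs_of_nonneg[OF nonneg] by (intro mult_left_mono nonneg)
        qed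
        also have "\<dots> = C / real N" by (simp add: C_def sum_divide_distrib)
        finally have "\<bar>?R w / real N - reach_sum \<beta> J (ratio N w)\<bar> < \<nu> / 2" using CN by (rule le_less_trans)
        then have "\<nu> / 2 \<le> \<bar>HG.edges_upto N J w / real N - ?R w / real N\<bar>" using w by linarith
        also have "\<dots> = \<bar>HG.edges_upto N J w - ?R w\<bar> / real N" using N0 by (simp add: diff_divide_distrib[symmetric])
        finally show "2 * (\<nu> / 4) * real N \<le> \<bar>HG.edges_upto N J w - ?R w\<bar>" using N0 by (simp add: field_simps)
      qed
      have [measurable]: "?R \<in> borel_measurable (P N)" by (rule measurable_compose[OF HG.Vs_rv]) simp
      have "\<P>(w in P N. \<nu> \<le> \<bar>HG.edges_upto N J w / real N - reach_sum \<beta> J (ratio N w)\<bar>)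
         \<le> \<P>(w in P N. 2 * (\<nu> / 4) * real N \<le> \<bar>HG.edges_upto N J w - ?R w\<bar>)"
        by (rule HG.finite_measure_mono[OF sub]) measurable
      also have "\<dots> \<le> 2 * (\<Sum>j\<le>J. \<beta> j) / ((\<nu> / 4)\<^sup>2 * real N)"
        using N \<nu> by (intro HG.edges_upto_concentration) auto
      also have "\<dots> = B / real N" by (simp add: B_def)
      finally show "norm (\<P>(w in P N. \<nu> \<le> \<bar>HG.edges_upto N J w / real N - reach_sum \<beta> J (ratio N w)\<bar>)) \<le> B / real N" by simp
    qed
  qed
qed

lemma reach_sum_rv[measurable]: "(\<lambda>w. reach_sum \<beta> J (ratio N w)) \<in> borel_measurable (P N)"
  by (intro borel_measurable_continuous_on[OF _ ratio_rv] continuous_at_imp_continuous_on) (simp add: reach_sum_isCont)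

text \<open>
  The distance \<open>d\<close> must be fixed before the truncation \<open>J\<close> that makes the tail improbable. It is
  chosen for one truncation \<open>J0\<close>; passing to larger \<open>J\<close> changes the sum uniformly little on the
  interval up to \<open>\<rho>\<close>. Of the tolerance \<open>\<nu>\<close>, three eighths go to the truncated sum, a quarter to its
  concentration and a quarter to the tail.
\<close>

lemma found_edges_near:
  assumes z: "0 \<le> z" "z < 1" "ereal z < conv_radius \<beta>" and \<nu>: "0 < \<nu>"
  shows "\<exists>d>0. (\<lambda>N. \<P>(w in P N. \<bar>ratio N w - z\<bar> < d \<and> \<nu> < \<bar>HG.found_edges N w / real N - reach_series \<beta> z\<bar>)) \<longlonglongrightarrow> 0"
proof -
  obtain \<rho> where \<rho>: "z < \<rho>" "\<rho> < 1" "ereal \<rho> < conv_radius \<beta>" "0 < \<rho>"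
    using pos_radius_between[OF nonneg z] by blast
  let ?w = "\<lambda>j. \<beta> j * (\<rho> ^ j + real j * \<rho> ^ (j - 1))"
  have \<rho>0: "0 \<le> \<rho>" and \<rho>1: "\<rho> \<le> 1" using \<rho> by auto
  have "0 < \<nu> / 8" using \<nu> by simp
  then obtain J0 where J0: "\<And>J J'. J0 \<le> J \<Longrightarrow> sum ?w {J<..J'} \<le> \<nu> / 8"
    using weight_tail[OF nonneg \<rho>0 \<rho>(3)] by blast
  obtain d0 where d0: "0 < d0" "\<forall>t. dist t z < d0 \<longrightarrow> dist (reach_sum \<beta> J0 t) (reach_sum \<beta> J0 z) < \<nu> / 8"
    using reach_sum_isCont[where \<beta>=\<beta> and J=J0 and t=z] \<open>0 < \<nu> / 8\<close> unfolding continuous_at_eps_delta by blast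
  define d where "d = min d0 ((\<rho> - z) / 2)"
  have d: "0 < d" "d \<le> d0" "z + d < \<rho>" using d0(1) \<rho>(1) by (auto simp: d_def min_def field_simps)
  have ser: "reach_series \<beta> z - reach_sum \<beta> J0 z \<le> \<nu> / 8"
  proof -
    have "(\<lambda>J. reach_sum \<beta> J z) \<longlonglongrightarrow> reach_series \<beta> z"
      using summable_sums[OF sums_summable[OF reach_weight_summable(3)[of \<beta>, OF nonneg z(1,3)]]]
      unfolding reach_sum_def reach_series_def by (simp only: sums_def_le)
    moreover have "\<forall>\<^sub>F J in sequentially. reach_sum \<beta> J z \<le> reach_sum \<beta> J0 z + \<nu> / 8"
      using eventually_ge_at_top[of J0]
    proof eventually_elim
      fix J assume "J0 \<le> J"
      then show "reach_sum \<beta> J z \<le> reach_sum \<beta> J0 z + \<nu> / 8"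
        using reach_sum_diff[of \<beta>, OF nonneg z(1) less_imp_le[OF \<rho>(1)] \<rho>1, of J0 J] J0[of J0 J] by simp
    qed
    ultimately have "reach_series \<beta> z \<le> reach_sum \<beta> J0 z + \<nu> / 8"
      by (intro tendsto_upperbound) auto
    then show ?thesis by simp
  qed
  have ser0: "reach_sum \<beta> J0 z \<le> reach_series \<beta> z" using z by (intro reach_sum_le_series nonneg) auto
  have close: "\<bar>reach_sum \<beta> J t - reach_series \<beta> z\<bar> \<le> 3 * \<nu> / 8"
    if "J0 \<le> J" "\<bar>t - z\<bar> < d" "0 \<le> t" for J t
  proof -
    have t: "t \<le> \<rho>" "t \<le> 1" using that d \<rho> by auto
    have "\<bar>reach_sum \<beta> J0 t - reach_sum \<beta> J0 z\<bar> < \<nu> / 8" using d0(2)[unfolded dist_real_def, rule_format, of t] that d by simp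
    moreover have "reach_sum \<beta> J t - reach_sum \<beta> J0 t \<le> \<nu> / 8"
      using reach_sum_diff[of \<beta>, OF nonneg that(3) t(1) \<rho>1 that(1)] J0[of J0 J] by simp
    moreover have "reach_sum \<beta> J0 t \<le> reach_sum \<beta> J t" by (rule reach_sum_mono[OF nonneg that(3) t(2) that(1)])
    ultimately show ?thesis using ser ser0 unfolding abs_le_iff abs_less_iff by linarith
  qed
  let ?Bad = "\<lambda>N. {w\<in>space (P N). \<bar>ratio N w - z\<bar> < d \<and> \<nu> < \<bar>HG.found_edges N w / real N - reach_series \<beta> z\<bar>}"
  have "(\<lambda>N. measure (P N) (?Bad N)) \<longlonglongrightarrow> 0"
  proof (rule LIMSEQ_I)
    fix r :: real assume r: "0 < r"
    have "0 < r * \<nu> / 8" using r \<nu> by simp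
    then obtain J1 where J1: "\<And>J J'. J1 \<le> J \<Longrightarrow> sum ?w {J<..J'} \<le> r * \<nu> / 8"
      using weight_tail[OF nonneg \<rho>0 \<rho>(3)] by blast
    \<comment> \<open>The first bound keeps the truncated sum close to its value at \<open>z\<close>, the second makes
      the tail improbable.\<close>
    define J where "J = max J0 J1"
    let ?E = "\<lambda>N. {w\<in>space (P N). \<nu> / 4 \<le> \<bar>HG.edges_upto N J w / real N - reach_sum \<beta> J (ratio N w)\<bar>}"
    have "(\<lambda>N. measure (P N) (?E N)) \<longlonglongrightarrow> 0" using \<nu> by (intro edges_upto_limit) simp
    then have ev1: "\<forall>\<^sub>F N in sequentially. measure (P N) (?E N) < r / 2" using r by (intro order_tendstoD) auto
    have "(\<lambda>N. 2 * \<rho> / real N) \<longlonglongrightarrow> 0" by (rule lim_const_over_n)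
    then have ev2: "\<forall>\<^sub>F N in sequentially. 2 * \<rho> / real N < \<rho> - (z + d)" using d by (intro order_tendstoD) auto
    have "\<forall>\<^sub>F N in sequentially. norm (measure (P N) (?Bad N) - 0) < r"
      using ev1 ev2 eventually_ge_at_top[of "max 2 J"]
    proof eventually_elim
      fix N assume e1: "measure (P N) (?E N) < r / 2" and e2: "2 * \<rho> / real N < \<rho> - (z + d)" and N: "max 2 J \<le> N"
      have N0: "0 < real N" using N by simp
      define k0 where "k0 = nat \<lfloor>\<rho> * (real N - 1)\<rfloor>"
      have N1: "0 \<le> \<rho> * (real N - 1)" using \<rho>0 N by simp
      have k0: "real k0 \<le> \<rho> * (real N - 1)" using N1 by (simp add: k0_def)
      let ?T = "{w\<in>space (P N). card (HG.Vs N w) \<le> k0 \<and> (\<nu> / 4) * real N \<le> HG.tail_edges N J w}"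
      have [measurable]: "(\<lambda>w. card (HG.Vs N w)) \<in> measurable (P N) (count_space UNIV)" by (rule measurable_compose[OF HG.Vs_rv]) simp
      have sub: "?Bad N \<subseteq> ?E N \<union> ?T"
      proof
        fix w assume w: "w \<in> ?Bad N"
        then have wd: "\<bar>ratio N w - z\<bar> < d" and wb: "\<nu> < \<bar>HG.found_edges N w / real N - reach_series \<beta> z\<bar>" and ws: "w \<in> space (P N)" by auto
        have f: "HG.found_edges N w / real N = HG.edges_upto N J w / real N + HG.tail_edges N J w / real N"
          using HG.found_edges_split[of J N w] N by (simp add: add_divide_distrib)
        have c: "\<bar>reach_sum \<beta> J (ratio N w) - reach_series \<beta> z\<bar> \<le> 3 * \<nu> / 8"
          using wd by (intro close ratio_nonneg) (auto simp: J_def)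
        show "w \<in> ?E N \<union> ?T"
        proof (cases "w \<in> ?E N")
          case False
          then have "\<bar>HG.edges_upto N J w / real N - reach_sum \<beta> J (ratio N w)\<bar> < \<nu> / 4" using ws by simp
          then have "\<nu> / 4 \<le> \<bar>HG.tail_edges N J w / real N\<bar>" using wb c \<nu> unfolding f by linarith
          moreover have "0 \<le> HG.tail_edges N J w" unfolding HG.tail_edges_def by (intro sum_nonneg) simp
          ultimately have t: "\<nu> / 4 * real N \<le> HG.tail_edges N J w" using N0 by (simp add: field_simps)
          have "ratio N w < \<rho> - 2 * \<rho> / real N" using wd e2 unfolding abs_less_iff by linarith
          then have "real (card (HG.Vs N w)) < (\<rho> - 2 * \<rho> / real N) * real N"
            unfolding ratio_def using N0 by (simp add: divide_less_eq)
          also have "\<dots> = \<rho> * real N - 2 * \<rho>" using N0 by (simp add: left_diff_distrib)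
          also have "\<dots> \<le> \<rho> * (real N - 1)" using \<rho>0 by (simp add: right_diff_distrib)
          finally have "card (HG.Vs N w) \<le> k0" unfolding k0_def by (simp add: le_nat_floor)
          then show ?thesis using t ws by simp
        qed simp
      qed
      have mT: "?T \<in> sets (P N)" by measurable
      have mE: "?E N \<in> sets (P N)" by measurable
      have "measure (P N) (?Bad N) \<le> measure (P N) (?E N \<union> ?T)"
        using mT mE by (intro HG.finite_measure_mono[OF sub]) auto
      also have "\<dots> \<le> measure (P N) (?E N) + measure (P N) ?T" by (rule measure_Un_le[OF mE mT])
      also have "measure (P N) ?T \<le> sum ?w {J<..N} / (\<nu> / 4)"
        using N \<nu> by (intro HG.tail_edges_small \<rho>0 k0) auto
      also have "\<dots> \<le> (r * \<nu> / 8) / (\<nu> / 4)" using \<nu> J1[of J N] by (intro divide_right_mono) (auto simp: J_def)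
      also have "\<dots> = r / 2" using \<nu> by simp
      finally have "measure (P N) (?Bad N) \<le> measure (P N) (?E N) + r / 2" by simp
      then show "norm (measure (P N) (?Bad N) - 0) < r" using e1 by simp
    qed
    then show "\<exists>no. \<forall>N\<ge>no. norm (measure (P N) (?Bad N) - 0) < r" by (simp add: eventually_sequentially)
  qed
  then show ?thesis using d(1) by blast
qed

text \<open>
  The drift vanishes at the zeros and also at \<open>z*\<close> if \<open>z* < 1\<close>.
\<close>

lemma zero_edge_limit:
  assumes "z \<in> zero_set \<beta> \<or> (z = z_star \<beta> \<and> z < 1)"
  shows "0 \<le> z" "z < 1" "ereal z < conv_radius \<beta>" "edge_limit \<beta> z = ereal (reach_series \<beta> z)"
proof -
  have "0 \<le> z \<and> z < 1 \<and> ereal z < conv_radius \<beta> \<and> series_der \<beta> z + ln (1 - z) = 0"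
    using assms
  proof
    assume "z \<in> zero_set \<beta>"
    then show ?thesis using zero_set_props[OF nonneg radius zero, of z] by auto
  next
    assume z: "z = z_star \<beta> \<and> z < 1"
    then have r: "0 \<le> z" "ereal z < conv_radius \<beta>" "drift \<beta> z = 0"
      using z_star_nonneg[of \<beta>, OF nonneg] z_star_radius[of \<beta>, OF nonneg] drift_z_star[of \<beta>, OF nonneg] by auto
    then show ?thesis using z drift_finite[of \<beta>, OF nonneg r(1,2)] by auto
  qed
  then show "0 \<le> z" "z < 1" "ereal z < conv_radius \<beta>" "edge_limit \<beta> z = ereal (reach_series \<beta> z)"
    using edge_limit_at_zero[of \<beta> z, OF nonneg] by auto
qed

text \<open>
  A truncated sum that exceeds \<open>x\<close> at \<open>1\<close> does so near \<open>1\<close> as well; this covers an infinite limit.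
\<close>

lemma found_edges_lower:
  assumes x: "ereal x < edge_limit \<beta> 1"
  shows "\<exists>r<1. (\<lambda>N. \<P>(w in P N. r < ratio N w \<and> HG.found_edges N w / real N \<le> x)) \<longlonglongrightarrow> 0 \<and>
    (\<forall>z\<in>zero_set \<beta>. r < z \<longrightarrow> ereal x < edge_limit \<beta> z)"
proof -
  obtain J' where "x < (\<Sum>j<J'. \<beta> j)" using x unfolding edge_limit_1[of \<beta>, OF nonneg] less_SUP_iff by auto
  also have "\<dots> \<le> (\<Sum>j\<le>J'. \<beta> j)" using nonneg by (intro sum_mono2) auto
  finally have J: "x < reach_sum \<beta> J' 1" by (simp add: reach_sum_1)
  define \<nu> where "\<nu> = (reach_sum \<beta> J' 1 - x) / 2"
  have \<nu>: "0 < \<nu>" using J by (simp add: \<nu>_def)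
  obtain d where d: "0 < d" "\<forall>t. dist t 1 < d \<longrightarrow> dist (reach_sum \<beta> J' t) (reach_sum \<beta> J' 1) < \<nu>"
    using reach_sum_isCont[where \<beta>=\<beta> and J=J' and t=1] \<nu> unfolding continuous_at_eps_delta by blast
  have near: "x + \<nu> < reach_sum \<beta> J' t" if "1 - d < t" "t \<le> 1" for t
  proof -
    have "\<bar>reach_sum \<beta> J' t - reach_sum \<beta> J' 1\<bar> < \<nu>" using d(2)[unfolded dist_real_def, rule_format, of t] that by simp
    then show ?thesis unfolding \<nu>_def abs_less_iff by (simp add: field_simps)
  qed
  let ?A = "\<lambda>N. {w\<in>space (P N). 1 - d < ratio N w \<and> HG.found_edges N w / real N \<le> x}"
  let ?E = "\<lambda>N. {w\<in>space (P N). \<nu> \<le> \<bar>HG.edges_upto N J' w / real N - reach_sum \<beta> J' (ratio N w)\<bar>}"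
  have "(\<lambda>N. measure (P N) (?A N)) \<longlonglongrightarrow> 0"
  proof (rule Lim_null_comparison[OF _ edges_upto_limit[OF \<nu>, of J']])
    show "\<forall>\<^sub>F N in sequentially. norm (measure (P N) (?A N)) \<le> measure (P N) (?E N)"
      using eventually_ge_at_top[of "Suc J'"]
    proof eventually_elim
      fix N assume N: "Suc J' \<le> N"
      have "?A N \<subseteq> ?E N"
      proof
        fix w assume w: "w \<in> ?A N"
        have "HG.edges_upto N J' w / real N \<le> HG.found_edges N w / real N"
          using N by (intro divide_right_mono HG.edges_upto_le_found) auto
        moreover have "x + \<nu> < reach_sum \<beta> J' (ratio N w)" using w by (intro near ratio_le_1) auto
        ultimately show "w \<in> ?E N" using w \<nu> by auto
      qed
      moreover have "?E N \<in> sets (P N)" by measurable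
      ultimately show "norm (measure (P N) (?A N)) \<le> measure (P N) (?E N)" by (simp add: HG.finite_measure_mono)
    qed
  qed
  moreover have "ereal x < edge_limit \<beta> z" if z: "z \<in> zero_set \<beta>" "1 - d < z" for z
  proof -
    note zp = zero_edge_limit[of z, OF disjI1[OF z(1)]]
    have "x + \<nu> < reach_sum \<beta> J' z" using zp z by (intro near) auto
    also have "\<dots> \<le> reach_series \<beta> z" using zp by (intro reach_sum_le_series nonneg) auto
    finally show ?thesis using \<nu> by (simp add: zp(4))
  qed
  ultimately show ?thesis using d(1) by (intro exI[of _ "1 - d"]) auto
qed

text \<open>
  All hyperedges together number about \<open>N * (\<Sum>j. \<beta> j)\<close>, and at a zero the series is at most its
  value at \<open>1\<close>.
\<close>

lemma found_edges_not_above: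
  assumes x: "edge_limit \<beta> 1 < ereal x"
  shows "(\<lambda>N. \<P>(w in P N. x \<le> HG.found_edges N w / real N)) \<longlonglongrightarrow> 0"
    and "\<forall>z\<in>zero_set \<beta>. edge_limit \<beta> z < ereal x"
proof -
  have g1: "edge_limit \<beta> 1 = (\<Sum>j. ereal (\<beta> j))" by (simp add: edge_limit_def gen_series_def)
  have fin: "(\<Sum>j. ereal (\<beta> j)) \<noteq> \<infinity>" using x unfolding g1 by auto
  have sum: "summable \<beta>" using fin nonneg by (intro summable_ereal) auto
  have s: "suminf \<beta> < x" using x unfolding g1 suminf_ereal'[OF sum] by simp
  define a where "a = x - suminf \<beta>"
  have a: "0 < a" using s by (simp add: a_def)
  have lim: "(\<lambda>N. (suminf \<beta> / a\<^sup>2) / real N) \<longlonglongrightarrow> 0" by (rule lim_const_over_n)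
  show "(\<lambda>N. \<P>(w in P N. x \<le> HG.found_edges N w / real N)) \<longlonglongrightarrow> 0"
  proof (rule Lim_null_comparison[OF _ lim])
    show "\<forall>\<^sub>F N in sequentially. norm (\<P>(w in P N. x \<le> HG.found_edges N w / real N)) \<le> (suminf \<beta> / a\<^sup>2) / real N"
      using eventually_gt_at_top[of 0]
    proof eventually_elim
      fix N :: nat assume N: "0 < N"
      have le: "(\<Sum>j\<le>N. \<beta> j) \<le> suminf \<beta>" using sum nonneg by (intro sum_le_suminf) auto
      have sub: "{w\<in>space (P N). x \<le> HG.found_edges N w / real N} \<subseteq> {w\<in>space (P N). ((\<Sum>j\<le>N. \<beta> j) + a) * real N \<le> HG.found_edges N w}"
      proof safe
        fix w assume "x \<le> HG.found_edges N w / real N"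
        then have "x * real N \<le> HG.found_edges N w" using N by (simp add: le_divide_eq)
        moreover have "((\<Sum>j\<le>N. \<beta> j) + a) * real N \<le> x * real N" using le by (intro mult_right_mono) (auto simp: a_def)
        ultimately show "((\<Sum>j\<le>N. \<beta> j) + a) * real N \<le> HG.found_edges N w" by linarith
      qed
      have "\<P>(w in P N. x \<le> HG.found_edges N w / real N) \<le> \<P>(w in P N. ((\<Sum>j\<le>N. \<beta> j) + a) * real N \<le> HG.found_edges N w)"
        by (rule HG.finite_measure_mono[OF sub]) measurable
      also have "\<dots> \<le> (\<Sum>j\<le>N. \<beta> j) / (a\<^sup>2 * real N)" by (rule HG.found_edges_upper[OF N a])
      also have "\<dots> \<le> suminf \<beta> / (a\<^sup>2 * real N)" using le by (intro divide_right_mono) auto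
      finally show "norm (\<P>(w in P N. x \<le> HG.found_edges N w / real N)) \<le> (suminf \<beta> / a\<^sup>2) / real N" by simp
    qed
  qed
  show "\<forall>z\<in>zero_set \<beta>. edge_limit \<beta> z < ereal x"
  proof
    fix z assume z: "z \<in> zero_set \<beta>"
    note zp = zero_edge_limit[of z, OF disjI1[OF z]]
    have "reach_series \<beta> z \<le> suminf \<beta>" unfolding reach_series_def
    proof (rule suminf_le)
      show "\<beta> j * reach_lim j z \<le> \<beta> j" for j
        using mult_left_mono[OF reach_lim_bounds(2)[of z j] nonneg[of j]] zp by simp
      show "summable (\<lambda>j. \<beta> j * reach_lim j z)"
        using reach_weight_summable(3)[of \<beta>, OF nonneg zp(1,3)] by (rule sums_summable)
      show "summable \<beta>" by (rule sum)
    qed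
    then show "edge_limit \<beta> z < ereal x" unfolding zp(4) using s by simp
  qed
qed

text \<open>
  The value \<open>1\<close> of \<open>z*\<close> needs neighbourhoods in the extended reals: a real bound \<open>x\<close> from below, and one
  from above unless the limit is infinite.
\<close>

lemma edges_limit:
  fixes f :: "ereal \<Rightarrow> real"
  assumes f: "continuous_on UNIV f" and fB: "\<And>x. \<bar>f x\<bar> \<le> B"
  shows "(\<lambda>N. \<integral>w. f (ereal (HG.found_edges N w / real N)) \<partial>P N) \<longlonglongrightarrow> (\<integral>w. f (edge_limit \<beta> (Z w)) \<partial>MW)"
proof (rule functional_limit[where B=B])
  have [measurable]: "f \<in> borel_measurable borel" using f by (rule borel_measurable_continuous_onI)
  show "(\<lambda>w. f (ereal (HG.found_edges N w / real N))) \<in> borel_measurable (P N)" for N by measurable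
  show "\<bar>f (ereal (HG.found_edges N w / real N))\<bar> \<le> B" for N w by (rule fB)
  show "\<bar>f (edge_limit \<beta> z)\<bar> \<le> B" for z by (rule fB)
next
  fix z \<eta> :: real assume z: "z \<in> zero_set \<beta> \<or> (z = z_star \<beta> \<and> z < 1)" and \<eta>: "0 < \<eta>"
  note zp = zero_edge_limit[OF z]
  have "isCont (\<lambda>x. f (ereal x)) (reach_series \<beta> z)"
  proof (rule continuous_on_interior)
    show "continuous_on UNIV (\<lambda>x. f (ereal x))" by (rule continuous_on_compose2[OF f continuous_on_ereal[OF continuous_on_id]]) simp
  qed simp
  then obtain \<nu> where \<nu>: "0 < \<nu>" "\<forall>y. dist y (reach_series \<beta> z) < \<nu> \<longrightarrow> dist (f (ereal y)) (f (ereal (reach_series \<beta> z))) < \<eta>"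
    using \<eta> unfolding continuous_at_eps_delta by blast
  have "0 < \<nu> / 2" using \<nu> by simp
  from found_edges_near[OF zp(1-3) this] obtain d where d: "0 < d"
    "(\<lambda>N. \<P>(w in P N. \<bar>ratio N w - z\<bar> < d \<and> \<nu> / 2 < \<bar>HG.found_edges N w / real N - reach_series \<beta> z\<bar>)) \<longlonglongrightarrow> 0" by blast
  have "(\<lambda>N. \<P>(w in P N. \<bar>ratio N w - z\<bar> < d \<and> \<eta> < \<bar>f (ereal (HG.found_edges N w / real N)) - f (edge_limit \<beta> z)\<bar>)) \<longlonglongrightarrow> 0"
  proof (rule Lim_null_comparison[OF always_eventually d(2)], rule allI)
    fix N
    have "\<nu> / 2 < \<bar>y - reach_series \<beta> z\<bar>" if "\<eta> < \<bar>f (ereal y) - f (edge_limit \<beta> z)\<bar>" for y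
    proof (rule ccontr)
      assume "\<not> \<nu> / 2 < \<bar>y - reach_series \<beta> z\<bar>"
      then have "\<bar>y - reach_series \<beta> z\<bar> < \<nu>" using \<nu>(1) by linarith
      then have "\<bar>f (ereal y) - f (ereal (reach_series \<beta> z))\<bar> < \<eta>" using \<nu>(2)[unfolded dist_real_def] by blast
      then show False using that zp(4) by simp
    qed
    then have "\<P>(w in P N. \<bar>ratio N w - z\<bar> < d \<and> \<eta> < \<bar>f (ereal (HG.found_edges N w / real N)) - f (edge_limit \<beta> z)\<bar>)
      \<le> \<P>(w in P N. \<bar>ratio N w - z\<bar> < d \<and> \<nu> / 2 < \<bar>HG.found_edges N w / real N - reach_series \<beta> z\<bar>)"
      by (intro HG.finite_measure_mono) (blast, measurable)
    then show "norm (\<P>(w in P N. \<bar>ratio N w - z\<bar> < d \<and> \<eta> < \<bar>f (ereal (HG.found_edges N w / real N)) - f (edge_limit \<beta> z)\<bar>))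
      \<le> \<P>(w in P N. \<bar>ratio N w - z\<bar> < d \<and> \<nu> / 2 < \<bar>HG.found_edges N w / real N - reach_series \<beta> z\<bar>)" by simp
  qed
  then show "\<exists>d>0. (\<lambda>N. \<P>(w in P N. \<bar>ratio N w - z\<bar> < d \<and> \<eta> < \<bar>f (ereal (HG.found_edges N w / real N)) - f (edge_limit \<beta> z)\<bar>)) \<longlonglongrightarrow> 0"
    using d(1) by blast
next
  fix \<eta> :: real assume \<eta>: "0 < \<eta>"
  let ?e = "edge_limit \<beta> 1"
  define U where "U = {y. \<bar>f y - f ?e\<bar> < \<eta>}"
  have U: "open U" unfolding U_def by (intro open_Collect_less continuous_intros f)
  have eU: "?e \<in> U" using \<eta> by (simp add: U_def)
  have "0 \<le> ?e" unfolding edge_limit_1[of \<beta>, OF nonneg] by (rule SUP_upper2[of 0]) auto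
  then have "- 1 < ?e" by (rule less_le_trans[rotated]) simp
  from open_left[OF U eU this] obtain b where b: "b < ?e" "{b <.. ?e} \<subseteq> U" by blast
  obtain x where x: "b < ereal x" "ereal x < ?e" using ereal_dense2[OF b(1)] by blast
  obtain r where r: "r < 1" "(\<lambda>N. \<P>(w in P N. r < ratio N w \<and> HG.found_edges N w / real N \<le> x)) \<longlonglongrightarrow> 0"
    "\<forall>z\<in>zero_set \<beta>. r < z \<longrightarrow> ereal x < edge_limit \<beta> z" using found_edges_lower[OF x(2)] by blast
  obtain G where G: "(\<lambda>N. measure (P N) (G N)) \<longlonglongrightarrow> 0" "\<And>N. G N \<in> sets (P N)"
    "\<And>N w. w \<in> space (P N) \<Longrightarrow> w \<notin> G N \<Longrightarrow> x < HG.found_edges N w / real N \<Longrightarrow> ereal (HG.found_edges N w / real N) \<in> U"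
    "\<And>z. z \<in> zero_set \<beta> \<Longrightarrow> ereal x < edge_limit \<beta> z \<Longrightarrow> edge_limit \<beta> z \<in> U"
  proof (cases "?e = \<infinity>")
    case True
    have in_U: "y \<in> U" if "ereal x < y" for y
      using b(2) x(1) that less_trans[OF x(1) that] unfolding True by auto
    show ?thesis by (rule that[of "\<lambda>_. {}"]) (auto intro!: in_U)
  next
    case False
    then have "?e < \<infinity>" by simp
    from open_right[OF U eU this] obtain c where c: "?e < c" "{?e ..< c} \<subseteq> U" by blast
    obtain x' where x': "?e < ereal x'" "ereal x' < c" using ereal_dense2[OF c(1)] by blast
    have in_U: "y \<in> U" if "ereal x < y" "y < ereal x'" for y
    proof (cases "y \<le> ?e")
      case True
      then show ?thesis using b(2) less_trans[OF x(1) that(1)] by auto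
    next
      case False
      then show ?thesis using c(2) less_trans[OF that(2) x'(2)] by auto
    qed
    show ?thesis
    proof (rule that[of "\<lambda>N. {w\<in>space (P N). x' \<le> HG.found_edges N w / real N}"])
      show "(\<lambda>N. \<P>(w in P N. x' \<le> HG.found_edges N w / real N)) \<longlonglongrightarrow> 0"
        by (rule found_edges_not_above(1)[OF x'(1)])
      show "{w\<in>space (P N). x' \<le> HG.found_edges N w / real N} \<in> sets (P N)" for N by measurable
      show "edge_limit \<beta> z \<in> U" if "z \<in> zero_set \<beta>" "ereal x < edge_limit \<beta> z" for z
        using found_edges_not_above(2)[OF x'(1)] that by (intro in_U) auto
    qed (auto intro!: in_U)
  qed
  let ?L = "\<lambda>N. {w\<in>space (P N). r < ratio N w \<and> HG.found_edges N w / real N \<le> x}"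
  have lim: "(\<lambda>N. measure (P N) (?L N) + measure (P N) (G N)) \<longlonglongrightarrow> 0"
    using tendsto_add[OF r(2) G(1)] by simp
  have "(\<lambda>N. \<P>(w in P N. r < ratio N w \<and> \<eta> < \<bar>f (ereal (HG.found_edges N w / real N)) - f ?e\<bar>)) \<longlonglongrightarrow> 0"
  proof (rule Lim_null_comparison[OF always_eventually lim], rule allI)
    fix N
    let ?X = "{w\<in>space (P N). r < ratio N w \<and> \<eta> < \<bar>f (ereal (HG.found_edges N w / real N)) - f ?e\<bar>}"
    have "?X \<subseteq> ?L N \<union> G N"
    proof
      fix w assume w: "w \<in> ?X"
      then have "ereal (HG.found_edges N w / real N) \<notin> U" by (simp add: U_def)
      then show "w \<in> ?L N \<union> G N" using G(3)[of w N] w by force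
    qed
    moreover have L: "?L N \<in> sets (P N)" by measurable
    ultimately have "measure (P N) ?X \<le> measure (P N) (?L N \<union> G N)" using G(2) by (intro HG.finite_measure_mono) auto
    also have "\<dots> \<le> measure (P N) (?L N) + measure (P N) (G N)" by (rule measure_Un_le[OF L G(2)])
    finally show "norm (measure (P N) ?X) \<le> measure (P N) (?L N) + measure (P N) (G N)" by simp
  qed
  moreover have "\<bar>f (edge_limit \<beta> z) - f ?e\<bar> \<le> \<eta>" if "z \<in> zero_set \<beta>" "r < z" for z
  proof -
    have "edge_limit \<beta> z \<in> U" using G(4)[OF that(1)] r(3) that by blast
    then show ?thesis by (simp add: U_def)
  qed
  ultimately show "\<exists>r<1. (\<lambda>N. \<P>(w in P N. r < ratio N w \<and> \<eta> < \<bar>f (ereal (HG.found_edges N w / real N)) - f ?e\<bar>)) \<longlonglongrightarrow> 0 \<and>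
     (\<forall>z\<in>zero_set \<beta>. r < z \<longrightarrow> \<bar>f (edge_limit \<beta> z) - f ?e\<bar> \<le> \<eta>)" using r(1) by blast
qed

end

theorem theorem2p2:
  fixes \<beta> :: "nat \<Rightarrow> real"
    and M :: "'b measure" and W :: "real \<Rightarrow> 'b \<Rightarrow> real"
    and P :: "nat \<Rightarrow> 'a measure"
    and V :: "nat \<Rightarrow> 'v set"
    and \<Lambda> :: "nat \<Rightarrow> 'a \<Rightarrow> 'v set \<Rightarrow> nat"
  assumes nonneg: "\<And>j. 0 \<le> \<beta> j"
    and radius: "conv_radius \<beta> \<notin> ereal ` zero_set \<beta>"
    and zero: "0 \<notin> zero_set \<beta>"
    and brownian: "brownian_motion M W"
    and vertices: "\<And>N. finite (V N)" "\<And>N. card (V N) = N"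
    and hypergraph: "\<And>N. poisson_hypergraph (P N) (V N) \<beta> (\<Lambda> N)"
  shows "weak_conv_m
           (\<lambda>N. distr (P N) borel
              (\<lambda>\<omega>. real (card (identifiable_vertices (V N) (\<Lambda> N \<omega>))) / real N))
           (distr M borel (\<lambda>\<omega>. Z_limit \<beta> (\<lambda>t. W t \<omega>)))
         \<and> weakly_converges
           (\<lambda>N. distr (P N) borel
              (\<lambda>\<omega>. ereal (real (num_hyperedges (V N)
                       (identifiable_hypergraph (V N) (\<Lambda> N \<omega>))) / real N)))
           (distr M borel (\<lambda>\<omega>. edge_limit \<beta> (Z_limit \<beta> (\<lambda>t. W t \<omega>))))"
proof -
  interpret large_hypergraphs \<beta> M W P V \<Lambda>
    by (rule large_hypergraphs.intro[OF nonneg radius zero brownian vertices(2) hypergraph])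
  have ratio: "(\<lambda>w. real (card (identifiable_vertices (V N) (\<Lambda> N w))) / real N) = ratio N" for N
    by (simp add: fun_eq_iff ratio_def HG.Vs_def)
  have edges: "(\<lambda>w. ereal (real (num_hyperedges (V N) (identifiable_hypergraph (V N) (\<Lambda> N w))) / real N))
      = (\<lambda>w. ereal (HG.found_edges N w / real N))" for N
    by (simp add: fun_eq_iff HG.found_edges_def)
  have Zr: "Z \<in> borel_measurable M" using Z_compose_rv[of borel "\<lambda>z. z"] by simp
  have Er: "(\<lambda>w. edge_limit \<beta> (Z w)) \<in> borel_measurable M" by (rule Z_compose_rv) simp
  have er: "(\<lambda>w. ereal (HG.found_edges N w / real N)) \<in> borel_measurable (P N)" for N by measurable
  have "weak_conv_m (\<lambda>N. distr (P N) borel (ratio N)) (distr M borel Z)"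
  proof (rule integral_bdd_continuous_conv_imp_weak_conv)
    show "real_distribution (distr (P N) borel (ratio N))" for N by (rule HG.real_distribution_distr) (rule ratio_rv)
    show "real_distribution (distr M borel Z)" by (rule ST.MW.real_distribution_distr) (rule Zr)
    fix f :: "real \<Rightarrow> real" assume f: "\<And>x. isCont f x" "\<And>x. \<bar>f x\<bar> \<le> 1"
    have "f \<in> borel_measurable borel" using f by (intro borel_measurable_continuous_onI continuous_at_imp_continuous_on) auto
    then show "(\<lambda>N. \<integral>x. f x \<partial>distr (P N) borel (ratio N)) \<longlonglongrightarrow> (\<integral>x. f x \<partial>distr M borel Z)"
      using ratio_limit[OF f] by (simp add: integral_distr[OF ratio_rv] integral_distr[OF Zr])
  qed
  moreover have "weakly_converges (\<lambda>N. distr (P N) borel (\<lambda>w. ereal (HG.found_edges N w / real N))) (distr M borel (\<lambda>w. edge_limit \<beta> (Z w)))"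
    unfolding weakly_converges_def
  proof (intro allI impI)
    fix f :: "ereal \<Rightarrow> real" assume f: "continuous_on UNIV f \<and> bounded (range f)"
    then obtain B where B: "\<And>x. \<bar>f x\<bar> \<le> B" by (auto simp: bounded_iff)
    have fm: "f \<in> borel_measurable borel" using f by (intro borel_measurable_continuous_onI) auto
    show "(\<lambda>N. \<integral>x. f x \<partial>distr (P N) borel (\<lambda>w. ereal (HG.found_edges N w / real N))) \<longlonglongrightarrow> (\<integral>x. f x \<partial>distr M borel (\<lambda>w. edge_limit \<beta> (Z w)))"
      using edges_limit[OF conjunct1[OF f] B] by (simp add: integral_distr[OF er fm] integral_distr[OF Er fm])
  qed
  ultimately show ?thesis unfolding ratio edges by simp
qed

end
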